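(* Let $Z_i$, $i\in\mathbb{N}$, be independent standard normal random variables and let $(\alpha_i)_{i\in\mathbb{N}}$ be a sequence in $\mathbb{R}$ with $0\le \alpha_i\le\alpha\le 1$ for all $i$ and $\sum_{i\in\mathbb{N}}\alpha_i=1$. Then there exists a smallest $x_0=x_0(\alpha,(\alpha_i)_{i\in\mathbb{N}})\ge 0$ such that $$\mathbb{P}\Bigl(\sum_{i\in\mathbb{N}}\alpha_i Z_i^2\ge x\Bigr)\le \mathbb{P}\bigl(\alpha Y_{1/\alpha}\ge x\bigr)\qquad\text{for all }x\ge x_0,\tag{$*$}$$ where $Y_{1/\alpha}$ is a chi-squared distributed random variable with (fractional) $\frac1\alpha$ degrees of freedom. Moreover, the value $$x_0^\star(\alpha):=\sup\Bigl\{x_0(\alpha,(\alpha_i)_{i\in\mathbb{N}})\ :\ 0\le\alpha_i\le\alpha\le 1,\ \sum_{i\in\mathbb{N}}\alpha_i=1\Bigr\}$$ is bounded from above by $1.5365$; i.e., inequality $( * )$ holds uniformly for all $x\ge 1.5365$, all $\alpha<1$ and all $(\alpha_i)_{i\in\mathbb{N}}$ with $0\le\alpha_i\le\alpha$ and $\sum_{i\in\mathbb{N}}\alpha_i=1$.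
   Context: For real $r>0$, a random variable $Y_r$ is chi-squared distributed with (fractional) $r$ degrees of freedom if it has density $\frac{x^{r/2-1}e^{-x/2}}{2^{r/2}\Gamma(r/2)}\mathbf 1_{(0,\infty)}(x)$. (The constraints force $\alpha>0$.) *)

theory Defs
  imports "HOL-Probability.Probability"
begin

definition chi_squared_density :: "real \<Rightarrow> real \<Rightarrow> real" where
  "chi_squared_density r x =
     (if 0 < x then x powr (r / 2 - 1) * exp (- x / 2) / (2 powr (r / 2) * Gamma (r / 2)) else 0)"

text \<open>
  Since the weights sum to 1, an admissible weight sequence exists only if
  \<open>0 < \<alpha>\<close>.
\<close>

definition admissible_weights :: "real \<Rightarrow> (nat \<Rightarrow> real) \<Rightarrow> bool" where
  "admissible_weights \<alpha> a \<longleftrightarrow> (\<forall>i. 0 \<le> a i \<and> a i \<le> \<alpha>) \<and> \<alpha> \<le> 1 \<and> a sums 1"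

text \<open>
  The series below converges almost surely for admissible \<open>a\<close> and standard normal
  \<open>Z i\<close>; the value of \<open>suminf\<close> at points of divergence therefore only
  matters on a null set.
\<close>

definition weighted_tail ::
    "'a measure \<Rightarrow> (nat \<Rightarrow> 'a \<Rightarrow> real) \<Rightarrow> (nat \<Rightarrow> real) \<Rightarrow> real \<Rightarrow> real" where
  "weighted_tail M Z a x = measure M {\<omega> \<in> space M. (\<Sum>i. a i * (Z i \<omega>)\<^sup>2) \<ge> x}"

text \<open>
  \<open>Y r\<close> is a random variable on \<open>N r\<close>, meant to be chi-squared
  distributed with \<open>r\<close> degrees of freedom.
\<close>

definition scaled_tail ::
    "(real \<Rightarrow> 'b measure) \<Rightarrow> (real \<Rightarrow> 'b \<Rightarrow> real) \<Rightarrow> real \<Rightarrow> real \<Rightarrow> real" where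
  "scaled_tail N Y \<alpha> x =
     measure (N (1 / \<alpha>)) {\<omega> \<in> space (N (1 / \<alpha>)). \<alpha> * Y (1 / \<alpha>) \<omega> \<ge> x}"

definition dominates_from :: "(real \<Rightarrow> real) \<Rightarrow> (real \<Rightarrow> real) \<Rightarrow> real \<Rightarrow> bool" where
  "dominates_from G F x\<^sub>0 \<longleftrightarrow> 0 \<le> x\<^sub>0 \<and> (\<forall>x\<ge>x\<^sub>0. F x \<le> G x)"

definition smallest_threshold ::
    "'a measure \<Rightarrow> (nat \<Rightarrow> 'a \<Rightarrow> real) \<Rightarrow> (real \<Rightarrow> 'b measure) \<Rightarrow> (real \<Rightarrow> 'b \<Rightarrow> real)
      \<Rightarrow> real \<Rightarrow> (nat \<Rightarrow> real) \<Rightarrow> real" where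
  "smallest_threshold M Z N Y \<alpha> a =
     (LEAST x\<^sub>0. dominates_from (scaled_tail N Y \<alpha>) (weighted_tail M Z a) x\<^sub>0)"

text \<open>
  The supremum is taken in the extended reals, so that an upper bound on it
  includes the claim that it is finite.
\<close>

definition worst_threshold ::
    "'a measure \<Rightarrow> (nat \<Rightarrow> 'a \<Rightarrow> real) \<Rightarrow> (real \<Rightarrow> 'b measure) \<Rightarrow> (real \<Rightarrow> 'b \<Rightarrow> real)
      \<Rightarrow> real \<Rightarrow> ereal" where
  "worst_threshold M Z N Y \<alpha> =
     (SUP a\<in>{a. admissible_weights \<alpha> a}. ereal (smallest_threshold M Z N Y \<alpha> a))"

end

theory Submission
  imports Defs
begin

lemma nonneg_propagates_left:
  fixes g g' :: "real \<Rightarrow> real"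
  assumes der: "\<And>t. t \<in> {a..b} \<Longrightarrow> (g has_real_derivative g' t) (at t)"
    and neg: "\<And>t. t \<in> {a..b} \<Longrightarrow> g t = 0 \<Longrightarrow> g' t < 0"
    and gb: "g b \<ge> 0" and t: "t \<in> {a..b}"
  shows "g t \<ge> 0"
proof (rule ccontr)
  assume "\<not> g t \<ge> 0"
  then have gt: "g t < 0" by simp
  have cont: "continuous_on {t..b} g"
    by (rule DERIV_continuous_on[where D = g'], rule has_field_derivative_at_within, rule der) (use t in auto)
  define S where "S = {t..b} \<inter> g -` {0..}"
  have clS: "closed S" unfolding S_def
    by (rule continuous_closed_preimage[OF cont]) auto
  have neS: "b \<in> S" using t gb by (auto simp: S_def)
  have bdd: "bdd_below S" by (rule bdd_belowI[of _ t]) (auto simp: S_def)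
  define q where "q = Inf S"
  have qS: "q \<in> S" unfolding q_def using closed_contains_Inf[OF _ bdd clS] neS by auto
  then have q: "t \<le> q" "q \<le> b" "0 \<le> g q" by (auto simp: S_def)
  have tq: "t < q" using q gt by (cases "t = q") auto
  have before: "g u < 0" if "t \<le> u" "u < q" for u
  proof (rule ccontr)
    assume "\<not> g u < 0"
    then have "u \<in> S" using that q by (auto simp: S_def)
    then have "q \<le> u" unfolding q_def by (rule cInf_lower[OF _ bdd])
    then show False using that by simp
  qed
  have "g q \<le> 0"
  proof (rule ccontr)
    assume "\<not> g q \<le> 0"
    then have "0 < g q" by simp
    have "continuous (at q) g" using der[of q] q t by (auto intro: DERIV_isCont)
    then have "(g \<longlongrightarrow> g q) (at q)" by (simp add: isCont_def)
    from order_tendstoD(1)[OF this \<open>0 < g q\<close>] obtain d where d: "d > 0" "\<And>u. u \<noteq> q \<Longrightarrow> dist u q < d \<Longrightarrow> 0 < g u"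
      unfolding eventually_at by auto
    define u where "u = max t (q - d/2)"
    have "t \<le> u" "u < q" "dist u q < d" using tq d by (auto simp: u_def dist_real_def)
    then show False using before[of u] d(2)[of u] by auto
  qed
  then have gq: "g q = 0" using q by simp
  have "g' q < 0" by (rule neg) (use q t gq in auto)
  from DERIV_neg_dec_left[OF der this] q t obtain d where
    d: "d > 0" "\<And>h. 0 < h \<Longrightarrow> h < d \<Longrightarrow> g q < g (q - h)" by auto
  define h where "h = min (d/2) (q - t)"
  have "0 < h" "h < d" "t \<le> q - h" "q - h < q" using tq d by (auto simp: h_def)
  then show False using d(2)[of h] before[of "q - h"] gq by auto
qed

lemma nonneg_propagates_right:
  fixes g g' :: "real \<Rightarrow> real"
  assumes der: "\<And>t. t \<in> {a..b} \<Longrightarrow> (g has_real_derivative g' t) (at t)"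
    and pos: "\<And>t. t \<in> {a..b} \<Longrightarrow> g t = 0 \<Longrightarrow> g' t > 0"
    and ga: "g a \<ge> 0" and t: "t \<in> {a..b}"
  shows "g t \<ge> 0"
proof -
  have "g (- (- t)) \<ge> 0"
  proof (rule nonneg_propagates_left[of "-b" "-a" "\<lambda>u. g (- u)" "\<lambda>u. - g' (- u)"])
    show "((\<lambda>u. g (- u)) has_real_derivative - g' (- u)) (at u)" if "u \<in> {-b..-a}" for u
      using DERIV_chain2[where f = g and g = uminus, OF der[of "- u"] DERIV_minus[OF DERIV_ident], of UNIV] that
      by auto
  qed (use pos ga t in auto)
  then show ?thesis by simp
qed

lemma ode_lower_bound:
  fixes g f :: "real \<Rightarrow> real"
  assumes b: "b > 0" and le: "x1 \<le> x2"
    and cont: "continuous_on {x1..x2} g"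
    and der: "\<And>x. x1 < x \<Longrightarrow> x < x2 \<Longrightarrow> (g has_real_derivative f x - b * g x) (at x)"
    and m: "\<And>x. x \<in> {x1..x2} \<Longrightarrow> f x \<ge> m"
  shows "b * g x2 \<ge> exp (- b * (x2 - x1)) * (b * g x1) + m * (1 - exp (- b * (x2 - x1)))"
proof -
  define h where "h x = exp (b * x) * (b * g x - m)" for x
  have hder: "(h has_real_derivative b * exp (b * x) * (f x - m)) (at x)" if "x1 < x" "x < x2" for x
    unfolding h_def by (auto intro!: derivative_eq_intros der that simp: algebra_simps)
  have "h x1 \<le> h x2"
  proof (rule DERIV_nonneg_imp_increasing_open[OF le])
    show "\<exists>y. (h has_real_derivative y) (at x) \<and> 0 \<le> y" if "x1 < x" "x < x2" for x
      using hder[OF that] m[of x] that b by (intro exI[of _ "b * exp (b * x) * (f x - m)"]) auto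
    show "continuous_on {x1..x2} h" unfolding h_def by (intro continuous_intros cont)
  qed
  then have le2: "exp (- b * x2) * h x1 \<le> exp (- b * x2) * h x2" by simp
  have e: "exp (- b * x2) * exp (b * x1) = exp (- b * (x2 - x1))" "exp (- b * x2) * exp (b * x2) = 1"
    by (simp_all add: mult_exp_exp right_diff_distrib)
  have "exp (- b * x2) * h x1 = exp (- b * x2) * exp (b * x1) * (b * g x1 - m)"
    "exp (- b * x2) * h x2 = exp (- b * x2) * exp (b * x2) * (b * g x2 - m)"
    by (simp_all only: h_def mult.assoc)
  then have "exp (- b * x2) * h x1 = exp (- b * (x2 - x1)) * (b * g x1 - m)" "exp (- b * x2) * h x2 = b * g x2 - m"
    by (simp_all only: e mult_1_left)
  then show ?thesis using le2
    by (simp only: right_diff_distrib mult_1_right) (simp add: mult.commute)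
qed

lemma ode_upper_bound:
  fixes g f :: "real \<Rightarrow> real"
  assumes b: "b > 0" and le: "x1 \<le> x2"
    and cont: "continuous_on {x1..x2} g"
    and der: "\<And>x. x1 < x \<Longrightarrow> x < x2 \<Longrightarrow> (g has_real_derivative f x - b * g x) (at x)"
    and m: "\<And>x. x \<in> {x1..x2} \<Longrightarrow> f x \<le> m"
  shows "b * g x2 \<le> exp (- b * (x2 - x1)) * (b * g x1) + m * (1 - exp (- b * (x2 - x1)))"
proof -
  have "b * (- g x2) \<ge> exp (- b * (x2 - x1)) * (b * (- g x1)) + (- m) * (1 - exp (- b * (x2 - x1)))"
    by (rule ode_lower_bound[OF b le, of "\<lambda>x. - g x" "\<lambda>x. - f x"])
       (auto intro!: continuous_intros cont derivative_eq_intros der m)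
  then show ?thesis by (simp add: algebra_simps)
qed

lemma self_decomposable_unimodal:
  fixes f f' :: "real \<Rightarrow> real" and G :: "'i \<Rightarrow> real \<Rightarrow> real" and b c :: "'i \<Rightarrow> real"
  assumes fin: "finite I" and c: "\<And>i. i \<in> I \<Longrightarrow> c i > 0" and b: "\<And>i. i \<in> I \<Longrightarrow> b i > 0"
    and fcont: "continuous_on {0..} f" and fnn: "\<And>x. x \<ge> 0 \<Longrightarrow> f x \<ge> 0" and f0: "f 0 = 0"
    and Gcont: "\<And>i. i \<in> I \<Longrightarrow> continuous_on {0..} (G i)" and G0: "\<And>i. i \<in> I \<Longrightarrow> G i 0 = 0"
    and fder: "\<And>x. x > 0 \<Longrightarrow> (f has_real_derivative f' x) (at x)"
    and Gder: "\<And>i x. i \<in> I \<Longrightarrow> x > 0 \<Longrightarrow> (G i has_real_derivative f x - b i * G i x) (at x)"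
    and eq: "\<And>x. x > 0 \<Longrightarrow> x * f x = (\<Sum>i\<in>I. c i * G i x)"
    and u: "0 \<le> u1" "u1 < u2" "u2 \<le> X" and fu: "f u1 > f u2"
  shows "f' X < 0"
proof -
  have deq: "f x + x * f' x = (\<Sum>i\<in>I. c i * (f x - b i * G i x))" if x: "x > 0" for x
  proof -
    have "((\<lambda>x. x * f x) has_real_derivative f x + x * f' x) (at x)"
      by (auto intro!: derivative_eq_intros fder x)
    moreover have "((\<lambda>x. x * f x) has_real_derivative (\<Sum>i\<in>I. c i * (f x - b i * G i x))) (at x)"
    proof (rule has_field_derivative_transform_within_open[of "\<lambda>x. \<Sum>i\<in>I. c i * G i x" _ _ "{0<..}"])
      show "((\<lambda>x. \<Sum>i\<in>I. c i * G i x) has_real_derivative (\<Sum>i\<in>I. c i * (f x - b i * G i x))) (at x)"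
        by (intro DERIV_sum DERIV_cmult Gder x)
    qed (use x eq in auto)
    ultimately show ?thesis by (rule DERIV_unique)
  qed
  obtain x1 where x1: "x1 \<in> {0..u2}" and x1max: "\<And>y. y \<in> {0..u2} \<Longrightarrow> f y \<le> f x1"
    using continuous_attains_sup[of "{0..u2}" f] continuous_on_subset[OF fcont, of "{0..u2}"] u by auto
  have fx1: "f x1 > f u2" using x1max[of u1] fu u by auto
  then have fx1pos: "f x1 > 0" using fnn[of u2] u by auto
  have "x1 \<noteq> 0" "x1 \<noteq> u2" using f0 fx1pos fx1 by auto
  then have x1in: "0 < x1" "x1 < u2" using x1 by auto
  have "f' x1 = 0"
  proof (rule DERIV_local_max[OF fder, of _ "min x1 (u2 - x1)"])
    show "\<forall>y. \<bar>x1 - y\<bar> < min x1 (u2 - x1) \<longrightarrow> f y \<le> f x1"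
      using x1max by (auto simp: abs_if split: if_splits)
  qed (use x1in in auto)
  then have sum1: "(\<Sum>i\<in>I. c i * (f x1 - b i * G i x1)) = f x1" using deq[of x1] x1in by simp
  define g where "g i = b i * G i x1 / f x1" for i
  have g1: "g i < 1" if i: "i \<in> I" for i
  proof -
    have "b i * G i x1 \<le> exp (- b i * (x1 - 0)) * (b i * G i 0) + f x1 * (1 - exp (- b i * (x1 - 0)))"
      by (rule ode_upper_bound[where f = f]) (use i x1in x1max b in \<open>auto intro: Gder continuous_on_subset[OF Gcont]\<close>)
    also have "\<dots> < f x1" using fx1pos by (simp add: G0[OF i] algebra_simps)
    finally show ?thesis using fx1pos by (simp add: g_def)
  qed
  have sumg: "(\<Sum>i\<in>I. c i * (1 - g i)) = 1"
  proof -
    have "(\<Sum>i\<in>I. c i * (f x1 - b i * G i x1)) = (\<Sum>i\<in>I. f x1 * (c i * (1 - g i)))"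
      by (intro sum.cong) (use fx1pos in \<open>auto simp: g_def field_simps\<close>)
    also have "\<dots> = f x1 * (\<Sum>i\<in>I. c i * (1 - g i))" by (simp add: sum_distrib_left)
    finally show ?thesis using sum1 fx1pos by simp
  qed
  then have Ine: "I \<noteq> {}" by auto
  have Gnn: "b i * G i x \<ge> exp (- b i * (x - y)) * (b i * G i y)" if i: "i \<in> I" and xy: "0 \<le> y" "y \<le> x" for i x y
  proof -
    have "b i * G i x \<ge> exp (- b i * (x - y)) * (b i * G i y) + 0 * (1 - exp (- b i * (x - y)))"
      by (rule ode_lower_bound[where f = f]) (use i xy b fnn in \<open>auto intro: Gder continuous_on_subset[OF Gcont]\<close>)
    then show ?thesis by simp
  qed
  obtain x2 where x2: "x2 \<in> {x1..X}" and x2min: "\<And>y. y \<in> {x1..X} \<Longrightarrow> f x2 \<le> f y"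
    using continuous_attains_inf[of "{x1..X}" f] continuous_on_subset[OF fcont, of "{x1..X}"] u x1in by auto
  have "x2 \<noteq> x1" using x2min[of u2] fx1 x1in u by auto
  then have x2gt: "x1 < x2" using x2 by auto
  have key: "f' x2 < 0"
  proof -
    have fx2: "f x2 \<le> f x1" using x2min[of x1] x1in u by auto
    have lower: "b i * G i x2 > f x2 * g i \<or> (f x2 = 0 \<and> b i * G i x2 \<ge> 0)" if i: "i \<in> I" for i
    proof -
      let ?e = "exp (- b i * (x2 - x1))"
      have e1: "?e < 1" using b[OF i] x2gt by simp
      have gnn: "g i \<ge> 0" using Gnn[OF i, of 0 x1] fx1pos x1in by (simp add: g_def G0[OF i])
      have "b i * G i x2 \<ge> ?e * (b i * G i x1) + f x2 * (1 - ?e)"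
        by (rule ode_lower_bound[where f = f])
           (use i x1in x2 x2min b in \<open>auto intro: Gder continuous_on_subset[OF Gcont]\<close>)
      moreover have "?e * (b i * G i x1) = ?e * (g i * f x1)" using fx1pos by (simp add: g_def)
      moreover have "?e * (g i * f x2) \<le> ?e * (g i * f x1)" using fx2 gnn by (intro mult_left_mono) auto
      ultimately have 1: "b i * G i x2 \<ge> ?e * (g i * f x2) + f x2 * (1 - ?e)" by linarith
      have "?e * (g i * f x2) + f x2 * (1 - ?e) = f x2 * g i + f x2 * ((1 - ?e) * (1 - g i))" by (simp add: algebra_simps)
      then have 2: "b i * G i x2 \<ge> f x2 * g i + f x2 * ((1 - ?e) * (1 - g i))" using 1 by linarith
      have e2: "(1 - ?e) * (1 - g i) > 0" using e1 g1[OF i] by simp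
      have "f x2 = 0 \<or> f x2 > 0" using fnn[of x2] x1in x2gt by auto
      then show ?thesis
      proof
        assume "f x2 > 0"
        then have "f x2 * ((1 - ?e) * (1 - g i)) > 0" using e2 by (rule mult_pos_pos)
        then show ?thesis using 2 by linarith
      qed (use 2 in simp)
    qed
    have fx2pos: "f x2 > 0"
    proof (rule ccontr)
      assume "\<not> f x2 > 0"
      then have z: "f x2 = 0" using fnn[of x2] x1in x2gt by auto
      
      have "x1 * f x1 = (\<Sum>i\<in>I. c i * G i x1)" by (rule eq[OF x1in(1)])
      moreover have "x1 * f x1 > 0" using x1in fx1pos by simp
      ultimately have "(\<Sum>i\<in>I. c i * G i x1) > 0" by simp
      then obtain i where i: "i \<in> I" "c i * G i x1 > 0"
        by (metis (no_types, lifting) leD not_le_imp_less sum_nonpos)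
      then have "G i x1 > 0" using c[OF i(1)] by (simp add: zero_less_mult_iff)
      have Gpos: "G j x2 \<ge> 0" if j: "j \<in> I" for j
        using Gnn[OF j, of 0 x2] G0[OF j] b[OF j] x1in x2gt by (simp add: zero_le_mult_iff)
      have "b i * G i x2 > 0"
      proof -
        have "0 < exp (- b i * (x2 - x1)) * (b i * G i x1)" using \<open>G i x1 > 0\<close> b[OF i(1)] by simp
        also have "\<dots> \<le> b i * G i x2" by (rule Gnn) (use i x1in x2gt in auto)
        finally show ?thesis .
      qed
      then have "0 < G i x2" using b[OF i(1)] by (simp add: zero_less_mult_iff)
      then have "0 < (\<Sum>i\<in>I. c i * G i x2)"
        using i Gpos c fin by (intro sum_pos2[of _ i]) (auto intro!: mult_nonneg_nonneg simp: less_imp_le)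
      then show False using eq[of x2] z x1in x2gt by simp
    qed
    have "(\<Sum>i\<in>I. c i * (f x2 - b i * G i x2)) < (\<Sum>i\<in>I. c i * (f x2 - f x2 * g i))"
      using lower fx2pos c Ine fin by (intro sum_strict_mono) auto
    also have "\<dots> = (\<Sum>i\<in>I. f x2 * (c i * (1 - g i)))" by (intro sum.cong) (auto simp: algebra_simps)
    also have "\<dots> = f x2" using sumg by (simp add: sum_distrib_left[symmetric])
    finally have "f x2 + x2 * f' x2 < f x2" using deq[of x2] x1in x2gt by simp
    then show ?thesis using x1in x2gt by (simp add: mult_less_0_iff)
  qed
  have "x2 = X"
  proof (rule ccontr)
    assume "x2 \<noteq> X"
    then have "x2 < X" using x2 by auto
    have "f' x2 = 0"
    proof (rule DERIV_local_min[OF fder, of _ "min (x2 - x1) (X - x2)"])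
      show "\<forall>y. \<bar>x2 - y\<bar> < min (x2 - x1) (X - x2) \<longrightarrow> f x2 \<le> f y"
        using x2min by (auto simp: abs_if split: if_splits)
    qed (use x1in x2gt \<open>x2 < X\<close> in auto)
    then show False using key by simp
  qed
  then show ?thesis using key by simp
qed

definition chord_majorant :: "real \<Rightarrow> real" where
  "chord_majorant y = y * (1 - 7/10 * (1 - y) * (1/3 - y))"

lemma chord_majorant_polynomial_inequality:
  fixes y x :: real
  assumes "0 \<le> y" "y \<le> 1" "3/2 \<le> x"
  shows "y * (1 - 7/10 * (1/3 - 8/3 * y + 3 * y^2)) \<le> x - 1 - 7/10 * (1/3 - y) * (x * (1 - y) + y)"
proof -
  have "0 \<le> (x - 3/2) * (1 - 7/10 * ((1/3 - y) * (1 - y)))"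
  proof (rule mult_nonneg_nonneg)
    have "(1/3 - y) * (1 - y) = 1/3 - y * (4/3 - y)" by (simp add: field_simps)
    then have "(1/3 - y) * (1 - y) \<le> 1/3" using assms mult_nonneg_nonneg[of y "4/3 - y"] by simp
    then show "0 \<le> 1 - 7/10 * ((1/3 - y) * (1 - y))" by simp
  qed (use assms in auto)
  moreover have "0 \<le> 21/10 * ((y + 13/90) * (y - 3/5)^2) + 8/1000 * y + 408/10000"
    using assms by (intro add_nonneg_nonneg mult_nonneg_nonneg) auto
  ultimately show ?thesis by (simp add: field_simps power2_eq_square power3_eq_cube)
qed

lemma chord_majorant_supersolution:
  fixes y x b :: real
  assumes "0 < y" "y < 1" "3/2 \<le> x" "1 \<le> b"
  shows "\<exists>d. (chord_majorant has_real_derivative d) (at y) \<and>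
     y^2 * d \<le> b * (x * chord_majorant y - y * (1 - chord_majorant y) / (1 - y))"
proof -
  define d where "d = 1 - 7/10 * (1/3 - 8/3 * y + 3 * y^2)"
  have der: "(chord_majorant has_real_derivative d) (at y)"
    unfolding chord_majorant_def d_def
    by (auto intro!: derivative_eq_intros simp: field_simps power2_eq_square)
  let ?B = "x - 1 - 7/10 * (1/3 - y) * (x * (1 - y) + y)"
  have "1 - chord_majorant y = (1 - y) * (1 + 7/10 * y * (1/3 - y))"
    by (simp add: chord_majorant_def field_simps)
  then have frac: "y * (1 - chord_majorant y) / (1 - y) = y * (1 + 7/10 * y * (1/3 - y))"
    using assms by simp
  have eq: "x * chord_majorant y - y * (1 - chord_majorant y) / (1 - y) = y * ?B"
    unfolding frac by (simp add: chord_majorant_def field_simps)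
  have le: "y * d \<le> ?B" unfolding d_def by (rule chord_majorant_polynomial_inequality) (use assms in auto)
  have "y * (1/3 - 8/3 * y + 3 * y^2) \<le> y * (4/3)"
  proof (rule mult_left_mono)
    have "y * y \<le> y" using assms by (simp add: mult_left_le)
    then show "1/3 - 8/3 * y + 3 * y^2 \<le> 4/3" using assms unfolding power2_eq_square by linarith
  qed (use assms in auto)
  then have "0 \<le> y * d" using assms by (simp add: d_def algebra_simps)
  then have "0 \<le> ?B" using le by linarith
  then have "y * ?B \<le> b * (y * ?B)" using assms mult_right_mono[of 1 b "y * ?B"] by simp
  moreover have "y^2 * d \<le> y * ?B" using mult_left_mono[OF le, of y] assms by (simp add: power2_eq_square mult.assoc)
  ultimately show ?thesis using der eq by (intro exI[of _ d]) auto
qed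

lemma s_curve_average_le_endpoint:
  fixes l l1 n :: "real \<Rightarrow> real" and \<rho> lam :: "'i \<Rightarrow> real"
  assumes \<kappa>: "0 < \<kappa>" "\<kappa> \<le> 1" and x: "3/2 \<le> x"
    and l: "\<And>t. t > 0 \<Longrightarrow> (l has_real_derivative l1 t) (at t)"
    and l1: "\<And>t. t > 0 \<Longrightarrow> (l1 has_real_derivative - n t / t^3) (at t)"
    and persist: "\<And>t1 t2. 0 < t1 \<Longrightarrow> t1 \<le> t2 \<Longrightarrow> n t1 \<ge> 0 \<Longrightarrow> n t2 \<ge> 0"
    and lim0: "(l \<longlongrightarrow> 0) (at_right 0)" and lim1: "((\<lambda>t. t * l1 t) \<longlongrightarrow> 0) (at_right 0)"
    and lnn: "\<And>t. t > 0 \<Longrightarrow> l t \<ge> 0"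
    and \<rho>: "\<And>i. i \<in> I \<Longrightarrow> \<rho> i \<ge> 0" "(\<Sum>i\<in>I. \<rho> i) = 1" and lam: "\<And>i. i \<in> I \<Longrightarrow> lam i \<ge> \<kappa>"
    and ode: "\<And>t. 0 < t \<Longrightarrow> t < \<kappa> \<Longrightarrow>
       x * l t - t^2 * l1 t = t * (\<Sum>i\<in>I. \<rho> i * ((l (lam i) - l t) / (lam i - t)))"
  shows "(\<forall>t\<in>{0<..\<kappa>}. l t \<le> t / \<kappa> * l \<kappa>) \<or> (\<forall>t\<in>{0<..\<kappa>}. l t \<le> chord_majorant (t / \<kappa>) * l \<kappa>)"
proof -
  define j where "j t = t * l1 t - l t" for t
  have jder: "(j has_real_derivative - n t / t^2) (at t)" if "t > 0" for t
    unfolding j_def using that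
    by (auto intro!: derivative_eq_intros l l1 simp: power2_eq_square power3_eq_cube)
  have jlim: "(j \<longlongrightarrow> 0) (at_right 0)" unfolding j_def using tendsto_diff[OF lim1 lim0] by simp
  have nneg: "n s < 0" if "n t < 0" "0 < s" "s \<le> t" for s t using persist[of s t] that by fastforce
  have jnn: "j t \<ge> 0" if t: "t > 0" "n t < 0" for t
  proof (rule tendsto_upperbound[OF jlim])
    show "\<forall>\<^sub>F s in at_right 0. j s \<le> j t"
      using eventually_at_right_real[OF t(1)]
    proof eventually_elim
      case (elim s)
      show ?case
      proof (rule DERIV_nonneg_imp_nondecreasing[where f = j])
        fix u assume u: "s \<le> u" "u \<le> t"
        then have "0 < u" using elim by auto
        then show "\<exists>y. (j has_real_derivative y) (at u) \<and> 0 \<le> y"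
          using jder[of u] nneg[OF t(2), of u] u by (intro exI[of _ "- n u / u^2"]) (auto simp: field_simps)
      qed (use elim in auto)
    qed
  qed auto
  have l1_dec: "l1 t \<le> l1 s" if "0 < s" "s \<le> t" "n s \<ge> 0" for s t
  proof (rule DERIV_nonpos_imp_nonincreasing[where f = l1])
    fix u assume u: "s \<le> u" "u \<le> t"
    then show "\<exists>y. (l1 has_real_derivative y) (at u) \<and> y \<le> 0"
      using l1[of u] persist[of s u] that by (intro exI[of _ "- n u / u^3"]) auto
  qed (use that in auto)
  have l1_inc: "l1 s \<le> l1 t" if "0 < s" "s \<le> t" "n t < 0" for s t
  proof (rule DERIV_nonneg_imp_nondecreasing[where f = l1])
    fix u assume u: "s \<le> u" "u \<le> t"
    then have "0 < u" "n u < 0" using that nneg[of t u] by auto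
    then show "\<exists>y. (l1 has_real_derivative y) (at u) \<and> 0 \<le> y"
      using l1[of u] by (intro exI[of _ "- n u / u^3"]) (auto simp: field_simps)
  qed (use that in auto)
  show ?thesis
  proof (cases "j \<kappa> \<ge> 0")
    case True
    have jpos: "j t \<ge> 0" if t: "0 < t" "t \<le> \<kappa>" for t
    proof (cases "n t < 0")
      case False
      have "j \<kappa> \<le> j t"
      proof (rule DERIV_nonpos_imp_nonincreasing[where f = j, OF t(2)])
        fix u assume u: "t \<le> u" "u \<le> \<kappa>"
        then show "\<exists>y. (j has_real_derivative y) (at u) \<and> y \<le> 0"
          using jder[of u] persist[of t u] t False by (intro exI[of _ "- n u / u^2"]) auto
      qed
      then show ?thesis using True by simp
    qed (use jnn t in auto)
    have "l t \<le> t / \<kappa> * l \<kappa>" if t: "t \<in> {0<..\<kappa>}" for t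
    proof -
      have "l t / t \<le> l \<kappa> / \<kappa>"
      proof (rule DERIV_nonneg_imp_nondecreasing[where f = "\<lambda>t. l t / t"])
        fix u assume u: "t \<le> u" "u \<le> \<kappa>"
        have "((\<lambda>t. l t / t) has_real_derivative j u / u^2) (at u)"
          using u t by (auto intro!: derivative_eq_intros l simp: j_def field_simps power2_eq_square)
        then show "\<exists>y. ((\<lambda>t. l t / t) has_real_derivative y) (at u) \<and> 0 \<le> y"
          using jpos[of u] u t by (intro exI[of _ "j u / u^2"]) auto
      qed (use t in auto)
      then show ?thesis using t \<kappa> by (simp add: field_simps)
    qed
    then show ?thesis by blast
  next
    case False
    then have jk: "j \<kappa> < 0" by simp
    have nk: "n \<kappa> \<ge> 0" using jnn[of \<kappa>] \<kappa> jk by fastforce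
    define D where "D t = l \<kappa> + l1 \<kappa> * (t - \<kappa>) - l t" for t
    have Dder: "(D has_real_derivative l1 \<kappa> - l1 t) (at t)" if "t > 0" for t
      unfolding D_def using that by (auto intro!: derivative_eq_intros l)
    have Dk: "D \<kappa> = 0" by (simp add: D_def)
    have D_above: "D t \<ge> 0" if t: "t \<ge> \<kappa>" for t
    proof -
      have "D \<kappa> \<le> D t"
      proof (rule DERIV_nonneg_imp_nondecreasing[where f = D, OF t])
        fix u assume u: "\<kappa> \<le> u" "u \<le> t"
        then show "\<exists>y. (D has_real_derivative y) (at u) \<and> 0 \<le> y"
          using Dder[of u] l1_dec[of \<kappa> u] nk \<kappa> by (intro exI[of _ "l1 \<kappa> - l1 u"]) auto
      qed
      then show ?thesis using Dk by simp
    qed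
    have D_below: "D t \<ge> 0" if t: "0 < t" "t \<le> \<kappa>" for t
    proof (rule ccontr)
      assume neg: "\<not> D t \<ge> 0"
      show False
      proof (cases "l1 t \<ge> l1 \<kappa>")
        case True
        have "D \<kappa> \<le> D t"
        proof (rule DERIV_nonpos_imp_nonincreasing[where f = D, OF t(2)])
          fix u assume u: "t \<le> u" "u \<le> \<kappa>"
          have "l1 u \<ge> l1 \<kappa>"
          proof (cases "n u \<ge> 0")
            case True then show ?thesis using l1_dec[of u \<kappa>] u t by auto
          next
            case False then show ?thesis using l1_inc[of t u] u t True by auto
          qed
          then show "\<exists>y. (D has_real_derivative y) (at u) \<and> y \<le> 0"
            using Dder[of u] u t by (intro exI[of _ "l1 \<kappa> - l1 u"]) auto
        qed
        then show False using neg Dk by simp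
      next
        case False
        then have nt: "n t < 0" using l1_dec[of t \<kappa>] t by fastforce
        \<comment> \<open>near the origin the tangent lies above\<close>
        have lim: "(D \<longlongrightarrow> l \<kappa> + l1 \<kappa> * (0 - \<kappa>) - 0) (at_right 0)"
          unfolding D_def by (intro tendsto_intros lim0)
        have "l \<kappa> + l1 \<kappa> * (0 - \<kappa>) - 0 \<le> D t"
        proof (rule tendsto_upperbound[OF lim])
          show "\<forall>\<^sub>F s in at_right 0. D s \<le> D t"
            using eventually_at_right_real[OF t(1)]
          proof eventually_elim
            case (elim s)
            show ?case
            proof (rule DERIV_nonneg_imp_nondecreasing[where f = D])
              fix u assume u: "s \<le> u" "u \<le> t"
              then show "\<exists>y. (D has_real_derivative y) (at u) \<and> 0 \<le> y"
                using Dder[of u] l1_inc[of u t] nt False elim by (intro exI[of _ "l1 \<kappa> - l1 u"]) auto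
            qed (use elim in auto)
          qed
        qed auto
        then show False using neg jk by (simp add: j_def algebra_simps)
      qed
    qed
    have chord: "(l (lam i) - l t) / (lam i - t) \<le> (l \<kappa> - l t) / (\<kappa> - t)"
      if t: "0 < t" "t < \<kappa>" and i: "i \<in> I" for t i
    proof -
      have 1: "l (lam i) \<le> l \<kappa> + l1 \<kappa> * (lam i - \<kappa>)" using D_above[OF lam[OF i]] by (simp add: D_def)
      have 2: "l1 \<kappa> \<le> (l \<kappa> - l t) / (\<kappa> - t)" using D_below[of t] t by (simp add: D_def field_simps)
      have "l (lam i) - l t \<le> (l \<kappa> - l t) + (l \<kappa> - l t) / (\<kappa> - t) * (lam i - \<kappa>)"
        using 1 mult_right_mono[OF 2, of "lam i - \<kappa>"] lam[OF i] by simp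
      also have "\<dots> = (l \<kappa> - l t) / (\<kappa> - t) * (lam i - t)" using t by (simp add: field_simps)
      finally show ?thesis using lam[OF i] t by (simp add: field_simps)
    qed
    have ineq: "t^2 * l1 t \<ge> x * l t - t * ((l \<kappa> - l t) / (\<kappa> - t))" if t: "0 < t" "t < \<kappa>" for t
    proof -
      have "(\<Sum>i\<in>I. \<rho> i * ((l (lam i) - l t) / (lam i - t))) \<le> (\<Sum>i\<in>I. \<rho> i * ((l \<kappa> - l t) / (\<kappa> - t)))"
        by (intro sum_mono mult_left_mono chord t \<rho>)
      also have "\<dots> = (l \<kappa> - l t) / (\<kappa> - t)" by (simp only: sum_distrib_right[symmetric] \<rho> mult_1_left)
      finally have "t * (\<Sum>i\<in>I. \<rho> i * ((l (lam i) - l t) / (lam i - t))) \<le> t * ((l \<kappa> - l t) / (\<kappa> - t))"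
        using t by (intro mult_left_mono) auto
      then show ?thesis using ode[OF t] by linarith
    qed
    define w where "w t = chord_majorant (t / \<kappa>) * l \<kappa> - l t" for t
    have wk: "w \<kappa> = 0" using \<kappa> by (simp add: w_def chord_majorant_def)
    have wder: "\<exists>d. (w has_real_derivative d) (at t) \<and> t^2 * d \<le> (x + t / (\<kappa> - t)) * w t"
      if t: "0 < t" "t < \<kappa>" for t
    proof -
      have y: "0 < t / \<kappa>" "t / \<kappa> < 1" and b1: "1 \<le> 1 / \<kappa>" using t \<kappa> by auto
      from chord_majorant_supersolution[OF y x b1] obtain d where
        d: "(chord_majorant has_real_derivative d) (at (t / \<kappa>))"
        and dle: "(t / \<kappa>)^2 * d \<le> 1 / \<kappa> * (x * chord_majorant (t / \<kappa>)
            - t / \<kappa> * (1 - chord_majorant (t / \<kappa>)) / (1 - t / \<kappa>))" by blast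
      have "((\<lambda>t. chord_majorant (t / \<kappa>)) has_real_derivative d * (1 / \<kappa>)) (at t)"
        by (rule DERIV_chain2[where f = chord_majorant and g = "\<lambda>t. t / \<kappa>", OF d]) (use \<kappa> in \<open>auto intro!: derivative_eq_intros\<close>)
      then have 1: "(w has_real_derivative d * (1 / \<kappa>) * l \<kappa> - l1 t) (at t)"
        unfolding w_def using t by (auto intro!: derivative_eq_intros l)
      have frac: "t / \<kappa> * (1 - chord_majorant (t / \<kappa>)) / (1 - t / \<kappa>) = t * (1 - chord_majorant (t / \<kappa>)) / (\<kappa> - t)"
        using t \<kappa> by (simp add: field_simps)
      have cancel: "\<kappa> * (1 / \<kappa> * z) = z" for z using \<kappa> by simp
      have "\<kappa> * ((t / \<kappa>)^2 * d) \<le> x * chord_majorant (t / \<kappa>) - t * (1 - chord_majorant (t / \<kappa>)) / (\<kappa> - t)"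
        using mult_left_mono[OF dle, of \<kappa>] \<kappa> unfolding cancel frac by simp
      then have "t^2 * (d * (1 / \<kappa>)) \<le> x * chord_majorant (t / \<kappa>) - t * (1 - chord_majorant (t / \<kappa>)) / (\<kappa> - t)"
        using \<kappa> by (simp add: power2_eq_square field_simps)
      then have "t^2 * (d * (1 / \<kappa>)) * l \<kappa> \<le> (x * chord_majorant (t / \<kappa>) - t * (1 - chord_majorant (t / \<kappa>)) / (\<kappa> - t)) * l \<kappa>"
        using lnn \<kappa> by (intro mult_right_mono) auto
      then have "t^2 * (d * (1 / \<kappa>) * l \<kappa> - l1 t) \<le>
         (x * chord_majorant (t / \<kappa>) - t * (1 - chord_majorant (t / \<kappa>)) / (\<kappa> - t)) * l \<kappa>
          - (x * l t - t * ((l \<kappa> - l t) / (\<kappa> - t)))"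
        using ineq[OF t] by (simp add: right_diff_distrib mult.assoc)
      also have "\<dots> = (x + t / (\<kappa> - t)) * w t"
      proof -
        define r where "r = t / (\<kappa> - t)"
        have e: "t * (1 - chord_majorant (t / \<kappa>)) / (\<kappa> - t) = r * (1 - chord_majorant (t / \<kappa>))"
          "t * ((l \<kappa> - l t) / (\<kappa> - t)) = r * (l \<kappa> - l t)" by (simp_all add: r_def)
        show ?thesis unfolding w_def r_def[symmetric] e by (simp add: algebra_simps)
      qed
      finally show ?thesis using 1 by blast
    qed
    have "w t \<ge> 0" if t: "0 < t" "t < \<kappa>" for t
    proof (rule ccontr)
      assume "\<not> w t \<ge> 0"
      then have wt: "w t < 0" by simp
      have wdiff: "\<exists>d. (w has_real_derivative d) (at u)" if "u > 0" for u
      proof -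
        have "(\<lambda>t. chord_majorant (t / \<kappa>)) differentiable (at u)"
          unfolding chord_majorant_def by (intro derivative_intros) (use \<kappa> in auto)
        then obtain d where "((\<lambda>t. chord_majorant (t / \<kappa>)) has_real_derivative d) (at u)"
          using real_differentiable_def by blast
        then have "(w has_real_derivative d * l \<kappa> - l1 u) (at u)"
          unfolding w_def using that by (auto intro!: derivative_eq_intros l)
        then show ?thesis by blast
      qed
      obtain q where q: "q \<in> {t..\<kappa>}" and qmin: "\<And>u. u \<in> {t..\<kappa>} \<Longrightarrow> w q \<le> w u"
      proof -
        have "continuous_on {t..\<kappa>} w"
        proof (rule continuous_at_imp_continuous_on, rule ballI)
          fix u assume "u \<in> {t..\<kappa>}"
          then show "isCont w u" using wdiff[of u] t DERIV_isCont by fastforce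
        qed
        then show ?thesis using continuous_attains_inf[of "{t..\<kappa>}" w] t that by auto
      qed
      have "w q < 0" using qmin[of t] t wt by auto
      then have qk: "q < \<kappa>" "0 < q" using q wk t by (auto simp: less_le)
      from wder[OF qk(2,1)] obtain d where d: "(w has_real_derivative d) (at q)"
        and "q^2 * d \<le> (x + q / (\<kappa> - q)) * w q" by blast
      moreover have "(x + q / (\<kappa> - q)) * w q < 0"
        using \<open>w q < 0\<close> x qk by (intro mult_pos_neg) (auto intro: add_pos_pos)
      ultimately have "q^2 * d < 0" by linarith
      then have "d < 0" using qk by (simp add: mult_less_0_iff)
      from DERIV_neg_dec_right[OF d this] obtain e where e: "e > 0" "\<And>h. 0 < h \<Longrightarrow> h < e \<Longrightarrow> w q > w (q + h)" by auto
      define h where "h = min (e/2) (\<kappa> - q)"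
      have "0 < h" "h < e" "q + h \<in> {t..\<kappa>}" using e qk q by (auto simp: h_def)
      then show False using e(2)[of h] qmin[of "q + h"] by auto
    qed
    then have "l t \<le> chord_majorant (t / \<kappa>) * l \<kappa>" if "t \<in> {0<..\<kappa>}" for t
      using that wk by (cases "t = \<kappa>") (auto simp: w_def)
    then show ?thesis by blast
  qed
qed

definition gamma_density :: "real \<Rightarrow> real \<Rightarrow> real \<Rightarrow> real" where
  "gamma_density k b x = (if 0 < x then b powr k * x powr (k - 1) * exp (- b * x) / Gamma k else 0)"

definition gamma_law :: "real \<Rightarrow> real \<Rightarrow> real measure" where
  "gamma_law k b = density lborel (\<lambda>x. ennreal (gamma_density k b x))"

lemma gamma_density_measurable [measurable]: "gamma_density k b \<in> borel_measurable borel"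
  unfolding gamma_density_def by measurable

lemma gamma_density_nonneg: "k > 0 \<Longrightarrow> 0 \<le> gamma_density k b x"
  by (auto simp: gamma_density_def intro!: divide_nonneg_nonneg mult_nonneg_nonneg Gamma_real_pos less_imp_le)

lemma sets_gamma_law [simp, measurable_cong]: "sets (gamma_law k b) = sets borel"
  by (simp add: gamma_law_def)

lemma space_gamma_law [simp]: "space (gamma_law k b) = UNIV"
  by (simp add: gamma_law_def)

lemma nn_integral_gamma_law:
  assumes [measurable]: "f \<in> borel_measurable borel"
  shows "(\<integral>\<^sup>+x. f x \<partial>gamma_law k b) = (\<integral>\<^sup>+x. ennreal (gamma_density k b x) * f x \<partial>lborel)"
  unfolding gamma_law_def by (rule nn_integral_density) auto

lemma nn_integral_gamma_density:
  assumes "k > 0" "b > 0"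
  shows "(\<integral>\<^sup>+x. ennreal (gamma_density k b x) \<partial>lborel) = 1"
proof -
  have "ennreal (Gamma k) = (\<integral>\<^sup>+t. ennreal (indicator {0..} t * t powr (k - 1) / exp t) \<partial>lborel)"
    by (rule Gamma_conv_nn_integral_real) fact
  also have "\<dots> = ennreal b * (\<integral>\<^sup>+x. ennreal (indicator {0..} (0 + b * x) * (0 + b * x) powr (k - 1) / exp (0 + b * x)) \<partial>lborel)"
    using assms by (subst nn_integral_real_affine[where c = b and t = 0]) auto
  also have "\<dots> = (\<integral>\<^sup>+x. ennreal (b * (indicator {0..} (0 + b * x) * (0 + b * x) powr (k - 1) / exp (0 + b * x))) \<partial>lborel)"
    using assms by (subst nn_integral_cmult[symmetric]) (auto simp: ennreal_mult'[symmetric] intro!: nn_integral_cong)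
  also have "\<dots> = (\<integral>\<^sup>+x. ennreal (Gamma k * gamma_density k b x) \<partial>lborel)"
  proof (rule nn_integral_cong_AE, rule AE_mp[OF AE_lborel_singleton[of 0]], intro AE_I2 impI)
    fix x :: real assume "x \<noteq> 0"
    show "ennreal (b * (indicator {0..} (0 + b * x) * (0 + b * x) powr (k - 1) / exp (0 + b * x))) = ennreal (Gamma k * gamma_density k b x)"
    proof (cases "x > 0")
      case True
      have "b * b powr (k - 1) = b powr k" using assms powr_mult_base[of b "k - 1"] by simp
      have "Gamma k \<noteq> 0" by (metis Gamma_real_pos assms(1) less_irrefl)
      then show ?thesis using \<open>b * b powr (k - 1) = b powr k\<close> True assms
        by (simp add: gamma_density_def powr_mult exp_minus field_simps)
    next
      case False
      then show ?thesis using \<open>x \<noteq> 0\<close> assms by (simp add: gamma_density_def zero_le_mult_iff)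
    qed
  qed
  also have "\<dots> = ennreal (Gamma k) * (\<integral>\<^sup>+x. ennreal (gamma_density k b x) \<partial>lborel)"
    using assms by (subst nn_integral_cmult[symmetric]) (auto simp: ennreal_mult' Gamma_real_pos less_imp_le)
  finally have eq: "ennreal (Gamma k) = ennreal (Gamma k) * (\<integral>\<^sup>+x. ennreal (gamma_density k b x) \<partial>lborel)" .
  have "ennreal (Gamma k) \<noteq> 0" "ennreal (Gamma k) \<noteq> \<top>"
    using assms by (simp_all add: ennreal_eq_0_iff not_le Gamma_real_pos)
  then show ?thesis using eq by (metis ennreal_mult_cancel_left mult.right_neutral)
qed

lemma prob_space_gamma_law: "k > 0 \<Longrightarrow> b > 0 \<Longrightarrow> prob_space (gamma_law k b)"
  by (rule prob_spaceI) (simp add: gamma_law_def emeasure_density nn_integral_gamma_density)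

lemma AE_gamma_law_pos: "AE x in gamma_law k b. 0 < x"
  unfolding gamma_law_def by (subst AE_density) (auto simp: gamma_density_def)

lemma gamma_density_tilt:
  assumes "c > 0" "b > 0"
  shows "gamma_density k (c * b) w = c powr k * exp (- (c - 1) * b * w) * gamma_density k b w"
proof -
  have "exp (- (c - 1) * b * w) * exp (- b * w) = exp (- (c * b) * w)"
    by (simp add: mult_exp_exp algebra_simps)
  then show ?thesis using assms by (simp add: gamma_density_def powr_mult field_simps)
qed

lemma nn_integral_powr_interval:
  fixes a c :: real assumes "a > -1" "c \<ge> 0"
  shows "(\<integral>\<^sup>+x. ennreal (x powr a) * indicator {0..c} x \<partial>lborel) = ennreal (c powr (a + 1) / (a + 1))"
proof -
  have "(\<integral>\<^sup>+x. ennreal (x powr a) * indicator {0..c} x \<partial>lborel) = (\<integral>\<^sup>+x. ennreal (indicator {0..c} x * x powr a) \<partial>lborel)"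
    by (intro nn_integral_cong) (auto split: split_indicator)
  also have "\<dots> = ennreal (c powr (a + 1) / (a + 1))"
    by (rule nn_integral_has_integral_lebesgue[OF _ has_integral_powr_from_0[OF assms]]) auto
  finally show ?thesis .
qed

lemma gamma_density_exponential_convolution:
  assumes "k > 0" "b > 0"
  shows "ennreal k * (\<integral>\<^sup>+w. ennreal (gamma_density k b w) * (indicator {w..} v * ennreal (exp (- b * (v - w)))) \<partial>lborel)
    = ennreal (v * gamma_density k b v)"
proof (cases "v > 0")
  case True
  let ?C = "b powr k * exp (- b * v) / Gamma k"
  have C: "?C \<ge> 0" using assms Gamma_real_pos[of k] by (simp add: less_imp_le)
  have "(\<integral>\<^sup>+w. ennreal (gamma_density k b w) * (indicator {w..} v * ennreal (exp (- b * (v - w)))) \<partial>lborel)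
    = (\<integral>\<^sup>+w. ennreal ?C * (ennreal (w powr (k - 1)) * indicator {0..v} w) \<partial>lborel)"
  proof (rule nn_integral_cong_AE, rule AE_mp[OF AE_lborel_singleton[of 0]], intro AE_I2 impI)
    fix w :: real assume "w \<noteq> 0"
    have "exp (- b * w) * exp (- b * (v - w)) = exp (- b * v)" by (simp add: mult_exp_exp algebra_simps)
    then have "gamma_density k b w * exp (- b * (v - w)) = ?C * w powr (k - 1)" if "w > 0"
      using that by (simp add: gamma_density_def field_simps)
    note pos = this
    show "ennreal (gamma_density k b w) * (indicator {w..} v * ennreal (exp (- b * (v - w))))
      = ennreal ?C * (ennreal (w powr (k - 1)) * indicator {0..v} w)"
    proof (cases "0 < w \<and> w \<le> v")
      case True
      then have "ennreal (gamma_density k b w) * ennreal (exp (- b * (v - w))) = ennreal ?C * ennreal (w powr (k - 1))"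
        using pos gamma_density_nonneg[OF assms(1), of b w] C by (simp only: ennreal_mult'[symmetric])
      then show ?thesis using True by (simp add: mult.assoc[symmetric])
    next
      case False
      then show ?thesis using \<open>w \<noteq> 0\<close> by (auto simp: gamma_density_def)
    qed
  qed
  also have "\<dots> = ennreal ?C * ennreal (v powr k / k)"
    using nn_integral_powr_interval[of "k - 1" v] assms True by (subst nn_integral_cmult) auto
  also have "\<dots> = ennreal (?C * (v powr k / k))" using C by (rule ennreal_mult'[symmetric])
  finally have eq: "(\<integral>\<^sup>+w. ennreal (gamma_density k b w) * (indicator {w..} v * ennreal (exp (- b * (v - w)))) \<partial>lborel)
    = ennreal (?C * (v powr k / k))" .
  have "v * v powr (k - 1) = v powr k" using True powr_mult_base[of v "k - 1"] by simp
  then have "k * (?C * (v powr k / k)) = v * gamma_density k b v"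
    using True assms by (simp add: gamma_density_def)
  then show ?thesis unfolding eq using assms by (simp add: ennreal_mult'[symmetric])
next
  case False
  have "(\<integral>\<^sup>+w. ennreal (gamma_density k b w) * (indicator {w..} v * ennreal (exp (- b * (v - w)))) \<partial>lborel)
    = (\<integral>\<^sup>+w. 0 \<partial>(lborel :: real measure))"
    using False by (intro nn_integral_cong) (auto simp: gamma_density_def split: split_indicator)
  then show ?thesis using False by (simp add: gamma_density_def)
qed

lemma size_bias_gamma_law:
  assumes k: "k > 0" "b > 0" and [measurable]: "\<phi> \<in> borel_measurable borel"
  shows "(\<integral>\<^sup>+w. ennreal w * \<phi> w \<partial>gamma_law k b)
    = ennreal k * (\<integral>\<^sup>+u. indicator {0..} u * ennreal (exp (- b * u)) * (\<integral>\<^sup>+w. \<phi> (w + u) \<partial>gamma_law k b) \<partial>lborel)"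
proof -
  have "(\<integral>\<^sup>+u. indicator {0..} u * ennreal (exp (- b * u)) * (\<integral>\<^sup>+w. \<phi> (w + u) \<partial>gamma_law k b) \<partial>lborel)
     = (\<integral>\<^sup>+u. (\<integral>\<^sup>+w. indicator {0..} u * ennreal (exp (- b * u)) * (ennreal (gamma_density k b w) * \<phi> (w + u)) \<partial>lborel) \<partial>lborel)"
    by (simp add: nn_integral_gamma_law nn_integral_cmult)
  also have "\<dots> = (\<integral>\<^sup>+w. (\<integral>\<^sup>+u. indicator {0..} u * ennreal (exp (- b * u)) * (ennreal (gamma_density k b w) * \<phi> (w + u)) \<partial>lborel) \<partial>lborel)"
    by (rule lborel_pair.Fubini') measurable
  also have "\<dots> = (\<integral>\<^sup>+w. (\<integral>\<^sup>+v. \<phi> v * (ennreal (gamma_density k b w) * (indicator {w..} v * ennreal (exp (- b * (v - w))))) \<partial>lborel) \<partial>lborel)"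
  proof (rule nn_integral_cong)
    fix w :: real
    have "(\<integral>\<^sup>+v. \<phi> v * (ennreal (gamma_density k b w) * (indicator {w..} v * ennreal (exp (- b * (v - w))))) \<partial>lborel)
      = (\<integral>\<^sup>+u. \<phi> (w + 1 * u) * (ennreal (gamma_density k b w) * (indicator {w..} (w + 1 * u) * ennreal (exp (- b * ((w + 1 * u) - w))))) \<partial>lborel)"
      by (subst nn_integral_real_affine[where c = 1 and t = w]) auto
    also have "\<dots> = (\<integral>\<^sup>+u. indicator {0..} u * ennreal (exp (- b * u)) * (ennreal (gamma_density k b w) * \<phi> (w + u)) \<partial>lborel)"
      by (intro nn_integral_cong) (auto simp: ac_simps split: split_indicator)
    finally show "(\<integral>\<^sup>+u. indicator {0..} u * ennreal (exp (- b * u)) * (ennreal (gamma_density k b w) * \<phi> (w + u)) \<partial>lborel)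
      = (\<integral>\<^sup>+v. \<phi> v * (ennreal (gamma_density k b w) * (indicator {w..} v * ennreal (exp (- b * (v - w))))) \<partial>lborel)" by simp
  qed
  also have "\<dots> = (\<integral>\<^sup>+v. (\<integral>\<^sup>+w. \<phi> v * (ennreal (gamma_density k b w) * (indicator {w..} v * ennreal (exp (- b * (v - w))))) \<partial>lborel) \<partial>lborel)"
    apply (rule lborel_pair.Fubini')
    apply (simp add: indicator_def)
    apply measurable
    done
  also have "\<dots> = (\<integral>\<^sup>+v. \<phi> v * (\<integral>\<^sup>+w. ennreal (gamma_density k b w) * (indicator {w..} v * ennreal (exp (- b * (v - w)))) \<partial>lborel) \<partial>lborel)"
    by (intro nn_integral_cong nn_integral_cmult) (auto simp: indicator_def)
  finally have "ennreal k * (\<integral>\<^sup>+u. indicator {0..} u * ennreal (exp (- b * u)) * (\<integral>\<^sup>+w. \<phi> (w + u) \<partial>gamma_law k b) \<partial>lborel)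
     = ennreal k * (\<integral>\<^sup>+v. \<phi> v * (\<integral>\<^sup>+w. ennreal (gamma_density k b w) * (indicator {w..} v * ennreal (exp (- b * (v - w)))) \<partial>lborel) \<partial>lborel)"
    by simp
  also have "\<dots> = (\<integral>\<^sup>+v. ennreal k * (\<phi> v * (\<integral>\<^sup>+w. ennreal (gamma_density k b w) * (indicator {w..} v * ennreal (exp (- b * (v - w)))) \<partial>lborel)) \<partial>lborel)"
    by (rule nn_integral_cmult[symmetric]) (auto simp: indicator_def)
  also have "\<dots> = (\<integral>\<^sup>+v. \<phi> v * ennreal (v * gamma_density k b v) \<partial>lborel)"
  proof (rule nn_integral_cong)
    fix v :: real
    show "ennreal k * (\<phi> v * (\<integral>\<^sup>+w. ennreal (gamma_density k b w) * (indicator {w..} v * ennreal (exp (- b * (v - w)))) \<partial>lborel))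
      = \<phi> v * ennreal (v * gamma_density k b v)"
      by (simp only: mult.left_commute[of "ennreal k"] gamma_density_exponential_convolution[OF k])
  qed
  also have "\<dots> = (\<integral>\<^sup>+v. ennreal (gamma_density k b v) * (ennreal v * \<phi> v) \<partial>lborel)"
    by (intro nn_integral_cong)
       (use gamma_density_nonneg[OF k(1), of b] in \<open>auto simp: gamma_density_def ennreal_mult' ac_simps not_less ennreal_mult''\<close>)
  also have "\<dots> = (\<integral>\<^sup>+w. ennreal w * \<phi> w \<partial>gamma_law k b)"
    by (simp add: nn_integral_gamma_law)
  finally show ?thesis by simp
qed

lemma gamma_law_convolution:
  assumes k: "k1 > 0" "k2 > 0" "b > 0"
  shows "gamma_law k1 b \<star> gamma_law k2 b = gamma_law (k1 + k2) b"
proof -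
  have fin: "finite_measure (gamma_law k1 b)" "finite_measure (gamma_law k2 b)"
    using prob_space_gamma_law k by (auto intro: prob_space.finite_measure)
  have Gpos: "Gamma k1 > 0" "Gamma k2 > 0" "Gamma (k1 + k2) > 0" using k by (auto intro!: Gamma_real_pos)
  have "gamma_law k1 b \<star> gamma_law k2 b
    = density lborel (\<lambda>x. \<integral>\<^sup>+y. ennreal (gamma_density k1 b (x - y)) * ennreal (gamma_density k2 b y) \<partial>lborel)"
    using fin unfolding gamma_law_def by (intro convolution_density) auto
  also have "\<dots> = density lborel (\<lambda>x. ennreal (gamma_density (k1 + k2) b x))"
  proof (rule density_cong)
    show "AE x in lborel. (\<integral>\<^sup>+y. ennreal (gamma_density k1 b (x - y)) * ennreal (gamma_density k2 b y) \<partial>lborel)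
       = ennreal (gamma_density (k1 + k2) b x)"
    proof (rule AE_mp[OF AE_lborel_singleton[of 0]], intro AE_I2 impI)
      fix x :: real assume "x \<noteq> 0"
      show "(\<integral>\<^sup>+y. ennreal (gamma_density k1 b (x - y)) * ennreal (gamma_density k2 b y) \<partial>lborel)
       = ennreal (gamma_density (k1 + k2) b x)"
      proof (cases "x > 0")
        case True
        let ?C = "b powr (k1 + k2) * exp (- b * x) / (Gamma k1 * Gamma k2) * x powr (k1 + k2 - 1)"
        have C: "?C \<ge> 0" using Gpos by simp
        have "(\<integral>\<^sup>+y. ennreal (gamma_density k1 b (x - y)) * ennreal (gamma_density k2 b y) \<partial>lborel)
           = ennreal x * (\<integral>\<^sup>+t. ennreal (gamma_density k1 b (x - (0 + x * t))) * ennreal (gamma_density k2 b (0 + x * t)) \<partial>lborel)"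
          using True by (subst nn_integral_real_affine[where c = x and t = 0]) auto
        also have "\<dots> = (\<integral>\<^sup>+t. ennreal x * (ennreal (gamma_density k1 b (x - (0 + x * t))) * ennreal (gamma_density k2 b (0 + x * t))) \<partial>lborel)"
          by (rule nn_integral_cmult[symmetric]) simp
        also have "\<dots> = (\<integral>\<^sup>+t. ennreal ?C * ennreal (indicator {0..1} t * (t powr (k2 - 1) * (1 - t) powr (k1 - 1))) \<partial>lborel)"
        proof (rule nn_integral_cong_AE, rule AE_mp[OF AE_lborel_singleton[of 0]], rule AE_mp[OF AE_lborel_singleton[of 1]], intro AE_I2 impI)
          fix t :: real assume t: "t \<noteq> 0" "t \<noteq> 1"
          show "ennreal x * (ennreal (gamma_density k1 b (x - (0 + x * t))) * ennreal (gamma_density k2 b (0 + x * t)))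
            = ennreal ?C * ennreal (indicator {0..1} t * (t powr (k2 - 1) * (1 - t) powr (k1 - 1)))"
          proof (cases "0 < t \<and> t < 1")
            case t01: True
            have p: "x - x * t = x * (1 - t)" "0 < x * (1 - t)" "0 < x * t" using True t01 by (auto simp: algebra_simps)
            have "b powr k1 * b powr k2 = b powr (k1 + k2)" by (simp add: powr_add)
            moreover have "exp (- b * (x * (1 - t))) * exp (- b * (x * t)) = exp (- b * x)"
              by (simp add: mult_exp_exp algebra_simps)
            moreover have "x * (x powr (k1 - 1) * x powr (k2 - 1)) = x powr (k1 + k2 - 1)"
              using True by (simp add: powr_mult_base powr_add[symmetric])
            moreover have "x * (gamma_density k1 b (x - (0 + x * t)) * gamma_density k2 b (0 + x * t))
              = (b powr k1 * b powr k2) * (exp (- b * (x * (1 - t))) * exp (- b * (x * t))) / (Gamma k1 * Gamma k2)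
                 * (x * (x powr (k1 - 1) * x powr (k2 - 1))) * (t powr (k2 - 1) * (1 - t) powr (k1 - 1))"
              using True t01 p by (simp add: gamma_density_def powr_mult)
            ultimately have "x * (gamma_density k1 b (x - (0 + x * t)) * gamma_density k2 b (0 + x * t))
              = ?C * (indicator {0..1} t * (t powr (k2 - 1) * (1 - t) powr (k1 - 1)))"
              using t01 by simp
            then show ?thesis using True C gamma_density_nonneg[OF k(1)] gamma_density_nonneg[OF k(2)]
              by (simp only: ennreal_mult'[symmetric] mult_nonneg_nonneg)
          next
            case False
            then have "t < 0 \<or> t > 1" using t by auto
            then have "gamma_density k1 b (x - (0 + x * t)) = 0 \<or> gamma_density k2 b (0 + x * t) = 0"
              using True by (auto simp: gamma_density_def zero_less_mult_iff not_less)
            moreover have "indicator {0..1} t = (0::real)" using False by (auto simp: t)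
            ultimately show ?thesis by auto
          qed
        qed
        also have "\<dots> = ennreal ?C * (\<integral>\<^sup>+t. ennreal (indicator {0..1} t * (t powr (k2 - 1) * (1 - t) powr (k1 - 1))) \<partial>lborel)"
          by (rule nn_integral_cmult) simp
        also have "(\<integral>\<^sup>+t. ennreal (indicator {0..1} t * (t powr (k2 - 1) * (1 - t) powr (k1 - 1))) \<partial>lborel) = ennreal (Beta k2 k1)"
          by (rule nn_integral_has_integral_lebesgue[OF _ has_integral_Beta_real]) (use k in auto)
        also have "ennreal ?C * ennreal (Beta k2 k1) = ennreal (?C * Beta k2 k1)"
          using C by (rule ennreal_mult'[symmetric])
        also have "?C * Beta k2 k1 = gamma_density (k1 + k2) b x"
          using True Gpos by (simp add: gamma_density_def Beta_def add.commute)
        finally show ?thesis .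
      next
        case False
        have "(\<integral>\<^sup>+y. ennreal (gamma_density k1 b (x - y)) * ennreal (gamma_density k2 b y) \<partial>lborel) = (\<integral>\<^sup>+y. 0 \<partial>(lborel :: real measure))"
          using False by (intro nn_integral_cong) (auto simp: gamma_density_def)
        then show ?thesis using False by (simp add: gamma_density_def)
      qed
    qed
  qed auto
  finally show ?thesis by (simp add: gamma_law_def)
qed

definition positive_params :: "(real \<times> real) list \<Rightarrow> bool" where
  "positive_params xs \<longleftrightarrow> (\<forall>(k, b)\<in>set xs. 0 < k \<and> 0 < b)"

lemma positive_params_simps [simp]:
  "positive_params []" "positive_params ((k, b) # xs) \<longleftrightarrow> 0 < k \<and> 0 < b \<and> positive_params xs"
  "positive_params (xs @ ys) \<longleftrightarrow> positive_params xs \<and> positive_params ys"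
  by (auto simp: positive_params_def)

fun gamma_sum_law :: "(real \<times> real) list \<Rightarrow> real measure" where
  "gamma_sum_law [] = return borel 0"
| "gamma_sum_law ((k, b) # xs) = (gamma_law k b \<star> gamma_sum_law xs)"

lemma sets_gamma_sum_law [simp, measurable_cong]: "sets (gamma_sum_law xs) = sets borel"
  by (induction xs rule: gamma_sum_law.induct) auto

lemma space_gamma_sum_law [simp]: "space (gamma_sum_law xs) = UNIV"
  using sets_eq_imp_space_eq[OF sets_gamma_sum_law] by simp

lemma prob_space_convolution:
  assumes "prob_space M" "prob_space N" and [measurable_cong]: "sets M = sets borel" "sets N = sets borel"
  shows "prob_space (M \<star> N)"
proof -
  interpret M: prob_space M by fact
  interpret N: prob_space N by fact
  interpret pair_prob_space M N ..
  show ?thesis unfolding convolution_def by (rule prob_space_distr) simp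
qed

lemma prob_space_gamma_sum_law: "positive_params xs \<Longrightarrow> prob_space (gamma_sum_law xs)"
  by (induction xs rule: gamma_sum_law.induct)
     (auto intro!: prob_space_return prob_space_convolution prob_space_gamma_law)

lemma gamma_law_sigma_finite: "k > 0 \<Longrightarrow> b > 0 \<Longrightarrow> sigma_finite_measure (gamma_law k b)"
  by (simp add: prob_space_gamma_law prob_space_imp_sigma_finite)

lemma AE_convolution_nonneg:
  fixes M N :: "real measure"
  assumes M: "prob_space M" "AE x in M. 0 \<le> x" and N: "prob_space N" "AE x in N. 0 \<le> x"
    and [measurable_cong, simp]: "sets M = sets borel" "sets N = sets borel"
  shows "AE x in M \<star> N. 0 \<le> x"
proof -
  have fin: "finite_measure M" "finite_measure N" using M N by (auto intro: prob_space.finite_measure)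
  have "emeasure (M \<star> N) {..<0} = (\<integral>\<^sup>+x. indicator {..<0} x \<partial>(M \<star> N))" by simp
  also have "\<dots> = (\<integral>\<^sup>+x. \<integral>\<^sup>+y. indicator {..<0} (x + y) \<partial>N \<partial>M)"
    by (rule nn_integral_convolution[OF fin]) auto
  also have "\<dots> = (\<integral>\<^sup>+x. 0 \<partial>M)"
  proof (rule nn_integral_cong_AE, rule AE_mp[OF M(2)], intro AE_I2 impI)
    fix x :: real assume "0 \<le> x"
    have "(\<integral>\<^sup>+y. indicator {..<0} (x + y) \<partial>N) = (\<integral>\<^sup>+y. 0 \<partial>N)"
      by (rule nn_integral_cong_AE, rule AE_mp[OF N(2)], intro AE_I2 impI) (use \<open>0 \<le> x\<close> in auto)
    then show "(\<integral>\<^sup>+y. indicator {..<0} (x + y) \<partial>N) = 0" by simp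
  qed
  finally have "emeasure (M \<star> N) {..<0} = 0" by simp
  then show ?thesis by (intro AE_I[of _ _ "{..<0}"]) auto
qed

lemma AE_gamma_sum_law_nonneg: "positive_params xs \<Longrightarrow> AE x in gamma_sum_law xs. 0 \<le> x"
proof (induction xs rule: gamma_sum_law.induct)
  case 1
  show ?case unfolding gamma_sum_law.simps by (subst AE_return) auto
next
  case (2 k b xs)
  have "AE x in gamma_law k b. 0 \<le> x" using AE_gamma_law_pos by eventually_elim simp
  then show ?case unfolding gamma_sum_law.simps using 2
    by (intro AE_convolution_nonneg prob_space_gamma_law prob_space_gamma_sum_law) auto
qed

lemma size_bias_gamma_sum_law:
  assumes "positive_params xs" and "\<phi> \<in> borel_measurable borel"
  shows "(\<integral>\<^sup>+q. ennreal q * \<phi> q \<partial>gamma_sum_law xs)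
    = (\<Sum>i<length xs. ennreal (fst (xs ! i)) *
        (\<integral>\<^sup>+u. indicator {0..} u * ennreal (exp (- snd (xs ! i) * u)) * (\<integral>\<^sup>+q. \<phi> (q + u) \<partial>gamma_sum_law xs) \<partial>lborel))"
  using assms
proof (induction xs arbitrary: \<phi> rule: gamma_sum_law.induct)
  case 1
  then show ?case by (simp add: nn_integral_return)
next
  case (2 k b xs)
  note [measurable] = 2(3)
  have kb: "k > 0" "b > 0" and xs: "positive_params xs" using 2(2) by auto
  let ?M = "gamma_law k b" and ?N = "gamma_sum_law xs"
  interpret M: prob_space ?M by (rule prob_space_gamma_law[OF kb])
  interpret N: prob_space ?N by (rule prob_space_gamma_sum_law[OF xs])
  interpret MN: pair_sigma_finite ?M lborel ..
  have conv: "(\<integral>\<^sup>+q. f q \<partial>(?M \<star> ?N)) = (\<integral>\<^sup>+x. \<integral>\<^sup>+y. f (x + y) \<partial>?N \<partial>?M)" if "f \<in> borel_measurable borel" for f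
    using that by (intro nn_integral_convolution) (auto intro: M.finite_measure_axioms N.finite_measure_axioms)
  let ?J = "\<lambda>c. (\<integral>\<^sup>+u. indicator {0..} u * ennreal (exp (- c * u)) * (\<integral>\<^sup>+q. \<phi> (q + u) \<partial>(?M \<star> ?N)) \<partial>lborel)"
  have "(\<integral>\<^sup>+q. ennreal q * \<phi> q \<partial>(?M \<star> ?N)) = (\<integral>\<^sup>+x. \<integral>\<^sup>+y. ennreal (x + y) * \<phi> (x + y) \<partial>?N \<partial>?M)"
    by (rule conv) simp
  also have "\<dots> = (\<integral>\<^sup>+x. (ennreal x * (\<integral>\<^sup>+y. \<phi> (x + y) \<partial>?N) + (\<integral>\<^sup>+y. ennreal y * \<phi> (x + y) \<partial>?N)) \<partial>?M)"
  proof (rule nn_integral_cong_AE, rule AE_mp[OF AE_gamma_law_pos], intro AE_I2 impI)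
    fix x :: real assume x: "0 < x"
    have "(\<integral>\<^sup>+y. ennreal (x + y) * \<phi> (x + y) \<partial>?N) = (\<integral>\<^sup>+y. (ennreal x * \<phi> (x + y) + ennreal y * \<phi> (x + y)) \<partial>?N)"
      by (rule nn_integral_cong_AE, rule AE_mp[OF AE_gamma_sum_law_nonneg[OF xs]], intro AE_I2 impI)
         (use x in \<open>auto simp: distrib_right\<close>)
    also have "\<dots> = ennreal x * (\<integral>\<^sup>+y. \<phi> (x + y) \<partial>?N) + (\<integral>\<^sup>+y. ennreal y * \<phi> (x + y) \<partial>?N)"
      by (subst nn_integral_add) (auto simp: nn_integral_cmult)
    finally show "(\<integral>\<^sup>+y. ennreal (x + y) * \<phi> (x + y) \<partial>?N) = \<dots>" .
  qed
  also have "\<dots> = (\<integral>\<^sup>+x. ennreal x * (\<integral>\<^sup>+y. \<phi> (x + y) \<partial>?N) \<partial>?M) + (\<integral>\<^sup>+x. \<integral>\<^sup>+y. ennreal y * \<phi> (x + y) \<partial>?N \<partial>?M)"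
    by (rule nn_integral_add) measurable
  also have "(\<integral>\<^sup>+x. ennreal x * (\<integral>\<^sup>+y. \<phi> (x + y) \<partial>?N) \<partial>?M) = ennreal k * ?J b"
  proof -
    have "(\<integral>\<^sup>+x. ennreal x * (\<integral>\<^sup>+y. \<phi> (x + y) \<partial>?N) \<partial>?M)
      = ennreal k * (\<integral>\<^sup>+u. indicator {0..} u * ennreal (exp (- b * u)) * (\<integral>\<^sup>+x. (\<integral>\<^sup>+y. \<phi> ((x + u) + y) \<partial>?N) \<partial>?M) \<partial>lborel)"
      by (rule size_bias_gamma_law[OF kb]) measurable
    also have "\<dots> = ennreal k * ?J b"
      by (subst conv) (auto simp: add.assoc add.commute add.left_commute)
    finally show ?thesis .
  qed
  also have "(\<integral>\<^sup>+x. \<integral>\<^sup>+y. ennreal y * \<phi> (x + y) \<partial>?N \<partial>?M)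
    = (\<integral>\<^sup>+x. (\<Sum>i<length xs. ennreal (fst (xs ! i)) *
        (\<integral>\<^sup>+u. indicator {0..} u * ennreal (exp (- snd (xs ! i) * u)) * (\<integral>\<^sup>+y. \<phi> (x + (y + u)) \<partial>?N) \<partial>lborel)) \<partial>?M)"
    by (intro nn_integral_cong 2(1)[OF xs]) measurable
  also have "\<dots> = (\<Sum>i<length xs. \<integral>\<^sup>+x. ennreal (fst (xs ! i)) *
        (\<integral>\<^sup>+u. indicator {0..} u * ennreal (exp (- snd (xs ! i) * u)) * (\<integral>\<^sup>+y. \<phi> (x + (y + u)) \<partial>?N) \<partial>lborel) \<partial>?M)"
    by (rule nn_integral_sum) measurable
  also have "\<dots> = (\<Sum>i<length xs. ennreal (fst (xs ! i)) * ?J (snd (xs ! i)))"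
  proof (rule sum.cong[OF refl])
    fix i
    let ?c = "snd (xs ! i)"
    have "(\<integral>\<^sup>+x. ennreal (fst (xs ! i)) * (\<integral>\<^sup>+u. indicator {0..} u * ennreal (exp (- ?c * u)) * (\<integral>\<^sup>+y. \<phi> (x + (y + u)) \<partial>?N) \<partial>lborel) \<partial>?M)
      = ennreal (fst (xs ! i)) * (\<integral>\<^sup>+x. (\<integral>\<^sup>+u. indicator {0..} u * ennreal (exp (- ?c * u)) * (\<integral>\<^sup>+y. \<phi> (x + (y + u)) \<partial>?N) \<partial>lborel) \<partial>?M)"
      by (rule nn_integral_cmult) measurable
    also have "(\<integral>\<^sup>+x. (\<integral>\<^sup>+u. indicator {0..} u * ennreal (exp (- ?c * u)) * (\<integral>\<^sup>+y. \<phi> (x + (y + u)) \<partial>?N) \<partial>lborel) \<partial>?M)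
      = (\<integral>\<^sup>+u. (\<integral>\<^sup>+x. indicator {0..} u * ennreal (exp (- ?c * u)) * (\<integral>\<^sup>+y. \<phi> (x + (y + u)) \<partial>?N) \<partial>?M) \<partial>lborel)"
      by (rule MN.Fubini'[symmetric]) measurable
    also have "\<dots> = ?J ?c"
      by (intro nn_integral_cong) (simp add: nn_integral_cmult conv add.assoc)
    finally show "(\<integral>\<^sup>+x. ennreal (fst (xs ! i)) * (\<integral>\<^sup>+u. indicator {0..} u * ennreal (exp (- ?c * u)) * (\<integral>\<^sup>+y. \<phi> (x + (y + u)) \<partial>?N) \<partial>lborel) \<partial>?M)
      = ennreal (fst (xs ! i)) * ?J ?c" .
  qed
  finally show ?case by (simp only: gamma_sum_law.simps length_Cons sum.lessThan_Suc_shift) simp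
qed

lemma has_real_derivative_integral:
  fixes g :: "real \<Rightarrow> 'a \<Rightarrow> real"
  assumes "finite_measure \<nu>" and d: "d > 0"
    and int: "\<And>y. \<bar>y - z\<bar> < d \<Longrightarrow> integrable \<nu> (g y)" and int': "integrable \<nu> g'"
    and bound: "AE q in \<nu>. \<forall>h. \<bar>h\<bar> < d \<longrightarrow> \<bar>g (z + h) q - g z q - h * g' q\<bar> \<le> C * h\<^sup>2"
  shows "((\<lambda>y. \<integral>q. g y q \<partial>\<nu>) has_real_derivative (\<integral>q. g' q \<partial>\<nu>)) (at z)"
proof -
  interpret finite_measure \<nu> by fact
  define K where "K = C * measure \<nu> (space \<nu>)"
  have est: "\<bar>(\<integral>q. g (z + h) q \<partial>\<nu>) - (\<integral>q. g z q \<partial>\<nu>) - h * (\<integral>q. g' q \<partial>\<nu>)\<bar> \<le> K * h\<^sup>2" if h: "\<bar>h\<bar> < d" for h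
  proof -
    have i1: "integrable \<nu> (g (z + h))" "integrable \<nu> (g z)" using int h d by auto
    have "\<bar>\<integral>q. (g (z + h) q - g z q - h * g' q) \<partial>\<nu>\<bar> \<le> (\<integral>q. \<bar>g (z + h) q - g z q - h * g' q\<bar> \<partial>\<nu>)"
      by (rule integral_abs_bound)
    also have "\<dots> \<le> (\<integral>q. C * h\<^sup>2 \<partial>\<nu>)"
    proof (rule integral_mono_AE)
      show "AE q in \<nu>. \<bar>g (z + h) q - g z q - h * g' q\<bar> \<le> C * h\<^sup>2"
        using bound by eventually_elim (use h in auto)
    qed (use i1 int' in auto)
    also have "\<dots> = K * h\<^sup>2" by (simp add: K_def)
    also have "(\<integral>q. (g (z + h) q - g z q - h * g' q) \<partial>\<nu>) = (\<integral>q. g (z + h) q \<partial>\<nu>) - (\<integral>q. g z q \<partial>\<nu>) - h * (\<integral>q. g' q \<partial>\<nu>)"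
      using i1 int' by simp
    finally show ?thesis .
  qed
  show ?thesis unfolding has_field_derivative_iff
  proof (rule LIM_zero_cancel, rule Lim_null_comparison[where g = "\<lambda>y. \<bar>K\<bar> * \<bar>y - z\<bar>"])
    show "((\<lambda>y. \<bar>K\<bar> * \<bar>y - z\<bar>) \<longlongrightarrow> 0) (at z)"
      by (auto intro!: tendsto_eq_intros)
    show "\<forall>\<^sub>F y in at z. norm (((\<integral>q. g y q \<partial>\<nu>) - (\<integral>q. g z q \<partial>\<nu>)) / (y - z) - (\<integral>q. g' q \<partial>\<nu>)) \<le> \<bar>K\<bar> * \<bar>y - z\<bar>"
      unfolding eventually_at
    proof (intro exI[of _ d] conjI d ballI impI)
      fix y assume y: "y \<noteq> z \<and> dist y z < d"
      then have "\<bar>(\<integral>q. g y q \<partial>\<nu>) - (\<integral>q. g z q \<partial>\<nu>) - (y - z) * (\<integral>q. g' q \<partial>\<nu>)\<bar> \<le> K * (y - z)\<^sup>2"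
        using est[of "y - z"] by (simp add: dist_real_def)
      also have "\<dots> \<le> \<bar>K\<bar> * (y - z)\<^sup>2" by (intro mult_right_mono) auto
      finally have "\<bar>(\<integral>q. g y q \<partial>\<nu>) - (\<integral>q. g z q \<partial>\<nu>) - (y - z) * (\<integral>q. g' q \<partial>\<nu>)\<bar> / \<bar>y - z\<bar> \<le> \<bar>K\<bar> * (y - z)\<^sup>2 / \<bar>y - z\<bar>"
        by (intro divide_right_mono) auto
      also have "\<bar>K\<bar> * (y - z)\<^sup>2 / \<bar>y - z\<bar> = \<bar>K\<bar> * \<bar>y - z\<bar>"
      proof -
        have sq: "(y - z)\<^sup>2 = \<bar>y - z\<bar> * \<bar>y - z\<bar>" by (metis power2_abs power2_eq_square)
        show ?thesis unfolding sq using y by (simp del: abs_mult_self_eq)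
      qed
      also have "\<bar>(\<integral>q. g y q \<partial>\<nu>) - (\<integral>q. g z q \<partial>\<nu>) - (y - z) * (\<integral>q. g' q \<partial>\<nu>)\<bar> / \<bar>y - z\<bar>
        = \<bar>((\<integral>q. g y q \<partial>\<nu>) - (\<integral>q. g z q \<partial>\<nu>)) / (y - z) - (\<integral>q. g' q \<partial>\<nu>)\<bar>"
        using y by (simp add: abs_divide[symmetric] diff_divide_distrib)
      finally show "norm (((\<integral>q. g y q \<partial>\<nu>) - (\<integral>q. g z q \<partial>\<nu>)) / (y - z) - (\<integral>q. g' q \<partial>\<nu>)) \<le> \<bar>K\<bar> * \<bar>y - z\<bar>" by simp
    qed
  qed
qed

definition exp_kernel :: "nat \<Rightarrow> real \<Rightarrow> real \<Rightarrow> real" where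
  "exp_kernel j s v = (if 0 < v then v ^ j * exp (- s * v) else 0)"

lemma exp_kernel_measurable [measurable]: "exp_kernel j s \<in> borel_measurable borel"
  unfolding exp_kernel_def by measurable

lemma exp_kernel_nonneg: "0 \<le> exp_kernel j s v"
  by (simp add: exp_kernel_def)

lemma exp_kernel_le:
  assumes "0 \<le> s" "v \<le> X" "0 \<le> X" shows "exp_kernel j s v \<le> X ^ j"
proof -
  have "v ^ j * exp (- s * v) \<le> X ^ j * 1" if "0 < v"
    using assms that by (intro mult_mono power_mono) auto
  then show ?thesis using assms by (auto simp: exp_kernel_def)
qed

lemma mult_exp_kernel: "v * exp_kernel j s v = exp_kernel (Suc j) s v"
  by (simp add: exp_kernel_def)

lemma exp_kernel_has_derivative:
  assumes s: "0 \<le> s" and j: "2 \<le> j"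
  shows "(exp_kernel j s has_real_derivative real j * exp_kernel (j - 1) s v - s * exp_kernel j s v) (at v)"
proof -
  consider "v > 0" | "v < 0" | "v = 0" by linarith
  then show ?thesis
  proof cases
    case 1
    have "((\<lambda>v. v ^ j * exp (- s * v)) has_real_derivative real j * exp_kernel (j - 1) s v - s * exp_kernel j s v) (at v)"
      using 1 by (auto intro!: derivative_eq_intros simp: exp_kernel_def algebra_simps)
    then show ?thesis
      by (rule has_field_derivative_transform_within_open[of _ _ _ "{0<..}"]) (use 1 in \<open>auto simp: exp_kernel_def\<close>)
  next
    case 2
    have "((\<lambda>v. 0) has_real_derivative real j * exp_kernel (j - 1) s v - s * exp_kernel j s v) (at v)"
      using 2 by (auto simp: exp_kernel_def)
    then show ?thesis
      by (rule has_field_derivative_transform_within_open[of _ _ _ "{..<0}"]) (use 2 in \<open>auto simp: exp_kernel_def\<close>)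
  next
    case 3
    have "((\<lambda>h. (exp_kernel j s h - exp_kernel j s 0) / (h - 0)) \<longlongrightarrow> 0) (at 0)"
    proof (rule Lim_null_comparison[where g = "\<lambda>h. \<bar>h\<bar>"])
      show "((\<lambda>h::real. \<bar>h\<bar>) \<longlongrightarrow> 0) (at 0)" by (auto intro!: tendsto_eq_intros)
      show "\<forall>\<^sub>F h in at 0. norm ((exp_kernel j s h - exp_kernel j s 0) / (h - 0)) \<le> \<bar>h\<bar>"
        unfolding eventually_at
      proof (intro exI[of _ 1] conjI ballI impI)
        fix h :: real assume h: "h \<noteq> 0 \<and> dist h 0 < 1"
        have "h ^ j * exp (- s * h) \<le> h ^ 2 * 1" if "h > 0"
          using that h s j by (intro mult_mono power_decreasing) (auto simp: dist_real_def)
        then show "norm ((exp_kernel j s h - exp_kernel j s 0) / (h - 0)) \<le> \<bar>h\<bar>"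
          using h by (auto simp: exp_kernel_def field_simps power2_eq_square abs_mult)
      qed auto
    qed
    then show ?thesis using 3 by (simp add: has_field_derivative_iff exp_kernel_def)
  qed
qed

lemma exp_kernel_lipschitz:
  assumes s: "0 \<le> s" and j: "1 \<le> j" and v: "v1 \<le> X" "v2 \<le> X" and X: "0 \<le> X"
  shows "\<bar>exp_kernel j s v1 - exp_kernel j s v2\<bar> \<le> (real j * X ^ (j - 1) + s * X ^ j) * \<bar>v1 - v2\<bar>"
proof -
  define \<omega> where "\<omega> v = v ^ j * exp (- s * v)" for v
  have eq: "exp_kernel j s v = \<omega> (max 0 v)" for v
    using j by (auto simp: exp_kernel_def \<omega>_def max_def)
  have "norm (\<omega> (max 0 v1) - \<omega> (max 0 v2)) \<le> (real j * X ^ (j - 1) + s * X ^ j) * norm (max 0 v1 - max 0 v2)"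
  proof (rule field_differentiable_bound[of "{0..X}" \<omega> "\<lambda>v. real j * v ^ (j - 1) * exp (- s * v) - s * (v ^ j * exp (- s * v))"])
    show "(\<omega> has_field_derivative real j * z ^ (j - 1) * exp (- s * z) - s * (z ^ j * exp (- s * z))) (at z within {0..X})" for z
      unfolding \<omega>_def by (auto intro!: derivative_eq_intros simp: algebra_simps)
    fix z assume z: "z \<in> {0..X}"
    have "norm (real j * z ^ (j - 1) * exp (- s * z) - s * (z ^ j * exp (- s * z))) \<le>
      norm (real j * z ^ (j - 1) * exp (- s * z)) + norm (s * (z ^ j * exp (- s * z)))" by (rule norm_triangle_ineq4)
    also have "\<dots> = real j * z ^ (j - 1) * exp (- s * z) + s * (z ^ j * exp (- s * z))" using z s by (simp add: abs_mult)
    also have "\<dots> \<le> real j * X ^ (j - 1) * 1 + s * (X ^ j * 1)"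
      using z s by (intro add_mono mult_mono power_mono) auto
    finally show "norm (real j * z ^ (j - 1) * exp (- s * z) - s * (z ^ j * exp (- s * z))) \<le> real j * X ^ (j - 1) + s * X ^ j" by simp
  qed (use v X in auto)
  also have "\<dots> \<le> (real j * X ^ (j - 1) + s * X ^ j) * \<bar>v1 - v2\<bar>"
    using s X by (intro mult_left_mono) (auto simp: max_def)
  finally show ?thesis by (simp add: eq)
qed

lemma exp_kernel_taylor:
  assumes s: "0 \<le> s" and j: "2 \<le> j" and v: "v \<le> X" "v + h \<le> X" and X: "0 \<le> X"
  shows "\<bar>exp_kernel j s (v + h) - exp_kernel j s v - h * (real j * exp_kernel (j - 1) s v - s * exp_kernel j s v)\<bar>
    \<le> (real j * (real (j - 1) * X ^ (j - 2) + s * X ^ (j - 1)) + s * (real j * X ^ (j - 1) + s * X ^ j)) * h\<^sup>2"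
proof -
  define D where "D u = real j * exp_kernel (j - 1) s u - s * exp_kernel j s u" for u
  define C where "C = real j * (real (j - 1) * X ^ (j - 2) + s * X ^ (j - 1)) + s * (real j * X ^ (j - 1) + s * X ^ j)"
  define S where "S = {min v (v + h)..max v (v + h)}"
  have C: "0 \<le> C" using s X by (simp add: C_def)
  have DL: "\<bar>D u - D v\<bar> \<le> C * \<bar>u - v\<bar>" if "u \<le> X" for u
  proof -
    have j2: "j - 2 = j - 1 - 1" "1 \<le> j - 1" using j by auto
    have "\<bar>D u - D v\<bar> \<le> real j * \<bar>exp_kernel (j - 1) s u - exp_kernel (j - 1) s v\<bar> + s * \<bar>exp_kernel j s u - exp_kernel j s v\<bar>"
    proof -
      have "D u - D v = real j * (exp_kernel (j - 1) s u - exp_kernel (j - 1) s v) - s * (exp_kernel j s u - exp_kernel j s v)"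
        by (simp add: D_def algebra_simps)
      then show ?thesis using s abs_triangle_ineq4[of "real j * (exp_kernel (j - 1) s u - exp_kernel (j - 1) s v)" "s * (exp_kernel j s u - exp_kernel j s v)"]
        by (simp add: abs_mult)
    qed
    also have "\<dots> \<le> real j * ((real (j - 1) * X ^ (j - 2) + s * X ^ (j - 1)) * \<bar>u - v\<bar>) + s * ((real j * X ^ (j - 1) + s * X ^ j) * \<bar>u - v\<bar>)"
    proof -
      have "\<bar>exp_kernel (j - 1) s u - exp_kernel (j - 1) s v\<bar> \<le> (real (j - 1) * X ^ (j - 2) + s * X ^ (j - 1)) * \<bar>u - v\<bar>"
        unfolding j2(1) by (rule exp_kernel_lipschitz[OF s j2(2) that v(1) X])
      moreover have "\<bar>exp_kernel j s u - exp_kernel j s v\<bar> \<le> (real j * X ^ (j - 1) + s * X ^ j) * \<bar>u - v\<bar>"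
        by (rule exp_kernel_lipschitz[OF s _ that v(1) X]) (use j in simp)
      ultimately show ?thesis using s by (intro add_mono mult_left_mono) auto
    qed
    also have "\<dots> = C * \<bar>u - v\<bar>" by (simp add: C_def algebra_simps)
    finally show ?thesis .
  qed
  have "norm ((\<lambda>u. exp_kernel j s u - u * D v) (v + h) - (\<lambda>u. exp_kernel j s u - u * D v) v) \<le> (C * \<bar>h\<bar>) * norm (v + h - v)"
  proof (rule field_differentiable_bound[of S _ "\<lambda>u. D u - D v"])
    show "((\<lambda>u. exp_kernel j s u - u * D v) has_field_derivative D u - D v) (at u within S)" for u
      unfolding D_def
      by (rule has_field_derivative_at_within) (auto intro!: derivative_eq_intros exp_kernel_has_derivative s j)
    fix u assume u: "u \<in> S"
    then have "\<bar>u - v\<bar> \<le> \<bar>h\<bar>" "u \<le> X" using v by (auto simp: S_def abs_if min_def max_def split: if_splits)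
    then show "norm (D u - D v) \<le> C * \<bar>h\<bar>"
      using DL[of u] C mult_left_mono[of "\<bar>u - v\<bar>" "\<bar>h\<bar>" C] by simp
  qed (auto simp: S_def)
  moreover have "(C * \<bar>h\<bar>) * norm (v + h - v) = C * h\<^sup>2" by (simp add: mult.assoc power2_eq_square)
  moreover have "(\<lambda>u. exp_kernel j s u - u * D v) (v + h) - (\<lambda>u. exp_kernel j s u - u * D v) v
    = exp_kernel j s (v + h) - exp_kernel j s v - h * D v" by (simp add: algebra_simps)
  ultimately have "norm (exp_kernel j s (v + h) - exp_kernel j s v - h * D v) \<le> C * h\<^sup>2" by (simp only:)
  then show ?thesis by (simp only: D_def C_def real_norm_def)
qed

definition exp_moment :: "real measure \<Rightarrow> nat \<Rightarrow> real \<Rightarrow> real \<Rightarrow> real" where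
  "exp_moment \<nu> j s x = (\<integral>q. exp_kernel j s (x - q) \<partial>\<nu>)"

locale nonneg_law = prob_space \<nu> for \<nu> :: "real measure" +
  assumes sets_law [simp, measurable_cong]: "sets \<nu> = sets borel"
    and AE_nonneg: "AE q in \<nu>. 0 \<le> q"
begin

lemma integrable_exp_kernel [simp]:
  assumes "0 \<le> s" shows "integrable \<nu> (\<lambda>q. exp_kernel j s (x - q))"
proof (rule integrable_const_bound)
  show "AE q in \<nu>. norm (exp_kernel j s (x - q)) \<le> (max 0 x) ^ j"
    using AE_nonneg by eventually_elim (use assms in \<open>auto simp: exp_kernel_nonneg intro!: exp_kernel_le\<close>)
qed simp

lemma exp_moment_nonneg: "0 \<le> exp_moment \<nu> j s x"
  by (simp add: exp_moment_def exp_kernel_nonneg)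

lemma exp_moment_eq_0: "x \<le> 0 \<Longrightarrow> exp_moment \<nu> j s x = 0"
proof -
  assume x: "x \<le> 0"
  have "exp_moment \<nu> j s x = (\<integral>q. 0 \<partial>\<nu>)" unfolding exp_moment_def
    by (rule integral_cong_AE) (use x AE_nonneg in \<open>auto simp: exp_kernel_def\<close>)
  then show ?thesis by simp
qed

lemma exp_moment_measurable [measurable]: "exp_moment \<nu> j s \<in> borel_measurable borel"
  unfolding exp_moment_def by measurable

lemma exp_moment_has_derivative_x:
  assumes s: "0 \<le> s" and j: "2 \<le> j"
  shows "(exp_moment \<nu> j s has_real_derivative real j * exp_moment \<nu> (j - 1) s x - s * exp_moment \<nu> j s x) (at x)"
proof -
  define X where "X = \<bar>x\<bar> + 1"
  define C where "C = real j * (real (j - 1) * X ^ (j - 2) + s * X ^ (j - 1)) + s * (real j * X ^ (j - 1) + s * X ^ j)"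
  have "((\<lambda>y. \<integral>q. exp_kernel j s (y - q) \<partial>\<nu>) has_real_derivative
    (\<integral>q. (real j * exp_kernel (j - 1) s (x - q) - s * exp_kernel j s (x - q)) \<partial>\<nu>)) (at x)"
  proof (rule has_real_derivative_integral[where d = 1 and C = C])
    show "AE q in \<nu>. \<forall>h. \<bar>h\<bar> < 1 \<longrightarrow> \<bar>exp_kernel j s (x + h - q) - exp_kernel j s (x - q) -
       h * (real j * exp_kernel (j - 1) s (x - q) - s * exp_kernel j s (x - q))\<bar> \<le> C * h\<^sup>2"
      using AE_nonneg
    proof eventually_elim
      case (elim q)
      show ?case
      proof (intro allI impI)
        fix h :: real assume h: "\<bar>h\<bar> < 1"
        have "x - q \<le> X" "x - q + h \<le> X" "0 \<le> X" using elim h by (auto simp: X_def)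
        from exp_kernel_taylor[OF s j this]
        show "\<bar>exp_kernel j s (x + h - q) - exp_kernel j s (x - q) -
          h * (real j * exp_kernel (j - 1) s (x - q) - s * exp_kernel j s (x - q))\<bar> \<le> C * h\<^sup>2"
          by (simp add: C_def algebra_simps)
      qed
    qed
  qed (use s in \<open>auto intro: finite_measure_axioms\<close>)
  then show ?thesis using s by (simp add: exp_moment_def[abs_def])
qed

lemma exp_moment_has_derivative_s:
  assumes s: "0 < s"
  shows "((\<lambda>s. exp_moment \<nu> j s x) has_real_derivative - exp_moment \<nu> (Suc j) s x) (at s)"
proof -
  define X where "X = max 0 x"
  have "((\<lambda>s. \<integral>q. exp_kernel j s (x - q) \<partial>\<nu>) has_real_derivative
    (\<integral>q. - exp_kernel (Suc j) s (x - q) \<partial>\<nu>)) (at s)"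
  proof (rule has_real_derivative_integral[where d = s and C = "X ^ (j + 2)"])
    show "AE q in \<nu>. \<forall>h. \<bar>h\<bar> < s \<longrightarrow> \<bar>exp_kernel j (s + h) (x - q) - exp_kernel j s (x - q) -
       h * (- exp_kernel (Suc j) s (x - q))\<bar> \<le> X ^ (j + 2) * h\<^sup>2"
      using AE_nonneg
    proof eventually_elim
      case (elim q)
      show ?case
      proof (intro allI impI)
        fix h :: real assume h: "\<bar>h\<bar> < s"
        define v where "v = x - q"
        show "\<bar>exp_kernel j (s + h) (x - q) - exp_kernel j s (x - q) - h * (- exp_kernel (Suc j) s (x - q))\<bar> \<le> X ^ (j + 2) * h\<^sup>2"
        proof (cases "0 < v")
          case True
          have vX: "v \<le> X" using elim by (auto simp: v_def X_def)
          define S where "S = {min s (s + h)..max s (s + h)}"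
          define D where "D u = - (v ^ (j + 1) * exp (- u * v))" for u
          have Dd: "(D has_real_derivative v ^ (j + 2) * exp (- u * v)) (at u within T)" for u T
            unfolding D_def by (auto intro!: derivative_eq_intros simp: algebra_simps)
          have nn: "0 \<le> u" if "u \<in> S" for u using that h s by (auto simp: S_def min_def split: if_splits)
          have DL: "norm (D u - D s) \<le> X ^ (j + 2) * norm (u - s)" if "u \<in> S" for u
          proof (rule field_differentiable_bound[of S D "\<lambda>u. v ^ (j + 2) * exp (- u * v)"])
            fix z assume "z \<in> S"
            have "v ^ (j + 2) * exp (- z * v) \<le> X ^ (j + 2) * 1"
              using True vX nn[OF \<open>z \<in> S\<close>] by (intro mult_mono power_mono) auto
            then show "norm (v ^ (j + 2) * exp (- z * v)) \<le> X ^ (j + 2)" using True by simp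
          qed (use that Dd in \<open>auto simp: S_def\<close>)
          have "norm ((\<lambda>u. v ^ j * exp (- u * v) - u * D s) (s + h) - (\<lambda>u. v ^ j * exp (- u * v) - u * D s) s)
            \<le> (X ^ (j + 2) * \<bar>h\<bar>) * norm (s + h - s)"
          proof (rule field_differentiable_bound[of S _ "\<lambda>u. D u - D s"])
            show "((\<lambda>u. v ^ j * exp (- u * v) - u * D s) has_field_derivative D u - D s) (at u within S)" for u
              unfolding D_def by (auto intro!: derivative_eq_intros simp: algebra_simps)
            fix u assume u: "u \<in> S"
            then have "\<bar>u - s\<bar> \<le> \<bar>h\<bar>" by (auto simp: S_def abs_if min_def max_def split: if_splits)
            then have "X ^ (j + 2) * \<bar>u - s\<bar> \<le> X ^ (j + 2) * \<bar>h\<bar>" by (intro mult_left_mono) (auto simp: X_def)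
            then show "norm (D u - D s) \<le> X ^ (j + 2) * \<bar>h\<bar>" using DL[OF u] by simp
          qed (auto simp: S_def)
          moreover have "(X ^ (j + 2) * \<bar>h\<bar>) * norm (s + h - s) = X ^ (j + 2) * h\<^sup>2" by (simp add: mult.assoc power2_eq_square)
          moreover have "(\<lambda>u. v ^ j * exp (- u * v) - u * D s) (s + h) - (\<lambda>u. v ^ j * exp (- u * v) - u * D s) s
            = exp_kernel j (s + h) v - exp_kernel j s v - h * (- exp_kernel (Suc j) s v)"
            using True by (simp add: exp_kernel_def D_def algebra_simps)
          ultimately have "norm (exp_kernel j (s + h) v - exp_kernel j s v - h * (- exp_kernel (Suc j) s v)) \<le> X ^ (j + 2) * h\<^sup>2"
            by (simp only:)
          then show ?thesis by (simp only: v_def real_norm_def)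
        next
          case False
          then show ?thesis by (simp add: exp_kernel_def v_def X_def)
        qed
      qed
    qed
    show "integrable \<nu> (\<lambda>q. exp_kernel j y (x - q))" if "\<bar>y - s\<bar> < s" for y
      using that by (intro integrable_exp_kernel) auto
  qed (use s in \<open>auto intro: finite_measure_axioms\<close>)
  then show ?thesis by (simp add: exp_moment_def)
qed

lemma exp_moment_tendsto_0:
  assumes "j \<le> 1"
  shows "((\<lambda>s. s ^ j * exp_moment \<nu> j s x) \<longlongrightarrow> 0) at_top"
proof -
  have "((\<lambda>s. \<integral>q. s ^ j * exp_kernel j s (x - q) \<partial>\<nu>) \<longlongrightarrow> (\<integral>q. 0 \<partial>\<nu>)) at_top"
  proof (rule integral_dominated_convergence_at_top[where w = "\<lambda>_. 1"])
    show "\<forall>\<^sub>F s in at_top. AE q in \<nu>. norm (s ^ j * exp_kernel j s (x - q)) \<le> 1"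
      using eventually_gt_at_top[of 0]
    proof eventually_elim
      case (elim s)
      have "s ^ j * exp_kernel j s v \<le> 1" for v
      proof (cases "0 < v")
        case True
        have "s * v * exp (- (s * v)) \<le> 1"
        proof -
          have "s * v \<le> exp (s * v)" using exp_ge_add_one_self[of "s * v"] by linarith
          then show ?thesis by (simp add: exp_minus field_simps)
        qed
        moreover have "exp (- (s * v)) \<le> 1" using True elim by simp
        moreover have "j = 0 \<or> j = 1" using assms by auto
        ultimately show ?thesis using True by (auto simp: exp_kernel_def mult.assoc)
      qed (simp add: exp_kernel_def)
      then show ?case using elim by (simp add: exp_kernel_nonneg)
    qed
    show "AE q in \<nu>. ((\<lambda>s. s ^ j * exp_kernel j s (x - q)) \<longlongrightarrow> 0) at_top"
    proof (rule AE_I2)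
      fix q
      show "((\<lambda>s. s ^ j * exp_kernel j s (x - q)) \<longlongrightarrow> 0) at_top"
      proof (cases "0 < x - q")
        case True
        have "((\<lambda>s. (s * (x - q)) ^ j / exp (s * (x - q))) \<longlongrightarrow> 0) at_top"
          by (rule filterlim_compose[OF tendsto_power_div_exp_0]) (use True in \<open>auto intro!: filterlim_at_top_mult_tendsto_pos[OF tendsto_const] filterlim_ident\<close>)
        moreover have "(s * (x - q)) ^ j / exp (s * (x - q)) = s ^ j * exp_kernel j s (x - q)" for s
          using True by (simp add: exp_kernel_def power_mult_distrib exp_minus divide_inverse)
        ultimately show ?thesis by (simp only:)
      qed (simp add: exp_kernel_def)
    qed
  qed auto
  then show ?thesis by (simp add: exp_moment_def)
qed

end

lemma nonneg_law_gamma_sum_law: "positive_params xs \<Longrightarrow> nonneg_law (gamma_sum_law xs)"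
  by (intro nonneg_law.intro nonneg_law_axioms.intro prob_space_gamma_sum_law AE_gamma_sum_law_nonneg) auto

lemma positive_params_nth: "positive_params xs \<Longrightarrow> i < length xs \<Longrightarrow> 0 < fst (xs ! i) \<and> 0 < snd (xs ! i)"
  by (force simp: positive_params_def case_prod_beta)

lemma (in nonneg_law) nn_integral_exp_kernel:
  "0 \<le> s \<Longrightarrow> (\<integral>\<^sup>+q. ennreal (exp_kernel j s (x - q)) \<partial>\<nu>) = ennreal (exp_moment \<nu> j s x)"
  unfolding exp_moment_def by (rule nn_integral_eq_integral) (auto simp: exp_kernel_nonneg)

lemma size_bias_exp_moment:
  assumes xs: "positive_params xs" and s: "0 \<le> s"
  defines "\<nu> \<equiv> gamma_sum_law xs"
  shows "0 \<le> x * exp_moment \<nu> j s x - exp_moment \<nu> (Suc j) s x"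
    and "ennreal (x * exp_moment \<nu> j s x - exp_moment \<nu> (Suc j) s x) =
      (\<Sum>i<length xs. ennreal (fst (xs ! i)) *
        (\<integral>\<^sup>+u. indicator {0..} u * ennreal (exp (- snd (xs ! i) * u)) * ennreal (exp_moment \<nu> j s (x - u)) \<partial>lborel))"
proof -
  interpret nonneg_law \<nu> unfolding \<nu>_def by (rule nonneg_law_gamma_sum_law[OF xs])
  let ?\<phi> = "\<lambda>q. ennreal (exp_kernel j s (x - q))"
  have eq: "q * exp_kernel j s (x - q) = x * exp_kernel j s (x - q) - exp_kernel (Suc j) s (x - q)" for q
    using mult_exp_kernel[of "x - q" j s] by (simp add: algebra_simps)
  have int: "integrable \<nu> (\<lambda>q. x * exp_kernel j s (x - q) - exp_kernel (Suc j) s (x - q))" using s by simp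
  have val: "(\<integral>q. (x * exp_kernel j s (x - q) - exp_kernel (Suc j) s (x - q)) \<partial>\<nu>) = x * exp_moment \<nu> j s x - exp_moment \<nu> (Suc j) s x"
    using s by (simp add: exp_moment_def)
  have nn: "AE q in \<nu>. 0 \<le> x * exp_kernel j s (x - q) - exp_kernel (Suc j) s (x - q)"
    using AE_nonneg by eventually_elim (simp add: eq[symmetric] exp_kernel_nonneg)
  show "0 \<le> x * exp_moment \<nu> j s x - exp_moment \<nu> (Suc j) s x"
    unfolding val[symmetric] by (rule integral_nonneg_AE[OF nn])
  have "ennreal (x * exp_moment \<nu> j s x - exp_moment \<nu> (Suc j) s x) = (\<integral>\<^sup>+q. ennreal (x * exp_kernel j s (x - q) - exp_kernel (Suc j) s (x - q)) \<partial>\<nu>)"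
    unfolding val[symmetric] by (rule nn_integral_eq_integral[OF int nn, symmetric])
  also have "\<dots> = (\<integral>\<^sup>+q. ennreal q * ?\<phi> q \<partial>\<nu>)"
    by (rule nn_integral_cong_AE, rule AE_mp[OF AE_nonneg], intro AE_I2 impI)
       (simp add: eq[symmetric] ennreal_mult exp_kernel_nonneg)
  also have "\<dots> = (\<Sum>i<length xs. ennreal (fst (xs ! i)) *
        (\<integral>\<^sup>+u. indicator {0..} u * ennreal (exp (- snd (xs ! i) * u)) * (\<integral>\<^sup>+q. ?\<phi> (q + u) \<partial>\<nu>) \<partial>lborel))"
    unfolding \<nu>_def by (rule size_bias_gamma_sum_law[OF xs]) simp
  also have "\<dots> = (\<Sum>i<length xs. ennreal (fst (xs ! i)) *
        (\<integral>\<^sup>+u. indicator {0..} u * ennreal (exp (- snd (xs ! i) * u)) * ennreal (exp_moment \<nu> j s (x - u)) \<partial>lborel))"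
    using nn_integral_exp_kernel[OF s, of j "x - _"] by (simp add: algebra_simps)
  finally show "ennreal (x * exp_moment \<nu> j s x - exp_moment \<nu> (Suc j) s x) = \<dots>" .
qed

lemma exp_moment_2_unimodal:
  assumes xs: "positive_params xs" and s: "0 < s"
    and u: "0 \<le> u1" "u1 < u2" "u2 \<le> X"
  defines "\<nu> \<equiv> gamma_sum_law xs"
  assumes less: "exp_moment \<nu> 2 s u2 < exp_moment \<nu> 2 s u1"
  shows "2 * exp_moment \<nu> 1 s X - s * exp_moment \<nu> 2 s X < 0"
proof -
  interpret nonneg_law \<nu> unfolding \<nu>_def by (rule nonneg_law_gamma_sum_law[OF xs])
  define n where "n = length xs"
  define c where "c i = (if i < n then fst (xs ! i) else 3)" for i
  define b where "b i = (if i < n then snd (xs ! i) else s)" for i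
  define f where "f = exp_moment \<nu> 2 s"
  define H where "H r x = exp (- r * x) * integral {-1..x} (\<lambda>y. exp (r * y) * f y)" for r x
  define G where "G i = (if i < n then H (b i) else (\<lambda>x. exp_moment \<nu> 3 s x / 3))" for i
  have fder: "(f has_real_derivative 2 * exp_moment \<nu> 1 s x - s * exp_moment \<nu> 2 s x) (at x)" for x
    using exp_moment_has_derivative_x[of s 2 x] s by (simp add: f_def)
  have fcont: "continuous_on A f" for A
    by (rule continuous_at_imp_continuous_on) (use fder DERIV_isCont in blast)
  have f0: "f x = 0" if "x \<le> 0" for x using exp_moment_eq_0[OF that] by (simp add: f_def)
  have Hder: "(H r has_real_derivative f x - r * H r x) (at x)" if x: "-1 < x" for r x
  proof -
    have "((\<lambda>x. integral {-1..x} (\<lambda>y. exp (r * y) * f y)) has_real_derivative exp (r * x) * f x) (at x within {-1..x+1})"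
      by (rule integral_has_real_derivative) (use x in \<open>auto intro!: continuous_intros fcont\<close>)
    moreover have "at x within {-1..x+1} = at x" by (rule at_within_interior) (use x in auto)
    ultimately have "((\<lambda>x. integral {-1..x} (\<lambda>y. exp (r * y) * f y)) has_real_derivative exp (r * x) * f x) (at x)" by simp
    moreover have "exp (- r * x) * (exp (r * x) * f x) = f x"
      by (simp only: mult.assoc[symmetric] mult_exp_exp) simp
    ultimately show ?thesis unfolding H_def
      by (auto intro!: derivative_eq_intros simp: algebra_simps)
  qed
  have Hcont: "continuous_on {0..} (H r)" for r
    by (rule continuous_at_imp_continuous_on) (use Hder DERIV_isCont in force)
  have Hint: "(\<integral>\<^sup>+u. indicator {0..} u * ennreal (exp (- r * u)) * ennreal (f (x - u)) \<partial>lborel) = ennreal (H r x)"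
    "0 \<le> H r x" if x: "0 < x" for r x
  proof -
    have "(\<integral>\<^sup>+u. indicator {0..} u * ennreal (exp (- r * u)) * ennreal (f (x - u)) \<partial>lborel)
      = (\<integral>\<^sup>+y. indicator {0..} (x + (-1) * y) * ennreal (exp (- r * (x + (-1) * y))) * ennreal (f (x - (x + (-1) * y))) \<partial>lborel)"
      by (subst nn_integral_real_affine[where c = "-1" and t = x]) (auto simp: f_def)
    also have "\<dots> = (\<integral>\<^sup>+y. ennreal (indicator {-1..x} y * (exp (- r * (x - y)) * f y)) \<partial>lborel)"
      by (intro nn_integral_cong)
         (use f0 exp_moment_nonneg in \<open>auto simp: f_def ennreal_mult'[symmetric] split: split_indicator\<close>)
    also have "\<dots> = ennreal (integral {-1..x} (\<lambda>y. exp (- r * (x - y)) * f y))"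
      by (rule nn_integral_has_integral_lebesgue)
         (use exp_moment_nonneg in \<open>auto simp: f_def[symmetric] intro!: integrable_integral integrable_continuous_real continuous_intros fcont\<close>, auto simp: f_def exp_moment_nonneg)
    also have "integral {-1..x} (\<lambda>y. exp (- r * (x - y)) * f y) = integral {-1..x} (\<lambda>y. exp (- r * x) * (exp (r * y) * f y))"
    proof (rule Henstock_Kurzweil_Integration.integral_cong)
      fix y :: real
      have "exp (- r * (x - y)) = exp (- r * x) * exp (r * y)" by (simp add: mult_exp_exp right_diff_distrib)
      then show "exp (- r * (x - y)) * f y = exp (- r * x) * (exp (r * y) * f y)" by (simp only: mult.assoc)
    qed
    also have "\<dots> = H r x" by (simp add: H_def)
    finally show "(\<integral>\<^sup>+u. indicator {0..} u * ennreal (exp (- r * u)) * ennreal (f (x - u)) \<partial>lborel) = ennreal (H r x)" .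
    show "0 \<le> H r x" unfolding H_def
      by (intro mult_nonneg_nonneg integral_nonneg integrable_continuous_real continuous_intros fcont)
         (auto simp: f_def exp_moment_nonneg)
  qed
  have cb: "c i > 0" "b i > 0" for i
    using positive_params_nth[OF xs, of i] s by (auto simp: c_def b_def n_def)
  have "(\<lambda>x. 2 * exp_moment \<nu> 1 s x - s * exp_moment \<nu> 2 s x) X < 0"
  proof (rule self_decomposable_unimodal[of "{..n}" c b f G _ u1 u2 X])
    show "x * f x = (\<Sum>i\<le>n. c i * G i x)" if x: "0 < x" for x
    proof -
      have Suc2: "Suc 2 = 3" by simp
      note sb = size_bias_exp_moment[OF xs less_imp_le[OF s], of x 2, folded \<nu>_def, folded f_def n_def, unfolded Suc2]
      have "ennreal (x * f x - exp_moment \<nu> 3 s x) = (\<Sum>i<n. ennreal (c i * H (b i) x))"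
        unfolding sb(2)
      proof (rule sum.cong[OF refl])
        fix i assume "i \<in> {..<n}"
        then have "fst (xs ! i) = c i" "snd (xs ! i) = b i" by (simp_all add: c_def b_def)
        then show "ennreal (fst (xs ! i)) * (\<integral>\<^sup>+u. indicator {0..} u * ennreal (exp (- snd (xs ! i) * u)) * ennreal (f (x - u)) \<partial>lborel)
          = ennreal (c i * H (b i) x)"
          by (simp only: Hint(1)[OF x] ennreal_mult'[OF less_imp_le[OF cb(1)]])
      qed
      also have "\<dots> = ennreal (\<Sum>i<n. c i * H (b i) x)"
        using cb Hint(2)[OF x] by (intro sum_ennreal mult_nonneg_nonneg) (auto simp: less_imp_le)
      finally have "x * f x - exp_moment \<nu> 3 s x = (\<Sum>i<n. c i * H (b i) x)"
        by (rule ennreal_inj[THEN iffD1, rotated 2])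
           (use sb(1) cb Hint(2)[OF x] in \<open>auto intro!: sum_nonneg mult_nonneg_nonneg simp: less_imp_le\<close>)
      then show ?thesis by (simp add: lessThan_Suc_atMost[symmetric] G_def) (simp add: c_def)
    qed
    show "(G i has_real_derivative f x - b i * G i x) (at x)" if "i \<in> {..n}" "0 < x" for i x
    proof (cases "i < n")
      case True
      then show ?thesis using Hder[of x] that by (simp add: G_def)
    next
      case False
      have "(exp_moment \<nu> 3 s has_real_derivative 3 * f x - s * exp_moment \<nu> 3 s x) (at x)"
        using exp_moment_has_derivative_x[of s 3 x] s by (simp add: f_def)
      then show ?thesis using False
        by (auto simp: G_def b_def intro!: derivative_eq_intros)
    qed
    show "continuous_on {0..} (G i)" for i
    proof (cases "i < n")
      case False
      have "continuous_on {0..} (exp_moment \<nu> 3 s)"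
        by (rule continuous_at_imp_continuous_on) (use exp_moment_has_derivative_x[of s 3] s DERIV_isCont in force)
      then show ?thesis using False by (auto simp: G_def intro!: continuous_intros)
    qed (use Hcont in \<open>simp add: G_def\<close>)
    show "G i 0 = 0" for i
    proof (cases "i < n")
      case True
      have "integral {-1..0} (\<lambda>y. exp (b i * y) * f y) = integral {-1..0::real} (\<lambda>y. 0 :: real)"
        by (rule Henstock_Kurzweil_Integration.integral_cong) (simp add: f0)
      then show ?thesis using True by (simp add: G_def H_def)
    qed (simp add: G_def exp_moment_eq_0)
  qed (use cb fcont f0 u less fder in \<open>auto simp: f_def exp_moment_nonneg\<close>)
  then show ?thesis by simp
qed

lemma exp_moment_slope_persists:
  assumes xs: "positive_params xs" and s: "0 < s" "s \<le> s0" and x: "0 < x"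
  defines "\<nu> \<equiv> gamma_sum_law xs"
  assumes nn: "0 \<le> 2 * exp_moment \<nu> 1 s0 x - s0 * exp_moment \<nu> 2 s0 x"
  shows "0 \<le> 2 * exp_moment \<nu> 1 s x - s * exp_moment \<nu> 2 s x"
proof -
  interpret nonneg_law \<nu> unfolding \<nu>_def by (rule nonneg_law_gamma_sum_law[OF xs])
  show ?thesis
  proof (cases "AE q in \<nu>. \<not> q < x")
    case True
    have "exp_moment \<nu> j s x = (\<integral>q. 0 \<partial>\<nu>)" for j
      unfolding exp_moment_def
      by (rule integral_cong_AE) (use True in \<open>auto simp: exp_kernel_def elim!: eventually_mono\<close>)
    then show ?thesis by simp
  next
    case False
    have M2pos: "0 < exp_moment \<nu> 2 \<sigma> x" if "0 < \<sigma>" for \<sigma>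
    proof (rule ccontr)
      assume "\<not> 0 < exp_moment \<nu> 2 \<sigma> x"
      then have "exp_moment \<nu> 2 \<sigma> x = 0" using exp_moment_nonneg[of 2 \<sigma> x] by linarith
      then have "AE q in \<nu>. exp_kernel 2 \<sigma> (x - q) = 0"
        unfolding exp_moment_def using that
        by (subst (asm) integral_nonneg_eq_0_iff_AE) (auto simp: exp_kernel_nonneg)
      then have "AE q in \<nu>. \<not> q < x" by eventually_elim (auto simp: exp_kernel_def)
      then show False using False by simp
    qed
    show ?thesis
    proof (rule nonneg_propagates_left[of s s0 "\<lambda>\<sigma>. 2 * exp_moment \<nu> 1 \<sigma> x - \<sigma> * exp_moment \<nu> 2 \<sigma> x"
        "\<lambda>\<sigma>. \<sigma> * exp_moment \<nu> 3 \<sigma> x - 3 * exp_moment \<nu> 2 \<sigma> x"])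
      fix \<sigma> assume \<sigma>: "\<sigma> \<in> {s..s0}"
      then have \<sigma>0: "0 < \<sigma>" using s by auto
      show "((\<lambda>\<sigma>. 2 * exp_moment \<nu> 1 \<sigma> x - \<sigma> * exp_moment \<nu> 2 \<sigma> x) has_real_derivative
        \<sigma> * exp_moment \<nu> 3 \<sigma> x - 3 * exp_moment \<nu> 2 \<sigma> x) (at \<sigma>)"
        using exp_moment_has_derivative_s[OF \<sigma>0, of 1 x] exp_moment_has_derivative_s[OF \<sigma>0, of 2 x]
        by (auto intro!: derivative_eq_intros simp: numeral_2_eq_2 numeral_3_eq_3)
      assume zero: "2 * exp_moment \<nu> 1 \<sigma> x - \<sigma> * exp_moment \<nu> 2 \<sigma> x = 0"
      have mono: "exp_moment \<nu> 2 \<sigma> y \<le> exp_moment \<nu> 2 \<sigma> x" if "0 \<le> y" "y \<le> x" for y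
      proof (rule ccontr)
        assume "\<not> exp_moment \<nu> 2 \<sigma> y \<le> exp_moment \<nu> 2 \<sigma> x"
        then have "exp_moment \<nu> 2 \<sigma> x < exp_moment \<nu> 2 \<sigma> y" by simp
        moreover from this have "y < x" using that by (cases "y = x") auto
        ultimately show False
          using exp_moment_2_unimodal[OF xs \<sigma>0, of y x x] that zero by (simp add: \<nu>_def)
      qed
      have d3: "(exp_moment \<nu> 3 \<sigma> has_real_derivative 3 * exp_moment \<nu> 2 \<sigma> y - \<sigma> * exp_moment \<nu> 3 \<sigma> y) (at y)" for y
        using exp_moment_has_derivative_x[of \<sigma> 3 y] \<sigma>0 by simp
      have c3: "continuous_on {0..x} (exp_moment \<nu> 3 \<sigma>)"
        by (rule continuous_at_imp_continuous_on) (use d3 DERIV_isCont in blast)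
      have "\<sigma> * exp_moment \<nu> 3 \<sigma> x \<le> exp (- \<sigma> * (x - 0)) * (\<sigma> * exp_moment \<nu> 3 \<sigma> 0)
         + 3 * exp_moment \<nu> 2 \<sigma> x * (1 - exp (- \<sigma> * (x - 0)))"
        by (rule ode_upper_bound[where f = "\<lambda>y. 3 * exp_moment \<nu> 2 \<sigma> y"])
           (use \<sigma>0 x d3 c3 mono in auto)
      also have "\<dots> < 3 * exp_moment \<nu> 2 \<sigma> x"
        using M2pos[OF \<sigma>0] by (simp add: exp_moment_eq_0 algebra_simps)
      finally show "\<sigma> * exp_moment \<nu> 3 \<sigma> x - 3 * exp_moment \<nu> 2 \<sigma> x < 0" by simp
    qed (use s nn in auto)
  qed
qed

lemma nn_integral_exponential_convolution:
  assumes "b < s"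
  shows "(\<integral>\<^sup>+u. indicator {0..} u * ennreal (exp (- b * u)) * ennreal (exp_kernel 0 s (v - u)) \<partial>lborel)
    = ennreal ((exp_kernel 0 b v - exp_kernel 0 s v) / (s - b))"
proof (cases "0 < v")
  case True
  define F where "F u = exp (- s * v) * exp ((s - b) * u) / (s - b)" for u
  have "(\<integral>\<^sup>+u. indicator {0..} u * ennreal (exp (- b * u)) * ennreal (exp_kernel 0 s (v - u)) \<partial>lborel)
    = (\<integral>\<^sup>+u. ennreal (exp (- s * v) * exp ((s - b) * u)) * indicator {0..v} u \<partial>lborel)"
  proof (rule nn_integral_cong_AE, rule AE_mp[OF AE_lborel_singleton[of v]], intro AE_I2 impI)
    fix u :: real assume "u \<noteq> v"
    have "exp (- b * u) * exp (- s * (v - u)) = exp (- s * v) * exp ((s - b) * u)"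
      by (simp add: mult_exp_exp algebra_simps)
    then show "indicator {0..} u * ennreal (exp (- b * u)) * ennreal (exp_kernel 0 s (v - u))
      = ennreal (exp (- s * v) * exp ((s - b) * u)) * indicator {0..v} u"
      using \<open>u \<noteq> v\<close> by (auto simp: exp_kernel_def ennreal_mult'[symmetric] split: split_indicator)
  qed
  also have "\<dots> = ennreal (F v - F 0)"
    by (rule nn_integral_FTC_Icc) (use assms True in \<open>auto simp: F_def intro!: derivative_eq_intros\<close>)
  also have "F v - F 0 = (exp_kernel 0 b v - exp_kernel 0 s v) / (s - b)"
  proof -
    have "exp (- s * v) * exp ((s - b) * v) = exp (- b * v)" by (simp add: mult_exp_exp algebra_simps)
    then show ?thesis using True by (simp add: F_def exp_kernel_def diff_divide_distrib)
  qed
  finally show ?thesis .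
next
  case False
  have "(\<integral>\<^sup>+u. indicator {0..} u * ennreal (exp (- b * u)) * ennreal (exp_kernel 0 s (v - u)) \<partial>lborel)
    = (\<integral>\<^sup>+u. 0 \<partial>(lborel :: real measure))"
    using False by (intro nn_integral_cong) (auto simp: exp_kernel_def split: split_indicator)
  then show ?thesis using False by (simp add: exp_kernel_def)
qed

lemma size_bias_exp_moment_0:
  assumes xs: "positive_params xs" and s: "\<And>i. i < length xs \<Longrightarrow> snd (xs ! i) < s" "0 \<le> s"
  defines "\<nu> \<equiv> gamma_sum_law xs"
  shows "x * exp_moment \<nu> 0 s x - exp_moment \<nu> 1 s x =
    (\<Sum>i<length xs. fst (xs ! i) * ((exp_moment \<nu> 0 (snd (xs ! i)) x - exp_moment \<nu> 0 s x) / (s - snd (xs ! i))))"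
proof -
  interpret nonneg_law \<nu> unfolding \<nu>_def by (rule nonneg_law_gamma_sum_law[OF xs])
  interpret P: pair_sigma_finite \<nu> lborel ..
  have inner: "(\<integral>\<^sup>+u. indicator {0..} u * ennreal (exp (- b * u)) * ennreal (exp_moment \<nu> 0 s (x - u)) \<partial>lborel)
    = ennreal ((exp_moment \<nu> 0 b x - exp_moment \<nu> 0 s x) / (s - b))"
    "0 \<le> (exp_moment \<nu> 0 b x - exp_moment \<nu> 0 s x) / (s - b)" if b: "0 < b" "b < s" for b
  proof -
    have nn: "0 \<le> (exp_kernel 0 b v - exp_kernel 0 s v) / (s - b)" for v
      using b by (auto simp: exp_kernel_def intro!: divide_nonneg_nonneg)
    have int: "integrable \<nu> (\<lambda>q. (exp_kernel 0 b (x - q) - exp_kernel 0 s (x - q)) / (s - b))" using b by simp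
    have val: "(\<integral>q. (exp_kernel 0 b (x - q) - exp_kernel 0 s (x - q)) / (s - b) \<partial>\<nu>) = (exp_moment \<nu> 0 b x - exp_moment \<nu> 0 s x) / (s - b)"
      using b by (simp add: exp_moment_def)
    have "(\<integral>\<^sup>+u. indicator {0..} u * ennreal (exp (- b * u)) * ennreal (exp_moment \<nu> 0 s (x - u)) \<partial>lborel)
      = (\<integral>\<^sup>+u. (\<integral>\<^sup>+q. indicator {0..} u * ennreal (exp (- b * u)) * ennreal (exp_kernel 0 s (x - u - q)) \<partial>\<nu>) \<partial>lborel)"
      using s(2) by (simp add: nn_integral_cmult nn_integral_exp_kernel)
    also have "\<dots> = (\<integral>\<^sup>+q. (\<integral>\<^sup>+u. indicator {0..} u * ennreal (exp (- b * u)) * ennreal (exp_kernel 0 s (x - u - q)) \<partial>lborel) \<partial>\<nu>)"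
      by (rule P.Fubini') measurable
    also have "\<dots> = (\<integral>\<^sup>+q. ennreal ((exp_kernel 0 b (x - q) - exp_kernel 0 s (x - q)) / (s - b)) \<partial>\<nu>)"
    proof (rule nn_integral_cong)
      fix q
      have "x - u - q = x - q - u" for u by simp
      then show "(\<integral>\<^sup>+u. indicator {0..} u * ennreal (exp (- b * u)) * ennreal (exp_kernel 0 s (x - u - q)) \<partial>lborel)
        = ennreal ((exp_kernel 0 b (x - q) - exp_kernel 0 s (x - q)) / (s - b))"
        by (simp only: nn_integral_exponential_convolution[OF b(2)])
    qed
    also have "\<dots> = ennreal ((exp_moment \<nu> 0 b x - exp_moment \<nu> 0 s x) / (s - b))"
      unfolding val[symmetric] by (rule nn_integral_eq_integral[OF int]) (use nn in auto)
    finally show "(\<integral>\<^sup>+u. indicator {0..} u * ennreal (exp (- b * u)) * ennreal (exp_moment \<nu> 0 s (x - u)) \<partial>lborel) = \<dots>" .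
    show "0 \<le> (exp_moment \<nu> 0 b x - exp_moment \<nu> 0 s x) / (s - b)"
      unfolding val[symmetric] by (rule integral_nonneg_AE) (use nn in auto)
  qed
  let ?t = "\<lambda>i. (exp_moment \<nu> 0 (snd (xs ! i)) x - exp_moment \<nu> 0 s x) / (s - snd (xs ! i))"
  have nn: "0 \<le> fst (xs ! i) * ?t i" if "i < length xs" for i
    by (rule mult_nonneg_nonneg) (use positive_params_nth[OF xs that] inner(2) s(1)[OF that] in \<open>auto simp: less_imp_le\<close>)
  have "ennreal (x * exp_moment \<nu> 0 s x - exp_moment \<nu> (Suc 0) s x) = (\<Sum>i<length xs. ennreal (fst (xs ! i)) * ennreal (?t i))"
    using size_bias_exp_moment(2)[OF xs s(2), of x 0, folded \<nu>_def] inner(1) s(1) positive_params_nth[OF xs]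
    by (auto intro!: sum.cong)
  also have "\<dots> = (\<Sum>i<length xs. ennreal (fst (xs ! i) * ?t i))"
    by (intro sum.cong refl ennreal_mult'[symmetric] less_imp_le) (use positive_params_nth[OF xs] in auto)
  also have "\<dots> = ennreal (\<Sum>i<length xs. fst (xs ! i) * ?t i)"
    using nn by (intro sum_ennreal) auto
  finally show ?thesis
    using size_bias_exp_moment(1)[OF xs s(2), of x 0, folded \<nu>_def] nn
    by (subst (asm) ennreal_inj) (auto intro!: sum_nonneg)
qed

lemma tendsto_inverse_at_top: "((\<lambda>\<sigma>::real. 1 / \<sigma>) \<longlongrightarrow> 0) at_top"
  by (rule tendsto_divide_0[OF tendsto_const filterlim_at_top_imp_at_infinity[OF filterlim_ident]])

lemma nn_integral_inverse_square: "(\<integral>\<^sup>+\<sigma>. ennreal (1 / \<sigma>\<^sup>2) * indicator {1..} \<sigma> \<partial>lborel) = 1"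
proof -
  have "(\<integral>\<^sup>+\<sigma>. ennreal (1 / \<sigma>\<^sup>2) * indicator {1..} \<sigma> \<partial>lborel) = ennreal (0 - (- 1 / 1))"
  proof (rule nn_integral_FTC_atLeast[where F = "\<lambda>\<sigma>. - 1 / \<sigma>"])
    show "((\<lambda>\<sigma>::real. - 1 / \<sigma>) \<longlongrightarrow> 0) at_top" using tendsto_minus[OF tendsto_inverse_at_top] by simp
  qed (auto intro!: derivative_eq_intros simp: power2_eq_square field_simps)
  then show ?thesis by simp
qed

lemma nn_integral_chord_majorant:
  "(\<integral>\<^sup>+\<sigma>. ennreal (chord_majorant (1 / \<sigma>) / \<sigma>) * indicator {1..} \<sigma> \<partial>lborel) = 1"
proof -
  define F where "F \<sigma> = - (23/30) / \<sigma> - 14/30 / \<sigma>\<^sup>2 + 7/30 / \<sigma>^3" for \<sigma> :: real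
  have "(\<integral>\<^sup>+\<sigma>. ennreal (chord_majorant (1 / \<sigma>) / \<sigma>) * indicator {1..} \<sigma> \<partial>lborel) = ennreal (0 - F 1)"
  proof (rule nn_integral_FTC_atLeast)
    show "(\<lambda>\<sigma>. chord_majorant (1 / \<sigma>) / \<sigma>) \<in> borel_measurable borel" unfolding chord_majorant_def by measurable
    have "((\<lambda>\<sigma>::real. - (23/30) * (1 / \<sigma>) - 14/30 * (1 / \<sigma>)\<^sup>2 + 7/30 * (1 / \<sigma>)^3) \<longlongrightarrow> - (23/30) * 0 - 14/30 * 0\<^sup>2 + 7/30 * 0^3) at_top"
      by (intro tendsto_intros tendsto_inverse_at_top)
    then show "(F \<longlongrightarrow> 0) at_top" by (simp add: F_def[abs_def] power_one_over)
    fix \<sigma> :: real assume \<sigma>: "1 \<le> \<sigma>"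
    show "(F has_real_derivative chord_majorant (1 / \<sigma>) / \<sigma>) (at \<sigma>)"
      unfolding F_def chord_majorant_def using \<sigma>
      by (auto intro!: derivative_eq_intros simp: field_simps eval_nat_numeral)
    define y where "y = 1 / \<sigma>"
    have y: "0 < y" "y \<le> 1" using \<sigma> by (auto simp: y_def)
    have "(1/3 - y) * (1 - y) = 1/3 - y * (4/3 - y)" by (simp add: field_simps)
    then have "(1 - y) * (1/3 - y) \<le> 1/3" using y mult_nonneg_nonneg[of y "4/3 - y"] by (simp add: mult.commute)
    then have "0 \<le> 1 - 7/10 * ((1 - y) * (1/3 - y))" by linarith
    then have "0 \<le> chord_majorant y" unfolding chord_majorant_def mult.assoc using y by (intro mult_nonneg_nonneg) auto
    then show "0 \<le> chord_majorant (1 / \<sigma>) / \<sigma>" using \<sigma> by (simp add: y_def)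
  qed
  then show ?thesis by (simp add: F_def)
qed

lemma exp_moment_average_le:
  assumes xs: "positive_params xs" and b: "1 \<le> b" "\<And>i. i < length xs \<Longrightarrow> snd (xs ! i) \<le> b"
    and mean: "(\<Sum>i<length xs. fst (xs ! i) / snd (xs ! i)) = 1" and x: "3/2 \<le> x"
  defines "\<nu> \<equiv> gamma_sum_law xs"
  shows "(\<integral>\<^sup>+\<sigma>. ennreal (exp_moment \<nu> 0 (b * \<sigma>) x / \<sigma>) * indicator {1..} \<sigma> \<partial>lborel) \<le> ennreal (exp_moment \<nu> 0 b x)"
proof -
  interpret nonneg_law \<nu> unfolding \<nu>_def by (rule nonneg_law_gamma_sum_law[OF xs])
  define l where "l t = exp_moment \<nu> 0 (1 / t) x" for t
  define l1 where "l1 t = exp_moment \<nu> 1 (1 / t) x / t\<^sup>2" for t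
  define n where "n t = 2 * exp_moment \<nu> 1 (1 / t) x - 1 / t * exp_moment \<nu> 2 (1 / t) x" for t
  have inv: "((\<lambda>t. 1 / t) has_real_derivative - 1 / t\<^sup>2) (at t)" if "t > 0" for t :: real
    using that by (auto intro!: derivative_eq_intros simp: power2_eq_square)
  have M: "((\<lambda>t. exp_moment \<nu> j (1 / t) x) has_real_derivative exp_moment \<nu> (Suc j) (1 / t) x / t\<^sup>2) (at t)" if "t > 0" for t j
    using DERIV_chain2[where f = "\<lambda>s. exp_moment \<nu> j s x" and g = "\<lambda>t. 1 / t", OF exp_moment_has_derivative_s[of "1 / t" j x] inv[OF that]] that
    by simp
  have props: "\<And>i. i < length xs \<Longrightarrow> 0 < fst (xs ! i) \<and> 0 < snd (xs ! i)" using positive_params_nth[OF xs] .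
  have "(\<forall>t\<in>{0<..1/b}. l t \<le> t / (1/b) * l (1/b)) \<or> (\<forall>t\<in>{0<..1/b}. l t \<le> chord_majorant (t / (1/b)) * l (1/b))"
  proof (rule s_curve_average_le_endpoint[of "1/b" x l l1 n "{..<length xs}" "\<lambda>i. fst (xs ! i) / snd (xs ! i)" "\<lambda>i. 1 / snd (xs ! i)"])
    show "(l has_real_derivative l1 t) (at t)" if "0 < t" for t
      using M[OF that, of 0] by (simp add: l_def[abs_def] l1_def)
    show "(l1 has_real_derivative - n t / t ^ 3) (at t)" if t: "0 < t" for t
    proof -
      have "((\<lambda>t. exp_moment \<nu> 1 (1 / t) x / t\<^sup>2) has_real_derivative
         (exp_moment \<nu> 2 (1 / t) x / t\<^sup>2 * t\<^sup>2 - exp_moment \<nu> 1 (1 / t) x * (2 * t)) / (t\<^sup>2 * t\<^sup>2)) (at t)"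
        using t M[OF t, of 1] by (auto intro!: derivative_eq_intros simp: numeral_2_eq_2)
      also have "(exp_moment \<nu> 2 (1 / t) x / t\<^sup>2 * t\<^sup>2 - exp_moment \<nu> 1 (1 / t) x * (2 * t)) / (t\<^sup>2 * t\<^sup>2) = - n t / t ^ 3"
        using t by (simp add: n_def field_simps eval_nat_numeral)
      finally show ?thesis by (simp add: l1_def[abs_def])
    qed
    show "0 \<le> n t2" if "0 < t1" "t1 \<le> t2" "0 \<le> n t1" for t1 t2
      using exp_moment_slope_persists[OF xs, of "1 / t2" "1 / t1" x] that x by (simp add: n_def \<nu>_def field_simps)
    show "(l \<longlongrightarrow> 0) (at_right 0)"
      unfolding filterlim_at_right_to_top l_def using exp_moment_tendsto_0[of 0 x] by (simp add: inverse_eq_divide)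
    have "\<forall>\<^sub>F s in at_top. s ^ 1 * exp_moment \<nu> 1 s x = inverse s * l1 (inverse s)"
      using eventually_gt_at_top[of 0] by eventually_elim (simp add: l1_def field_simps power2_eq_square inverse_eq_divide)
    then show "((\<lambda>t. t * l1 t) \<longlongrightarrow> 0) (at_right 0)"
      unfolding filterlim_at_right_to_top by (rule Lim_transform_eventually[OF exp_moment_tendsto_0[of 1 x], rotated]) simp
    show "x * l t - t\<^sup>2 * l1 t = t * (\<Sum>i<length xs. fst (xs ! i) / snd (xs ! i) * ((l (1 / snd (xs ! i)) - l t) / (1 / snd (xs ! i) - t)))"
      if t: "0 < t" "t < 1 / b" for t
    proof -
      have lt: "snd (xs ! i) < 1 / t" if "i < length xs" for i
      proof -
        have "b < 1 / t" using t b by (simp add: field_simps)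
        then show ?thesis using b(2)[OF that] by linarith
      qed
      have "x * l t - t\<^sup>2 * l1 t = x * exp_moment \<nu> 0 (1 / t) x - exp_moment \<nu> 1 (1 / t) x"
        using t by (simp add: l_def l1_def)
      also have "\<dots> = (\<Sum>i<length xs. fst (xs ! i) * ((exp_moment \<nu> 0 (snd (xs ! i)) x - exp_moment \<nu> 0 (1 / t) x) / (1 / t - snd (xs ! i))))"
        unfolding \<nu>_def by (rule size_bias_exp_moment_0[OF xs lt]) (use t in auto)
      also have "\<dots> = (\<Sum>i<length xs. t * (fst (xs ! i) / snd (xs ! i) * ((l (1 / snd (xs ! i)) - l t) / (1 / snd (xs ! i) - t))))"
      proof (rule sum.cong[OF refl])
        fix i assume "i \<in> {..<length xs}"
        then have i: "i < length xs" by simp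
        define c where "c = snd (xs ! i)"
        have c: "0 < c" "c < 1 / t" using props[OF i] lt[OF i] by (auto simp: c_def)
        then have ct: "1 - c * t > 0" using t by (simp add: field_simps)
        have e1: "1 / t - c = (1 - c * t) / t" using t by (simp add: field_simps)
        have e2: "1 / c - t = (1 - c * t) / c" using c by (simp add: field_simps)
        show "fst (xs ! i) * ((exp_moment \<nu> 0 (snd (xs ! i)) x - exp_moment \<nu> 0 (1 / t) x) / (1 / t - snd (xs ! i)))
          = t * (fst (xs ! i) / snd (xs ! i) * ((l (1 / snd (xs ! i)) - l t) / (1 / snd (xs ! i) - t)))"
          unfolding c_def[symmetric] e1 e2 using c t ct by (simp add: l_def)
      qed
      finally show ?thesis by (simp add: sum_distrib_left)
    qed
    show "1 / b \<le> 1 / snd (xs ! i)" if "i \<in> {..<length xs}" for i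
      using that b(2)[of i] props[of i] by (simp add: frac_le)
  qed (use b x mean props in \<open>auto simp: l_def exp_moment_nonneg less_imp_le\<close>)
  moreover have "t / (1 / b) = b * t" for t using b by simp
  ultimately consider (1) "\<forall>t\<in>{0<..1/b}. l t \<le> b * t * l (1/b)" | (2) "\<forall>t\<in>{0<..1/b}. l t \<le> chord_majorant (b * t) * l (1/b)" by metis
  then obtain V where V: "\<And>t. t \<in> {0<..1/b} \<Longrightarrow> l t \<le> V (b * t) * l (1/b)"
    and Vint: "(\<integral>\<^sup>+\<sigma>. ennreal (V (1 / \<sigma>) / \<sigma>) * indicator {1..} \<sigma> \<partial>lborel) = 1"
    and Vm [measurable]: "V \<in> borel_measurable borel"
  proof cases
    case 1
    then show ?thesis using that[of "\<lambda>y. y"] nn_integral_inverse_square by (auto simp: power2_eq_square)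
  next
    case 2
    have "chord_majorant \<in> borel_measurable borel" unfolding chord_majorant_def[abs_def] by measurable
    then show ?thesis using 2 that[of chord_majorant] nn_integral_chord_majorant by auto
  qed
  have "(\<integral>\<^sup>+\<sigma>. ennreal (exp_moment \<nu> 0 (b * \<sigma>) x / \<sigma>) * indicator {1..} \<sigma> \<partial>lborel)
    \<le> (\<integral>\<^sup>+\<sigma>. ennreal (exp_moment \<nu> 0 b x) * (ennreal (V (1 / \<sigma>) / \<sigma>) * indicator {1..} \<sigma>) \<partial>lborel)"
  proof (rule nn_integral_mono)
    fix \<sigma> :: real
    show "ennreal (exp_moment \<nu> 0 (b * \<sigma>) x / \<sigma>) * indicator {1..} \<sigma> \<le> ennreal (exp_moment \<nu> 0 b x) * (ennreal (V (1 / \<sigma>) / \<sigma>) * indicator {1..} \<sigma>)"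
    proof (cases "1 \<le> \<sigma>")
      case True
      define t where "t = 1 / (b * \<sigma>)"
      have t: "t \<in> {0<..1/b}" "b * t = 1 / \<sigma>" "1 / t = b * \<sigma>" using True b by (auto simp: t_def field_simps)
      have "exp_moment \<nu> 0 (b * \<sigma>) x \<le> V (1 / \<sigma>) * exp_moment \<nu> 0 b x"
        using V[OF t(1)] unfolding t(2) by (simp add: l_def t(3))
      then have "exp_moment \<nu> 0 (b * \<sigma>) x / \<sigma> \<le> exp_moment \<nu> 0 b x * (V (1 / \<sigma>) / \<sigma>)"
        using True by (simp add: field_simps)
      then have "ennreal (exp_moment \<nu> 0 (b * \<sigma>) x / \<sigma>) \<le> ennreal (exp_moment \<nu> 0 b x * (V (1 / \<sigma>) / \<sigma>))" by (rule ennreal_leI)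
      also have "\<dots> = ennreal (exp_moment \<nu> 0 b x) * ennreal (V (1 / \<sigma>) / \<sigma>)" by (rule ennreal_mult'[OF exp_moment_nonneg])
      finally show ?thesis using True by simp
    qed simp
  qed
  also have "\<dots> = ennreal (exp_moment \<nu> 0 b x)" by (subst nn_integral_cmult) (auto simp: Vint)
  finally show ?thesis .
qed

definition exp_integral :: "real \<Rightarrow> ennreal" where
  "exp_integral z = (\<integral>\<^sup>+\<sigma>. ennreal (exp (- z * \<sigma>) / \<sigma>) * indicator {1..} \<sigma> \<partial>lborel)"

lemma exp_integral_measurable [measurable]: "exp_integral \<in> borel_measurable borel"
  unfolding exp_integral_def by measurable

theorem exp_integral_le_exp_moment:
  assumes xs: "positive_params xs" and b: "1 \<le> b" "\<And>i. i < length xs \<Longrightarrow> snd (xs ! i) \<le> b"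
    and mean: "(\<Sum>i<length xs. fst (xs ! i) / snd (xs ! i)) = 1" and x: "3/2 \<le> x"
  shows "(\<integral>\<^sup>+q. indicator {..<x} q * exp_integral (b * (x - q)) \<partial>gamma_sum_law xs) \<le> ennreal (exp_moment (gamma_sum_law xs) 0 b x)"
proof -
  let ?\<nu> = "gamma_sum_law xs"
  interpret nonneg_law ?\<nu> by (rule nonneg_law_gamma_sum_law[OF xs])
  interpret P: pair_sigma_finite ?\<nu> lborel ..
  have "(\<integral>\<^sup>+q. indicator {..<x} q * exp_integral (b * (x - q)) \<partial>?\<nu>)
    = (\<integral>\<^sup>+q. (\<integral>\<^sup>+\<sigma>. ennreal (exp_kernel 0 (b * \<sigma>) (x - q)) * (ennreal (1 / \<sigma>) * indicator {1..} \<sigma>) \<partial>lborel) \<partial>?\<nu>)"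
  proof (rule nn_integral_cong)
    fix q
    have "indicator {..<x} q * exp_integral (b * (x - q)) = (\<integral>\<^sup>+\<sigma>. indicator {..<x} q * (ennreal (exp (- (b * (x - q)) * \<sigma>) / \<sigma>) * indicator {1..} \<sigma>) \<partial>lborel)"
      unfolding exp_integral_def by (rule nn_integral_cmult[symmetric]) measurable
    also have "\<dots> = (\<integral>\<^sup>+\<sigma>. ennreal (exp_kernel 0 (b * \<sigma>) (x - q)) * (ennreal (1 / \<sigma>) * indicator {1..} \<sigma>) \<partial>lborel)"
    proof (rule nn_integral_cong)
      fix \<sigma> :: real
      have "ennreal (exp (- (b * (x - q)) * \<sigma>) / \<sigma>) = ennreal (exp (- (b * \<sigma>) * (x - q))) * ennreal (1 / \<sigma>)"
        by (subst ennreal_mult'[symmetric]) (auto simp: algebra_simps)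
      then show "indicator {..<x} q * (ennreal (exp (- (b * (x - q)) * \<sigma>) / \<sigma>) * indicator {1..} \<sigma>)
        = ennreal (exp_kernel 0 (b * \<sigma>) (x - q)) * (ennreal (1 / \<sigma>) * indicator {1..} \<sigma>)"
        by (auto simp: exp_kernel_def mult.assoc split: split_indicator)
    qed
    finally show "indicator {..<x} q * exp_integral (b * (x - q)) = \<dots>" .
  qed
  also have "\<dots> = (\<integral>\<^sup>+\<sigma>. (\<integral>\<^sup>+q. ennreal (exp_kernel 0 (b * \<sigma>) (x - q)) * (ennreal (1 / \<sigma>) * indicator {1..} \<sigma>) \<partial>?\<nu>) \<partial>lborel)"
    by (rule P.Fubini'[symmetric]) (unfold exp_kernel_def, measurable)
  also have "\<dots> = (\<integral>\<^sup>+\<sigma>. ennreal (exp_moment ?\<nu> 0 (b * \<sigma>) x / \<sigma>) * indicator {1..} \<sigma> \<partial>lborel)"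
  proof (rule nn_integral_cong)
    fix \<sigma> :: real
    show "(\<integral>\<^sup>+q. ennreal (exp_kernel 0 (b * \<sigma>) (x - q)) * (ennreal (1 / \<sigma>) * indicator {1..} \<sigma>) \<partial>?\<nu>)
      = ennreal (exp_moment ?\<nu> 0 (b * \<sigma>) x / \<sigma>) * indicator {1..} \<sigma>"
    proof (cases "1 \<le> \<sigma>")
      case True
      have "ennreal (exp_moment ?\<nu> 0 (b * \<sigma>) x / \<sigma>) = ennreal (exp_moment ?\<nu> 0 (b * \<sigma>) x) * ennreal (1 / \<sigma>)"
        by (subst ennreal_mult'[symmetric]) (auto simp: exp_moment_nonneg)
      then show ?thesis using True b by (simp add: nn_integral_multc nn_integral_exp_kernel)
    qed simp
  qed
  also have "\<dots> \<le> ennreal (exp_moment ?\<nu> 0 b x)" by (rule exp_moment_average_le[OF assms])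
  finally show ?thesis .
qed

lemma antimono_of_right_derivative_bound:
  fixes g :: "real \<Rightarrow> real"
  assumes ab: "a \<le> b" and cont: "continuous_on {a..b} g"
    and step: "\<And>s e. a \<le> s \<Longrightarrow> s < b \<Longrightarrow> 0 < e \<Longrightarrow> \<exists>t. s < t \<and> t \<le> b \<and> g t \<le> g s + e * (t - s)"
  shows "g b \<le> g a"
proof -
  have "g b \<le> g a + e * (b - a)" if e: "0 < e" for e
  proof -
    define S where "S = {a..b} \<inter> (\<lambda>t. g t - e * (t - a)) -` {..g a}"
    have clS: "closed S" unfolding S_def
      by (rule continuous_closed_preimage) (auto intro!: continuous_intros cont)
    have aS: "a \<in> S" using ab by (auto simp: S_def)
    have bdd: "bdd_above S" by (rule bdd_aboveI[of _ b]) (auto simp: S_def)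
    define q where "q = Sup S"
    have qS: "q \<in> S" unfolding q_def using closed_contains_Sup[OF _ bdd clS] aS by auto
    have "q = b"
    proof (rule ccontr)
      assume "q \<noteq> b"
      then have "a \<le> q" "q < b" using qS by (auto simp: S_def)
      from step[OF this e] obtain t where t: "q < t" "t \<le> b" "g t \<le> g q + e * (t - q)" by blast
      then have "t \<in> S" using qS by (auto simp: S_def algebra_simps)
      then have "t \<le> q" unfolding q_def by (rule cSup_upper[OF _ bdd])
      then show False using t by simp
    qed
    then show ?thesis using qS by (simp add: S_def)
  qed
  note bound = this
  show ?thesis
  proof (rule field_le_epsilon)
    fix e :: real assume e: "0 < e"
    have "g b \<le> g a + e / (b - a + 1) * (b - a)" using ab e by (intro bound) auto
    also have "e / (b - a + 1) * (b - a) \<le> e" using ab e by (simp add: field_simps)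
    finally show "g b \<le> g a + e" by simp
  qed
qed

lemma powr_le_1_plus:
  fixes s e :: real assumes "0 \<le> s" "0 < e" "e \<le> 1" shows "s powr e \<le> 1 + e * s"
proof (cases "s = 0")
  case False
  then have s: "0 < s" using assms by simp
  have "s powr e = exp (e * ln s)" using s by (simp add: powr_def)
  also have "\<dots> = exp ((1 - e) *\<^sub>R 0 + e *\<^sub>R ln s)" by simp
  also have "\<dots> \<le> (1 - e) * exp 0 + e * exp (ln s)"
    by (rule convex_onD[OF exp_convex]) (use assms in auto)
  also have "\<dots> \<le> 1 + e * s" using s assms by simp
  finally show ?thesis .
qed (use assms in simp)

lemma exp_integral_antimono: "z \<le> z' \<Longrightarrow> exp_integral z' \<le> exp_integral z"
  unfolding exp_integral_def
  by (intro nn_integral_mono) (auto split: split_indicator intro!: ennreal_leI divide_right_mono)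

lemma gamma_tail_le:
  assumes e: "0 < e" "e \<le> 1" and b: "0 < b" and v: "0 < v"
  shows "emeasure (gamma_law e b) {v<..} \<le> ennreal (e / Gamma (1 + e)) * (exp_integral (b * v) + ennreal e)"
proof -
  define z where "z = b * v"
  have z: "0 < z" using b v by (simp add: z_def)
  have G: "Gamma (1 + e) = e * Gamma e" using Gamma_plus1[of e] e by (simp add: add.commute nonpos_Ints_def)
      
  have Gpos: "0 < Gamma e" by (rule Gamma_real_pos[OF e(1)])
  have "emeasure (gamma_law e b) {v<..} = (\<integral>\<^sup>+u. ennreal (gamma_density e b u) * indicator {v<..} u \<partial>lborel)"
    unfolding gamma_law_def by (simp add: emeasure_density)
  also have "\<dots> = ennreal v * (\<integral>\<^sup>+\<sigma>. ennreal (gamma_density e b (0 + v * \<sigma>)) * indicator {v<..} (0 + v * \<sigma>) \<partial>lborel)"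
    using v by (subst nn_integral_real_affine[where c = v and t = 0]) auto
  also have "\<dots> = (\<integral>\<^sup>+\<sigma>. ennreal v * (ennreal (gamma_density e b (0 + v * \<sigma>)) * indicator {v<..} (0 + v * \<sigma>)) \<partial>lborel)"
    by (rule nn_integral_cmult[symmetric]) simp
  also have "\<dots> \<le> (\<integral>\<^sup>+\<sigma>. ennreal (1 / Gamma e) * (ennreal (exp (- z * \<sigma>) / \<sigma>) * indicator {1..} \<sigma> + ennreal e * (ennreal (z * exp (- z * \<sigma>)) * indicator {1..} \<sigma>)) \<partial>lborel)"
  proof (rule nn_integral_mono)
    fix \<sigma> :: real
    show "ennreal v * (ennreal (gamma_density e b (0 + v * \<sigma>)) * indicator {v<..} (0 + v * \<sigma>)) \<le>
      ennreal (1 / Gamma e) * (ennreal (exp (- z * \<sigma>) / \<sigma>) * indicator {1..} \<sigma> + ennreal e * (ennreal (z * exp (- z * \<sigma>)) * indicator {1..} \<sigma>))"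
    proof (cases "1 < \<sigma>")
      case True
      have "v * gamma_density e b (v * \<sigma>) = 1 / Gamma e * ((z * \<sigma>) powr e * exp (- z * \<sigma>) / \<sigma>)"
      proof -
        have "(z * \<sigma>) powr e = b powr e * (v * \<sigma>) powr e" using b v True by (simp add: z_def powr_mult mult.assoc)
        also have "(v * \<sigma>) powr e = (v * \<sigma>) * (v * \<sigma>) powr (e - 1)" using v True by (simp add: powr_mult_base)
        finally show ?thesis using v True b by (simp add: gamma_density_def z_def mult.assoc)
      qed
      also have "\<dots> \<le> 1 / Gamma e * ((1 + e * (z * \<sigma>)) * exp (- z * \<sigma>) / \<sigma>)"
        using Gpos z True powr_le_1_plus[of "z * \<sigma>" e] e by (intro mult_left_mono divide_right_mono mult_right_mono) auto
      also have "\<dots> = 1 / Gamma e * (exp (- z * \<sigma>) / \<sigma> + e * (z * exp (- z * \<sigma>)))"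
        using True by (simp add: field_simps)
      finally have "ennreal (v * gamma_density e b (v * \<sigma>)) \<le> ennreal (1 / Gamma e * (exp (- z * \<sigma>) / \<sigma> + e * (z * exp (- z * \<sigma>))))"
        by (rule ennreal_leI)
      also have "\<dots> = ennreal (1 / Gamma e) * (ennreal (exp (- z * \<sigma>) / \<sigma>) + ennreal e * ennreal (z * exp (- z * \<sigma>)))"
      proof -
        have n: "0 \<le> 1 / Gamma e" "0 \<le> exp (- z * \<sigma>) / \<sigma>" "0 \<le> e * (z * exp (- z * \<sigma>))" "0 \<le> e"
          using Gpos True e z by auto
        show ?thesis by (simp only: ennreal_mult'[OF n(1)] ennreal_plus[OF n(2,3)] ennreal_mult'[OF n(4)])
      qed
      finally show ?thesis using True v by (simp add: ennreal_mult')
    next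
      case False
      then have "indicator {v<..} (0 + v * \<sigma>) = (0::ennreal)" using v by (auto simp: not_less mult_left_le)
      then show ?thesis by simp
    qed
  qed
  also have "\<dots> = ennreal (1 / Gamma e) * (exp_integral z + ennreal e * (\<integral>\<^sup>+\<sigma>. ennreal (z * exp (- z * \<sigma>)) * indicator {1..} \<sigma> \<partial>lborel))"
    unfolding exp_integral_def by (subst nn_integral_cmult, simp, subst nn_integral_add) (auto simp: nn_integral_cmult)
  also have "(\<integral>\<^sup>+\<sigma>. ennreal (z * exp (- z * \<sigma>)) * indicator {1..} \<sigma> \<partial>lborel) = ennreal (0 - (- exp (- z * 1)))"
  proof (rule nn_integral_FTC_atLeast[where F = "\<lambda>\<sigma>. - exp (- z * \<sigma>)"])
    have "LIM \<sigma> at_top. z * \<sigma> :> at_top" using z filterlim_at_top_mult_tendsto_pos[OF tendsto_const z filterlim_ident]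
      by (simp add: mult.commute)
    then have "((\<lambda>\<sigma>. exp (- (z * \<sigma>))) \<longlongrightarrow> 0) at_top"
      using filterlim_compose[OF exp_at_bot, of "\<lambda>\<sigma>. - (z * \<sigma>)"] by (simp add: filterlim_uminus_at_top)
    then show "((\<lambda>\<sigma>. - exp (- z * \<sigma>)) \<longlongrightarrow> 0) at_top" using tendsto_minus by fastforce
  qed (use z in \<open>auto intro!: derivative_eq_intros\<close>)
  also have "ennreal (1 / Gamma e) * (exp_integral z + ennreal e * ennreal (0 - (- exp (- z * 1)))) \<le> ennreal (1 / Gamma e) * (exp_integral z + ennreal e * 1)"
    using z by (intro mult_left_mono add_mono) (auto simp flip: ennreal_1 intro!: ennreal_leI)
  finally show ?thesis using e by (simp add: G z_def)
qed

lemma emeasure_gamma_law_singleton: "emeasure (gamma_law k b) {x} = 0"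
proof -
  have "emeasure (gamma_law k b) {x} = (\<integral>\<^sup>+u. ennreal (gamma_density k b u) * indicator {x} u \<partial>lborel)"
    unfolding gamma_law_def by (rule emeasure_density) auto
  also have "\<dots> = (\<integral>\<^sup>+u. 0 \<partial>(lborel :: real measure))"
    by (rule nn_integral_cong_AE, rule AE_mp[OF AE_lborel_singleton[of x]]) auto
  finally show ?thesis by simp
qed

context nonneg_law
begin

lemma nonneg_law_gamma_convolution:
  assumes "0 < k" "0 < b" shows "nonneg_law (gamma_law k b \<star> \<nu>)"
proof -
  have "AE w in gamma_law k b. 0 \<le> w" using AE_gamma_law_pos by eventually_elim simp
  then show ?thesis
    by (intro nonneg_law.intro nonneg_law_axioms.intro prob_space_convolution AE_convolution_nonneg)
       (auto simp: prob_space_gamma_law assms prob_space_axioms AE_nonneg)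
qed

lemma emeasure_gamma_convolution_singleton:
  assumes "0 < k" "0 < b" shows "emeasure (gamma_law k b \<star> \<nu>) {x} = 0"
proof -
  interpret G: prob_space "gamma_law k b" by (rule prob_space_gamma_law[OF assms])
  have "emeasure (gamma_law k b \<star> \<nu>) {x} = emeasure (\<nu> \<star> gamma_law k b) {x}"
    by (subst convolution_commutative) (auto intro: finite_measure_axioms G.finite_measure_axioms)
  also have "\<dots> = (\<integral>\<^sup>+q. emeasure (gamma_law k b) {w. w + q \<in> {x}} \<partial>\<nu>)"
    using sets_eq_imp_space_eq[OF sets_law]
    by (intro convolution_emeasure) (auto intro: finite_measure_axioms G.finite_measure_axioms)
  also have "\<dots> = (\<integral>\<^sup>+q. 0 \<partial>\<nu>)"
  proof (rule nn_integral_cong)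
    fix q
    have "{w. w + q \<in> {x}} = {x - q}" by auto
    then show "emeasure (gamma_law k b) {w. w + q \<in> {x}} = 0" by (simp add: emeasure_gamma_law_singleton)
  qed
  finally show ?thesis by simp
qed

lemma truncated_gamma_mean:
  assumes kb: "0 < k" "0 < b"
  defines "\<mu> \<equiv> gamma_law k b \<star> \<nu>"
  shows "(\<integral>z. indicator {z. fst z + snd z \<le> x} z * (b * fst z) \<partial>(gamma_law k b \<Otimes>\<^sub>M \<nu>))
    = k * (measure \<mu> {..x} - exp_moment \<mu> 0 b x)"
proof -
  let ?G = "gamma_law k b"
  interpret G: prob_space ?G by (rule prob_space_gamma_law[OF kb])
  interpret P: pair_prob_space ?G \<nu> ..
  interpret mu: nonneg_law \<mu> unfolding \<mu>_def by (rule nonneg_law_gamma_convolution[OF kb])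
  interpret Pl: pair_sigma_finite \<mu> lborel ..
  have conv: "(\<integral>\<^sup>+q. f q \<partial>\<mu>) = (\<integral>\<^sup>+w. \<integral>\<^sup>+q. f (w + q) \<partial>\<nu> \<partial>?G)" if "f \<in> borel_measurable borel" for f
    unfolding \<mu>_def using that by (intro nn_integral_convolution) (auto intro: G.finite_measure_axioms finite_measure_axioms)
  let ?I = "\<lambda>q. indicator {..x} q * ((1 - exp (- b * (x - q))) / b) :: real"
  have Inn: "0 \<le> ?I q" for q using kb by (auto simp: indicator_def)
  have int: "integrable \<mu> ?I"
  proof (rule mu.integrable_const_bound)
    show "AE q in \<mu>. norm (?I q) \<le> 1 / b" using kb by (intro AE_I2) (auto simp: indicator_def divide_right_mono)
  qed simp
  have "(\<integral>\<^sup>+z. ennreal (indicator {z. fst z + snd z \<le> x} z * fst z) \<partial>(?G \<Otimes>\<^sub>M \<nu>))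
    = (\<integral>\<^sup>+w. \<integral>\<^sup>+q. ennreal (indicator {z. fst z + snd z \<le> x} (w, q) * w) \<partial>\<nu> \<partial>?G)"
    by (subst nn_integral_fst[symmetric]) auto
  also have "\<dots> = (\<integral>\<^sup>+w. ennreal w * (\<integral>\<^sup>+q. indicator {..x} (w + q) \<partial>\<nu>) \<partial>?G)"
  proof (rule nn_integral_cong)
    fix w :: real
    have "(\<integral>\<^sup>+q. ennreal (indicator {z. fst z + snd z \<le> x} (w, q) * w) \<partial>\<nu>) = (\<integral>\<^sup>+q. ennreal w * indicator {..x} (w + q) \<partial>\<nu>)"
      by (intro nn_integral_cong) (auto split: split_indicator)
    also have "\<dots> = ennreal w * (\<integral>\<^sup>+q. indicator {..x} (w + q) \<partial>\<nu>)" by (rule nn_integral_cmult) simp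
    finally show "(\<integral>\<^sup>+q. ennreal (indicator {z. fst z + snd z \<le> x} (w, q) * w) \<partial>\<nu>) = \<dots>" .
  qed
  also have "\<dots> = ennreal k * (\<integral>\<^sup>+u. indicator {0..} u * ennreal (exp (- b * u)) * (\<integral>\<^sup>+w. (\<integral>\<^sup>+q. indicator {..x} (w + u + q) \<partial>\<nu>) \<partial>?G) \<partial>lborel)"
    by (rule size_bias_gamma_law[OF kb]) measurable
  also have "\<dots> = ennreal k * (\<integral>\<^sup>+u. (\<integral>\<^sup>+q. indicator {0..} u * ennreal (exp (- b * u)) * indicator {..x} (q + u) \<partial>\<mu>) \<partial>lborel)"
    by (simp add: nn_integral_cmult conv add.assoc add.commute[of _ "_ :: real"] add.left_commute)
  also have "(\<integral>\<^sup>+u. (\<integral>\<^sup>+q. indicator {0..} u * ennreal (exp (- b * u)) * indicator {..x} (q + u) \<partial>\<mu>) \<partial>lborel)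
    = (\<integral>\<^sup>+q. (\<integral>\<^sup>+u. indicator {0..} u * ennreal (exp (- b * u)) * indicator {..x} (q + u) \<partial>lborel) \<partial>\<mu>)"
    by (rule Pl.Fubini') measurable
  also have "\<dots> = (\<integral>\<^sup>+q. ennreal (?I q) \<partial>\<mu>)"
  proof (rule nn_integral_cong)
    fix q :: real
    show "(\<integral>\<^sup>+u. indicator {0..} u * ennreal (exp (- b * u)) * indicator {..x} (q + u) \<partial>lborel) = ennreal (?I q)"
    proof (cases "q \<le> x")
      case True
      have "(\<integral>\<^sup>+u. indicator {0..} u * ennreal (exp (- b * u)) * indicator {..x} (q + u) \<partial>lborel)
        = (\<integral>\<^sup>+u. ennreal (exp (- b * u)) * indicator {0..x - q} u \<partial>lborel)"
        by (intro nn_integral_cong) (auto split: split_indicator)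
      also have "\<dots> = ennreal (- exp (- b * (x - q)) / b - (- exp (- b * 0) / b))"
        by (rule nn_integral_FTC_Icc[where F = "\<lambda>u. - exp (- b * u) / b"])
           (use True kb in \<open>auto intro!: derivative_eq_intros\<close>)
      finally show ?thesis using True by (simp add: diff_divide_distrib)
    next
      case False
      have "(\<integral>\<^sup>+u. indicator {0..} u * ennreal (exp (- b * u)) * indicator {..x} (q + u) \<partial>lborel) = (\<integral>\<^sup>+u. 0 \<partial>(lborel :: real measure))"
        by (intro nn_integral_cong) (use False in \<open>auto split: split_indicator\<close>)
      then show ?thesis using False by simp
    qed
  qed
  also have "\<dots> = ennreal (\<integral>q. ?I q \<partial>\<mu>)" by (rule nn_integral_eq_integral[OF int]) (use Inn in auto)
  also have "ennreal k * ennreal (\<integral>q. ?I q \<partial>\<mu>) = ennreal (k * (\<integral>q. ?I q \<partial>\<mu>))"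
    using kb by (intro ennreal_mult'[symmetric]) simp
  finally have eq: "(\<integral>\<^sup>+z. ennreal (indicator {z. fst z + snd z \<le> x} z * fst z) \<partial>(?G \<Otimes>\<^sub>M \<nu>)) = ennreal (k * (\<integral>q. ?I q \<partial>\<mu>))" .
  have AEpos: "AE z in ?G \<Otimes>\<^sub>M \<nu>. 0 < fst z" 
  proof (rule P.AE_pair_measure)
    show "{z \<in> space (?G \<Otimes>\<^sub>M \<nu>). 0 < fst z} \<in> sets (?G \<Otimes>\<^sub>M \<nu>)" by measurable
    show "AE w in ?G. AE q in \<nu>. 0 < fst (w, q)" using AE_gamma_law_pos by eventually_elim simp
  qed
  have "(\<integral>z. indicator {z. fst z + snd z \<le> x} z * fst z \<partial>(?G \<Otimes>\<^sub>M \<nu>)) = enn2real (ennreal (k * (\<integral>q. ?I q \<partial>\<mu>)))"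
    unfolding eq[symmetric] by (rule integral_eq_nn_integral) (use AEpos in \<open>auto elim!: eventually_mono\<close>)
  also have "\<dots> = k * (\<integral>q. ?I q \<partial>\<mu>)"
    using kb Inn by (intro enn2real_ennreal mult_nonneg_nonneg integral_nonneg_AE) auto
  finally have eq2: "(\<integral>z. indicator {z. fst z + snd z \<le> x} z * fst z \<partial>(?G \<Otimes>\<^sub>M \<nu>)) = k * (\<integral>q. ?I q \<partial>\<mu>)" .
  have iI: "integrable \<mu> (indicator {..x} :: real \<Rightarrow> real)"
    by (rule mu.integrable_const_bound[where B = 1]) (auto simp: indicator_def)
  have "b * (\<integral>q. ?I q \<partial>\<mu>) = (\<integral>q. indicator {..x} q - indicator {..x} q * exp (- b * (x - q)) \<partial>\<mu>)"
    using kb by (subst integral_mult_right_zero[symmetric]) (auto intro!: Bochner_Integration.integral_cong split: split_indicator)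
  also have "\<dots> = (\<integral>q. indicator {..x} q - exp_kernel 0 b (x - q) \<partial>\<mu>)"
  proof (rule integral_cong_AE)
    have "AE q in \<mu>. q \<noteq> x"
      using emeasure_gamma_convolution_singleton[OF kb, of x] by (intro AE_I[of _ _ "{x}"]) (auto simp: \<mu>_def)
    then show "AE q in \<mu>. indicator {..x} q - indicator {..x} q * exp (- b * (x - q)) = indicator {..x} q - exp_kernel 0 b (x - q)"
      by eventually_elim (auto simp: exp_kernel_def indicator_def)
  qed measurable
  also have "\<dots> = measure \<mu> {..x} - exp_moment \<mu> 0 b x"
    using kb iI by (subst Bochner_Integration.integral_diff) (auto simp: exp_moment_def)
  finally have val: "b * (\<integral>q. ?I q \<partial>\<mu>) = measure \<mu> {..x} - exp_moment \<mu> 0 b x" .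
  have "(\<integral>z. indicator {z. fst z + snd z \<le> x} z * (b * fst z) \<partial>(?G \<Otimes>\<^sub>M \<nu>)) = b * (k * (\<integral>q. ?I q \<partial>\<mu>))"
    unfolding eq2[symmetric] by (subst integral_mult_right_zero[symmetric]) (auto simp: ac_simps)
  also have "\<dots> = k * (b * (\<integral>q. ?I q \<partial>\<mu>))" by simp
  also have "\<dots> = k * (measure \<mu> {..x} - exp_moment \<mu> 0 b x)" by (simp only: val)
  finally show ?thesis .
qed

end

lemma upper_tail_measurable [measurable]:
  assumes "prob_space M" "sets M = sets borel"
  shows "(\<lambda>v. measure M {v::real<..}) \<in> borel_measurable borel"
proof -
  interpret prob_space M by fact
  have "mono (\<lambda>v. - measure M {v<..})"
    by (rule monoI) (auto intro!: finite_measure_mono simp: assms)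
  then have "(\<lambda>v. - (- measure M {v<..})) \<in> borel_measurable borel"
    by (intro borel_measurable_uminus borel_measurable_mono)
  then show ?thesis by simp
qed

context nonneg_law
begin

lemma measure_gamma_convolution_tilt:
  assumes kb: "0 < k" "0 < b" and e: "0 < \<eta>"
  defines "c \<equiv> 1 + \<eta>"
  defines "tilt \<equiv> \<lambda>w. c powr k * exp (- \<eta> * b * w)"
  defines "V \<equiv> gamma_law (k * \<eta>) (b * c)"
  shows "measure (gamma_law (k * c) (b * c) \<star> \<nu>) {x<..}
      = (\<integral>z. tilt (fst z) * measure V {x - fst z - snd z<..} \<partial>(gamma_law k b \<Otimes>\<^sub>M \<nu>))"
    and "(\<integral>z. tilt (fst z) \<partial>(gamma_law k b \<Otimes>\<^sub>M \<nu>)) = 1"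
    and "AE z in gamma_law k b \<Otimes>\<^sub>M \<nu>. 0 < fst z"
    and "integrable (gamma_law k b \<Otimes>\<^sub>M \<nu>) (\<lambda>z. tilt (fst z))"
    and "integrable (gamma_law k b \<Otimes>\<^sub>M \<nu>) (\<lambda>z. tilt (fst z) * measure V {x - fst z - snd z<..})"
proof -
  let ?G = "gamma_law k b"
  have c: "1 < c" "0 < c" using e by (auto simp: c_def)
  interpret G: prob_space ?G by (rule prob_space_gamma_law[OF kb])
  interpret V: prob_space V unfolding V_def by (rule prob_space_gamma_law) (use kb e c in auto)
  have setsV [simp, measurable_cong]: "sets V = sets borel" by (simp add: V_def)
  interpret Gc: prob_space "gamma_law k (b * c)" by (rule prob_space_gamma_law) (use kb c in auto)
  interpret P: pair_prob_space ?G \<nu> ..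
  have T [measurable]: "(\<lambda>v. measure V {v<..}) \<in> borel_measurable borel"
    by (rule upper_tail_measurable) (auto intro: V.prob_space_axioms)
  have tilt_nn: "0 \<le> tilt w" for w by (simp add: tilt_def)
  have tilt_m [measurable]: "tilt \<in> borel_measurable borel" unfolding tilt_def by measurable
  have cc: "gamma_density k (b * c) w = tilt w * gamma_density k b w" for w
    using gamma_density_tilt[OF c(2) kb(2), of k w] by (simp add: tilt_def c_def mult.commute[of b])
  have change: "(\<integral>\<^sup>+w. h w \<partial>gamma_law k (b * c)) = (\<integral>\<^sup>+w. ennreal (tilt w) * h w \<partial>?G)"
    if [measurable]: "h \<in> borel_measurable borel" for h
    by (simp add: nn_integral_gamma_law cc ennreal_mult' tilt_nn mult.assoc)
       (simp add: mult.left_commute)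
  show AEpos: "AE z in ?G \<Otimes>\<^sub>M \<nu>. 0 < fst z"
  proof (rule P.AE_pair_measure)
    show "{z \<in> space (?G \<Otimes>\<^sub>M \<nu>). 0 < fst z} \<in> sets (?G \<Otimes>\<^sub>M \<nu>)" by measurable
    show "AE w in ?G. AE q in \<nu>. 0 < fst (w, q)" using AE_gamma_law_pos by eventually_elim simp
  qed
  have tilt_le: "tilt w \<le> c powr k" if "0 < w" for w
    using that e kb by (simp add: tilt_def mult_left_le)
  show int1: "integrable (?G \<Otimes>\<^sub>M \<nu>) (\<lambda>z. tilt (fst z))"
    by (rule P.integrable_const_bound[where B = "c powr k"])
       (use AEpos tilt_le tilt_nn in \<open>auto elim!: eventually_mono\<close>)
  show int2: "integrable (?G \<Otimes>\<^sub>M \<nu>) (\<lambda>z. tilt (fst z) * measure V {x - fst z - snd z<..})"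
  proof (rule P.integrable_const_bound[where B = "c powr k"])
    show "AE z in ?G \<Otimes>\<^sub>M \<nu>. norm (tilt (fst z) * measure V {x - fst z - snd z<..}) \<le> c powr k"
      using AEpos
    proof eventually_elim
      case (elim z)
      have "tilt (fst z) * measure V {x - fst z - snd z<..} \<le> c powr k * 1"
        using tilt_le[OF elim] tilt_nn by (intro mult_mono) auto
      then show ?case using tilt_nn by (simp add: abs_mult)
    qed
  qed measurable
  have "ennreal (\<integral>z. tilt (fst z) \<partial>(?G \<Otimes>\<^sub>M \<nu>)) = (\<integral>\<^sup>+z. ennreal (tilt (fst z)) \<partial>(?G \<Otimes>\<^sub>M \<nu>))"
    by (rule nn_integral_eq_integral[OF int1, symmetric]) (simp add: tilt_nn)
  also have "\<dots> = (\<integral>\<^sup>+w. \<integral>\<^sup>+q. ennreal (tilt w) \<partial>\<nu> \<partial>?G)"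
    by (subst nn_integral_fst[symmetric]) auto
  also have "\<dots> = (\<integral>\<^sup>+w. ennreal (tilt w) * 1 \<partial>?G)" by (simp add: emeasure_space_1)
  also have "\<dots> = (\<integral>\<^sup>+w. 1 \<partial>gamma_law k (b * c))" by (rule change[symmetric]) simp
  also have "\<dots> = ennreal 1" using Gc.emeasure_space_1 by simp
  finally show "(\<integral>z. tilt (fst z) \<partial>(?G \<Otimes>\<^sub>M \<nu>)) = 1"
    by (subst (asm) ennreal_inj) (auto intro!: integral_nonneg_AE simp: tilt_nn)
  have kc: "k * c = k + k * \<eta>" by (simp add: c_def algebra_simps)
  have "(gamma_law (k * c) (b * c) \<star> \<nu>) = ((gamma_law k (b * c) \<star> V) \<star> \<nu>)"
    unfolding kc V_def using kb e c by (subst gamma_law_convolution) auto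
  also have "\<dots> = (gamma_law k (b * c) \<star> (V \<star> \<nu>))"
    using sets_eq_imp_space_eq[OF sets_law]
    by (intro convolution_associative[symmetric]) (auto intro: finite_measure_axioms V.finite_measure_axioms Gc.finite_measure_axioms)
  also have "(V \<star> \<nu>) = (\<nu> \<star> V)" by (rule convolution_commutative) (auto intro: finite_measure_axioms V.finite_measure_axioms)
  finally have split: "(gamma_law (k * c) (b * c) \<star> \<nu>) = (gamma_law k (b * c) \<star> (\<nu> \<star> V))" .
  interpret nV: prob_space "\<nu> \<star> V" by (rule prob_space_convolution) (auto intro: prob_space_axioms V.prob_space_axioms)
  interpret full: prob_space "gamma_law (k * c) (b * c) \<star> \<nu>"
    by (rule prob_space_convolution) (use kb c in \<open>auto intro: prob_space_axioms prob_space_gamma_law\<close>)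
  have "ennreal (measure (gamma_law (k * c) (b * c) \<star> \<nu>) {x<..}) = (\<integral>\<^sup>+y. indicator {x<..} y \<partial>(gamma_law k (b * c) \<star> (\<nu> \<star> V)))"
    unfolding split[symmetric] by (simp add: full.emeasure_eq_measure)
  also have "\<dots> = (\<integral>\<^sup>+w. \<integral>\<^sup>+r. indicator {x<..} (w + r) \<partial>(\<nu> \<star> V) \<partial>gamma_law k (b * c))"
    by (rule nn_integral_convolution) (auto intro: Gc.finite_measure_axioms nV.finite_measure_axioms)
  also have "\<dots> = (\<integral>\<^sup>+w. \<integral>\<^sup>+q. ennreal (measure V {x - w - q<..}) \<partial>\<nu> \<partial>gamma_law k (b * c))"
  proof (rule nn_integral_cong)
    fix w
    have "(\<integral>\<^sup>+r. indicator {x<..} (w + r) \<partial>(\<nu> \<star> V)) = (\<integral>\<^sup>+q. \<integral>\<^sup>+v. indicator {x<..} (w + (q + v)) \<partial>V \<partial>\<nu>)"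
      by (rule nn_integral_convolution) (auto intro: finite_measure_axioms V.finite_measure_axioms)
    also have "\<dots> = (\<integral>\<^sup>+q. ennreal (measure V {x - w - q<..}) \<partial>\<nu>)"
    proof (rule nn_integral_cong)
      fix q
      have "(\<integral>\<^sup>+v. indicator {x<..} (w + (q + v)) \<partial>V) = (\<integral>\<^sup>+v. indicator {x - w - q<..} v \<partial>V)"
        by (intro nn_integral_cong) (auto split: split_indicator)
      then show "(\<integral>\<^sup>+v. indicator {x<..} (w + (q + v)) \<partial>V) = ennreal (measure V {x - w - q<..})"
        by (simp add: V.emeasure_eq_measure)
    qed
    finally show "(\<integral>\<^sup>+r. indicator {x<..} (w + r) \<partial>(\<nu> \<star> V)) = \<dots>" .
  qed
  also have "\<dots> = (\<integral>\<^sup>+w. ennreal (tilt w) * (\<integral>\<^sup>+q. ennreal (measure V {x - w - q<..}) \<partial>\<nu>) \<partial>?G)"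
    by (rule change) measurable
  also have "\<dots> = (\<integral>\<^sup>+w. \<integral>\<^sup>+q. ennreal (tilt w * measure V {x - w - q<..}) \<partial>\<nu> \<partial>?G)"
    by (simp add: ennreal_mult' tilt_nn nn_integral_cmult)
  also have "\<dots> = (\<integral>\<^sup>+z. ennreal (tilt (fst z) * measure V {x - fst z - snd z<..}) \<partial>(?G \<Otimes>\<^sub>M \<nu>))"
    by (subst nn_integral_fst[symmetric]) auto
  also have "\<dots> = ennreal (\<integral>z. tilt (fst z) * measure V {x - fst z - snd z<..} \<partial>(?G \<Otimes>\<^sub>M \<nu>))"
    by (rule nn_integral_eq_integral[OF int2]) (simp add: tilt_nn)
  finally show "measure (gamma_law (k * c) (b * c) \<star> \<nu>) {x<..}
      = (\<integral>z. tilt (fst z) * measure V {x - fst z - snd z<..} \<partial>(?G \<Otimes>\<^sub>M \<nu>))"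
    by (subst (asm) ennreal_inj) (auto intro!: integral_nonneg_AE simp: tilt_nn)
qed

lemma measure_gamma_convolution_pair:
  assumes kb: "0 < k" "0 < b"
  shows "measure (gamma_law k b \<star> \<nu>) {..x} = measure (gamma_law k b \<Otimes>\<^sub>M \<nu>) {z. fst z + snd z \<le> x}"
    and "measure (gamma_law k b \<star> \<nu>) {x<..} = 1 - measure (gamma_law k b \<Otimes>\<^sub>M \<nu>) {z. fst z + snd z \<le> x}"
proof -
  interpret mu: nonneg_law "gamma_law k b \<star> \<nu>" by (rule nonneg_law_gamma_convolution[OF kb])
  have sp: "space \<nu> = UNIV" using sets_eq_imp_space_eq[OF sets_law] by simp
  have "(\<lambda>(x, y). x + y) -` {..x} \<inter> space (gamma_law k b \<Otimes>\<^sub>M \<nu>) = {z. fst z + snd z \<le> x}"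
    by (auto simp: space_pair_measure sp)
  then show 1: "measure (gamma_law k b \<star> \<nu>) {..x} = measure (gamma_law k b \<Otimes>\<^sub>M \<nu>) {z. fst z + snd z \<le> x}"
    unfolding convolution_def by (subst measure_distr) auto
  have "{x<..} = space (gamma_law k b \<star> \<nu>) - {..x}" by auto
  moreover have "measure (gamma_law k b \<star> \<nu>) (space (gamma_law k b \<star> \<nu>) - {..x}) = 1 - measure (gamma_law k b \<star> \<nu>) {..x}"
    by (rule mu.prob_compl) simp
  ultimately show "measure (gamma_law k b \<star> \<nu>) {x<..} = 1 - measure (gamma_law k b \<Otimes>\<^sub>M \<nu>) {z. fst z + snd z \<le> x}"
    unfolding 1[symmetric] by (simp only:)
qed

lemma truncated_tail_integral_le:
  assumes kb: "0 < k" "0 < b" and e: "0 < \<eta>" "k * \<eta> \<le> 1"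
  defines "\<mu> \<equiv> gamma_law k b \<star> \<nu>"
  assumes E: "(\<integral>\<^sup>+q. indicator {..<x} q * exp_integral (b * (x - q)) \<partial>\<mu>) \<le> ennreal E" "0 \<le> E"
  shows "(\<integral>z. indicator {z. fst z + snd z \<le> x} z * measure (gamma_law (k * \<eta>) (b * (1 + \<eta>))) {x - fst z - snd z<..} \<partial>(gamma_law k b \<Otimes>\<^sub>M \<nu>))
    \<le> k * \<eta> / Gamma (1 + k * \<eta>) * (E + k * \<eta>)"
proof -
  let ?G = "gamma_law k b" and ?V = "gamma_law (k * \<eta>) (b * (1 + \<eta>))"
  define C where "C = k * \<eta> / Gamma (1 + k * \<eta>)"
  have C: "0 \<le> C" using kb e by (auto simp: C_def intro!: divide_nonneg_nonneg less_imp_le[OF Gamma_real_pos] add_pos_pos)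
  interpret G: prob_space ?G by (rule prob_space_gamma_law[OF kb])
  interpret V: prob_space ?V by (rule prob_space_gamma_law) (use kb e in auto)
  interpret P: pair_prob_space ?G \<nu> ..
  interpret mu: nonneg_law \<mu> unfolding \<mu>_def by (rule nonneg_law_gamma_convolution[OF kb])
  have T [measurable]: "(\<lambda>v. measure ?V {v<..}) \<in> borel_measurable borel"
    by (rule upper_tail_measurable) (auto intro: V.prob_space_axioms)
  have conv: "(\<integral>\<^sup>+q. f q \<partial>\<mu>) = (\<integral>\<^sup>+w. \<integral>\<^sup>+q. f (w + q) \<partial>\<nu> \<partial>?G)" if "f \<in> borel_measurable borel" for f
    unfolding \<mu>_def using that by (intro nn_integral_convolution) (auto intro: G.finite_measure_axioms finite_measure_axioms)
  have int: "integrable (?G \<Otimes>\<^sub>M \<nu>) (\<lambda>z. indicator {z. fst z + snd z \<le> x} z * measure ?V {x - fst z - snd z<..})"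
    by (rule P.integrable_const_bound[where B = 1]) (auto simp: indicator_def)
  have "ennreal (\<integral>z. indicator {z. fst z + snd z \<le> x} z * measure ?V {x - fst z - snd z<..} \<partial>(?G \<Otimes>\<^sub>M \<nu>))
    = (\<integral>\<^sup>+z. ennreal (indicator {z. fst z + snd z \<le> x} z * measure ?V {x - fst z - snd z<..}) \<partial>(?G \<Otimes>\<^sub>M \<nu>))"
    by (rule nn_integral_eq_integral[OF int, symmetric]) simp
  also have "\<dots> = (\<integral>\<^sup>+w. \<integral>\<^sup>+q. ennreal (indicator {..x} (w + q) * measure ?V {x - (w + q)<..}) \<partial>\<nu> \<partial>?G)"
    by (subst nn_integral_fst[symmetric]) (auto simp: indicator_def diff_diff_eq intro!: nn_integral_cong)
  also have "\<dots> = (\<integral>\<^sup>+q. ennreal (indicator {..x} q * measure ?V {x - q<..}) \<partial>\<mu>)"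
    by (rule conv[symmetric]) measurable
  also have "\<dots> \<le> (\<integral>\<^sup>+q. ennreal C * (indicator {..<x} q * exp_integral (b * (x - q)) + ennreal (k * \<eta>)) \<partial>\<mu>)"
  proof (rule nn_integral_mono_AE)
    have "AE q in \<mu>. q \<noteq> x"
      using emeasure_gamma_convolution_singleton[OF kb, of x]
      by (intro AE_I[of _ _ "{x}"]) (auto simp: \<mu>_def)
    then show "AE q in \<mu>. ennreal (indicator {..x} q * measure ?V {x - q<..}) \<le> ennreal C * (indicator {..<x} q * exp_integral (b * (x - q)) + ennreal (k * \<eta>))"
    proof eventually_elim
      case (elim q)
      show ?case
      proof (cases "q < x")
        case True
        have "ennreal (measure ?V {x - q<..}) = emeasure ?V {x - q<..}" by (simp add: V.emeasure_eq_measure)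
        also have "\<dots> \<le> ennreal C * (exp_integral (b * (1 + \<eta>) * (x - q)) + ennreal (k * \<eta>))"
          unfolding C_def by (rule gamma_tail_le) (use kb e True in auto)
        also have "\<dots> \<le> ennreal C * (exp_integral (b * (x - q)) + ennreal (k * \<eta>))"
          using kb e True by (intro mult_left_mono add_mono exp_integral_antimono mult_right_mono) auto
        finally show ?thesis using True by simp
      next
        case False
        then show ?thesis using elim by simp
      qed
    qed
  qed
  also have "\<dots> = ennreal C * ((\<integral>\<^sup>+q. indicator {..<x} q * exp_integral (b * (x - q)) \<partial>\<mu>) + ennreal (k * \<eta>))"
    by (subst nn_integral_cmult, simp, subst nn_integral_add) (auto simp: mu.emeasure_space_1)
  also have "\<dots> \<le> ennreal C * (ennreal E + ennreal (k * \<eta>))" by (intro mult_left_mono add_mono E) auto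
  also have "\<dots> = ennreal (C * (E + k * \<eta>))"
  proof -
    have n: "0 \<le> k * \<eta>" using kb e by simp
    show ?thesis by (simp only: ennreal_mult'[OF C] ennreal_plus[OF E(2) n])
  qed
  finally show ?thesis using C E kb e unfolding C_def[symmetric] by (subst (asm) ennreal_le_iff) auto
qed

lemma gamma_convolution_tail_difference:
  assumes kb: "0 < k" "0 < b" and e: "0 < \<eta>" "k * \<eta> \<le> 1"
  defines "\<mu> \<equiv> gamma_law k b \<star> \<nu>"
  assumes E: "(\<integral>\<^sup>+q. indicator {..<x} q * exp_integral (b * (x - q)) \<partial>\<mu>) \<le> ennreal E" "0 \<le> E"
  shows "measure (gamma_law (k * (1 + \<eta>)) (b * (1 + \<eta>)) \<star> \<nu>) {x<..} \<le> measure \<mu> {x<..}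
    + k * (\<eta> - ln (1 + \<eta>)) - k * \<eta> * exp_moment \<mu> 0 b x
    + (1 + \<eta>) powr k * (k * \<eta> / Gamma (1 + k * \<eta>) * (E + k * \<eta>))"
proof -
  let ?G = "gamma_law k b" and ?V = "gamma_law (k * \<eta>) (b * (1 + \<eta>))"
  let ?P = "?G \<Otimes>\<^sub>M \<nu>"
  define A where "A = {z::real \<times> real. fst z + snd z \<le> x}"
  define tilt where "tilt w = (1 + \<eta>) powr k * exp (- \<eta> * b * w)" for w
  define T where "T z = measure ?V {x - fst z - snd z<..}" for z
  have c: "1 < 1 + \<eta>" "0 < ln (1 + \<eta>)" "ln (1 + \<eta>) \<le> \<eta>" using e ln_add_one_self_le_self[of \<eta>] by auto
  interpret G: prob_space ?G by (rule prob_space_gamma_law[OF kb])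
  interpret V: prob_space ?V by (rule prob_space_gamma_law) (use kb e in auto)
  interpret P: pair_prob_space ?G \<nu> ..
  interpret mu: nonneg_law \<mu> unfolding \<mu>_def by (rule nonneg_law_gamma_convolution[OF kb])
  have T0 [measurable]: "(\<lambda>v. measure ?V {v<..}) \<in> borel_measurable borel"
    by (rule upper_tail_measurable) (auto intro: V.prob_space_axioms)
  have A [measurable]: "A \<in> sets ?P"
  proof -
    have "A = {z \<in> space ?P. fst z + snd z \<le> x}"
      using sets_eq_imp_space_eq[OF sets_law] by (auto simp: A_def space_pair_measure)
    also have "\<dots> \<in> sets ?P" by measurable
    finally show ?thesis .
  qed
  have Tm [measurable]: "T \<in> borel_measurable ?P" unfolding T_def by measurable
  have T01: "0 \<le> T z" "T z \<le> 1" for z by (auto simp: T_def)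
  note tilts = measure_gamma_convolution_tilt(1)[OF kb e(1), of x, folded tilt_def T_def]
    measure_gamma_convolution_tilt(2-4)[OF kb e(1), folded tilt_def]
    measure_gamma_convolution_tilt(5)[OF kb e(1), of x, folded tilt_def T_def]
  have iA: "integrable ?P (indicator A :: _ \<Rightarrow> real)"
    by (rule P.integrable_const_bound[where B = 1]) (auto simp: indicator_def)
  have iAw: "integrable ?P (\<lambda>z. indicator A z * (b * fst z))"
  proof (rule P.integrable_const_bound[where B = "b * \<bar>x\<bar>"])
    have "AE z in ?P. 0 \<le> snd z"
    proof (rule P.AE_pair_measure)
      show "{z \<in> space ?P. 0 \<le> snd z} \<in> sets ?P" by measurable
      show "AE w in ?G. AE q in \<nu>. 0 \<le> snd (w, q)" using AE_nonneg by simp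
    qed
    then show "AE z in ?P. norm (indicator A z * (b * fst z)) \<le> b * \<bar>x\<bar>"
      using tilts(3) by eventually_elim (use kb in \<open>auto simp: A_def indicator_def abs_mult\<close>)
  qed measurable
  have iAt: "integrable ?P (\<lambda>z. indicator A z * tilt (fst z))"
    using integrable_mult_indicator[OF A tilts(4)] by simp
  have iAT: "integrable ?P (\<lambda>z. indicator A z * T z)"
    by (rule P.integrable_const_bound[where B = 1]) (use T01 in \<open>auto simp: indicator_def\<close>)
  have "measure (gamma_law (k * (1 + \<eta>)) (b * (1 + \<eta>)) \<star> \<nu>) {x<..} = (\<integral>z. tilt (fst z) * T z \<partial>?P)"
    by (rule tilts(1))
  also have "\<dots> \<le> (\<integral>z. tilt (fst z) - indicator A z * tilt (fst z) + (1 + \<eta>) powr k * (indicator A z * T z) \<partial>?P)"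
  proof (rule integral_mono_AE)
    show "AE z in ?P. tilt (fst z) * T z \<le> tilt (fst z) - indicator A z * tilt (fst z) + (1 + \<eta>) powr k * (indicator A z * T z)"
      using tilts(3)
    proof eventually_elim
      case (elim z)
      have "tilt (fst z) \<le> (1 + \<eta>) powr k" using elim e kb by (simp add: tilt_def mult_left_le)
      then have "tilt (fst z) * T z \<le> (1 + \<eta>) powr k * T z" by (intro mult_right_mono T01)
      moreover have "tilt (fst z) * T z \<le> tilt (fst z) * 1" by (intro mult_left_mono T01) (simp add: tilt_def)
      ultimately show ?case by (auto simp: indicator_def)
    qed
  qed (use tilts(4,5) iAt iAT in auto)
  also have "\<dots> = 1 - (\<integral>z. indicator A z * tilt (fst z) \<partial>?P) + (1 + \<eta>) powr k * (\<integral>z. indicator A z * T z \<partial>?P)"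
    using tilts(2,4) iAt iAT by simp
  finally have f1: "measure (gamma_law (k * (1 + \<eta>)) (b * (1 + \<eta>)) \<star> \<nu>) {x<..} \<le> \<dots>" .
  have f2: "(\<integral>z. indicator A z * tilt (fst z) \<partial>?P) \<ge> (\<integral>z. indicator A z * (1 + k * ln (1 + \<eta>)) - \<eta> * (indicator A z * (b * fst z)) \<partial>?P)"
  proof (rule integral_mono)
    show "indicator A z * (1 + k * ln (1 + \<eta>)) - \<eta> * (indicator A z * (b * fst z)) \<le> indicator A z * tilt (fst z)" for z
    proof -
      have "tilt (fst z) = exp (k * ln (1 + \<eta>) - \<eta> * b * fst z)"
        using c by (simp add: tilt_def powr_def mult_exp_exp)
      then have "1 + (k * ln (1 + \<eta>) - \<eta> * b * fst z) \<le> tilt (fst z)"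
        using exp_ge_add_one_self[of "k * ln (1 + \<eta>) - \<eta> * b * fst z"] by (simp only:)
      then show ?thesis by (auto simp: indicator_def algebra_simps)
    qed
  qed (use iA iAw iAt in auto)
  have f3: "(\<integral>z. indicator A z * (1 + k * ln (1 + \<eta>)) - \<eta> * (indicator A z * (b * fst z)) \<partial>?P)
     = measure ?P A * (1 + k * ln (1 + \<eta>)) - \<eta> * (\<integral>z. indicator A z * (b * fst z) \<partial>?P)"
    using iA iAw sets.sets_into_space[OF A] by (simp add: Int_absorb2)
  have "(\<integral>z. indicator A z * (b * fst z) \<partial>?P) \<le> k * (measure \<mu> {..x} - exp_moment \<mu> 0 b x)"
    unfolding A_def \<mu>_def by (rule order_eq_refl, rule truncated_gamma_mean[OF kb])
  then have f4: "\<eta> * (\<integral>z. indicator A z * (b * fst z) \<partial>?P) \<le> \<eta> * (k * (measure \<mu> {..x} - exp_moment \<mu> 0 b x))"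
    using e by (intro mult_left_mono) auto
  have "(\<integral>z. indicator A z * T z \<partial>?P) \<le> k * \<eta> / Gamma (1 + k * \<eta>) * (E + k * \<eta>)"
    unfolding A_def T_def by (rule truncated_tail_integral_le[OF kb e E[unfolded \<mu>_def]])
  then have f5: "(1 + \<eta>) powr k * (\<integral>z. indicator A z * T z \<partial>?P) \<le> (1 + \<eta>) powr k * (k * \<eta> / Gamma (1 + k * \<eta>) * (E + k * \<eta>))"
    by (intro mult_left_mono) auto
  have main: "measure (gamma_law (k * (1 + \<eta>)) (b * (1 + \<eta>)) \<star> \<nu>) {x<..}
    \<le> 1 - (measure ?P A * (1 + k * ln (1 + \<eta>)) - \<eta> * (k * (measure \<mu> {..x} - exp_moment \<mu> 0 b x)))
      + (1 + \<eta>) powr k * (k * \<eta> / Gamma (1 + k * \<eta>) * (E + k * \<eta>))"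
    using f1 f2 f3 f4 f5 by linarith
  have PA: "measure \<mu> {..x} = measure ?P A" "measure \<mu> {x<..} = 1 - measure ?P A"
    unfolding \<mu>_def A_def by (rule measure_gamma_convolution_pair[OF kb])+
  have "k * (\<eta> - ln (1 + \<eta>)) * measure ?P A \<le> k * (\<eta> - ln (1 + \<eta>))"
    using kb c by (intro mult_left_le) auto
  then show ?thesis using main unfolding PA by (simp add: algebra_simps)
qed

end

lemma gamma_density_dominated:
  assumes p: "0 < \<rho>" "0 < p" "p \<le> r"
  obtains B where "\<And>\<beta> w. p \<le> \<beta> \<Longrightarrow> \<beta> \<le> r \<Longrightarrow> 0 < w \<Longrightarrow> w \<le> x \<Longrightarrow> gamma_density (\<rho> * \<beta>) \<beta> w \<le> B * w powr (\<rho> * p - 1)"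
proof -
  have "continuous_on {\<rho> * p..\<rho> * r} (Gamma :: real \<Rightarrow> real)"
    by (intro continuous_intros) (use p in \<open>auto simp: nonpos_Ints_def mult_le_0_iff dest!: order_trans[of 0] less_le_trans[OF mult_pos_pos[OF p(1,2)]]\<close>)
  then obtain y0 where y0: "y0 \<in> {\<rho> * p..\<rho> * r}" "\<And>y. y \<in> {\<rho> * p..\<rho> * r} \<Longrightarrow> Gamma y0 \<le> Gamma y"
    using continuous_attains_inf[of "{\<rho> * p..\<rho> * r}" "Gamma :: real \<Rightarrow> real"] p by auto
  have "0 < y0" using y0(1) p by (auto intro: less_le_trans[OF mult_pos_pos])
  then have g: "0 < Gamma y0" by (rule Gamma_real_pos)
  define B where "B = (max 1 r powr (\<rho> * r)) * (max 1 x powr (\<rho> * (r - p))) / Gamma y0"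
  show ?thesis
  proof (rule that[of B])
    fix \<beta> w :: real assume h: "p \<le> \<beta>" "\<beta> \<le> r" "0 < w" "w \<le> x"
    have b0: "0 < \<beta>" using h p by simp
    have 1: "\<beta> powr (\<rho> * \<beta>) \<le> max 1 r powr (\<rho> * r)"
    proof -
      have "\<beta> powr (\<rho> * \<beta>) \<le> max 1 r powr (\<rho> * \<beta>)" using b0 h p by (intro powr_mono2) auto
      also have "\<dots> \<le> max 1 r powr (\<rho> * r)" using h p by (intro powr_mono) auto
      finally show ?thesis .
    qed
    have 2: "w powr (\<rho> * \<beta> - 1) \<le> max 1 x powr (\<rho> * (r - p)) * w powr (\<rho> * p - 1)"
    proof -
      have "w powr (\<rho> * \<beta> - 1) = w powr (\<rho> * (\<beta> - p)) * w powr (\<rho> * p - 1)"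
        using h by (simp add: powr_add[symmetric] algebra_simps)
      also have "w powr (\<rho> * (\<beta> - p)) \<le> max 1 x powr (\<rho> * (\<beta> - p))" using h p by (intro powr_mono2) auto
      also have "\<dots> \<le> max 1 x powr (\<rho> * (r - p))" using h p by (intro powr_mono) auto
      finally show ?thesis by (simp add: mult_right_mono)
    qed
    have 3: "1 / Gamma (\<rho> * \<beta>) \<le> 1 / Gamma y0"
      using y0(2)[of "\<rho> * \<beta>"] g h p by (intro divide_left_mono) (auto intro!: mult_pos_pos Gamma_real_pos b0)
    have "gamma_density (\<rho> * \<beta>) \<beta> w = \<beta> powr (\<rho> * \<beta>) * w powr (\<rho> * \<beta> - 1) * exp (- \<beta> * w) * (1 / Gamma (\<rho> * \<beta>))"
      using h by (simp add: gamma_density_def)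
    also have "\<dots> \<le> (max 1 r powr (\<rho> * r)) * (max 1 x powr (\<rho> * (r - p)) * w powr (\<rho> * p - 1)) * 1 * (1 / Gamma y0)"
      using 1 2 3 b0 h p by (intro mult_mono) (auto intro!: less_imp_le[OF Gamma_real_pos] mult_pos_pos)
    also have "\<dots> = B * w powr (\<rho> * p - 1)" by (simp add: B_def)
    finally show "gamma_density (\<rho> * \<beta>) \<beta> w \<le> B * w powr (\<rho> * p - 1)" .
  qed
qed

context nonneg_law
begin

lemma measure_gamma_convolution_density:
  assumes kb: "0 < k" "0 < b"
  shows "measure (gamma_law k b \<star> \<nu>) {x<..} = 1 - (\<integral>w. gamma_density k b w * measure \<nu> {..x - w} \<partial>lborel)"
    and "integrable lborel (\<lambda>w. gamma_density k b w * measure \<nu> {..x - w})"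
proof -
  interpret G: prob_space "gamma_law k b" by (rule prob_space_gamma_law[OF kb])
  interpret mu: nonneg_law "gamma_law k b \<star> \<nu>" by (rule nonneg_law_gamma_convolution[OF kb])
  have "mono (\<lambda>y. measure \<nu> {..y})" by (rule monoI) (auto intro!: finite_measure_mono)
  then have F [measurable]: "(\<lambda>y. measure \<nu> {..y}) \<in> borel_measurable borel" by (rule borel_measurable_mono)
  have dm: "integrable lborel (gamma_density k b)"
    by (rule integrableI_nonneg) (auto simp: gamma_density_nonneg kb nn_integral_gamma_density)
  show int: "integrable lborel (\<lambda>w. gamma_density k b w * measure \<nu> {..x - w})"
    by (rule Bochner_Integration.integrable_bound[OF dm]) (auto simp: gamma_density_nonneg kb abs_mult mult_left_le)
  have "ennreal (measure (gamma_law k b \<star> \<nu>) {..x}) = (\<integral>\<^sup>+w. \<integral>\<^sup>+q. indicator {..x} (w + q) \<partial>\<nu> \<partial>gamma_law k b)"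
    by (subst nn_integral_convolution[symmetric])
       (auto intro: finite_measure_axioms G.finite_measure_axioms simp: mu.emeasure_eq_measure)
  also have "\<dots> = (\<integral>\<^sup>+w. ennreal (measure \<nu> {..x - w}) \<partial>gamma_law k b)"
  proof (rule nn_integral_cong)
    fix w
    have "(\<integral>\<^sup>+q. indicator {..x} (w + q) \<partial>\<nu>) = (\<integral>\<^sup>+q. indicator {..x - w} q \<partial>\<nu>)"
      by (intro nn_integral_cong) (auto split: split_indicator)
    then show "(\<integral>\<^sup>+q. indicator {..x} (w + q) \<partial>\<nu>) = ennreal (measure \<nu> {..x - w})" by (simp add: emeasure_eq_measure)
  qed
  also have "\<dots> = (\<integral>\<^sup>+w. ennreal (gamma_density k b w * measure \<nu> {..x - w}) \<partial>lborel)"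
    by (subst nn_integral_gamma_law) (auto simp: ennreal_mult' gamma_density_nonneg kb)
  also have "\<dots> = ennreal (\<integral>w. gamma_density k b w * measure \<nu> {..x - w} \<partial>lborel)"
    by (rule nn_integral_eq_integral[OF int]) (auto simp: gamma_density_nonneg kb)
  finally have eq: "measure (gamma_law k b \<star> \<nu>) {..x} = (\<integral>w. gamma_density k b w * measure \<nu> {..x - w} \<partial>lborel)"
    by (subst (asm) ennreal_inj) (auto intro!: integral_nonneg_AE simp: gamma_density_nonneg kb)
  have "{x<..} = space (gamma_law k b \<star> \<nu>) - {..x}" by auto
  moreover have "measure (gamma_law k b \<star> \<nu>) (space (gamma_law k b \<star> \<nu>) - {..x}) = 1 - measure (gamma_law k b \<star> \<nu>) {..x}"
    by (rule mu.prob_compl) simp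
  ultimately show "measure (gamma_law k b \<star> \<nu>) {x<..} = 1 - (\<integral>w. gamma_density k b w * measure \<nu> {..x - w} \<partial>lborel)"
    unfolding eq[symmetric] by (simp only:)
qed

lemma continuous_on_gamma_convolution_tail:
  assumes p: "0 < \<rho>" "0 < p" "p \<le> r"
  shows "continuous_on {p..r} (\<lambda>b. measure (gamma_law (\<rho> * b) b \<star> \<nu>) {x<..})"
proof (rule continuous_on_sequentiallyI)
  fix u :: "nat \<Rightarrow> real" and a assume u: "\<forall>n. u n \<in> {p..r}" and a: "a \<in> {p..r}" and lim: "u \<longlonglongrightarrow> a"
  obtain B where B: "\<And>\<beta> w. p \<le> \<beta> \<Longrightarrow> \<beta> \<le> r \<Longrightarrow> 0 < w \<Longrightarrow> w \<le> max 0 x \<Longrightarrow> gamma_density (\<rho> * \<beta>) \<beta> w \<le> B * w powr (\<rho> * p - 1)"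
    using gamma_density_dominated[OF p, of "max 0 x"] by blast
  have pos: "0 < u n" "0 < \<rho> * u n" "0 < a" "0 < \<rho> * a" for n
  proof -
    have "0 < u n" using u p by (meson atLeastAtMost_iff less_le_trans)
    moreover have "0 < a" using a p by auto
    ultimately show "0 < u n" "0 < \<rho> * u n" "0 < a" "0 < \<rho> * a" using p by auto
  qed
  have F0: "measure \<nu> {..y} = 0" if "y < 0" for y
  proof -
    have "measure \<nu> {..y} = 0 \<longleftrightarrow> (AE q in \<nu>. q \<notin> {..y})" by (rule prob_eq_0) simp
    moreover have "AE q in \<nu>. q \<notin> {..y}" using AE_nonneg by eventually_elim (use that in auto)
    ultimately show ?thesis by simp
  qed
  have "mono (\<lambda>y. measure \<nu> {..y})" by (rule monoI) (auto intro!: finite_measure_mono)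
  then have F [measurable]: "(\<lambda>y. measure \<nu> {..y}) \<in> borel_measurable borel" by (rule borel_measurable_mono)
  have "(\<lambda>n. \<integral>w. gamma_density (\<rho> * u n) (u n) w * measure \<nu> {..x - w} \<partial>lborel)
    \<longlonglongrightarrow> (\<integral>w. gamma_density (\<rho> * a) a w * measure \<nu> {..x - w} \<partial>lborel)"
  proof (rule integral_dominated_convergence[where w = "\<lambda>w. B * (indicator {0..max 0 x} w * w powr (\<rho> * p - 1))"])
    have "(\<lambda>w. w powr (\<rho> * p - 1)) integrable_on {0..max 0 x}"
      using has_integral_powr_from_0[of "\<rho> * p - 1" "max 0 x"] p by (auto simp: integrable_on_def)
    then have "set_integrable lborel {0..max 0 x} (\<lambda>w. w powr (\<rho> * p - 1))"
      using absolutely_integrable_on_iff_nonneg[of "{0..max 0 x}" "\<lambda>w. w powr (\<rho> * p - 1)"]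
      by (simp add: set_integrable_def integrable_completion)
    then show "integrable lborel (\<lambda>w. B * (indicator {0..max 0 x} w * w powr (\<rho> * p - 1)))"
      by (simp add: set_integrable_def)
    show "AE w in lborel. (\<lambda>n. gamma_density (\<rho> * u n) (u n) w * measure \<nu> {..x - w}) \<longlonglongrightarrow> gamma_density (\<rho> * a) a w * measure \<nu> {..x - w}"
    proof (rule AE_I2)
      fix w
      have "\<rho> * a \<notin> \<int>\<^sub>\<le>\<^sub>0" using pos(4) by (auto simp: nonpos_Ints_def)
      moreover have "Gamma (\<rho> * a) \<noteq> 0" by (metis Gamma_real_pos pos(4) less_irrefl)
      ultimately show "(\<lambda>n. gamma_density (\<rho> * u n) (u n) w * measure \<nu> {..x - w}) \<longlonglongrightarrow> gamma_density (\<rho> * a) a w * measure \<nu> {..x - w}"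
        unfolding gamma_density_def using pos
        by (cases "0 < w") (auto intro!: tendsto_intros lim)
    qed
    show "AE w in lborel. norm (gamma_density (\<rho> * u n) (u n) w * measure \<nu> {..x - w}) \<le> B * (indicator {0..max 0 x} w * w powr (\<rho> * p - 1))" for n
    proof (rule AE_I2)
      fix w
      show "norm (gamma_density (\<rho> * u n) (u n) w * measure \<nu> {..x - w}) \<le> B * (indicator {0..max 0 x} w * w powr (\<rho> * p - 1))"
      proof (cases "0 < w \<and> w \<le> x")
        case True
        have un: "p \<le> u n" "u n \<le> r" using u by auto
        have "gamma_density (\<rho> * u n) (u n) w * measure \<nu> {..x - w} \<le> gamma_density (\<rho> * u n) (u n) w * 1"
          by (intro mult_left_mono gamma_density_nonneg pos) auto
        also have "\<dots> \<le> B * w powr (\<rho> * p - 1)" using B[OF un, of w] True by simp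
        finally show ?thesis using True by (simp add: abs_mult gamma_density_nonneg pos)
      next
        case False
        have zero: "gamma_density (\<rho> * u n) (u n) w * measure \<nu> {..x - w} = 0"
          using False F0[of "x - w"] by (auto simp: gamma_density_def)
        have "0 \<le> B * (indicator {0..max 0 x} w * w powr (\<rho> * p - 1))"
        proof (cases "w \<in> {0..max 0 x} \<and> w \<noteq> 0")
          case True
          then show ?thesis using False by auto
        next
          case False
          then show ?thesis by (auto simp: indicator_def)
        qed
        then show ?thesis unfolding zero by simp
      qed
    qed
  qed measurable
  then show "(\<lambda>n. measure (gamma_law (\<rho> * u n) (u n) \<star> \<nu>) {x<..}) \<longlonglongrightarrow> measure (gamma_law (\<rho> * a) a \<star> \<nu>) {x<..}"
    using pos by (simp add: measure_gamma_convolution_density(1) tendsto_diff)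
qed

lemma gamma_convolution_tail_antimono:
  assumes \<rho>: "0 < \<rho>" and b: "0 < b1" "b1 \<le> b2"
    and E: "\<And>b. b1 \<le> b \<Longrightarrow> b < b2 \<Longrightarrow>
      (\<integral>\<^sup>+q. indicator {..<x} q * exp_integral (b * (x - q)) \<partial>(gamma_law (\<rho> * b) b \<star> \<nu>))
        \<le> ennreal (exp_moment (gamma_law (\<rho> * b) b \<star> \<nu>) 0 b x)"
  shows "measure (gamma_law (\<rho> * b2) b2 \<star> \<nu>) {x<..} \<le> measure (gamma_law (\<rho> * b1) b1 \<star> \<nu>) {x<..}"
proof (rule antimono_of_right_derivative_bound[OF b(2) continuous_on_gamma_convolution_tail[OF \<rho> b]])
  fix s e :: real assume s: "b1 \<le> s" "s < b2" and e: "0 < e"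
  define k where "k = \<rho> * s"
  define L where "L = exp_moment (gamma_law k s \<star> \<nu>) 0 s x"
  have s0: "0 < s" and k0: "0 < k" using s b \<rho> by (auto simp: k_def)
  interpret mu: nonneg_law "gamma_law k s \<star> \<nu>" by (rule nonneg_law_gamma_convolution[OF k0 s0])
  have L0: "0 \<le> L" by (simp add: L_def mu.exp_moment_nonneg)
  define r where "r \<eta> = k * (1 - ln (1 + \<eta>) / \<eta>) - k * L + (1 + \<eta>) powr k * (k / Gamma (1 + k * \<eta>) * (L + k * \<eta>))" for \<eta>
  have "(r \<longlongrightarrow> k * (1 - 1) - k * L + (1 + 0) powr k * (k / Gamma (1 + k * 0) * (L + k * 0))) (at_right 0)"
  proof -
    have "((\<lambda>h::real. ln (1 + h)) has_real_derivative 1) (at 0)" by (auto intro!: derivative_eq_intros)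
    then have "((\<lambda>h::real. ln (1 + h) / h) \<longlongrightarrow> 1) (at 0)" by (simp add: has_field_derivative_iff)
    then have ln1: "((\<lambda>h::real. ln (1 + h) / h) \<longlongrightarrow> 1) (at_right 0)" by (rule tendsto_mono[OF at_le, rotated]) simp
    have "(1::real) + k * 0 \<notin> \<int>\<^sub>\<le>\<^sub>0" by (auto simp: nonpos_Ints_def)
    then show ?thesis unfolding r_def by (intro tendsto_intros ln1) auto
  qed
  then have "(r \<longlongrightarrow> 0) (at_right 0)" by simp
  then have ev: "\<forall>\<^sub>F \<eta> in at_right 0. r \<eta> < e * s" by (rule order_tendstoD(2)) (use e s0 in simp)
  have "\<forall>\<^sub>F \<eta> in at_right 0. r \<eta> < e * s \<and> \<eta> \<in> {0<..<min (1/k) ((b2 - s) / s)}"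
    by (intro eventually_conj ev eventually_at_right_real) (use s s0 k0 in auto)
  then obtain \<eta> where \<eta>: "r \<eta> < e * s" "0 < \<eta>" "\<eta> < 1 / k" "\<eta> < (b2 - s) / s"
    using eventually_happens[of _ "at_right (0::real)"] by fastforce
  have k\<eta>: "k * \<eta> \<le> 1" using \<eta> k0 by (simp add: field_simps)
  have "measure (gamma_law (k * (1 + \<eta>)) (s * (1 + \<eta>)) \<star> \<nu>) {x<..} \<le> measure (gamma_law k s \<star> \<nu>) {x<..}
    + k * (\<eta> - ln (1 + \<eta>)) - k * \<eta> * L + (1 + \<eta>) powr k * (k * \<eta> / Gamma (1 + k * \<eta>) * (L + k * \<eta>))"
    unfolding L_def by (rule gamma_convolution_tail_difference[OF k0 s0 \<eta>(2) k\<eta>])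
      (use E[OF s] mu.exp_moment_nonneg in \<open>auto simp: k_def\<close>)
  also have "\<dots> = measure (gamma_law k s \<star> \<nu>) {x<..} + \<eta> * r \<eta>"
    using \<eta> by (simp add: r_def algebra_simps)
  also have "\<dots> \<le> measure (gamma_law k s \<star> \<nu>) {x<..} + \<eta> * (e * s)"
    using \<eta> by (intro add_left_mono mult_left_mono) auto
  finally have "measure (gamma_law (\<rho> * (s * (1 + \<eta>))) (s * (1 + \<eta>)) \<star> \<nu>) {x<..} \<le> measure (gamma_law (\<rho> * s) s \<star> \<nu>) {x<..} + e * (s * (1 + \<eta>) - s)"
    by (simp add: k_def algebra_simps)
  moreover have "s < s * (1 + \<eta>)" "s * (1 + \<eta>) \<le> b2" using \<eta> s0 by (auto simp: field_simps)
  ultimately show "\<exists>t. s < t \<and> t \<le> b2 \<and> measure (gamma_law (\<rho> * t) t \<star> \<nu>) {x<..} \<le> measure (gamma_law (\<rho> * s) s \<star> \<nu>) {x<..} + e * (t - s)"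
    by blast
qed

end

theorem gamma_sum_tail_rate_antimono:
  assumes xs: "positive_params xs" and \<rho>: "0 < \<rho>" and b: "1 \<le> b1" "b1 \<le> b2"
    and rates: "\<And>i. i < length xs \<Longrightarrow> snd (xs ! i) \<le> b1"
    and mean: "\<rho> + (\<Sum>i<length xs. fst (xs ! i) / snd (xs ! i)) = 1" and x: "3/2 \<le> x"
  shows "measure (gamma_sum_law ((\<rho> * b2, b2) # xs)) {x<..} \<le> measure (gamma_sum_law ((\<rho> * b1, b1) # xs)) {x<..}"
proof -
  interpret nonneg_law "gamma_sum_law xs" by (rule nonneg_law_gamma_sum_law[OF xs])
  have "measure (gamma_law (\<rho> * b2) b2 \<star> gamma_sum_law xs) {x<..} \<le> measure (gamma_law (\<rho> * b1) b1 \<star> gamma_sum_law xs) {x<..}"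
  proof (rule gamma_convolution_tail_antimono[OF \<rho> _ b(2)])
    fix s assume s: "b1 \<le> s" "s < b2"
    have "(\<integral>\<^sup>+q. indicator {..<x} q * exp_integral (s * (x - q)) \<partial>gamma_sum_law ((\<rho> * s, s) # xs))
        \<le> ennreal (exp_moment (gamma_sum_law ((\<rho> * s, s) # xs)) 0 s x)"
    proof (rule exp_integral_le_exp_moment)
      show "snd (((\<rho> * s, s) # xs) ! i) \<le> s" if "i < length ((\<rho> * s, s) # xs)" for i
        using that rates[of "i - 1"] s by (cases i) auto
      show "(\<Sum>i<length ((\<rho> * s, s) # xs). fst (((\<rho> * s, s) # xs) ! i) / snd (((\<rho> * s, s) # xs) ! i)) = 1"
        using mean s b by (simp add: sum.lessThan_Suc_shift del: sum.lessThan_Suc)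
    qed (use xs \<rho> s b x in auto)
    then show "(\<integral>\<^sup>+q. indicator {..<x} q * exp_integral (s * (x - q)) \<partial>(gamma_law (\<rho> * s) s \<star> gamma_sum_law xs))
        \<le> ennreal (exp_moment (gamma_law (\<rho> * s) s \<star> gamma_sum_law xs) 0 s x)" by simp
  qed (use b in auto)
  then show ?thesis by simp
qed

definition chi_params :: "real list \<Rightarrow> (real \<times> real) list" where
  "chi_params ws = map (\<lambda>a. (1 / 2, 1 / (2 * a))) ws"

lemma chi_params_simps [simp]:
  "chi_params [] = []" "chi_params (a # ws) = (1 / 2, 1 / (2 * a)) # chi_params ws"
  "length (chi_params ws) = length ws"
  by (simp_all add: chi_params_def)

lemma chi_params_nth: "i < length ws \<Longrightarrow> chi_params ws ! i = (1 / 2, 1 / (2 * (ws ! i)))"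
  by (simp add: chi_params_def)

lemma positive_chi_params: "(\<And>a. a \<in> set ws \<Longrightarrow> 0 < a) \<Longrightarrow> positive_params (chi_params ws)"
  by (induction ws) auto

lemma mean_chi_params:
  "(\<And>a. a \<in> set ws \<Longrightarrow> 0 < a) \<Longrightarrow>
    (\<Sum>i<length ws. fst (chi_params ws ! i) / snd (chi_params ws ! i)) = sum_list ws"
  by (induction ws) (simp_all add: sum.lessThan_Suc_shift del: sum.lessThan_Suc)

lemma gamma_sum_law_merge:
  assumes "0 < k" "0 < l" "0 < b" "positive_params xs"
  shows "gamma_sum_law ((k, b) # (l, b) # xs) = gamma_sum_law ((k + l, b) # xs)"
proof -
  have p: "prob_space (gamma_law k b)" "prob_space (gamma_law l b)" "prob_space (gamma_sum_law xs)"
    using assms by (auto intro: prob_space_gamma_law prob_space_gamma_sum_law)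
  show ?thesis using p assms
    by (simp add: convolution_associative prob_space.finite_measure gamma_law_convolution)
qed

lemma merge_small_weights:
  assumes "sorted ws" and ws: "\<And>a. a \<in> set ws \<Longrightarrow> \<kappa> \<le> a \<and> a \<le> \<beta>" and fs: "\<And>a. a \<in> set fs \<Longrightarrow> \<beta> \<le> a"
    and "0 < \<kappa>" "\<kappa> \<le> \<beta>" "\<beta> \<le> 1/2" "0 < \<rho>" and sum: "\<rho> + sum_list ws + sum_list fs = 1" and x: "3/2 \<le> x"
  shows "measure (gamma_sum_law ((\<rho> * (1 / (2 * \<kappa>)), 1 / (2 * \<kappa>)) # chi_params (ws @ fs))) {x<..}
    \<le> measure (gamma_sum_law (((\<rho> + sum_list ws) * (1 / (2 * \<beta>)), 1 / (2 * \<beta>)) # chi_params fs)) {x<..}"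
  using assms
proof (induction ws arbitrary: \<kappa> \<rho>)
  case Nil
  have pos: "0 < a" if "a \<in> set fs" for a using Nil that by force
  have "measure (gamma_sum_law ((\<rho> * (1 / (2 * \<kappa>)), 1 / (2 * \<kappa>)) # chi_params fs)) {x<..}
    \<le> measure (gamma_sum_law ((\<rho> * (1 / (2 * \<beta>)), 1 / (2 * \<beta>)) # chi_params fs)) {x<..}"
  proof (rule gamma_sum_tail_rate_antimono)
    show "snd (chi_params fs ! i) \<le> 1 / (2 * \<beta>)" if "i < length (chi_params fs)" for i
      using that Nil(3)[of "fs ! i"] Nil(4,5) by (auto simp: chi_params_def intro!: divide_left_mono)
    show "\<rho> + (\<Sum>i<length (chi_params fs). fst (chi_params fs ! i) / snd (chi_params fs ! i)) = 1"
      using Nil(8) mean_chi_params[of fs] pos by simp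
  qed (use Nil pos in \<open>auto intro!: positive_chi_params simp: field_simps\<close>)
  then show ?case by simp
next
  case (Cons a ws)
  have a: "\<kappa> \<le> a" "a \<le> \<beta>" "0 < a" using Cons.prems(2)[of a] Cons.prems(4) by auto
  have wsa: "\<And>y. y \<in> set ws \<Longrightarrow> a \<le> y \<and> y \<le> \<beta>" using Cons.prems(1,2) by auto
  have pos: "0 < y" if "y \<in> set (ws @ fs)" for y
    using that wsa[of y] Cons.prems(3)[of y] a by fastforce
  have ge: "a \<le> y" if "y \<in> set (a # ws @ fs)" for y
    using that wsa[of y] Cons.prems(3)[of y] a by fastforce
  let ?rest = "chi_params (ws @ fs)"
  have "measure (gamma_sum_law ((\<rho> * (1 / (2 * \<kappa>)), 1 / (2 * \<kappa>)) # chi_params (a # ws @ fs))) {x<..}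
    \<le> measure (gamma_sum_law ((\<rho> * (1 / (2 * a)), 1 / (2 * a)) # chi_params (a # ws @ fs))) {x<..}"
  proof (rule gamma_sum_tail_rate_antimono)
    show "snd (chi_params (a # ws @ fs) ! i) \<le> 1 / (2 * a)" if "i < length (chi_params (a # ws @ fs))" for i
    proof -
      have "a \<le> (a # ws @ fs) ! i" by (rule ge, rule nth_mem) (use that in simp)
      then show ?thesis using that a by (subst chi_params_nth) (auto intro!: divide_left_mono)
    qed
    have posa: "0 < y" if "y \<in> set (a # ws @ fs)" for y using ge[OF that] a by linarith
    show "\<rho> + (\<Sum>i<length (chi_params (a # ws @ fs)). fst (chi_params (a # ws @ fs) ! i) / snd (chi_params (a # ws @ fs) ! i)) = 1"
    proof -
      have m: "(\<Sum>i<length (chi_params (a # ws @ fs)). fst (chi_params (a # ws @ fs) ! i) / snd (chi_params (a # ws @ fs) ! i)) = sum_list (a # ws @ fs)"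
        unfolding chi_params_simps(3) by (rule mean_chi_params, rule posa)
      show ?thesis unfolding m using Cons.prems(8) by simp
    qed
    show "positive_params (chi_params (a # ws @ fs))" by (rule positive_chi_params[OF posa])
    have "a \<le> 1 / 2" using a(2) Cons.prems(6) by linarith
    then show "1 \<le> 1 / (2 * a)" using a(3) by simp
    show "1 / (2 * a) \<le> 1 / (2 * \<kappa>)" using a(1) Cons.prems(4) by (simp add: frac_le)
  qed (use Cons.prems(7,9) in auto)
  also have "gamma_sum_law ((\<rho> * (1 / (2 * a)), 1 / (2 * a)) # chi_params (a # ws @ fs))
    = gamma_sum_law (((\<rho> + a) * (1 / (2 * a)), 1 / (2 * a)) # ?rest)"
  proof -
    have "gamma_sum_law ((\<rho> * (1 / (2 * a)), 1 / (2 * a)) # (1 / 2, 1 / (2 * a)) # ?rest)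
      = gamma_sum_law ((\<rho> * (1 / (2 * a)) + 1 / 2, 1 / (2 * a)) # ?rest)"
      by (rule gamma_sum_law_merge) (use Cons.prems a pos in \<open>auto intro!: positive_chi_params\<close>)
    moreover have "\<rho> * (1 / (2 * a)) + 1 / 2 = (\<rho> + a) * (1 / (2 * a))" using a by (simp add: field_simps)
    ultimately show ?thesis by simp
  qed
  also have "measure (gamma_sum_law (((\<rho> + a) * (1 / (2 * a)), 1 / (2 * a)) # ?rest)) {x<..}
    \<le> measure (gamma_sum_law (((\<rho> + a + sum_list ws) * (1 / (2 * \<beta>)), 1 / (2 * \<beta>)) # chi_params fs)) {x<..}"
    by (rule Cons.IH) (use Cons.prems a wsa in auto)
  finally show ?case by (simp add: add.assoc)
qed

lemma convolution_return_0:
  fixes M :: "real measure"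
  assumes "finite_measure M" and [measurable_cong, simp]: "sets M = sets borel"
  shows "(M \<star> return borel 0) = M"
proof (rule measure_eqI)
  fix A assume "A \<in> sets (M \<star> return borel 0)"
  then have A [measurable]: "A \<in> sets borel" by simp
  have "emeasure (M \<star> return borel 0) A = (\<integral>\<^sup>+q. indicator A q \<partial>(M \<star> return borel 0))" by simp
  also have "\<dots> = (\<integral>\<^sup>+w. \<integral>\<^sup>+q. indicator A (w + q) \<partial>return borel 0 \<partial>M)"
    by (rule nn_integral_convolution[OF assms(1) prob_space.finite_measure[OF prob_space_return]]) auto
  also have "\<dots> = emeasure M A" by (simp add: nn_integral_return)
  finally show "emeasure (M \<star> return borel 0) A = emeasure M A" .
qed simp

lemma gamma_sum_law_single: "0 < k \<Longrightarrow> 0 < b \<Longrightarrow> gamma_sum_law [(k, b)] = gamma_law k b"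
  by (simp add: convolution_return_0 prob_space.finite_measure prob_space_gamma_law)

text \<open>H\<close>

lemma chi_sum_tail_le_gamma_tail:
  assumes ws: "sorted ws" "ws \<noteq> []" "\<And>a. a \<in> set ws \<Longrightarrow> 0 < a \<and> a \<le> \<beta>" and \<beta>: "\<beta> \<le> 1/2"
    and sum: "sum_list ws = 1" and x: "3/2 \<le> x"
  shows "measure (gamma_sum_law (chi_params ws)) {x<..} \<le> measure (gamma_law (1 / (2 * \<beta>)) (1 / (2 * \<beta>))) {x<..}"
proof -
  obtain a vs where w: "ws = a # vs" using ws(2) by (cases ws) auto
  have a: "0 < a" "a \<le> \<beta>" using ws(3)[of a] w by auto
  have "measure (gamma_sum_law ((a * (1 / (2 * a)), 1 / (2 * a)) # chi_params (vs @ []))) {x<..}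
    \<le> measure (gamma_sum_law (((a + sum_list vs) * (1 / (2 * \<beta>)), 1 / (2 * \<beta>)) # chi_params [])) {x<..}"
    by (rule merge_small_weights) (use ws \<beta> a sum x w in auto)
  moreover have "gamma_sum_law (((a + sum_list vs) * (1 / (2 * \<beta>)), 1 / (2 * \<beta>)) # chi_params []) = gamma_law (1 / (2 * \<beta>)) (1 / (2 * \<beta>))"
    using sum w a gamma_sum_law_single[of "1 / (2 * \<beta>)" "1 / (2 * \<beta>)"] by simp
  ultimately show ?thesis using a w by simp
qed

lemma chi_sum_tail_le_two_weights:
  assumes ws: "sorted ws" "ws \<noteq> []" "\<And>w. w \<in> set ws \<Longrightarrow> 0 < w" and a: "1/2 \<le> a"
    and sum: "sum_list ws + a = 1" and x: "3/2 \<le> x"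
  shows "measure (gamma_sum_law (chi_params (ws @ [a]))) {x<..} \<le> measure (gamma_sum_law (chi_params [1 - a, a])) {x<..}"
proof -
  obtain w vs where w: "ws = w # vs" using ws(2) by (cases ws) auto
  have wpos: "0 < w" using ws(3)[of w] w by auto
  have vs: "0 \<le> sum_list vs" "\<And>v. v \<in> set vs \<Longrightarrow> v \<le> sum_list vs"
    using ws(3) w by (auto intro!: sum_list_nonneg member_le_sum_list simp: less_imp_le) 
  have "measure (gamma_sum_law ((w * (1 / (2 * w)), 1 / (2 * w)) # chi_params (vs @ [a]))) {x<..}
    \<le> measure (gamma_sum_law (((w + sum_list vs) * (1 / (2 * (1 - a))), 1 / (2 * (1 - a))) # chi_params [a])) {x<..}"
    by (rule merge_small_weights) (use ws a sum x w wpos vs in \<open>fastforce+\<close>)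
  moreover have "(w + sum_list vs) * (1 / (2 * (1 - a))) = 1 / 2" "w * (1 / (2 * w)) = 1 / 2"
    using sum w wpos vs by (simp_all add: field_simps)
  ultimately show ?thesis by (simp only: w append_Cons chi_params_simps)
qed

lemma exp_le_quadratic:
  fixes y :: real assumes "y \<le> 1" shows "exp y \<le> 1 + y + y\<^sup>2"
proof (cases "0 \<le> y")
  case True
  then show ?thesis using exp_bound[of y] assms by simp
next
  case False
  have "1 \<le> (1 + y + y\<^sup>2) * (1 - y)"
  proof -
    have "(1 + y + y\<^sup>2) * (1 - y) = 1 - y * y\<^sup>2" by (simp add: algebra_simps power2_eq_square)
    then show ?thesis using False by (simp add: mult_le_0_iff)
  qed
  also have "\<dots> \<le> (1 + y + y\<^sup>2) * exp (- y)"
  proof (rule mult_left_mono)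
    show "1 - y \<le> exp (- y)" using exp_ge_add_one_self[of "- y"] by simp
    have "0 \<le> (1 + y/2)\<^sup>2 + 3/4 * y\<^sup>2" by simp
    then show "0 \<le> 1 + y + y\<^sup>2" by (simp add: power2_eq_square algebra_simps)
  qed
  finally show ?thesis by (simp add: exp_minus field_simps)
qed

lemma gamma_tail_ge:
  assumes e: "0 < e" and b: "0 < b" and v: "0 < v"
  shows "ennreal (e / Gamma (1 + e)) * (ennreal (min 1 (b * v) powr e) * exp_integral (b * v)) \<le> emeasure (gamma_law e b) {v<..}"
proof -
  define z where "z = b * v"
  have z: "0 < z" using b v by (simp add: z_def)
  have G: "Gamma (1 + e) = e * Gamma e" using Gamma_plus1[of e] e by (simp add: add.commute nonpos_Ints_def)
  have Gpos: "0 < Gamma e" by (rule Gamma_real_pos[OF e(1)])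
  let ?m = "1 / Gamma e * min 1 z powr e"
  have m: "0 \<le> ?m" using Gpos by simp
  have "ennreal (1 / Gamma e) * (ennreal (min 1 z powr e) * exp_integral z) = (\<integral>\<^sup>+\<sigma>. ennreal ?m * (ennreal (exp (- z * \<sigma>) / \<sigma>) * indicator {1..} \<sigma>) \<partial>lborel)"
  proof -
    have "0 \<le> 1 / Gamma e" using Gpos by simp
    then have "ennreal (1 / Gamma e) * (ennreal (min 1 z powr e) * exp_integral z) = ennreal ?m * exp_integral z"
      by (simp only: mult.assoc[symmetric] ennreal_mult')
    also have "\<dots> = (\<integral>\<^sup>+\<sigma>. ennreal ?m * (ennreal (exp (- z * \<sigma>) / \<sigma>) * indicator {1..} \<sigma>) \<partial>lborel)"
      unfolding exp_integral_def by (rule nn_integral_cmult[symmetric]) measurable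
    finally show ?thesis .
  qed
  also have "\<dots> \<le> (\<integral>\<^sup>+\<sigma>. ennreal v * (ennreal (gamma_density e b (0 + v * \<sigma>)) * indicator {v<..} (0 + v * \<sigma>)) \<partial>lborel)"
  proof (rule nn_integral_mono_AE, rule AE_mp[OF AE_lborel_singleton[of 1]], intro AE_I2 impI)
    fix \<sigma> :: real assume "\<sigma> \<noteq> 1"
    show "ennreal ?m * (ennreal (exp (- z * \<sigma>) / \<sigma>) * indicator {1..} \<sigma>) \<le> ennreal v * (ennreal (gamma_density e b (0 + v * \<sigma>)) * indicator {v<..} (0 + v * \<sigma>))"
    proof (cases "1 < \<sigma>")
      case True
      have le: "min 1 z powr e \<le> (z * \<sigma>) powr e"
      proof (rule powr_mono2)
        have "z * 1 \<le> z * \<sigma>" using z True by (intro mult_left_mono) auto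
        then show "min 1 z \<le> z * \<sigma>" by auto
      qed (use e z in auto)
      have "?m * (exp (- z * \<sigma>) / \<sigma>) \<le> 1 / Gamma e * (z * \<sigma>) powr e * (exp (- z * \<sigma>) / \<sigma>)"
        using le Gpos True by (intro mult_right_mono mult_left_mono) auto
      also have "\<dots> = v * gamma_density e b (v * \<sigma>)"
      proof -
        have "(z * \<sigma>) powr e = b powr e * (v * \<sigma>) powr e" using b v True by (simp add: z_def powr_mult mult.assoc)
        also have "(v * \<sigma>) powr e = (v * \<sigma>) * (v * \<sigma>) powr (e - 1)" using v True by (simp add: powr_mult_base)
        finally show ?thesis using v True b by (simp add: gamma_density_def z_def mult.assoc)
      qed
      finally have "ennreal (?m * (exp (- z * \<sigma>) / \<sigma>)) \<le> ennreal (v * gamma_density e b (v * \<sigma>))" by (rule ennreal_leI)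
      then have "ennreal ?m * ennreal (exp (- z * \<sigma>) / \<sigma>) \<le> ennreal v * ennreal (gamma_density e b (v * \<sigma>))"
        using v by (simp only: ennreal_mult'[OF m] ennreal_mult'[OF less_imp_le[OF v]])
      then show ?thesis using True v by simp
    next
      case False
      then show ?thesis using \<open>\<sigma> \<noteq> 1\<close> by simp
    qed
  qed
  also have "\<dots> = ennreal v * (\<integral>\<^sup>+\<sigma>. ennreal (gamma_density e b (0 + v * \<sigma>)) * indicator {v<..} (0 + v * \<sigma>) \<partial>lborel)"
    by (rule nn_integral_cmult) simp
  also have "\<dots> = (\<integral>\<^sup>+u. ennreal (gamma_density e b u) * indicator {v<..} u \<partial>lborel)"
    using v by (subst nn_integral_real_affine[where c = v and t = 0]) auto
  also have "\<dots> = emeasure (gamma_law e b) {v<..}" unfolding gamma_law_def by (simp add: emeasure_density)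
  finally show ?thesis using e by (simp add: G z_def)
qed

lemma exp_integral_SUP:
  assumes b: "0 < b" and v: "0 < v" and k: "0 < k"
  shows "(SUP n. ennreal (min 1 (b * v) powr (k / real (Suc n))) * exp_integral (b * (1 + 1 / real (Suc n)) * v)) = exp_integral (b * v)"
    and "incseq (\<lambda>n. ennreal (min 1 (b * v) powr (k / real (Suc n))) * exp_integral (b * (1 + 1 / real (Suc n)) * v))"
proof -
  define f where "f n \<sigma> = ennreal (min 1 (b * v) powr (k / real (Suc n)) * (exp (- (b * (1 + 1 / real (Suc n)) * v) * \<sigma>) / \<sigma>)) * indicator {1..} \<sigma>" for n \<sigma>
  define z where "z = b * v"
  have z: "0 < z" using b v by (simp add: z_def)
  have fint: "ennreal (min 1 (b * v) powr (k / real (Suc n))) * exp_integral (b * (1 + 1 / real (Suc n)) * v) = (\<integral>\<^sup>+\<sigma>. f n \<sigma> \<partial>lborel)" for n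
  proof -
    have "ennreal (min 1 (b * v) powr (k / real (Suc n))) * exp_integral (b * (1 + 1 / real (Suc n)) * v)
      = (\<integral>\<^sup>+\<sigma>. ennreal (min 1 (b * v) powr (k / real (Suc n))) * (ennreal (exp (- (b * (1 + 1 / real (Suc n)) * v) * \<sigma>) / \<sigma>) * indicator {1..} \<sigma>) \<partial>lborel)"
      unfolding exp_integral_def by (rule nn_integral_cmult[symmetric]) measurable
    also have "\<dots> = (\<integral>\<^sup>+\<sigma>. f n \<sigma> \<partial>lborel)"
      by (intro nn_integral_cong) (simp only: f_def mult.assoc[symmetric] ennreal_mult'[OF powr_ge_zero])
    finally show ?thesis .
  qed
  have inc: "incseq f"
  proof (intro incseq_SucI le_funI)
    fix n \<sigma>
    have "min 1 z powr (k / real (Suc n)) * (exp (- (b * (1 + 1 / real (Suc n)) * v) * \<sigma>) / \<sigma>)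
      \<le> min 1 z powr (k / real (Suc (Suc n))) * (exp (- (b * (1 + 1 / real (Suc (Suc n))) * v) * \<sigma>) / \<sigma>)" if "1 \<le> \<sigma>"
    proof (intro mult_mono divide_right_mono)
      have "k / real (Suc (Suc n)) \<le> k / real (Suc n)" using k by (intro divide_left_mono) auto
      then show "min 1 z powr (k / real (Suc n)) \<le> min 1 z powr (k / real (Suc (Suc n)))"
        using z by (intro powr_mono') auto
      have "1 / real (Suc (Suc n)) \<le> 1 / real (Suc n)" by (intro divide_left_mono) auto
      then have "b * (1 + 1 / real (Suc (Suc n))) * v * \<sigma> \<le> b * (1 + 1 / real (Suc n)) * v * \<sigma>"
        using b v that by (intro mult_right_mono mult_left_mono add_left_mono) auto
      then show "exp (- (b * (1 + 1 / real (Suc n)) * v) * \<sigma>) \<le> exp (- (b * (1 + 1 / real (Suc (Suc n))) * v) * \<sigma>)" by simp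
    qed (use that in auto)
    then show "f n \<sigma> \<le> f (Suc n) \<sigma>" unfolding f_def z_def by (auto split: split_indicator intro!: ennreal_leI)
  qed
  have meas: "f n \<in> borel_measurable lborel" for n unfolding f_def by measurable
  have sup: "(SUP n. f n \<sigma>) = ennreal (exp (- (b * v) * \<sigma>) / \<sigma>) * indicator {1..} \<sigma>" for \<sigma>
  proof (rule LIMSEQ_unique)
    show "(\<lambda>n. f n \<sigma>) \<longlonglongrightarrow> (SUP n. f n \<sigma>)"
      by (rule LIMSEQ_SUP) (use inc in \<open>auto simp: incseq_def le_fun_def\<close>)
    have n0: "(\<lambda>n. 1 / real (Suc n)) \<longlonglongrightarrow> 0" using LIMSEQ_inverse_real_of_nat by (simp add: inverse_eq_divide)
    have n1: "(\<lambda>n. k / real (Suc n)) \<longlonglongrightarrow> 0" using tendsto_mult[OF tendsto_const[of k] n0] by simp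
    have "(\<lambda>n. min 1 z powr (k / real (Suc n)) * (exp (- (b * (1 + 1 / real (Suc n)) * v) * \<sigma>) / \<sigma>)) \<longlonglongrightarrow> min 1 z powr 0 * (exp (- (b * (1 + 0) * v) * \<sigma>) / \<sigma>)" if "1 \<le> \<sigma>"
      by (intro tendsto_intros n0 n1) (use z that in auto)
    then have "(\<lambda>n. min 1 z powr (k / real (Suc n)) * (exp (- (b * (1 + 1 / real (Suc n)) * v) * \<sigma>) / \<sigma>)) \<longlonglongrightarrow> exp (- (b * v) * \<sigma>) / \<sigma>" if "1 \<le> \<sigma>"
      using that z by (simp add: min_def split: if_splits)
    then show "(\<lambda>n. f n \<sigma>) \<longlonglongrightarrow> ennreal (exp (- (b * v) * \<sigma>) / \<sigma>) * indicator {1..} \<sigma>"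
      unfolding f_def z_def by (cases "1 \<le> \<sigma>") (auto intro!: tendsto_ennrealI)
  qed
  have "(SUP n. \<integral>\<^sup>+\<sigma>. f n \<sigma> \<partial>lborel) = (\<integral>\<^sup>+\<sigma>. (SUP n. f n \<sigma>) \<partial>lborel)"
    by (rule nn_integral_monotone_convergence_SUP[OF inc meas, symmetric])
  then show "(SUP n. ennreal (min 1 (b * v) powr (k / real (Suc n))) * exp_integral (b * (1 + 1 / real (Suc n)) * v)) = exp_integral (b * v)"
    unfolding fint sup unfolding exp_integral_def .
  show "incseq (\<lambda>n. ennreal (min 1 (b * v) powr (k / real (Suc n))) * exp_integral (b * (1 + 1 / real (Suc n)) * v))"
    unfolding fint by (rule incseq_SucI, rule nn_integral_mono) (use inc in \<open>auto simp: incseq_Suc_iff le_fun_def\<close>)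
qed

lemma mono_of_right_derivative_bound:
  fixes g :: "real \<Rightarrow> real"
  assumes ab: "a \<le> b" and cont: "continuous_on {a..b} g"
    and step: "\<And>s e. a \<le> s \<Longrightarrow> s < b \<Longrightarrow> 0 < e \<Longrightarrow> \<exists>t. s < t \<and> t \<le> b \<and> g s - e * (t - s) \<le> g t"
  shows "g a \<le> g b"
proof -
  have "- g b \<le> - g a"
  proof (rule antimono_of_right_derivative_bound[OF ab])
    show "continuous_on {a..b} (\<lambda>x. - g x)" by (intro continuous_intros cont)
    show "\<exists>t. s < t \<and> t \<le> b \<and> - g t \<le> - g s + e * (t - s)" if s: "a \<le> s" "s < b" "0 < e" for s e
      using step[OF s] by (auto simp: algebra_simps)
  qed
  then show ?thesis by simp
qed

context nonneg_law
begin

lemma truncated_tail_integral_ge: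
  assumes kb: "0 < k" "0 < b" and e: "0 < \<eta>"
  defines "\<mu> \<equiv> gamma_law k b \<star> \<nu>"
  assumes E: "ennreal E \<le> (\<integral>\<^sup>+q. indicator {..<x} q * (ennreal (min 1 (b * (x - q)) powr (k * \<eta>)) * exp_integral (b * (1 + \<eta>) * (x - q))) \<partial>\<mu>)" "0 \<le> E"
  shows "k * \<eta> / Gamma (1 + k * \<eta>) * E
    \<le> (\<integral>z. indicator {z. fst z + snd z \<le> x} z * measure (gamma_law (k * \<eta>) (b * (1 + \<eta>))) {x - fst z - snd z<..} \<partial>(gamma_law k b \<Otimes>\<^sub>M \<nu>))"
proof -
  let ?G = "gamma_law k b" and ?V = "gamma_law (k * \<eta>) (b * (1 + \<eta>))"
  define C where "C = k * \<eta> / Gamma (1 + k * \<eta>)"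
  have C: "0 \<le> C" using kb e by (auto simp: C_def intro!: divide_nonneg_nonneg less_imp_le[OF Gamma_real_pos] add_pos_pos)
  interpret G: prob_space ?G by (rule prob_space_gamma_law[OF kb])
  interpret V: prob_space ?V by (rule prob_space_gamma_law) (use kb e in auto)
  interpret P: pair_prob_space ?G \<nu> ..
  interpret mu: nonneg_law \<mu> unfolding \<mu>_def by (rule nonneg_law_gamma_convolution[OF kb])
  have T [measurable]: "(\<lambda>v. measure ?V {v<..}) \<in> borel_measurable borel"
    by (rule upper_tail_measurable) (auto intro: V.prob_space_axioms)
  have conv: "(\<integral>\<^sup>+q. f q \<partial>\<mu>) = (\<integral>\<^sup>+w. \<integral>\<^sup>+q. f (w + q) \<partial>\<nu> \<partial>?G)" if "f \<in> borel_measurable borel" for f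
    unfolding \<mu>_def using that by (intro nn_integral_convolution) (auto intro: G.finite_measure_axioms finite_measure_axioms)
  have int: "integrable (?G \<Otimes>\<^sub>M \<nu>) (\<lambda>z. indicator {z. fst z + snd z \<le> x} z * measure ?V {x - fst z - snd z<..})"
    by (rule P.integrable_const_bound[where B = 1]) (auto simp: indicator_def)
  have "ennreal (C * E) = ennreal C * ennreal E" by (rule ennreal_mult'[OF C])
  also have "\<dots> \<le> ennreal C * (\<integral>\<^sup>+q. indicator {..<x} q * (ennreal (min 1 (b * (x - q)) powr (k * \<eta>)) * exp_integral (b * (1 + \<eta>) * (x - q))) \<partial>\<mu>)"
    by (rule mult_left_mono[OF E(1)]) simp
  also have "\<dots> = (\<integral>\<^sup>+q. ennreal C * (indicator {..<x} q * (ennreal (min 1 (b * (x - q)) powr (k * \<eta>)) * exp_integral (b * (1 + \<eta>) * (x - q)))) \<partial>\<mu>)"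
    by (rule nn_integral_cmult[symmetric]) measurable
  also have "\<dots> \<le> (\<integral>\<^sup>+q. ennreal (indicator {..x} q * measure ?V {x - q<..}) \<partial>\<mu>)"
  proof (rule nn_integral_mono)
    fix q
    show "ennreal C * (indicator {..<x} q * (ennreal (min 1 (b * (x - q)) powr (k * \<eta>)) * exp_integral (b * (1 + \<eta>) * (x - q))))
      \<le> ennreal (indicator {..x} q * measure ?V {x - q<..})"
    proof (cases "q < x")
      case True
      have "b * (x - q) * 1 \<le> b * (x - q) * (1 + \<eta>)" using True kb e by (intro mult_left_mono) auto
      then have "min 1 (b * (x - q)) \<le> min 1 (b * (1 + \<eta>) * (x - q))" by (simp add: ac_simps)
      then have "min 1 (b * (x - q)) powr (k * \<eta>) \<le> min 1 (b * (1 + \<eta>) * (x - q)) powr (k * \<eta>)"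
        using True kb e by (intro powr_mono2) auto
      then have "ennreal C * (ennreal (min 1 (b * (x - q)) powr (k * \<eta>)) * exp_integral (b * (1 + \<eta>) * (x - q)))
        \<le> ennreal C * (ennreal (min 1 (b * (1 + \<eta>) * (x - q)) powr (k * \<eta>)) * exp_integral (b * (1 + \<eta>) * (x - q)))"
        by (intro mult_left_mono mult_right_mono ennreal_leI) auto
      also have "\<dots> \<le> emeasure ?V {x - q<..}"
        unfolding C_def by (rule gamma_tail_ge) (use kb e True in auto)
      also have "\<dots> = ennreal (measure ?V {x - q<..})" by (simp add: V.emeasure_eq_measure)
      finally show ?thesis using True by simp
    qed simp
  qed
  also have "\<dots> = (\<integral>\<^sup>+w. \<integral>\<^sup>+q. ennreal (indicator {..x} (w + q) * measure ?V {x - (w + q)<..}) \<partial>\<nu> \<partial>?G)"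
    by (rule conv) measurable
  also have "\<dots> = (\<integral>\<^sup>+z. ennreal (indicator {z. fst z + snd z \<le> x} z * measure ?V {x - fst z - snd z<..}) \<partial>(?G \<Otimes>\<^sub>M \<nu>))"
    by (subst nn_integral_fst[symmetric]) (auto simp: indicator_def diff_diff_eq intro!: nn_integral_cong)
  also have "\<dots> = ennreal (\<integral>z. indicator {z. fst z + snd z \<le> x} z * measure ?V {x - fst z - snd z<..} \<partial>(?G \<Otimes>\<^sub>M \<nu>))"
    by (rule nn_integral_eq_integral[OF int]) simp
  finally show ?thesis unfolding C_def[symmetric]
    by (subst (asm) ennreal_le_iff) (auto intro!: integral_nonneg_AE)
qed

lemma gamma_convolution_tail_difference_ge:
  assumes kb: "0 < k" "0 < b" and e: "0 < \<eta>" "\<eta> * (k + b * \<bar>x\<bar>) \<le> 1"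
  defines "\<mu> \<equiv> gamma_law k b \<star> \<nu>"
  assumes E: "ennreal E \<le> (\<integral>\<^sup>+q. indicator {..<x} q * (ennreal (min 1 (b * (x - q)) powr (k * \<eta>)) * exp_integral (b * (1 + \<eta>) * (x - q))) \<partial>\<mu>)" "0 \<le> E"
  shows "measure \<mu> {x<..} - k * \<eta> * exp_moment \<mu> 0 b x - (\<eta> * (k + b * \<bar>x\<bar>))\<^sup>2
      + exp (- \<eta> * b * \<bar>x\<bar>) * (k * \<eta> / Gamma (1 + k * \<eta>) * E)
    \<le> measure (gamma_law (k * (1 + \<eta>)) (b * (1 + \<eta>)) \<star> \<nu>) {x<..}"
proof -
  let ?G = "gamma_law k b" and ?V = "gamma_law (k * \<eta>) (b * (1 + \<eta>))"
  let ?P = "?G \<Otimes>\<^sub>M \<nu>"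
  define K where "K = k + b * \<bar>x\<bar>"
  define A where "A = {z::real \<times> real. fst z + snd z \<le> x}"
  define tilt where "tilt w = (1 + \<eta>) powr k * exp (- \<eta> * b * w)" for w
  define T where "T z = measure ?V {x - fst z - snd z<..}" for z
  have c: "1 < 1 + \<eta>" "0 < ln (1 + \<eta>)" "ln (1 + \<eta>) \<le> \<eta>" using e ln_add_one_self_le_self[of \<eta>] by auto
  interpret G: prob_space ?G by (rule prob_space_gamma_law[OF kb])
  interpret V: prob_space ?V by (rule prob_space_gamma_law) (use kb e in auto)
  interpret P: pair_prob_space ?G \<nu> ..
  interpret mu: nonneg_law \<mu> unfolding \<mu>_def by (rule nonneg_law_gamma_convolution[OF kb])
  have T0 [measurable]: "(\<lambda>v. measure ?V {v<..}) \<in> borel_measurable borel"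
    by (rule upper_tail_measurable) (auto intro: V.prob_space_axioms)
  have A [measurable]: "A \<in> sets ?P"
  proof -
    have "A = {z \<in> space ?P. fst z + snd z \<le> x}"
      using sets_eq_imp_space_eq[OF sets_law] by (auto simp: A_def space_pair_measure)
    also have "\<dots> \<in> sets ?P" by measurable
    finally show ?thesis .
  qed
  have Tm [measurable]: "T \<in> borel_measurable ?P" unfolding T_def by measurable
  have T01: "0 \<le> T z" "T z \<le> 1" for z by (auto simp: T_def)
  have T1: "T z = 1" if "z \<notin> A" for z
  proof -
    have "AE v in ?V. v \<in> {x - fst z - snd z<..}"
      using AE_gamma_law_pos by eventually_elim (use that in \<open>auto simp: A_def\<close>)
    then show ?thesis unfolding T_def by (subst V.prob_eq_1) auto
  qed
  note tilts = measure_gamma_convolution_tilt(1)[OF kb e(1), of x, folded tilt_def T_def]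
    measure_gamma_convolution_tilt(2-4)[OF kb e(1), folded tilt_def]
    measure_gamma_convolution_tilt(5)[OF kb e(1), of x, folded tilt_def T_def]
  have AEsnd: "AE z in ?P. 0 \<le> snd z"
  proof (rule P.AE_pair_measure)
    show "{z \<in> space ?P. 0 \<le> snd z} \<in> sets ?P" by measurable
    show "AE w in ?G. AE q in \<nu>. 0 \<le> snd (w, q)" using AE_nonneg by simp
  qed
  have iA: "integrable ?P (indicator A :: _ \<Rightarrow> real)"
    by (rule P.integrable_const_bound[where B = 1]) (auto simp: indicator_def)
  have iAw: "integrable ?P (\<lambda>z. indicator A z * (b * fst z))"
  proof (rule P.integrable_const_bound[where B = "b * \<bar>x\<bar>"])
    show "AE z in ?P. norm (indicator A z * (b * fst z)) \<le> b * \<bar>x\<bar>"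
      using tilts(3) AEsnd by eventually_elim (use kb in \<open>auto simp: A_def indicator_def abs_mult\<close>)
  qed measurable
  have iAt: "integrable ?P (\<lambda>z. indicator A z * tilt (fst z))"
    using integrable_mult_indicator[OF A tilts(4)] by simp
  have iAT: "integrable ?P (\<lambda>z. indicator A z * T z)"
    by (rule P.integrable_const_bound[where B = 1]) (use T01 in \<open>auto simp: indicator_def\<close>)
  have "1 - (\<integral>z. indicator A z * tilt (fst z) \<partial>?P) + exp (- \<eta> * b * \<bar>x\<bar>) * (\<integral>z. indicator A z * T z \<partial>?P)
    = (\<integral>z. tilt (fst z) - indicator A z * tilt (fst z) + exp (- \<eta> * b * \<bar>x\<bar>) * (indicator A z * T z) \<partial>?P)"
    using tilts(2,4) iAt iAT by simp
  also have "\<dots> \<le> (\<integral>z. tilt (fst z) * T z \<partial>?P)"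
  proof (rule integral_mono_AE)
    show "AE z in ?P. tilt (fst z) - indicator A z * tilt (fst z) + exp (- \<eta> * b * \<bar>x\<bar>) * (indicator A z * T z) \<le> tilt (fst z) * T z"
      using tilts(3) AEsnd
    proof eventually_elim
      case (elim z)
      show ?case
      proof (cases "z \<in> A")
        case True
        then have "\<eta> * b * fst z \<le> \<eta> * b * \<bar>x\<bar>" using elim e kb by (intro mult_left_mono) (auto simp: A_def)
        then have "exp (- \<eta> * b * \<bar>x\<bar>) \<le> 1 * exp (- \<eta> * b * fst z)" by simp
        also have "\<dots> \<le> tilt (fst z)" unfolding tilt_def using c kb by (intro mult_right_mono ge_one_powr_ge_zero) auto
        finally have "exp (- \<eta> * b * \<bar>x\<bar>) * T z \<le> tilt (fst z) * T z" by (intro mult_right_mono T01)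
        then show ?thesis using True by simp
      qed (simp add: T1)
    qed
  qed (use tilts(4,5) iAt iAT in auto)
  finally have f1: "1 - (\<integral>z. indicator A z * tilt (fst z) \<partial>?P) + exp (- \<eta> * b * \<bar>x\<bar>) * (\<integral>z. indicator A z * T z \<partial>?P)
    \<le> measure (gamma_law (k * (1 + \<eta>)) (b * (1 + \<eta>)) \<star> \<nu>) {x<..}" using tilts(1) by simp
  have f2: "(\<integral>z. indicator A z * tilt (fst z) \<partial>?P) \<le> (\<integral>z. indicator A z * (1 + \<eta> * k + (\<eta> * K)\<^sup>2) - \<eta> * (indicator A z * (b * fst z)) \<partial>?P)"
  proof (rule integral_mono_AE)
    show "AE z in ?P. indicator A z * tilt (fst z) \<le> indicator A z * (1 + \<eta> * k + (\<eta> * K)\<^sup>2) - \<eta> * (indicator A z * (b * fst z))"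
      using tilts(3) AEsnd
    proof eventually_elim
      case (elim z)
      show ?case
      proof (cases "z \<in> A")
        case True
        then have w: "0 < fst z" "fst z \<le> \<bar>x\<bar>" using elim by (auto simp: A_def)
        define y where "y = \<eta> * (k - b * fst z)"
        have "\<bar>k - b * fst z\<bar> \<le> K"
        proof -
          have "b * fst z \<le> b * \<bar>x\<bar>" "0 \<le> b * fst z" using w kb by (auto intro: mult_left_mono)
          then show ?thesis using kb unfolding K_def abs_le_iff by (intro conjI; linarith)
        qed
        then have yK: "\<bar>y\<bar> \<le> \<eta> * K" using e by (simp add: y_def abs_mult)
        then have "y \<le> 1" using e by (simp add: K_def)
        have "tilt (fst z) = exp (k * ln (1 + \<eta>) - \<eta> * b * fst z)" using c by (simp add: tilt_def powr_def mult_exp_exp)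
        also have "\<dots> \<le> exp y" using c kb mult_left_mono[OF c(3), of k] by (simp add: y_def algebra_simps)
        also have "\<dots> \<le> 1 + y + y\<^sup>2" by (rule exp_le_quadratic) fact
        also have "y\<^sup>2 \<le> (\<eta> * K)\<^sup>2" using yK by (metis abs_ge_zero power2_abs power_mono)
        finally show ?thesis using True by (simp add: y_def algebra_simps)
      qed simp
    qed
  qed (use iA iAw iAt in auto)
  have f3: "(\<integral>z. indicator A z * (1 + \<eta> * k + (\<eta> * K)\<^sup>2) - \<eta> * (indicator A z * (b * fst z)) \<partial>?P)
     = measure ?P A * (1 + \<eta> * k + (\<eta> * K)\<^sup>2) - \<eta> * (\<integral>z. indicator A z * (b * fst z) \<partial>?P)"
    using iA iAw sets.sets_into_space[OF A] by (simp add: Int_absorb2)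
  have f4: "(\<integral>z. indicator A z * (b * fst z) \<partial>?P) = k * (measure \<mu> {..x} - exp_moment \<mu> 0 b x)"
    unfolding A_def \<mu>_def by (rule truncated_gamma_mean[OF kb])
  have "k * \<eta> / Gamma (1 + k * \<eta>) * E \<le> (\<integral>z. indicator A z * T z \<partial>?P)"
    unfolding A_def T_def by (rule truncated_tail_integral_ge[OF kb e(1) E[unfolded \<mu>_def]])
  then have f5: "exp (- \<eta> * b * \<bar>x\<bar>) * (k * \<eta> / Gamma (1 + k * \<eta>) * E) \<le> exp (- \<eta> * b * \<bar>x\<bar>) * (\<integral>z. indicator A z * T z \<partial>?P)"
    by (intro mult_left_mono) auto
  have PA: "measure \<mu> {..x} = measure ?P A" "measure \<mu> {x<..} = 1 - measure ?P A"
    unfolding \<mu>_def A_def by (rule measure_gamma_convolution_pair[OF kb])+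
  have f6: "measure ?P A * (\<eta> * K)\<^sup>2 \<le> (\<eta> * K)\<^sup>2" by (rule mult_left_le_one_le) auto
  have "measure ?P A * (1 + \<eta> * k + (\<eta> * K)\<^sup>2) - \<eta> * (k * (measure ?P A - exp_moment \<mu> 0 b x))
    = measure ?P A + measure ?P A * (\<eta> * K)\<^sup>2 + k * \<eta> * exp_moment \<mu> 0 b x" by (simp add: algebra_simps)
  then have "(\<integral>z. indicator A z * tilt (fst z) \<partial>?P) \<le> measure ?P A + (\<eta> * K)\<^sup>2 + k * \<eta> * exp_moment \<mu> 0 b x"
    using f2 f6 unfolding f3 f4 PA by linarith
  then show ?thesis using f1 f5 unfolding PA K_def[symmetric] by linarith
qed

lemma gamma_convolution_tail_mono:
  assumes \<rho>: "0 < \<rho>" and b: "0 < b1" "b1 \<le> b2"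
    and E: "\<And>b. b1 \<le> b \<Longrightarrow> b < b2 \<Longrightarrow>
      ennreal (exp_moment (gamma_law (\<rho> * b) b \<star> \<nu>) 0 b x)
        \<le> (\<integral>\<^sup>+q. indicator {..<x} q * exp_integral (b * (x - q)) \<partial>(gamma_law (\<rho> * b) b \<star> \<nu>))"
  shows "measure (gamma_law (\<rho> * b1) b1 \<star> \<nu>) {x<..} \<le> measure (gamma_law (\<rho> * b2) b2 \<star> \<nu>) {x<..}"
proof (rule mono_of_right_derivative_bound[OF b(2) continuous_on_gamma_convolution_tail[OF \<rho> b]])
  fix s e :: real assume s: "b1 \<le> s" "s < b2" and e: "0 < e"
  define k where "k = \<rho> * s"
  define \<mu> where "\<mu> = (gamma_law k s \<star> \<nu>)"
  define L where "L = exp_moment \<mu> 0 s x"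
  have s0: "0 < s" and k0: "0 < k" using s b \<rho> by (auto simp: k_def)
  interpret mu: nonneg_law \<mu> unfolding \<mu>_def by (rule nonneg_law_gamma_convolution[OF k0 s0])
  define K where "K = k + s * \<bar>x\<bar>"
  have K0: "0 < K" using k0 s0 by (simp add: K_def add_pos_nonneg)
  define \<delta> where "\<delta> = e * s / (4 * k)"
  have \<delta>: "0 < \<delta>" using e s0 k0 by (simp add: \<delta>_def)
  define E' where "E' = max 0 (L - \<delta>)"
  have L0: "0 \<le> L" by (simp add: L_def mu.exp_moment_nonneg)
  define f where "f n q = indicator {..<x} q * (ennreal (min 1 (s * (x - q)) powr (k / real (Suc n))) * exp_integral (s * (1 + 1 / real (Suc n)) * (x - q)))" for n q
  have fm [measurable]: "f n \<in> borel_measurable borel" for n unfolding f_def by measurable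
  have finc: "incseq f"
  proof (intro incseq_SucI le_funI)
    fix n q
    show "f n q \<le> f (Suc n) q"
      using exp_integral_SUP(2)[OF s0 _ k0, of "x - q"] unfolding f_def incseq_Suc_iff by (auto split: split_indicator)
  qed
  have fsup: "(SUP n. f n q) = indicator {..<x} q * exp_integral (s * (x - q))" for q
    using exp_integral_SUP(1)[OF s0 _ k0, of "x - q"] by (auto simp: f_def split: split_indicator)
  have SUPint: "(SUP n. \<integral>\<^sup>+q. f n q \<partial>\<mu>) = (\<integral>\<^sup>+q. indicator {..<x} q * exp_integral (s * (x - q)) \<partial>\<mu>)"
    unfolding fsup[symmetric] by (rule nn_integral_monotone_convergence_SUP[symmetric]) (use finc in auto)
  have "\<exists>n0. \<forall>n\<ge>n0. ennreal E' \<le> (\<integral>\<^sup>+q. f n q \<partial>\<mu>)"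
  proof (cases "L - \<delta> \<le> 0")
    case True
    then show ?thesis by (simp add: E'_def)
  next
    case False
    then have "ennreal E' < ennreal L" using \<delta> by (simp add: E'_def ennreal_less_iff)
    also have "\<dots> \<le> (SUP n. \<integral>\<^sup>+q. f n q \<partial>\<mu>)"
      unfolding SUPint L_def using E[OF s] by (simp add: \<mu>_def k_def)
    finally obtain n0 where n0: "ennreal E' < (\<integral>\<^sup>+q. f n0 q \<partial>\<mu>)" by (auto simp: less_SUP_iff)
    have "ennreal E' \<le> (\<integral>\<^sup>+q. f n q \<partial>\<mu>)" if "n0 \<le> n" for n
    proof -
      have "(\<integral>\<^sup>+q. f n0 q \<partial>\<mu>) \<le> (\<integral>\<^sup>+q. f n q \<partial>\<mu>)"
        by (rule nn_integral_mono) (use finc that in \<open>auto simp: incseq_def le_fun_def\<close>)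
      then show ?thesis using n0 by (meson less_imp_le order_trans)
    qed
    then show ?thesis by blast
  qed
  then obtain n0 where n0: "\<And>n. n0 \<le> n \<Longrightarrow> ennreal E' \<le> (\<integral>\<^sup>+q. f n q \<partial>\<mu>)" by blast
  define r where "r \<eta> = - k * L - \<eta> * K\<^sup>2 + exp (- \<eta> * s * \<bar>x\<bar>) * (k / Gamma (1 + k * \<eta>) * E')" for \<eta>
  have n\<eta>: "(\<lambda>n. 1 / real (Suc n)) \<longlonglongrightarrow> 0" using LIMSEQ_inverse_real_of_nat by (simp add: inverse_eq_divide)
  have "(1::real) + k * 0 \<notin> \<int>\<^sub>\<le>\<^sub>0" by (auto simp: nonpos_Ints_def)
  then have "(\<lambda>n. r (1 / real (Suc n))) \<longlonglongrightarrow> - k * L - 0 * K\<^sup>2 + exp (- 0 * s * \<bar>x\<bar>) * (k / Gamma (1 + k * 0) * E')"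
    unfolding r_def by (intro tendsto_intros n\<eta>) auto
  then have rlim: "(\<lambda>n. r (1 / real (Suc n))) \<longlonglongrightarrow> - k * L + k * E'" by simp
  have "k * \<delta> = e * s / 4" using k0 by (simp add: \<delta>_def)
  moreover have "k * (L - \<delta>) \<le> k * E'" using k0 by (intro mult_left_mono) (auto simp: E'_def)
  moreover have "0 < e * s" using e s0 by simp
  ultimately have "- e * s < - k * L + k * E'" by (simp add: right_diff_distrib)
  then have ev1: "\<forall>\<^sub>F n in sequentially. - e * s < r (1 / real (Suc n))" using rlim by (rule order_tendstoD(1)[rotated])
  have ev2: "\<forall>\<^sub>F n in sequentially. 1 / real (Suc n) < min (1 / K) ((b2 - s) / s)"
    using n\<eta> by (rule order_tendstoD(2)) (use K0 s s0 in auto)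
  from eventually_conj[OF ev1 eventually_conj[OF ev2 eventually_ge_at_top[of n0]]]
  obtain n where n: "- e * s < r (1 / real (Suc n))" "1 / real (Suc n) < min (1 / K) ((b2 - s) / s)" "n0 \<le> n"
    using eventually_happens[of _ sequentially] by fastforce
  define \<eta> where "\<eta> = 1 / real (Suc n)"
  have \<eta>: "0 < \<eta>" "- e * s < r \<eta>" "\<eta> * K \<le> 1" "\<eta> < (b2 - s) / s"
    using n K0 by (auto simp: \<eta>_def field_simps)
  have k\<eta>: "k / real (Suc n) = k * \<eta>" by (simp add: \<eta>_def)
  have EE: "ennreal E' \<le> (\<integral>\<^sup>+q. indicator {..<x} q * (ennreal (min 1 (s * (x - q)) powr (k * \<eta>)) * exp_integral (s * (1 + \<eta>) * (x - q))) \<partial>\<mu>)"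
    using n0[OF n(3)] unfolding f_def k\<eta> \<eta>_def[symmetric] .
  have "measure \<mu> {x<..} - k * \<eta> * L - (\<eta> * (k + s * \<bar>x\<bar>))\<^sup>2 + exp (- \<eta> * s * \<bar>x\<bar>) * (k * \<eta> / Gamma (1 + k * \<eta>) * E')
    \<le> measure (gamma_law (k * (1 + \<eta>)) (s * (1 + \<eta>)) \<star> \<nu>) {x<..}"
    unfolding L_def \<mu>_def
    by (rule gamma_convolution_tail_difference_ge[OF k0 s0 \<eta>(1)])
       (use \<eta>(3) EE in \<open>simp_all add: K_def \<mu>_def E'_def\<close>)
  moreover have "measure \<mu> {x<..} - k * \<eta> * L - (\<eta> * (k + s * \<bar>x\<bar>))\<^sup>2 + exp (- \<eta> * s * \<bar>x\<bar>) * (k * \<eta> / Gamma (1 + k * \<eta>) * E')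
    = measure \<mu> {x<..} + \<eta> * r \<eta>"
    unfolding r_def K_def by (simp add: algebra_simps power2_eq_square)
  moreover have "\<eta> * (- e * s) \<le> \<eta> * r \<eta>" using \<eta> by (intro mult_left_mono) auto
  ultimately have "measure \<mu> {x<..} - e * (s * (1 + \<eta>) - s) \<le> measure (gamma_law (k * (1 + \<eta>)) (s * (1 + \<eta>)) \<star> \<nu>) {x<..}"
    by (simp add: algebra_simps)
  then have "measure (gamma_law (\<rho> * s) s \<star> \<nu>) {x<..} - e * (s * (1 + \<eta>) - s) \<le> measure (gamma_law (\<rho> * (s * (1 + \<eta>))) (s * (1 + \<eta>)) \<star> \<nu>) {x<..}"
    by (simp add: \<mu>_def k_def mult.assoc)
  moreover have "s < s * (1 + \<eta>)" "s * (1 + \<eta>) \<le> b2" using \<eta> s0 by (auto simp: field_simps)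
  ultimately show "\<exists>t. s < t \<and> t \<le> b2 \<and> measure (gamma_law (\<rho> * s) s \<star> \<nu>) {x<..} - e * (t - s) \<le> measure (gamma_law (\<rho> * t) t \<star> \<nu>) {x<..}"
    by blast
qed

end

lemma (in nonneg_law) nn_integral_exp_integral:
  assumes b: "0 \<le> b"
  shows "(\<integral>\<^sup>+q. indicator {..<x} q * exp_integral (b * (x - q)) \<partial>\<nu>)
    = (\<integral>\<^sup>+\<sigma>. ennreal (exp_moment \<nu> 0 (b * \<sigma>) x / \<sigma>) * indicator {1..} \<sigma> \<partial>lborel)"
proof -
  interpret P: pair_sigma_finite \<nu> lborel ..
  have "(\<integral>\<^sup>+q. indicator {..<x} q * exp_integral (b * (x - q)) \<partial>\<nu>)
    = (\<integral>\<^sup>+q. (\<integral>\<^sup>+\<sigma>. ennreal (exp_kernel 0 (b * \<sigma>) (x - q)) * (ennreal (1 / \<sigma>) * indicator {1..} \<sigma>) \<partial>lborel) \<partial>\<nu>)"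
  proof (rule nn_integral_cong)
    fix q
    have "indicator {..<x} q * exp_integral (b * (x - q)) = (\<integral>\<^sup>+\<sigma>. indicator {..<x} q * (ennreal (exp (- (b * (x - q)) * \<sigma>) / \<sigma>) * indicator {1..} \<sigma>) \<partial>lborel)"
      unfolding exp_integral_def by (rule nn_integral_cmult[symmetric]) measurable
    also have "\<dots> = (\<integral>\<^sup>+\<sigma>. ennreal (exp_kernel 0 (b * \<sigma>) (x - q)) * (ennreal (1 / \<sigma>) * indicator {1..} \<sigma>) \<partial>lborel)"
    proof (rule nn_integral_cong)
      fix \<sigma> :: real
      have "ennreal (exp (- (b * (x - q)) * \<sigma>) / \<sigma>) = ennreal (exp (- (b * \<sigma>) * (x - q))) * ennreal (1 / \<sigma>)"
        by (subst ennreal_mult'[symmetric]) (auto simp: algebra_simps)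
      then show "indicator {..<x} q * (ennreal (exp (- (b * (x - q)) * \<sigma>) / \<sigma>) * indicator {1..} \<sigma>)
        = ennreal (exp_kernel 0 (b * \<sigma>) (x - q)) * (ennreal (1 / \<sigma>) * indicator {1..} \<sigma>)"
        by (auto simp: exp_kernel_def mult.assoc split: split_indicator)
    qed
    finally show "indicator {..<x} q * exp_integral (b * (x - q)) = \<dots>" .
  qed
  also have "\<dots> = (\<integral>\<^sup>+\<sigma>. (\<integral>\<^sup>+q. ennreal (exp_kernel 0 (b * \<sigma>) (x - q)) * (ennreal (1 / \<sigma>) * indicator {1..} \<sigma>) \<partial>\<nu>) \<partial>lborel)"
    by (rule P.Fubini'[symmetric]) (unfold exp_kernel_def, measurable)
  also have "\<dots> = (\<integral>\<^sup>+\<sigma>. ennreal (exp_moment \<nu> 0 (b * \<sigma>) x / \<sigma>) * indicator {1..} \<sigma> \<partial>lborel)"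
  proof (rule nn_integral_cong)
    fix \<sigma> :: real
    show "(\<integral>\<^sup>+q. ennreal (exp_kernel 0 (b * \<sigma>) (x - q)) * (ennreal (1 / \<sigma>) * indicator {1..} \<sigma>) \<partial>\<nu>)
      = ennreal (exp_moment \<nu> 0 (b * \<sigma>) x / \<sigma>) * indicator {1..} \<sigma>"
    proof (cases "1 \<le> \<sigma>")
      case True
      have "ennreal (exp_moment \<nu> 0 (b * \<sigma>) x / \<sigma>) = ennreal (exp_moment \<nu> 0 (b * \<sigma>) x) * ennreal (1 / \<sigma>)"
        by (subst ennreal_mult'[symmetric]) (auto simp: exp_moment_nonneg)
      then show ?thesis using True b by (simp add: nn_integral_multc nn_integral_exp_kernel)
    qed simp
  qed
  finally show ?thesis .
qed

lemma gamma_law_exp_moment_0_pos: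
  assumes b: "0 < k" "0 < b" and s: "0 \<le> s" and x: "0 < x"
  shows "0 < exp_moment (gamma_law k b) 0 s x"
proof (rule ccontr)
  interpret nonneg_law "gamma_law k b"
    using nonneg_law_gamma_sum_law[of "[(k, b)]"] gamma_sum_law_single[OF b] b by simp
  assume "\<not> 0 < exp_moment (gamma_law k b) 0 s x"
  then have "(\<integral>q. exp_kernel 0 s (x - q) \<partial>gamma_law k b) = 0"
    using exp_moment_nonneg[of 0 s x] by (simp add: exp_moment_def)
  then have "AE q in gamma_law k b. exp_kernel 0 s (x - q) = 0"
    by (subst (asm) integral_nonneg_eq_0_iff_AE) (use s in \<open>auto simp: exp_kernel_nonneg\<close>)
  then have "AE q in lborel. 0 < gamma_density k b q \<longrightarrow> exp_kernel 0 s (x - q) = 0"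
    unfolding gamma_law_def by (simp add: AE_density)
  then have "AE q in lborel. q \<notin> {0<..<x}"
  proof eventually_elim
    case (elim q)
    have "0 < gamma_density k b q \<and> exp_kernel 0 s (x - q) \<noteq> 0" if "0 < q" "q < x"
      using that b Gamma_real_pos[OF b(1)] by (simp add: gamma_density_def exp_kernel_def del: Gamma_real_pos)
    with elim show ?case by auto
  qed
  then have "emeasure lborel {0<..<x} = 0"
    by (subst (asm) AE_iff_measurable[where N = "{0<..<x}"]) auto
  then show False using x by simp
qed

lemma gamma_law_normalized_exp_moment_antimono:
  assumes b: "0 < b1" "b1 \<le> b2" and x: "0 < x" and \<sigma>: "1 \<le> \<sigma>"
  shows "exp_moment (gamma_law b2 b2) 0 (b2 * \<sigma>) x / exp_moment (gamma_law b2 b2) 0 b2 x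
    \<le> exp_moment (gamma_law b1 b1) 0 (b1 * \<sigma>) x / exp_moment (gamma_law b1 b1) 0 b1 x"
proof -
  define m where "m j b s = exp_moment (gamma_law b b) j s x" for j b s
  define u where "u b \<tau> = m 0 b (b / \<tau>) / m 0 b b" for b \<tau>
  define B where "B b \<tau> = m 1 b (b / \<tau>) / m 0 b b" for b \<tau>
  have law: "nonneg_law (gamma_law b b)" if "0 < b" for b
    using nonneg_law_gamma_sum_law[of "[(b, b)]"] gamma_sum_law_single[of b b] that by simp
  have mpos: "0 < m 0 b b" if "0 < b" for b unfolding m_def using that x by (intro gamma_law_exp_moment_0_pos) auto
  have B0: "0 \<le> B b \<tau>" if "0 < b" for b \<tau>
    using mpos[OF that] nonneg_law.exp_moment_nonneg[OF law[OF that]] by (simp add: B_def m_def)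
  have der: "(u b has_real_derivative b / \<tau>\<^sup>2 * B b \<tau>) (at \<tau>)" if "0 < b" "0 < \<tau>" for b \<tau>
  proof -
    interpret nonneg_law "gamma_law b b" by (rule law[OF that(1)])
    have "((\<lambda>s. m 0 b s) has_real_derivative - m 1 b (b / \<tau>)) (at (b / \<tau>))"
      using exp_moment_has_derivative_s[of "b / \<tau>" 0 x] that by (simp add: m_def)
    moreover have "((\<lambda>\<tau>. b / \<tau>) has_real_derivative - (b / \<tau>\<^sup>2)) (at \<tau>)"
      using that by (auto intro!: derivative_eq_intros simp: power2_eq_square)
    ultimately have "((\<lambda>\<tau>. m 0 b (b / \<tau>)) has_real_derivative - m 1 b (b / \<tau>) * - (b / \<tau>\<^sup>2)) (at \<tau>)"
      by (rule DERIV_chain2)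
    from DERIV_cdivide[OF this, of "m 0 b b"] show ?thesis by (simp add: u_def[abs_def] B_def field_simps)
  qed
  have ode: "B b \<tau> = x * u b \<tau> - (1 - u b \<tau>) * (\<tau> / (1 - \<tau>))" if "0 < b" "0 < \<tau>" "\<tau> < 1" for b \<tau>
  proof -
    have "b < b / \<tau>" using that by (simp add: field_simps)
    then have "x * m 0 b (b / \<tau>) - m 1 b (b / \<tau>) = b * ((m 0 b b - m 0 b (b / \<tau>)) / (b / \<tau> - b))"
      using size_bias_exp_moment_0[of "[(b, b)]" "b / \<tau>" x] gamma_sum_law_single[of b b] that by (simp add: m_def)
    also have "\<dots> = (m 0 b b - m 0 b (b / \<tau>)) * (\<tau> / (1 - \<tau>))" using that by (simp add: field_simps)
    finally have "m 1 b (b / \<tau>) = x * m 0 b (b / \<tau>) - (m 0 b b - m 0 b (b / \<tau>)) * (\<tau> / (1 - \<tau>))" by simp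
    then have "B b \<tau> = (x * m 0 b (b / \<tau>) - (m 0 b b - m 0 b (b / \<tau>)) * (\<tau> / (1 - \<tau>))) / m 0 b b" by (simp add: B_def)
    also have "\<dots> = x * u b \<tau> - (m 0 b b - m 0 b (b / \<tau>)) / m 0 b b * (\<tau> / (1 - \<tau>))"
    proof -
      have "(x * A - D * T) / M = x * (A / M) - D / M * T" for A D T M :: real by (simp add: diff_divide_distrib)
      then show ?thesis by (simp only: u_def)
    qed
    also have "(m 0 b b - m 0 b (b / \<tau>)) / m 0 b b = 1 - u b \<tau>"
      using mpos[OF that(1)] by (simp add: u_def diff_divide_distrib)
    finally show ?thesis .
  qed
  define w where "w \<tau> = u b1 \<tau> - u b2 \<tau>" for \<tau>
  have wder: "(w has_real_derivative (b1 * B b1 \<tau> - b2 * B b2 \<tau>) / \<tau>\<^sup>2) (at \<tau>)" if "0 < \<tau>" for \<tau>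
    unfolding w_def using der[OF _ that] b by (auto intro!: derivative_eq_intros simp: diff_divide_distrib)
  have wneg: "b1 * B b1 \<tau> - b2 * B b2 \<tau> < 0" if "0 < \<tau>" "\<tau> < 1" "w \<tau> < 0" for \<tau>
  proof -
    have "b1 * B b2 \<tau> \<le> b2 * B b2 \<tau>" using b B0[of b2] by (intro mult_right_mono) auto
    then have "b1 * B b1 \<tau> - b2 * B b2 \<tau> \<le> b1 * (B b1 \<tau> - B b2 \<tau>)" by (simp add: right_diff_distrib)
    also have "B b1 \<tau> - B b2 \<tau> = (x + \<tau> / (1 - \<tau>)) * w \<tau>"
    proof -
      have "x * U - (1 - U) * T - (x * V - (1 - V) * T) = (x + T) * (U - V)" for U V T :: real by (simp add: algebra_simps)
      then show ?thesis using ode[of b1 \<tau>] ode[of b2 \<tau>] that b by (simp only: w_def)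
    qed
    also have "b1 * ((x + \<tau> / (1 - \<tau>)) * w \<tau>) < 0" using that b x by (intro mult_pos_neg add_pos_pos) auto
    finally show ?thesis .
  qed
  define \<tau> where "\<tau> = 1 / \<sigma>"
  have \<tau>: "0 < \<tau>" "\<tau> \<le> 1" using \<sigma> by (auto simp: \<tau>_def)
  have w1: "w 1 = 0" using mpos[of b1] mpos[of b2] b by (simp add: w_def u_def)
  have cont: "continuous_on {\<tau>..1} w"
    using \<tau> by (intro continuous_at_imp_continuous_on ballI DERIV_isCont[OF wder]) auto
  obtain t where t: "t \<in> {\<tau>..1}" "\<And>s. s \<in> {\<tau>..1} \<Longrightarrow> w t \<le> w s"
    using continuous_attains_inf[OF _ _ cont] \<tau> by auto
  have "0 \<le> w t"
  proof (rule ccontr)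
    assume n: "\<not> 0 \<le> w t"
    then have t1: "t < 1" using t(1) w1 by (cases "t = 1") auto
    have "(b1 * B b1 t - b2 * B b2 t) / t\<^sup>2 < 0" using wneg[of t] n t1 t(1) \<tau> by (simp add: divide_neg_pos)
    from DERIV_neg_dec_right[OF wder this] obtain d where d: "0 < d" "\<And>h. 0 < h \<Longrightarrow> h < d \<Longrightarrow> w (t + h) < w t"
      using t(1) \<tau> by auto
    define h where "h = min (d / 2) (1 - t)"
    have "0 < h" "h < d" "t + h \<le> 1" using d t1 by (auto simp: h_def)
    then show False using d(2)[of h] t(2)[of "t + h"] t(1) by auto
  qed
  then have "0 \<le> w \<tau>" using t(2)[of \<tau>] \<tau> by auto
  then show ?thesis using \<sigma> by (simp add: w_def u_def \<tau>_def m_def)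
qed

lemma gamma_law_tail_quasi_concave:
  assumes b: "0 < b1" "b1 \<le> b" "b \<le> b2" and x: "0 < x"
  shows "min (measure (gamma_law b1 b1) {x<..}) (measure (gamma_law b2 b2) {x<..}) \<le> measure (gamma_law b b) {x<..}"
proof -
  define m where "m b s = exp_moment (gamma_law b b) 0 s x" for b s
  define J where "J b = (\<integral>\<^sup>+\<sigma>. ennreal (m b (b * \<sigma>) / m b b / \<sigma>) * indicator {1..} \<sigma> \<partial>lborel)" for b
  have law: "nonneg_law (gamma_law b b)" if "0 < b" for b
    using nonneg_law_gamma_sum_law[of "[(b, b)]"] gamma_sum_law_single[of b b] that by simp
  have mpos: "0 < m b b" if "0 < b" for b unfolding m_def using that x by (intro gamma_law_exp_moment_0_pos) auto
  have J: "J c \<le> J b" if "0 < b" "b \<le> c" for b c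
    unfolding J_def
  proof (intro nn_integral_mono)
    fix \<sigma> :: real
    show "ennreal (m c (c * \<sigma>) / m c c / \<sigma>) * indicator {1..} \<sigma> \<le> ennreal (m b (b * \<sigma>) / m b b / \<sigma>) * indicator {1..} \<sigma>"
      using divide_right_mono[OF gamma_law_normalized_exp_moment_antimono[OF that x, of \<sigma>], of \<sigma>]
      by (auto simp: m_def split: split_indicator intro!: ennreal_leI)
  qed
  have eq: "(\<integral>\<^sup>+q. indicator {..<x} q * exp_integral (b * (x - q)) \<partial>gamma_law b b) = ennreal (m b b) * J b" if "0 < b" for b
  proof -
    interpret nonneg_law "gamma_law b b" by (rule law[OF that])
    have [measurable]: "(\<lambda>\<sigma>. m b (b * \<sigma>)) \<in> borel_measurable borel"
      unfolding m_def exp_moment_def exp_kernel_def by measurable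
    have "ennreal (m b (b * \<sigma>) / \<sigma>) * indicator {1..} \<sigma> = ennreal (m b b) * (ennreal (m b (b * \<sigma>) / m b b / \<sigma>) * indicator {1..} \<sigma>)" for \<sigma>
      using mpos[OF that] by (subst mult.assoc[symmetric], subst ennreal_mult'[symmetric]) auto
    then have "(\<integral>\<^sup>+q. indicator {..<x} q * exp_integral (b * (x - q)) \<partial>gamma_law b b)
      = (\<integral>\<^sup>+\<sigma>. ennreal (m b b) * (ennreal (m b (b * \<sigma>) / m b b / \<sigma>) * indicator {1..} \<sigma>) \<partial>lborel)"
      using that by (subst nn_integral_exp_integral) (auto simp: m_def)
    also have "\<dots> = ennreal (m b b) * J b" unfolding J_def by (rule nn_integral_cmult) measurable
    finally show ?thesis .
  qed
  interpret delta: nonneg_law "return borel (0::real)"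
    using nonneg_law_gamma_sum_law[of "[]"] by simp
  have law1: "(gamma_law (1 * c) c \<star> return borel 0) = gamma_law c c" if "0 < c" for c
    using that by (subst convolution_return_0) (auto intro: prob_space.finite_measure[OF prob_space_gamma_law])
  show ?thesis
  proof (cases "J b \<le> 1")
    case True
    have "measure (gamma_law (1 * b2) b2 \<star> return borel 0) {x<..} \<le> measure (gamma_law (1 * b) b \<star> return borel 0) {x<..}"
    proof (rule delta.gamma_convolution_tail_antimono)
      fix s assume s: "b \<le> s" "s < b2"
      then have s0: "0 < s" using b by linarith
      have "J s \<le> 1" using J[of b s] True s b by (auto intro: order_trans)
      then have "ennreal (m s s) * J s \<le> ennreal (m s s) * 1" by (rule mult_left_mono) simp
      then show "(\<integral>\<^sup>+q. indicator {..<x} q * exp_integral (s * (x - q)) \<partial>(gamma_law (1 * s) s \<star> return borel 0))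
        \<le> ennreal (exp_moment (gamma_law (1 * s) s \<star> return borel 0) 0 s x)"
        unfolding law1[OF s0] eq[OF s0] by (simp add: m_def)
    qed (use b in auto)
    then show ?thesis using b law1[of b] law1[of b1] law1[of b2] by simp
  next
    case False
    have "measure (gamma_law (1 * b1) b1 \<star> return borel 0) {x<..} \<le> measure (gamma_law (1 * b) b \<star> return borel 0) {x<..}"
    proof (rule delta.gamma_convolution_tail_mono)
      fix s assume s: "b1 \<le> s" "s < b"
      then have s0: "0 < s" using b by linarith
      have "1 \<le> J s" using J[of s b] False s s0 by (auto intro: order_trans)
      then have "ennreal (m s s) * 1 \<le> ennreal (m s s) * J s" by (rule mult_left_mono) simp
      then show "ennreal (exp_moment (gamma_law (1 * s) s \<star> return borel 0) 0 s x)
        \<le> (\<integral>\<^sup>+q. indicator {..<x} q * exp_integral (s * (x - q)) \<partial>(gamma_law (1 * s) s \<star> return borel 0))"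
        unfolding law1[OF s0] eq[OF s0] by (simp add: m_def)
    qed (use b in auto)
    then show ?thesis using b law1[of b] law1[of b1] law1[of b2] by simp
  qed
qed

lemma nn_integral_continuous_interval:
  fixes h :: "real \<Rightarrow> real"
  assumes "continuous_on {a..b} h" "\<And>x. x \<in> {a..b} \<Longrightarrow> 0 \<le> h x"
  shows "(\<integral>\<^sup>+x. ennreal (h x) * indicator {a..b} x \<partial>lborel) = ennreal (integral {a..b} h)"
  using assms by (intro nn_integral_has_integral_lebesgue' integrable_integral integrable_continuous_interval)

definition mixed_rate :: "real \<Rightarrow> real \<Rightarrow> real \<Rightarrow> real" where
  "mixed_rate b1 b2 \<phi> = (b1 + b2) / 2 + (b1 - b2) / 2 * cos \<phi>"

lemma mixed_rate_pos: "0 < b1 \<Longrightarrow> 0 < b2 \<Longrightarrow> 0 < mixed_rate b1 b2 \<phi>"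
proof -
  assume b: "0 < b1" "0 < b2"
  have "mixed_rate b1 b2 \<phi> = b1 * ((1 + cos \<phi>) / 2) + b2 * ((1 - cos \<phi>) / 2)" by (simp add: mixed_rate_def field_simps)
  moreover have "0 \<le> 1 + cos \<phi>" "0 \<le> 1 - cos \<phi>" using cos_ge_minus_one[of \<phi>] cos_le_one[of \<phi>] by linarith+
  moreover have "0 < 1 + cos \<phi> \<or> 0 < 1 - cos \<phi>" by linarith
  ultimately show ?thesis using b by (auto intro: add_pos_nonneg add_nonneg_pos)
qed

lemma continuous_on_mixed_rate [continuous_intros]: "continuous_on A (mixed_rate b1 b2)"
  unfolding mixed_rate_def by (intro continuous_intros)

lemma mixed_rate_measurable [measurable]: "mixed_rate b1 b2 \<in> borel_measurable borel"
  by (intro borel_measurable_continuous_onI continuous_intros)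

definition two_gamma_density :: "real \<Rightarrow> real \<Rightarrow> real \<Rightarrow> real" where
  "two_gamma_density b1 b2 y = (if 0 < y then sqrt (b1 * b2) / pi * integral {0..pi} (\<lambda>\<phi>. exp (- mixed_rate b1 b2 \<phi> * y)) else 0)"

lemma gamma_density_half:
  assumes "0 < w" "0 < b" shows "gamma_density (1/2) b w = sqrt b / sqrt pi * exp (- b * w) / sqrt w"
  using assms powr_minus_divide[of w "1/2"] by (simp add: gamma_density_def powr_half_sqrt Gamma_one_half_real)

lemma gamma_density_half_convolution:
  assumes b: "0 < b1" "0 < b2" and y: "0 < y"
  shows "(\<integral>\<^sup>+w. ennreal (gamma_density (1/2) b1 (y - w)) * ennreal (gamma_density (1/2) b2 w) \<partial>lborel)
    = ennreal (two_gamma_density b1 b2 y)"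
proof -
  define g where "g \<phi> = y * ((1 - cos \<phi>) / 2)" for \<phi>
  have g: "g 0 = 0" "g pi = y" by (auto simp: g_def)
  have "(\<integral>\<^sup>+w. ennreal (gamma_density (1/2) b1 (y - w)) * ennreal (gamma_density (1/2) b2 w) \<partial>lborel)
    = (\<integral>\<^sup>+w. ennreal (gamma_density (1/2) b1 (y - w)) * ennreal (gamma_density (1/2) b2 w) * indicator {g 0..g pi} w \<partial>lborel)"
    unfolding g
  proof (rule nn_integral_cong)
    fix w
    show "ennreal (gamma_density (1/2) b1 (y - w)) * ennreal (gamma_density (1/2) b2 w)
      = ennreal (gamma_density (1/2) b1 (y - w)) * ennreal (gamma_density (1/2) b2 w) * indicator {0..y} w"
      by (cases "0 \<le> w \<and> w \<le> y") (auto simp: gamma_density_def)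
  qed
  also have "\<dots> = (\<integral>\<^sup>+\<phi>. ennreal (gamma_density (1/2) b1 (y - g \<phi>)) * ennreal (gamma_density (1/2) b2 (g \<phi>)) * ennreal (y * (sin \<phi> / 2)) * indicator {0..pi} \<phi> \<partial>lborel)"
  proof (rule nn_integral_substitution_aux)
    show "(g has_real_derivative y * (sin \<phi> / 2)) (at \<phi>)" for \<phi>
      unfolding g_def by (auto intro!: derivative_eq_intros)
    show "0 \<le> y * (sin \<phi> / 2)" if "\<phi> \<in> {0..pi}" for \<phi> using that y sin_ge_zero[of \<phi>] by auto
    show "continuous_on {0..pi} (\<lambda>\<phi>. y * (sin \<phi> / 2))" by (auto intro!: continuous_intros)
  qed auto
  also have "\<dots> = (\<integral>\<^sup>+\<phi>. ennreal (sqrt (b1 * b2) / pi * exp (- mixed_rate b1 b2 \<phi> * y)) * indicator {0..pi} \<phi> \<partial>lborel)"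
  proof (rule nn_integral_cong_AE, rule AE_mp[OF AE_lborel_singleton[of 0]], rule AE_mp[OF AE_lborel_singleton[of pi]], intro AE_I2 impI)
    fix \<phi> :: real assume \<phi>: "\<phi> \<noteq> 0" "\<phi> \<noteq> pi"
    show "ennreal (gamma_density (1/2) b1 (y - g \<phi>)) * ennreal (gamma_density (1/2) b2 (g \<phi>)) * ennreal (y * (sin \<phi> / 2)) * indicator {0..pi} \<phi>
      = ennreal (sqrt (b1 * b2) / pi * exp (- mixed_rate b1 b2 \<phi> * y)) * indicator {0..pi} \<phi>"
    proof (cases "\<phi> \<in> {0..pi}")
      case True
      then have s: "0 < sin \<phi>" using \<phi> by (intro sin_gt_zero) auto
      have sq: "(1 + cos \<phi>) * (1 - cos \<phi>) = (sin \<phi>)\<^sup>2" by (simp add: sin_squared_eq power2_eq_square algebra_simps)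
      have "0 < (1 + cos \<phi>) * (1 - cos \<phi>)" unfolding sq using s by simp
      then have c: "0 < 1 + cos \<phi>" "0 < 1 - cos \<phi>"
        using cos_ge_minus_one[of \<phi>] cos_le_one[of \<phi>] by (auto simp: zero_less_mult_iff)
      have yg: "y - g \<phi> = y * ((1 + cos \<phi>) / 2)" by (simp add: g_def field_simps)
      have pos: "0 < g \<phi>" "0 < y - g \<phi>" unfolding yg using c y by (auto simp: g_def)
      have "sqrt (y - g \<phi>) * sqrt (g \<phi>) = sqrt ((y * (sin \<phi> / 2))\<^sup>2)"
      proof -
        have P: "y * ((1 + C) / 2) * (y * ((1 - C) / 2)) = y * y / 4 * ((1 + C) * (1 - C))" for C :: real by (simp add: field_simps)
        then show ?thesis unfolding real_sqrt_mult[symmetric] yg unfolding g_def P sq by (simp add: power2_eq_square)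
      qed
      then have r: "sqrt (y - g \<phi>) * sqrt (g \<phi>) = y * (sin \<phi> / 2)" using s y by simp
      have e: "exp (- b1 * (y - g \<phi>)) * exp (- b2 * g \<phi>) = exp (- mixed_rate b1 b2 \<phi> * y)"
        unfolding yg by (simp add: mult_exp_exp g_def mixed_rate_def field_simps)
      have "gamma_density (1/2) b1 (y - g \<phi>) * gamma_density (1/2) b2 (g \<phi>)
        = (sqrt b1 * sqrt b2) / (sqrt pi * sqrt pi) * (exp (- b1 * (y - g \<phi>)) * exp (- b2 * g \<phi>)) / (sqrt (y - g \<phi>) * sqrt (g \<phi>))"
        unfolding gamma_density_half[OF pos(1) b(2)] gamma_density_half[OF pos(2) b(1)] by (simp add: ac_simps)
      also have "\<dots> = sqrt (b1 * b2) / pi * exp (- mixed_rate b1 b2 \<phi> * y) / (y * (sin \<phi> / 2))"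
        unfolding r e by (simp add: real_sqrt_mult)
      finally have "gamma_density (1/2) b1 (y - g \<phi>) * gamma_density (1/2) b2 (g \<phi>) * (y * (sin \<phi> / 2))
        = sqrt (b1 * b2) / pi * exp (- mixed_rate b1 b2 \<phi> * y)" using s y by simp
      moreover have "0 \<le> gamma_density (1/2) b1 (y - g \<phi>)" "0 \<le> gamma_density (1/2) b2 (g \<phi>)" by (simp_all add: gamma_density_nonneg)
      ultimately show ?thesis by (metis ennreal_mult' mult_nonneg_nonneg)
    qed simp
  qed
  also have "\<dots> = ennreal (integral {0..pi} (\<lambda>\<phi>. sqrt (b1 * b2) / pi * exp (- mixed_rate b1 b2 \<phi> * y)))"
    by (rule nn_integral_continuous_interval) (use b in \<open>auto intro!: continuous_intros\<close>)
  finally show ?thesis using y by (simp add: two_gamma_density_def)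
qed

lemma gamma_law_half_convolution:
  assumes b: "0 < b1" "0 < b2"
  shows "(gamma_law (1/2) b1 \<star> gamma_law (1/2) b2) = density lborel (\<lambda>y. ennreal (two_gamma_density b1 b2 y))"
    and "two_gamma_density b1 b2 \<in> borel_measurable borel"
proof -
  have eq: "(\<integral>\<^sup>+w. ennreal (gamma_density (1/2) b1 (y - w)) * ennreal (gamma_density (1/2) b2 w) \<partial>lborel)
    = ennreal (two_gamma_density b1 b2 y)" if "y \<noteq> 0" for y
  proof (cases "0 < y")
    case False
    then have "(\<integral>\<^sup>+w. ennreal (gamma_density (1/2) b1 (y - w)) * ennreal (gamma_density (1/2) b2 w) \<partial>lborel) = integral\<^sup>N lborel (\<lambda>w::real. 0)"
      by (intro nn_integral_cong) (auto simp: gamma_density_def)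
    then show ?thesis using False by (simp add: two_gamma_density_def)
  qed (rule gamma_density_half_convolution[OF b])
  have nn: "0 \<le> two_gamma_density b1 b2 y" for y
    unfolding two_gamma_density_def using b
    by (auto intro!: divide_nonneg_nonneg mult_nonneg_nonneg Henstock_Kurzweil_Integration.integral_nonneg integrable_continuous_interval continuous_intros)
  show m: "two_gamma_density b1 b2 \<in> borel_measurable borel"
  proof (rule measurable_cong[THEN iffD2])
    show "(\<lambda>y. if y = 0 then 0 else enn2real (\<integral>\<^sup>+w. ennreal (gamma_density (1/2) b1 (y - w)) * ennreal (gamma_density (1/2) b2 w) \<partial>lborel)) \<in> borel_measurable borel"
      by measurable
    show "two_gamma_density b1 b2 y = (if y = 0 then 0 else enn2real (\<integral>\<^sup>+w. ennreal (gamma_density (1/2) b1 (y - w)) * ennreal (gamma_density (1/2) b2 w) \<partial>lborel))" for y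
      using eq[of y] nn[of y] by (simp add: two_gamma_density_def)
  qed
  have fin: "finite_measure (gamma_law (1/2) b1)" "finite_measure (gamma_law (1/2) b2)"
    using b by (auto intro!: prob_space.finite_measure prob_space_gamma_law)
  have "(gamma_law (1/2) b1 \<star> gamma_law (1/2) b2)
    = density lborel (\<lambda>y. \<integral>\<^sup>+w. ennreal (gamma_density (1/2) b1 (y - w)) * ennreal (gamma_density (1/2) b2 w) \<partial>lborel)"
    using fin unfolding gamma_law_def by (intro convolution_density) auto
  also have "\<dots> = density lborel (\<lambda>y. ennreal (two_gamma_density b1 b2 y))"
  proof (rule density_cong)
    show "AE y in lborel. (\<integral>\<^sup>+w. ennreal (gamma_density (1/2) b1 (y - w)) * ennreal (gamma_density (1/2) b2 w) \<partial>lborel) = ennreal (two_gamma_density b1 b2 y)"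
      using AE_lborel_singleton[of 0] by eventually_elim (rule eq)
  qed (use m in measurable)
  finally show "(gamma_law (1/2) b1 \<star> gamma_law (1/2) b2) = density lborel (\<lambda>y. ennreal (two_gamma_density b1 b2 y))" .
qed

lemma measure_gamma_law_half_convolution:
  assumes b: "0 < b1" "0 < b2" and x: "0 \<le> x"
  shows "measure (gamma_law (1/2) b1 \<star> gamma_law (1/2) b2) {x<..}
    = sqrt (b1 * b2) / pi * integral {0..pi} (\<lambda>\<phi>. exp (- mixed_rate b1 b2 \<phi> * x) / mixed_rate b1 b2 \<phi>)"
proof -
  note [measurable] = gamma_law_half_convolution(2)[OF b]
  define C where "C = sqrt (b1 * b2) / pi"
  have C: "0 \<le> C" using b by (simp add: C_def)
  let ?r = "mixed_rate b1 b2"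
  have r: "0 < ?r \<phi>" for \<phi> by (rule mixed_rate_pos[OF b])
  have tail: "(\<integral>\<^sup>+y. ennreal (C * exp (- ?r \<phi> * y)) * indicator {x<..} y \<partial>lborel) = ennreal (C * (exp (- ?r \<phi> * x) / ?r \<phi>))" for \<phi>
  proof -
    have "(\<integral>\<^sup>+y. ennreal (C * exp (- ?r \<phi> * y)) * indicator {x<..} y \<partial>lborel) = (\<integral>\<^sup>+y. ennreal (C * exp (- ?r \<phi> * y)) * indicator {x..} y \<partial>lborel)"
      by (rule nn_integral_cong_AE, rule AE_mp[OF AE_lborel_singleton[of x]]) (auto split: split_indicator)
    also have "\<dots> = ennreal (0 - (- C * (exp (- ?r \<phi> * x) / ?r \<phi>)))"
    proof (rule nn_integral_FTC_atLeast)
      show "DERIV (\<lambda>y. - C * (exp (- ?r \<phi> * y) / ?r \<phi>)) y :> C * exp (- ?r \<phi> * y)" for y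
        using r[of \<phi>] by (auto intro!: derivative_eq_intros)
      have "filterlim (\<lambda>y. - ?r \<phi> * y) at_bot at_top"
        using r[of \<phi>] by (intro filterlim_tendsto_neg_mult_at_bot[OF tendsto_const]) (auto intro: filterlim_ident)
      then have "((\<lambda>y. exp (- ?r \<phi> * y)) \<longlongrightarrow> 0) at_top" by (rule filterlim_compose[OF exp_at_bot])
      then have "((\<lambda>y. - C * (exp (- ?r \<phi> * y) / ?r \<phi>)) \<longlongrightarrow> - C * (0 / ?r \<phi>)) at_top" using r[of \<phi>] by (intro tendsto_intros) auto
      then show "((\<lambda>y. - C * (exp (- ?r \<phi> * y) / ?r \<phi>)) \<longlongrightarrow> 0) at_top" by simp
    qed (use C in auto)
    finally show ?thesis by simp
  qed
  have "emeasure (gamma_law (1/2) b1 \<star> gamma_law (1/2) b2) {x<..}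
    = (\<integral>\<^sup>+y. ennreal (two_gamma_density b1 b2 y) * indicator {x<..} y \<partial>lborel)"
    unfolding gamma_law_half_convolution(1)[OF b] by (rule emeasure_density) measurable
  also have "\<dots> = (\<integral>\<^sup>+y. (\<integral>\<^sup>+\<phi>. ennreal (C * exp (- ?r \<phi> * y)) * indicator {0..pi} \<phi> * indicator {x<..} y \<partial>lborel) \<partial>lborel)"
  proof (rule nn_integral_cong)
    fix y
    show "ennreal (two_gamma_density b1 b2 y) * indicator {x<..} y = (\<integral>\<^sup>+\<phi>. ennreal (C * exp (- ?r \<phi> * y)) * indicator {0..pi} \<phi> * indicator {x<..} y \<partial>lborel)"
    proof (cases "x < y")
      case True
      have "(\<integral>\<^sup>+\<phi>. ennreal (C * exp (- ?r \<phi> * y)) * indicator {0..pi} \<phi> \<partial>lborel) = ennreal (integral {0..pi} (\<lambda>\<phi>. C * exp (- ?r \<phi> * y)))"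
        by (rule nn_integral_continuous_interval) (use C in \<open>auto intro!: continuous_intros\<close>)
      then show ?thesis using True x by (simp add: two_gamma_density_def C_def)
    qed simp
  qed
  also have "\<dots> = (\<integral>\<^sup>+\<phi>. (\<integral>\<^sup>+y. ennreal (C * exp (- ?r \<phi> * y)) * indicator {0..pi} \<phi> * indicator {x<..} y \<partial>lborel) \<partial>lborel)"
    by (rule lborel_pair.Fubini'[symmetric]) measurable
  also have "\<dots> = (\<integral>\<^sup>+\<phi>. (\<integral>\<^sup>+y. ennreal (C * exp (- ?r \<phi> * y)) * indicator {x<..} y \<partial>lborel) * indicator {0..pi} \<phi> \<partial>lborel)"
    by (subst nn_integral_multc[symmetric]) (auto intro!: nn_integral_cong simp: ac_simps)
  also have "\<dots> = ennreal (integral {0..pi} (\<lambda>\<phi>. C * (exp (- ?r \<phi> * x) / ?r \<phi>)))"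
    unfolding tail
    by (rule nn_integral_continuous_interval) (use C r in \<open>auto intro!: continuous_intros mult_nonneg_nonneg divide_nonneg_pos simp: less_imp_neq[OF r, symmetric] simp del: times_divide_eq_right\<close>)
  also have "\<dots> = ennreal (C * integral {0..pi} (\<lambda>\<phi>. exp (- ?r \<phi> * x) / ?r \<phi>))"
    by (simp only: Henstock_Kurzweil_Integration.integral_mult_right)
  finally show ?thesis unfolding measure_def C_def[symmetric] using C r
    by (subst enn2real_ennreal[symmetric]) (auto intro!: mult_nonneg_nonneg Henstock_Kurzweil_Integration.integral_nonneg integrable_continuous_interval continuous_intros less_imp_le[OF r] divide_nonneg_pos simp: less_imp_neq[OF r, symmetric])
qed

text \<open>RATIO\<close>

lemma tail_le_of_antimono_density_ratio:
  fixes f h :: "real \<Rightarrow> real"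
  assumes [measurable]: "f \<in> borel_measurable borel" "h \<in> borel_measurable borel"
    and fin: "finite_measure (density lborel f)" "finite_measure (density lborel h)"
    and nn: "\<And>y. c < y \<Longrightarrow> 0 \<le> f y" and h: "\<And>y. c < y \<Longrightarrow> 0 < h y"
    and ratio: "\<And>y z. c < y \<Longrightarrow> y \<le> z \<Longrightarrow> f z / h z \<le> f y / h y"
    and c: "measure (density lborel f) {c<..} \<le> measure (density lborel h) {c<..}" and x: "c \<le> x"
  shows "measure (density lborel f) {x<..} \<le> measure (density lborel h) {x<..}"
proof (cases "x = c")
  case False
  then have cx: "c < x" using x by simp
  interpret F: finite_measure "density lborel f" by (rule fin)
  interpret H: finite_measure "density lborel h" by (rule fin)
  have comp: "measure (density lborel u) A \<le> measure (density lborel v) A"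
    if [measurable]: "A \<in> sets borel" "u \<in> borel_measurable borel" "v \<in> borel_measurable borel"
      and uv: "\<And>y. y \<in> A \<Longrightarrow> u y \<le> v y" and fin: "finite_measure (density lborel v)" for A and u v :: "real \<Rightarrow> real"
    unfolding measure_def
  proof (rule enn2real_mono)
    show "emeasure (density lborel u) A \<le> emeasure (density lborel v) A"
      by (auto simp: emeasure_density intro!: nn_integral_mono ennreal_leI uv split: split_indicator)
    show "emeasure (density lborel v) A < top" using finite_measure.emeasure_finite[OF fin, of A] by (simp add: top.not_eq_extremum)
  qed
  show ?thesis
  proof (cases "f x \<le> h x")
    case True
    show ?thesis
    proof (rule comp)
      fix y assume "y \<in> {x<..}"
      then have y: "c < y" "x \<le> y" using cx by auto
      have "f y / h y \<le> f x / h x" by (rule ratio) (use cx y in auto)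
      also have "\<dots> \<le> 1" using True h[OF cx] by simp
      finally show "f y \<le> h y" using h[OF y(1)] by simp
    qed (use fin in auto)
  next
    case False
    have "measure (density lborel h) {c<..x} \<le> measure (density lborel f) {c<..x}"
    proof (rule comp)
      fix y assume "y \<in> {c<..x}"
      then have y: "c < y" "y \<le> x" by auto
      have "1 \<le> f x / h x" using False h[OF cx] by simp
      also have "\<dots> \<le> f y / h y" by (rule ratio) (use y in auto)
      finally show "h y \<le> f y" using h[OF y(1)] by simp
    qed (use fin in auto)
    moreover have "{x<..} = {c<..} - {c<..x}" using cx by auto
    ultimately show ?thesis using c F.finite_measure_Diff[of "{c<..}" "{c<..x}"] H.finite_measure_Diff[of "{c<..}" "{c<..x}"]
      by (auto simp: greaterThanAtMost_def)
  qed
qed (use c in simp)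

definition cos_moment :: "nat \<Rightarrow> real \<Rightarrow> real" where
  "cos_moment j z = integral {0..pi} (\<lambda>\<phi>. cos \<phi> ^ j * exp (z * cos \<phi>))"

lemma cos_moment_integrable [simp]: "(\<lambda>\<phi>. cos \<phi> ^ j * exp (z * cos \<phi>)) integrable_on {0..pi}"
  by (intro integrable_continuous_interval continuous_intros)

lemma cos_moment_has_derivative: "(cos_moment j has_real_derivative cos_moment (Suc j) z) (at z)"
proof -
  have "((\<lambda>z. integral (cbox 0 pi) (\<lambda>\<phi>. cos \<phi> ^ j * exp (z * cos \<phi>))) has_field_derivative
      integral (cbox 0 pi) (\<lambda>\<phi>. cos \<phi> ^ Suc j * exp (z * cos \<phi>))) (at z within UNIV)"
  proof (rule leibniz_rule_field_derivative)
    show "((\<lambda>z. cos \<phi> ^ j * exp (z * cos \<phi>)) has_field_derivative cos \<phi> ^ Suc j * exp (z * cos \<phi>)) (at z within UNIV)" for z \<phi> :: real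
      by (auto intro!: derivative_eq_intros)
    show "continuous_on (UNIV \<times> cbox 0 pi) (\<lambda>(z, \<phi>). cos \<phi> ^ Suc j * exp (z * cos \<phi>))"
      unfolding split_beta by (intro continuous_intros)
  qed auto
  then show ?thesis by (simp add: cos_moment_def[abs_def])
qed

lemma cos_moment_0_pos: "0 < cos_moment 0 z"
proof -
  have "integral {0..pi} (\<lambda>\<phi>. exp (- \<bar>z\<bar>)) \<le> cos_moment 0 z"
    unfolding cos_moment_def
  proof (rule integral_le)
    show "(\<lambda>\<phi>. cos \<phi> ^ 0 * exp (z * cos \<phi>)) integrable_on {0..pi}" by (rule cos_moment_integrable)
    fix \<phi> :: real
    have "\<bar>z * cos \<phi>\<bar> \<le> \<bar>z\<bar> * 1" unfolding abs_mult by (intro mult_left_mono) auto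
    then show "exp (- \<bar>z\<bar>) \<le> cos \<phi> ^ 0 * exp (z * cos \<phi>)" by simp
  qed auto
  then show ?thesis by (simp add: less_le_trans[rotated])
qed

lemma cos_moment_bessel: "cos_moment 1 z = z * (cos_moment 0 z - cos_moment 2 z)"
proof -
  have a: "((\<lambda>\<phi>. cos \<phi> * exp (z * cos \<phi>) - z * (sin \<phi>)\<^sup>2 * exp (z * cos \<phi>)) has_integral
      sin pi * exp (z * cos pi) - sin 0 * exp (z * cos 0)) {0..pi}"
    by (rule fundamental_theorem_of_calculus)
       (auto intro!: derivative_eq_intros simp: has_real_derivative_iff_has_vector_derivative[symmetric] power2_eq_square algebra_simps)
  have b: "cos \<phi> * exp (z * cos \<phi>) - z * (sin \<phi>)\<^sup>2 * exp (z * cos \<phi>)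
      = cos \<phi> ^ 1 * exp (z * cos \<phi>) - z * (cos \<phi> ^ 0 * exp (z * cos \<phi>) - cos \<phi> ^ 2 * exp (z * cos \<phi>))" for \<phi>
    by (simp add: sin_squared_eq algebra_simps)
  have c: "((\<lambda>\<phi>. cos \<phi> ^ 1 * exp (z * cos \<phi>) - z * (cos \<phi> ^ 0 * exp (z * cos \<phi>) - cos \<phi> ^ 2 * exp (z * cos \<phi>))) has_integral
      cos_moment 1 z - z * (cos_moment 0 z - cos_moment 2 z)) {0..pi}"
    unfolding cos_moment_def by (intro has_integral_diff has_integral_mult_right integrable_integral cos_moment_integrable)
  show ?thesis using has_integral_unique[OF c a[unfolded b]] by simp
qed

lemma cos_moment_0_0: "cos_moment 0 0 = pi" by (simp add: cos_moment_def)

lemma cos_moment_2_0: "cos_moment 2 0 = pi / 2"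
proof -
  have "((\<lambda>\<phi>. (cos \<phi>)\<^sup>2) has_integral ((pi + sin pi * cos pi) / 2 - (0 + sin 0 * cos 0) / 2)) {0..pi}"
    by (rule fundamental_theorem_of_calculus)
       (auto intro!: derivative_eq_intros simp: has_real_derivative_iff_has_vector_derivative[symmetric] power2_eq_square[symmetric] sin_squared_eq)
  then show ?thesis by (simp add: cos_moment_def integral_unique)
qed

lemma cos_moment_cauchy_schwarz: "(cos_moment 1 z)\<^sup>2 \<le> cos_moment 0 z * cos_moment 2 z"
proof -
  let ?m = "\<lambda>j. cos_moment j z"
  have a: "((\<lambda>\<phi>. (?m 0)\<^sup>2 * (cos \<phi> ^ 2 * exp (z * cos \<phi>)) - 2 * ?m 0 * ?m 1 * (cos \<phi> ^ 1 * exp (z * cos \<phi>)) + (?m 1)\<^sup>2 * (cos \<phi> ^ 0 * exp (z * cos \<phi>)))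
    has_integral (?m 0)\<^sup>2 * ?m 2 - 2 * ?m 0 * ?m 1 * ?m 1 + (?m 1)\<^sup>2 * ?m 0) {0..pi}"
    unfolding cos_moment_def
    by (intro has_integral_add has_integral_diff has_integral_mult_right integrable_integral cos_moment_integrable)
  have b: "(?m 0)\<^sup>2 * (cos \<phi> ^ 2 * exp (z * cos \<phi>)) - 2 * ?m 0 * ?m 1 * (cos \<phi> ^ 1 * exp (z * cos \<phi>)) + (?m 1)\<^sup>2 * (cos \<phi> ^ 0 * exp (z * cos \<phi>))
    = (?m 0 * cos \<phi> - ?m 1)\<^sup>2 * exp (z * cos \<phi>)" for \<phi> by (simp add: power2_eq_square algebra_simps)
  have "0 \<le> (?m 0)\<^sup>2 * ?m 2 - 2 * ?m 0 * ?m 1 * ?m 1 + (?m 1)\<^sup>2 * ?m 0"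
    using a unfolding b by (rule has_integral_nonneg) auto
  also have "\<dots> = ?m 0 * (?m 0 * ?m 2 - (?m 1)\<^sup>2)" by (simp add: power2_eq_square algebra_simps)
  finally show ?thesis using cos_moment_0_pos[of z] by (simp add: zero_le_mult_iff)
qed

definition cos_moment_excess :: "real \<Rightarrow> real \<Rightarrow> real" where
  "cos_moment_excess x t = cos_moment 1 (x * t / (1 - t\<^sup>2)) - t * cos_moment 0 (x * t / (1 - t\<^sup>2))"

lemma square_less_1: "\<bar>t::real\<bar> < 1 \<Longrightarrow> t\<^sup>2 < 1" by (simp add: abs_square_less_1)

lemma cos_moment_excess_has_derivative:
  fixes x t :: real
  assumes t: "\<bar>t\<bar> < 1"
  defines "z \<equiv> x * t / (1 - t\<^sup>2)"
  shows "(cos_moment_excess x has_real_derivative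
    x * (1 + t\<^sup>2) / (1 - t\<^sup>2)\<^sup>2 * (cos_moment 2 z - t * cos_moment 1 z) - cos_moment 0 z) (at t)"
proof -
  have r: "0 < 1 - t\<^sup>2" using square_less_1[OF t] by simp
  have zd: "((\<lambda>t. x * t / (1 - t\<^sup>2)) has_real_derivative x * (1 + t\<^sup>2) / (1 - t\<^sup>2)\<^sup>2) (at t)"
    using r by (auto intro!: derivative_eq_intros simp: power2_eq_square algebra_simps)
  have md: "((\<lambda>t. cos_moment j (x * t / (1 - t\<^sup>2))) has_real_derivative cos_moment (Suc j) z * (x * (1 + t\<^sup>2) / (1 - t\<^sup>2)\<^sup>2)) (at t)" for j
    unfolding z_def by (rule DERIV_chain2[OF cos_moment_has_derivative zd])
  show ?thesis unfolding cos_moment_excess_def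
    by (rule derivative_eq_intros md refl)+ (simp add: z_def numeral_2_eq_2 algebra_simps)
qed

lemma cos_moment_excess_zero_derivative:
  assumes t: "0 < t" "t < 1" and x: "0 < x" and zero: "cos_moment_excess x t = 0"
  defines "z \<equiv> x * t / (1 - t\<^sup>2)"
  shows "x * (1 + t\<^sup>2) / (1 - t\<^sup>2)\<^sup>2 * (cos_moment 2 z - t * cos_moment 1 z) - cos_moment 0 z
    = cos_moment 0 z * ((x * t\<^sup>2 + x - 2) / (1 - t\<^sup>2))"
proof -
  define r where "r = 1 - t\<^sup>2"
  have r: "0 < r" using square_less_1[of t] t by (simp add: r_def)
  have m1: "cos_moment 1 z = t * cos_moment 0 z" using zero by (simp add: cos_moment_excess_def z_def)
  have "t * cos_moment 0 z = x * t / r * (cos_moment 0 z - cos_moment 2 z)"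
    using cos_moment_bessel[of z] m1 by (simp add: z_def r_def)
  then have "t * (cos_moment 0 z * r) = t * (x * (cos_moment 0 z - cos_moment 2 z))" using r by (simp add: field_simps)
  then have "cos_moment 0 z * r = x * (cos_moment 0 z - cos_moment 2 z)" using t by simp
  then have m2: "cos_moment 2 z = cos_moment 0 z - cos_moment 0 z * r / x" using x by (simp add: field_simps)
  have "x * (1 + t\<^sup>2) / r\<^sup>2 * (cos_moment 2 z - t * cos_moment 1 z) - cos_moment 0 z
    = x * (1 + t\<^sup>2) / r\<^sup>2 * (cos_moment 0 z * ((1 - t\<^sup>2) - r / x)) - cos_moment 0 z"
    unfolding m1 m2 by (simp add: power2_eq_square algebra_simps)
  also have "\<dots> = x * (1 + t\<^sup>2) / r\<^sup>2 * (cos_moment 0 z * (r - r / x)) - cos_moment 0 z" by (simp add: r_def)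
  also have "\<dots> = cos_moment 0 z * (((x - 1) * (1 + t\<^sup>2) - r) / r)" using r x by (simp add: field_simps power2_eq_square)
  also have "(x - 1) * (1 + t\<^sup>2) - r = x * t\<^sup>2 + x - 2" by (simp add: r_def algebra_simps)
  finally show ?thesis by (simp add: r_def)
qed

lemma cos_moment_excess_single_sign_change:
  assumes x: "1 < x" "x < 2" and t0: "0 \<le> t0" "t0 < 1"
  shows "(\<forall>t\<in>{0..t0}. cos_moment_excess x t \<le> 0) \<or> (\<forall>t\<in>{t0..<1}. 0 \<le> cos_moment_excess x t)"
proof -
  let ?D = "cos_moment_excess x"
  define D' where "D' t = (let z = x * t / (1 - t\<^sup>2) in x * (1 + t\<^sup>2) / (1 - t\<^sup>2)\<^sup>2 * (cos_moment 2 z - t * cos_moment 1 z) - cos_moment 0 z)" for t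
  have der: "(?D has_real_derivative D' t) (at t)" if "\<bar>t\<bar> < 1" for t
    unfolding D'_def Let_def by (rule cos_moment_excess_has_derivative[OF that])
  have zero: "\<exists>c>0. D' t = c * (x * t\<^sup>2 + x - 2)" if "0 < t" "t < 1" "?D t = 0" for t
  proof -
    have "D' t = cos_moment 0 (x * t / (1 - t\<^sup>2)) / (1 - t\<^sup>2) * (x * t\<^sup>2 + x - 2)"
      unfolding D'_def Let_def using cos_moment_excess_zero_derivative[of t x] that x by simp
    moreover have "0 < cos_moment 0 (x * t / (1 - t\<^sup>2)) / (1 - t\<^sup>2)"
      using square_less_1[of t] that by (intro divide_pos_pos cos_moment_0_pos) auto
    ultimately show ?thesis by blast
  qed
  define ts where "ts = sqrt ((2 - x) / x)"
  have ts: "0 < ts" "ts < 1" using x by (auto simp: ts_def)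
  have ts2: "x * ts\<^sup>2 + x - 2 = 0" using x by (simp add: ts_def field_simps)
  have less: "x * t\<^sup>2 + x - 2 < 0" if "0 \<le> t" "t < ts" for t
  proof -
    have "t\<^sup>2 < ts\<^sup>2" using that by (intro power_strict_mono) auto
    then have "x * t\<^sup>2 < x * ts\<^sup>2" using x by simp
    then show ?thesis using ts2 by linarith
  qed
  have greater: "0 < x * t\<^sup>2 + x - 2" if "ts < t" for t
  proof -
    have "ts\<^sup>2 < t\<^sup>2" using that ts by (intro power_strict_mono) auto
    then have "x * ts\<^sup>2 < x * t\<^sup>2" using x by simp
    then show ?thesis using ts2 by linarith
  qed
  have D0: "?D 0 = 0" using cos_moment_bessel[of 0] by (simp add: cos_moment_excess_def)
  have "D' 0 < 0" using x by (simp add: D'_def cos_moment_0_0 cos_moment_2_0)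
  from DERIV_neg_dec_right[OF der[of 0] this]
  obtain d where d: "0 < d" "\<And>h. 0 < h \<Longrightarrow> h < d \<Longrightarrow> ?D h < 0" using D0 by auto
  have nonpos: "?D t \<le> 0" if t: "0 < t" "t < ts" for t
  proof -
    define e where "e = min (d / 2) t"
    have e: "0 < e" "e < d" "e \<le> t" using d t by (auto simp: e_def)
    have "- ?D t \<ge> 0"
    proof (rule nonneg_propagates_right[where a = e and b = t and g = "\<lambda>t. - ?D t" and g' = "\<lambda>t. - D' t"])
      show "((\<lambda>s. - ?D s) has_real_derivative - D' s) (at s)" if "s \<in> {e..t}" for s
        using that e t ts by (intro DERIV_minus der) auto
      show "0 < - D' s" if s: "s \<in> {e..t}" "- ?D s = 0" for s
      proof -
        obtain c where "0 < c" "D' s = c * (x * s\<^sup>2 + x - 2)" using zero[of s] s e t ts by auto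
        moreover have "x * s\<^sup>2 + x - 2 < 0" using less[of s] s e t by auto
        ultimately show ?thesis by (simp add: mult_pos_neg)
      qed
    qed (use d(2)[OF e(1,2)] e in auto)
    then show ?thesis by simp
  qed
  have nonpos_ts: "?D ts \<le> 0"
  proof (rule tendsto_upperbound)
    show "(?D \<longlongrightarrow> ?D ts) (at_left ts)"
      using DERIV_isCont[OF der[of ts]] ts by (auto simp: isCont_def intro: filterlim_at_split[THEN iffD1, THEN conjunct1])
    show "\<forall>\<^sub>F t in at_left ts. ?D t \<le> 0"
      using eventually_at_left_real[OF ts(1)] by eventually_elim (auto intro: nonpos)
  qed auto
  show ?thesis
  proof (rule disjCI)
    assume "\<not> (\<forall>t\<in>{t0..<1}. 0 \<le> ?D t)"
    then obtain t2 where t2: "t0 \<le> t2" "t2 < 1" "?D t2 < 0" by auto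
    show "\<forall>t\<in>{0..t0}. ?D t \<le> 0"
    proof (rule ccontr)
      assume "\<not> (\<forall>t\<in>{0..t0}. ?D t \<le> 0)"
      then obtain t1 where t1: "0 \<le> t1" "t1 \<le> t0" "0 < ?D t1" by auto
      have "t1 \<noteq> 0" using t1 D0 by auto
      then have "ts < t1" using nonpos[of t1] nonpos_ts t1 by (cases t1 ts rule: linorder_cases) auto
      have "0 \<le> ?D t2"
      proof (rule nonneg_propagates_right[where a = t1 and b = t2 and g = ?D and g' = D'])
        show "(?D has_real_derivative D' s) (at s)" if "s \<in> {t1..t2}" for s using that t1 t2 by (intro der) auto
        show "0 < D' s" if s: "s \<in> {t1..t2}" "?D s = 0" for s
        proof -
          obtain c where "0 < c" "D' s = c * (x * s\<^sup>2 + x - 2)" using zero[of s] s \<open>ts < t1\<close> ts t2 by auto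
          then show ?thesis using greater[of s] s \<open>ts < t1\<close> by simp
        qed
      qed (use t1 t2 in auto)
      then show False using t2 by simp
    qed
  qed
qed

definition two_weight_tail :: "real \<Rightarrow> real \<Rightarrow> real" where
  "two_weight_tail x t = integral {0..pi} (\<lambda>\<phi>. sqrt (1 - t\<^sup>2) * (exp (- (x * (1 - t * cos \<phi>) / (1 - t\<^sup>2))) / (1 - t * cos \<phi>)) / pi)"

lemma one_minus_mult_cos_pos:
  fixes t \<phi> :: real
  assumes "\<bar>t\<bar> < 1" shows "0 < 1 - t * cos \<phi>"
proof -
  note assms
  moreover have "\<bar>t * cos \<phi>\<bar> \<le> \<bar>t\<bar> * 1" unfolding abs_mult by (intro mult_left_mono) auto
  ultimately show ?thesis by linarith
qed

lemma two_weight_tail_has_derivative: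
  assumes t: "\<bar>t\<bar> < 1"
  shows "(two_weight_tail x has_real_derivative
    x * exp (- (x / (1 - t\<^sup>2))) / (pi * sqrt (1 - t\<^sup>2) * (1 - t\<^sup>2)) * cos_moment_excess x t) (at t)"
proof -
  let ?U = "{-1<..<1::real}"
  define E where "E t \<phi> = exp (- (x * (1 - t * cos \<phi>) / (1 - t\<^sup>2)))" for t \<phi>
  define F where "F t \<phi> = E t \<phi> * ((cos \<phi> - t) / (1 - t * cos \<phi>)\<^sup>2 - x * (2 * t / (1 - t\<^sup>2) - cos \<phi> / (1 - t * cos \<phi>))) / (sqrt (1 - t\<^sup>2) * pi)" for t \<phi>
  have pos: "0 < 1 - t * cos \<phi>" "0 < 1 - t\<^sup>2" if "t \<in> ?U" for t \<phi>
    using one_minus_mult_cos_pos[of t \<phi>] square_less_1[of t] that by auto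
  have nz: "1 - fst u * cos (snd u) \<noteq> 0" "1 - (fst u)\<^sup>2 \<noteq> 0" "0 < 1 - (fst u)\<^sup>2" if "u \<in> ?U \<times> cbox 0 pi" for u
    using pos(1)[of "fst u" "snd u"] pos(2)[of "fst u"] that by auto
  have "((\<lambda>t. integral (cbox 0 pi) (\<lambda>\<phi>. sqrt (1 - t\<^sup>2) * (E t \<phi> / (1 - t * cos \<phi>)) / pi)) has_field_derivative
      integral (cbox 0 pi) (F t)) (at t within ?U)"
  proof (rule leibniz_rule_field_derivative)
    fix t \<phi> :: real assume u: "t \<in> ?U"
    define r where "r = 1 - t\<^sup>2" define n where "n = 1 - t * cos \<phi>" define s where "s = sqrt r"
    have rn: "0 < r" "0 < n" using pos[OF u] by (auto simp: r_def n_def)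
    have s: "0 < s" "s * s = r" using rn by (auto simp: s_def)
    have sd: "((\<lambda>t. sqrt (1 - t\<^sup>2)) has_field_derivative - t / s) (at t)"
      using rn by (auto intro!: derivative_eq_intros simp: s_def r_def divide_simps)
    have Ed: "((\<lambda>t. E t \<phi>) has_field_derivative E t \<phi> * (- (x * (2 * t * n - cos \<phi> * r) / r\<^sup>2))) (at t)"
      unfolding E_def using rn
      by (auto intro!: derivative_eq_intros simp: r_def n_def power2_eq_square algebra_simps)
    have nd: "((\<lambda>t. 1 - t * cos \<phi>) has_field_derivative - cos \<phi>) (at t)" by (auto intro!: derivative_eq_intros)
    have "((\<lambda>t. sqrt (1 - t\<^sup>2) * (E t \<phi> / (1 - t * cos \<phi>)) / pi) has_field_derivative
      (- t / s * (E t \<phi> / n) + (E t \<phi> * (- (x * (2 * t * n - cos \<phi> * r) / r\<^sup>2)) * n + E t \<phi> * cos \<phi>) / (n * n) * s) / pi) (at t)"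
      using DERIV_cdivide[OF DERIV_mult[OF sd DERIV_divide[OF Ed nd]], of pi] rn by (simp add: r_def n_def s_def)
    also have "(- t / s * (E t \<phi> / n) + (E t \<phi> * (- (x * (2 * t * n - cos \<phi> * r) / r\<^sup>2)) * n + E t \<phi> * cos \<phi>) / (n * n) * s) / pi
      = E t \<phi> * (- t / n + (- (x * (2 * t * n - cos \<phi> * r) / r\<^sup>2) * n + cos \<phi>) / (n * n) * (s * s)) / (s * pi)"
      using s(1) rn by (simp add: field_simps)
    also have "- t / n + (- (x * (2 * t * n - cos \<phi> * r) / r\<^sup>2) * n + cos \<phi>) / (n * n) * (s * s)
      = (cos \<phi> * r - t * n) / n\<^sup>2 - x * (2 * t / r - cos \<phi> / n)"
      unfolding s(2) using rn by (simp add: field_simps power2_eq_square)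
    also have "cos \<phi> * r - t * n = cos \<phi> - t" by (simp add: r_def n_def power2_eq_square algebra_simps)
    finally show "((\<lambda>t. sqrt (1 - t\<^sup>2) * (E t \<phi> / (1 - t * cos \<phi>)) / pi) has_field_derivative F t \<phi>) (at t within ?U)"
      unfolding F_def r_def n_def s_def by (rule has_field_derivative_at_within)
  next
    show "(\<lambda>\<phi>. sqrt (1 - t\<^sup>2) * (E t \<phi> / (1 - t * cos \<phi>)) / pi) integrable_on cbox 0 pi" if "t \<in> ?U" for t
      unfolding E_def by (intro integrable_continuous continuous_intros) (use pos[OF that] in \<open>auto simp: less_imp_neq[symmetric]\<close>)
    show "continuous_on (?U \<times> cbox 0 pi) (\<lambda>(t, \<phi>). F t \<phi>)"
      unfolding split_beta F_def E_def by (intro continuous_intros) (use nz in auto)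
  qed (use t in auto)
  then have D: "(two_weight_tail x has_real_derivative integral {0..pi} (F t)) (at t)"
    using t by (subst (asm) at_within_open) (auto simp: two_weight_tail_def[abs_def] E_def)
  define r where "r = 1 - t\<^sup>2"
  have tU: "t \<in> ?U" using t by auto
  have r: "0 < r" using pos[OF tU] by (simp add: r_def)
  have z: "x * t / (1 - t\<^sup>2) * c - x / r = - (x * (1 - t * c) / (1 - t\<^sup>2))" for c by (simp add: r_def right_diff_distrib diff_divide_distrib ac_simps)
  have FTC: "((\<lambda>\<phi>. E t \<phi> * ((cos \<phi> - t) / (1 - t * cos \<phi>)\<^sup>2 - x * t * (sin \<phi>)\<^sup>2 / (r * (1 - t * cos \<phi>)))) has_integral
      sin pi / (1 - t * cos pi) * E t pi - sin 0 / (1 - t * cos 0) * E t 0) {0..pi}"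
  proof (rule fundamental_theorem_of_calculus)
    fix \<phi> :: real
    define n where "n = 1 - t * cos \<phi>"
    have n: "0 < n" using pos[OF tU] by (simp add: n_def)
    have Ed: "(E t has_real_derivative E t \<phi> * (- (x * (t * sin \<phi>) / r))) (at \<phi>)"
      unfolding E_def using r by (auto intro!: derivative_eq_intros simp: r_def)
    have nd: "((\<lambda>\<phi>. 1 - t * cos \<phi>) has_real_derivative t * sin \<phi>) (at \<phi>)" by (auto intro!: derivative_eq_intros)
    have "((\<lambda>\<phi>. sin \<phi> / (1 - t * cos \<phi>) * E t \<phi>) has_real_derivative
       (cos \<phi> * n - sin \<phi> * (t * sin \<phi>)) / (n * n) * E t \<phi> + E t \<phi> * (- (x * (t * sin \<phi>) / r)) * (sin \<phi> / n)) (at \<phi>)"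
      using DERIV_mult[OF DERIV_divide[OF DERIV_sin nd] Ed] n by (simp add: n_def)
    also have "(cos \<phi> * n - sin \<phi> * (t * sin \<phi>)) = cos \<phi> - t"
    proof -
      have "C * (1 - t * C) - S * (t * S) = C - t * (C * C + S * S)" for C S :: real by (simp add: algebra_simps)
      then show ?thesis unfolding n_def by (simp only: sin_cos_squared_add3 mult_1_right)
    qed
    also have "(cos \<phi> - t) / (n * n) * E t \<phi> + E t \<phi> * (- (x * (t * sin \<phi>) / r)) * (sin \<phi> / n)
      = E t \<phi> * ((cos \<phi> - t) / n\<^sup>2 - x * t * (sin \<phi>)\<^sup>2 / (r * n))"
      by (simp add: power2_eq_square right_diff_distrib ac_simps)
    finally show "((\<lambda>\<phi>. sin \<phi> / (1 - t * cos \<phi>) * E t \<phi>) has_vector_derivative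
        E t \<phi> * ((cos \<phi> - t) / (1 - t * cos \<phi>)\<^sup>2 - x * t * (sin \<phi>)\<^sup>2 / (r * (1 - t * cos \<phi>)))) (at \<phi> within {0..pi})"
      unfolding n_def has_real_derivative_iff_has_vector_derivative[symmetric] by (rule has_field_derivative_at_within)
  qed auto
  have "((\<lambda>\<phi>. E t \<phi> * (cos \<phi> - t)) has_integral exp (- (x / r)) * cos_moment_excess x t) {0..pi}"
  proof -
    have "((\<lambda>\<phi>. exp (- (x / r)) * (cos \<phi> ^ 1 * exp (x * t / (1 - t\<^sup>2) * cos \<phi>) - t * (cos \<phi> ^ 0 * exp (x * t / (1 - t\<^sup>2) * cos \<phi>)))) has_integral
      exp (- (x / r)) * cos_moment_excess x t) {0..pi}"
      unfolding cos_moment_excess_def cos_moment_def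
      by (intro has_integral_mult_right has_integral_diff integrable_integral cos_moment_integrable)
    moreover have "exp (- (x / r)) * (cos \<phi> ^ 1 * exp (x * t / (1 - t\<^sup>2) * cos \<phi>) - t * (cos \<phi> ^ 0 * exp (x * t / (1 - t\<^sup>2) * cos \<phi>))) = E t \<phi> * (cos \<phi> - t)" for \<phi>
    proof -
      have "exp (- (x / r)) * exp (x * t / (1 - t\<^sup>2) * cos \<phi>) = E t \<phi>"
        unfolding mult_exp_exp E_def z[symmetric] by simp
      then show ?thesis by (simp add: algebra_simps)
    qed
    ultimately show ?thesis by simp
  qed
  from has_integral_mult_right[OF has_integral_add[OF FTC has_integral_mult_right[OF this, of "x / r"]], of "1 / (sqrt r * pi)"]
  have I: "((\<lambda>\<phi>. 1 / (sqrt r * pi) * (E t \<phi> * ((cos \<phi> - t) / (1 - t * cos \<phi>)\<^sup>2 - x * t * (sin \<phi>)\<^sup>2 / (r * (1 - t * cos \<phi>))) + x / r * (E t \<phi> * (cos \<phi> - t))))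
    has_integral 1 / (sqrt r * pi) * (x / r * (exp (- (x / r)) * cos_moment_excess x t))) {0..pi}" by simp
  have Feq: "1 / (sqrt r * pi) * (E t \<phi> * ((cos \<phi> - t) / (1 - t * cos \<phi>)\<^sup>2 - x * t * (sin \<phi>)\<^sup>2 / (r * (1 - t * cos \<phi>))) + x / r * (E t \<phi> * (cos \<phi> - t))) = F t \<phi>" for \<phi>
  proof -
    define n where "n = 1 - t * cos \<phi>"
    have n: "0 < n" using pos[OF tU] by (simp add: n_def)
    have "(cos \<phi> - t) * n - t * (sin \<phi>)\<^sup>2 = cos \<phi> * r - 2 * t * n"
      unfolding sin_squared_eq by (simp add: n_def r_def power2_eq_square algebra_simps)
    then have "((cos \<phi> - t) * n - t * (sin \<phi>)\<^sup>2) / (r * n) = (cos \<phi> * r - 2 * t * n) / (r * n)" by simp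
    then have key: "(cos \<phi> - t) / r - t * (sin \<phi>)\<^sup>2 / (r * n) = cos \<phi> / n - 2 * t / r"
      using n r by (simp add: diff_divide_distrib)
    have "E t \<phi> * ((cos \<phi> - t) / n\<^sup>2 - x * t * (sin \<phi>)\<^sup>2 / (r * n)) + x / r * (E t \<phi> * (cos \<phi> - t))
      = E t \<phi> * ((cos \<phi> - t) / n\<^sup>2 + x * ((cos \<phi> - t) / r - t * (sin \<phi>)\<^sup>2 / (r * n)))"
    proof -
      have "e * (A - x * t * S / m) + x / r * (e * B) = e * (A + x * (B / r - t * S / m))" for e A S m B :: real
        by (simp add: ring_distribs ac_simps)
      then show ?thesis .
    qed
    also have "\<dots> = E t \<phi> * ((cos \<phi> - t) / n\<^sup>2 - x * (2 * t / r - cos \<phi> / n))" unfolding key by (simp add: algebra_simps)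
    finally show ?thesis unfolding F_def n_def[symmetric] r_def[symmetric] by simp
  qed
  have "integral {0..pi} (F t) = 1 / (sqrt r * pi) * (x / r * (exp (- (x / r)) * cos_moment_excess x t))"
    using integral_unique[OF I[unfolded Feq]] by simp
  also have "\<dots> = x * exp (- (x / r)) / (pi * sqrt r * r) * cos_moment_excess x t" by (simp add: ac_simps)
  finally show ?thesis using D by (simp add: r_def)
qed

lemma distr_gamma_law_scale:
  assumes c: "0 < c" and b: "0 < b"
  shows "distr (gamma_law k b) borel (\<lambda>w. c * w) = gamma_law k (b / c)"
proof (rule measure_eqI)
  fix A assume "A \<in> sets (distr (gamma_law k b) borel (\<lambda>w. c * w))"
  then have A [measurable]: "A \<in> sets borel" by simp
  have cA: "(\<lambda>w. c * w) -` A \<in> sets borel" using measurable_sets[of "\<lambda>w. c * w" borel borel A] by simp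
  have d: "c * gamma_density k (b / c) (c * w) = gamma_density k b w" for w
  proof (cases "0 < w")
    case True
    have "c * (c powr (k - 1) * (b / c) powr k) = b powr k"
    proof -
      have "c * c powr (k - 1) = c powr k" using c powr_mult_base[of c "k - 1"] by simp
      then have "c * (c powr (k - 1) * (b / c) powr k) = c powr k * (b powr k / c powr k)"
        using c b by (simp only: powr_divide mult.assoc[symmetric] less_imp_le)
      then show ?thesis using c by simp
    qed
    moreover have "c * gamma_density k (b / c) (c * w) = (c * (c powr (k - 1) * (b / c) powr k)) * w powr (k - 1) * exp (- b * w) / Gamma k"
      using True c by (simp add: gamma_density_def powr_mult)
    ultimately show ?thesis using True by (simp add: gamma_density_def)
  qed (use c in \<open>auto simp: gamma_density_def zero_less_mult_iff\<close>)
  have "emeasure (gamma_law k (b / c)) A = (\<integral>\<^sup>+u. ennreal (gamma_density k (b / c) u) * indicator A u \<partial>lborel)"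
    unfolding gamma_law_def by (rule emeasure_density) measurable
  also have "\<dots> = ennreal c * (\<integral>\<^sup>+w. ennreal (gamma_density k (b / c) (0 + c * w)) * indicator A (0 + c * w) \<partial>lborel)"
    using c by (subst nn_integral_real_affine[where c = c and t = 0]) auto
  also have "\<dots> = (\<integral>\<^sup>+w. ennreal c * (ennreal (gamma_density k (b / c) (0 + c * w)) * indicator A (0 + c * w)) \<partial>lborel)"
    by (rule nn_integral_cmult[symmetric]) measurable
  also have "\<dots> = (\<integral>\<^sup>+w. ennreal (gamma_density k b w) * indicator ((\<lambda>w. c * w) -` A) w \<partial>lborel)"
  proof (rule nn_integral_cong)
    fix w
    have "ennreal c * ennreal (gamma_density k (b / c) (0 + c * w)) = ennreal (gamma_density k b w)"
      using ennreal_mult'[of c "gamma_density k (b / c) (c * w)"] c by (simp add: d)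
    then show "ennreal c * (ennreal (gamma_density k (b / c) (0 + c * w)) * indicator A (0 + c * w))
      = ennreal (gamma_density k b w) * indicator ((\<lambda>w. c * w) -` A) w"
      by (auto simp: indicator_def)
  qed
  also have "\<dots> = emeasure (gamma_law k b) ((\<lambda>w. c * w) -` A)"
    unfolding gamma_law_def by (rule emeasure_density[symmetric]) (use cA in auto)
  also have "\<dots> = emeasure (distr (gamma_law k b) borel (\<lambda>w. c * w)) A" by (subst emeasure_distr) auto
  finally show "emeasure (distr (gamma_law k b) borel (\<lambda>w. c * w)) A = emeasure (gamma_law k (b / c)) A" ..
qed simp

lemma measure_gamma_law_scale:
  assumes "0 < c" "0 < b"
  shows "measure (gamma_law k (b / c)) {v<..} = measure (gamma_law k b) {v / c<..}"
proof -
  have "(\<lambda>w. c * w) -` {v<..} = {v / c<..}" using assms by (auto simp: field_simps)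
  then show ?thesis by (subst distr_gamma_law_scale[OF assms, symmetric]) (simp add: measure_distr)
qed

lemma gamma_law_tail_rate_mono:
  assumes k: "0 < k" and b: "0 < b" "b \<le> b'" and v: "0 \<le> v"
  shows "measure (gamma_law k b') {v<..} \<le> measure (gamma_law k b) {v<..}"
proof -
  interpret prob_space "gamma_law k b" by (rule prob_space_gamma_law[OF k b(1)])
  have "v * 1 \<le> v * (b' / b)" using b v by (intro mult_left_mono) auto
  then have "{v / (b / b')<..} \<subseteq> {v<..}" by auto
  then have "measure (gamma_law k b) {v / (b / b')<..} \<le> measure (gamma_law k b) {v<..}"
    by (intro finite_measure_mono) auto
  then show ?thesis using measure_gamma_law_scale[of "b / b'" b k v] b by simp
qed

lemma measure_convolution_tail_le:
  fixes M N :: "real measure"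
  assumes M: "prob_space M" "sets M = sets borel" and N: "prob_space N" "sets N = sets borel"
  shows "measure (M \<star> N) {x<..} \<le> measure M {x - e<..} + measure N {e<..}"
proof -
  note [measurable_cong] = M(2) N(2)
  interpret M: prob_space M by (rule M)
  interpret N: prob_space N by (rule N)
  interpret P: pair_prob_space M N ..
  have sp: "space M = UNIV" "space N = UNIV" using sets_eq_imp_space_eq[OF M(2)] sets_eq_imp_space_eq[OF N(2)] by auto
  have [measurable]: "{x - e<..} \<in> sets M" "{e<..} \<in> sets N" using M N by auto
  have "measure (M \<star> N) {x<..} = measure (M \<Otimes>\<^sub>M N) ((\<lambda>(x, y). x + y) -` {x<..} \<inter> space (M \<Otimes>\<^sub>M N))"
    unfolding convolution_def by (rule measure_distr) auto
  also have "\<dots> \<le> measure (M \<Otimes>\<^sub>M N) ({x - e<..} \<times> space N \<union> space M \<times> {e<..})"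
    by (rule P.finite_measure_mono) (auto simp: sp)
  also have "\<dots> \<le> measure (M \<Otimes>\<^sub>M N) ({x - e<..} \<times> space N) + measure (M \<Otimes>\<^sub>M N) (space M \<times> {e<..})"
    by (rule measure_Un_le) auto
  also have "\<dots> = measure M {x - e<..} + measure N {e<..}"
    by (simp add: measure_def N.emeasure_pair_measure_Times enn2real_mult M.emeasure_space_1 N.emeasure_space_1)
  finally show ?thesis .
qed

lemma measure_upper_tail_tendsto_0:
  fixes M :: "real measure"
  assumes "prob_space M" and sets: "sets M = sets borel" and e: "0 < e"
  shows "(\<lambda>n. measure M {e * real n<..}) \<longlonglongrightarrow> 0"
proof -
  interpret prob_space M by fact
  have "(\<lambda>n. measure M {e * real n<..}) \<longlonglongrightarrow> measure M (\<Inter>n. {e * real n<..})"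
  proof (rule finite_Lim_measure_decseq)
    show "decseq (\<lambda>n. {e * real n<..})" using e by (auto simp: decseq_def intro: le_less_trans[rotated] mult_left_mono)
  qed (auto simp: sets)
  moreover have "(\<Inter>n. {e * real n<..}) = {}"
  proof -
    have "y \<notin> (\<Inter>n. {e * real n<..})" for y
    proof -
      obtain n where "y / e < real n" using reals_Archimedean2 by blast
      then have "\<not> e * real n < y" using e by (simp add: field_simps)
      then show ?thesis by (auto intro: exI[of _ n])
    qed
    then show ?thesis by blast
  qed
  ultimately show ?thesis by simp
qed

lemma measure_upper_tail_left_limit:
  fixes M :: "real measure"
  assumes "prob_space M" and sets: "sets M = sets borel" and atom: "measure M {x} = 0"
  shows "(\<lambda>n. measure M {x - 1 / real (Suc n)<..}) \<longlonglongrightarrow> measure M {x<..}"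
proof -
  interpret prob_space M by fact
  have "(\<lambda>n. measure M {x - 1 / real (Suc n)<..}) \<longlonglongrightarrow> measure M (\<Inter>n. {x - 1 / real (Suc n)<..})"
  proof (rule finite_Lim_measure_decseq)
    show "decseq (\<lambda>n. {x - 1 / real (Suc n)<..})"
    proof (rule decseq_SucI)
      fix n
      have "1 / real (Suc (Suc n)) \<le> 1 / real (Suc n)" by (intro divide_left_mono) auto
      then show "{x - 1 / real (Suc (Suc n))<..} \<subseteq> {x - 1 / real (Suc n)<..}" by auto
    qed
  qed (auto simp: sets)
  moreover have "(\<Inter>n. {x - 1 / real (Suc n)<..}) = {x..}"
  proof (intro equalityI subsetI)
    fix y assume y: "y \<in> (\<Inter>n. {x - 1 / real (Suc n)<..})"
    show "y \<in> {x..}"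
    proof (rule ccontr)
      assume "y \<notin> {x..}"
      then obtain n where "inverse (real (Suc n)) < x - y" using reals_Archimedean[of "x - y"] by auto
      then show False using y by (auto simp: inverse_eq_divide dest: spec[of _ n])
    qed
  next
    fix y assume "y \<in> {x..}"
    moreover have "0 < 1 / real (Suc n)" for n by simp
    ultimately show "y \<in> (\<Inter>n. {x - 1 / real (Suc n)<..})" by (force intro: less_le_trans[rotated])
  qed
  moreover have "measure M {x..} = measure M {x<..}"
  proof -
    have "{x..} = insert x {x<..}" by auto
    moreover have "measure M ({x} \<union> {x<..}) = measure M {x} + measure M {x<..}"
      by (rule finite_measure_Union) (auto simp: sets)
    ultimately show ?thesis using atom by simp
  qed
  ultimately show ?thesis by simp
qed

lemma mixed_rate_two_weights:
  assumes "\<bar>t\<bar> < 1"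
  shows "mixed_rate (1 / (1 + t)) (1 / (1 - t)) \<phi> = (1 - t * cos \<phi>) / (1 - t\<^sup>2)"
proof -
  have tt: "1 + t \<noteq> 0" "1 - t \<noteq> 0" using assms by auto
  have "(1 / (1 + t) + 1 / (1 - t)) / 2 = 1 / ((1 + t) * (1 - t))" "(1 / (1 + t) - 1 / (1 - t)) / 2 = - t / ((1 + t) * (1 - t))"
    using tt by (simp_all add: add_frac_eq diff_frac_eq)
  moreover have "(1 + t) * (1 - t) = 1 - t\<^sup>2" by (simp add: power2_eq_square algebra_simps)
  moreover have "mixed_rate (1 / (1 + t)) (1 / (1 - t)) \<phi>
    = (1 / (1 + t) + 1 / (1 - t)) / 2 + (1 / (1 + t) - 1 / (1 - t)) / 2 * cos \<phi>" by (rule mixed_rate_def)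
  ultimately have "mixed_rate (1 / (1 + t)) (1 / (1 - t)) \<phi> = 1 / (1 - t\<^sup>2) + - t / (1 - t\<^sup>2) * cos \<phi>" by (simp only:)
  then show ?thesis by (simp add: diff_divide_distrib)
qed

lemma two_weight_tail_eq:
  assumes t: "\<bar>t\<bar> < 1" and x: "0 \<le> x"
  shows "measure (gamma_law (1/2) (1 / (1 + t)) \<star> gamma_law (1/2) (1 / (1 - t))) {x<..} = two_weight_tail x t"
proof -
  define r where "r = 1 - t\<^sup>2"
  have tt: "0 < 1 + t" "0 < 1 - t" using t by auto
  have rt: "r = (1 + t) * (1 - t)" by (simp add: r_def power2_eq_square algebra_simps)
  have r: "0 < r" unfolding rt using tt by simp
  have m: "mixed_rate (1 / (1 + t)) (1 / (1 - t)) \<phi> = (1 - t * cos \<phi>) / r" for \<phi>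
    unfolding r_def by (rule mixed_rate_two_weights[OF t])
  have s: "sqrt (1 / (1 + t) * (1 / (1 - t))) = 1 / sqrt r" unfolding rt by (simp add: real_sqrt_divide real_sqrt_mult)
  have ss: "1 / sqrt r * r = sqrt r" using r real_sqrt_mult_self[of r] by (simp add: field_simps)
  have "1 / sqrt r / pi * (exp (- ((1 - t * cos \<phi>) / r) * x) / ((1 - t * cos \<phi>) / r))
    = (1 / sqrt r * r) * (exp (- (x * (1 - t * cos \<phi>) / r)) / (1 - t * cos \<phi>)) / pi" for \<phi>
    by (simp add: ac_simps)
  then show ?thesis using measure_gamma_law_half_convolution[of "1 / (1 + t)" "1 / (1 - t)" x] tt x
    unfolding m s two_weight_tail_def r_def[symmetric] ss Henstock_Kurzweil_Integration.integral_mult_right[symmetric]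
    by (simp only: divide_pos_pos zero_less_one simp_thms ss)
qed

lemma two_weight_tail_le:
  assumes x: "1 < x" "x < 2" and t: "0 \<le> t" "t < 1"
  shows "two_weight_tail x t \<le> max (exp (- x)) (measure (gamma_law (1/2) (1/2)) {x<..})"
proof -
  define c where "c t = x * exp (- (x / (1 - t\<^sup>2))) / (pi * sqrt (1 - t\<^sup>2) * (1 - t\<^sup>2))" for t
  have der: "(two_weight_tail x has_real_derivative c s * cos_moment_excess x s) (at s)" if "0 \<le> s" "s < 1" for s
    unfolding c_def by (rule two_weight_tail_has_derivative) (use that in auto)
  have c: "0 \<le> c s" if "0 \<le> s" "s < 1" for s
    unfolding c_def using x square_less_1[of s] that by (intro divide_nonneg_nonneg mult_nonneg_nonneg) auto
  interpret T: prob_space "gamma_law (1/2) (1/2)" by (rule prob_space_gamma_law) auto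
  interpret T1: prob_space "gamma_law (1/2) 1" by (rule prob_space_gamma_law) auto
  from cos_moment_excess_single_sign_change[OF x t] show ?thesis
  proof
    assume neg: "\<forall>s\<in>{0..t}. cos_moment_excess x s \<le> 0"
    have "two_weight_tail x t \<le> two_weight_tail x 0"
    proof (rule DERIV_nonpos_imp_nonincreasing[where f = "two_weight_tail x", OF t(1)])
      fix s assume s: "0 \<le> s" "s \<le> t"
      then show "\<exists>y. (two_weight_tail x has_real_derivative y) (at s) \<and> y \<le> 0"
        using der[of s] c[of s] neg t by (intro exI[of _ "c s * cos_moment_excess x s"]) (auto intro: mult_nonneg_nonpos)
    qed
    also have "two_weight_tail x 0 = exp (- x)" by (simp add: two_weight_tail_def)
    finally show ?thesis by simp
  next
    assume pos: "\<forall>s\<in>{t..<1}. 0 \<le> cos_moment_excess x s"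
    have inc: "two_weight_tail x t \<le> two_weight_tail x s" if s: "t \<le> s" "s < 1" for s
    proof (rule DERIV_nonneg_imp_nondecreasing[where f = "two_weight_tail x", OF s(1)])
      fix u assume u: "t \<le> u" "u \<le> s"
      then show "\<exists>y. (two_weight_tail x has_real_derivative y) (at u) \<and> 0 \<le> y"
        using der[of u] c[of u] pos t s by (intro exI[of _ "c u * cos_moment_excess x u"]) auto
    qed
    have bound: "two_weight_tail x t \<le> measure (gamma_law (1/2) (1/2)) {x - e<..} + measure (gamma_law (1/2) 1) {e * real n<..}"
      if e: "0 < e" "e < x" and n: "1 / (1 - t) \<le> real n" "1 \<le> n" for e n
    proof -
      define s where "s = 1 - 1 / real n"
      have s: "t \<le> s" "s < 1" "0 \<le> s" using n t by (auto simp: s_def field_simps)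
      have "two_weight_tail x t \<le> two_weight_tail x s" by (rule inc[OF s(1,2)])
      also have "\<dots> = measure (gamma_law (1/2) (1 / (1 + s)) \<star> gamma_law (1/2) (1 / (1 - s))) {x<..}"
        by (rule two_weight_tail_eq[symmetric]) (use s x in auto)
      also have "\<dots> \<le> measure (gamma_law (1/2) (1 / (1 + s))) {x - e<..} + measure (gamma_law (1/2) (1 / (1 - s))) {e<..}"
        by (rule measure_convolution_tail_le) (use s in \<open>auto intro!: prob_space_gamma_law\<close>)
      also have "measure (gamma_law (1/2) (1 / (1 + s))) {x - e<..} \<le> measure (gamma_law (1/2) (1/2)) {x - e<..}"
        by (rule gamma_law_tail_rate_mono) (use s e in \<open>auto simp: field_simps\<close>)
      also have "measure (gamma_law (1/2) (1 / (1 - s))) {e<..} = measure (gamma_law (1/2) 1) {e * real n<..}"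
        using measure_gamma_law_scale[of "1 - s" 1 "1/2" e] s by (simp add: s_def)
      finally show ?thesis by simp
    qed
    have lim: "two_weight_tail x t \<le> measure (gamma_law (1/2) (1/2)) {x - e<..}" if e: "0 < e" "e < x" for e
    proof (rule tendsto_lowerbound)
      show "(\<lambda>n. measure (gamma_law (1/2) (1/2)) {x - e<..} + measure (gamma_law (1/2) 1) {e * real n<..})
        \<longlonglongrightarrow> measure (gamma_law (1/2) (1/2)) {x - e<..}"
        using tendsto_add[OF tendsto_const measure_upper_tail_tendsto_0[OF T1.prob_space_axioms _ e(1)]] by simp
      show "\<forall>\<^sub>F n in sequentially. two_weight_tail x t \<le> measure (gamma_law (1/2) (1/2)) {x - e<..} + measure (gamma_law (1/2) 1) {e * real n<..}"
        using eventually_ge_at_top[of "nat \<lceil>1 / (1 - t)\<rceil>"] eventually_ge_at_top[of 1]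
        by eventually_elim (rule bound[OF e], linarith)
    qed simp
    have "two_weight_tail x t \<le> measure (gamma_law (1/2) (1/2)) {x<..}"
    proof (rule tendsto_lowerbound)
      show "(\<lambda>n. measure (gamma_law (1/2) (1/2)) {x - 1 / real (Suc n)<..}) \<longlonglongrightarrow> measure (gamma_law (1/2) (1/2)) {x<..}"
        by (rule measure_upper_tail_left_limit[OF T.prob_space_axioms]) (auto simp: measure_def emeasure_gamma_law_singleton)
      show "\<forall>\<^sub>F n in sequentially. two_weight_tail x t \<le> measure (gamma_law (1/2) (1/2)) {x - 1 / real (Suc n)<..}"
      proof (intro always_eventually allI lim)
        fix n
        have "1 / real (Suc n) \<le> 1" by simp
        then show "1 / real (Suc n) < x" using x by linarith
      qed simp
    qed simp
    then show ?thesis by simp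
  qed
qed

lemma cos_moment_ratio_le:
  assumes t: "0 \<le> t" "t < 1" and y: "1 \<le> y"
  defines "z \<equiv> t * y / (1 - t\<^sup>2)"
  shows "cos_moment 1 z \<le> (1 - (1 - t) / y) * cos_moment 0 z"
proof (cases "t = 0")
  case True
  then show ?thesis using cos_moment_bessel[of 0] cos_moment_0_pos[of 0] y by (simp add: z_def)
next
  case False
  define R where "R = 1 - (1 - t) / y"
  define r where "r = cos_moment 1 z / cos_moment 0 z"
  have t0: "0 < t" using t False by simp
  have m0: "0 < cos_moment 0 z" by (rule cos_moment_0_pos)
  have m1: "cos_moment 1 z = r * cos_moment 0 z" using m0 by (simp add: r_def)
  have z: "0 < z" unfolding z_def using t0 t y square_less_1[of t] by simp
  have "(1 - t) / y \<le> 1 - t" using y t by (simp add: divide_le_eq mult_le_cancel_left1)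
  then have R: "t \<le> R" by (simp add: R_def)
  have "z * (cos_moment 1 z)\<^sup>2 \<le> z * (cos_moment 0 z * cos_moment 2 z)"
    using z cos_moment_cauchy_schwarz by (intro mult_left_mono) auto
  also have "\<dots> = cos_moment 0 z * (z * cos_moment 0 z - cos_moment 1 z)"
    unfolding cos_moment_bessel[of z] by (simp add: algebra_simps)
  finally have "(cos_moment 0 z)\<^sup>2 * (z * r\<^sup>2 + r - z) \<le> 0" unfolding m1 by (simp add: power2_eq_square algebra_simps)
  then have rz: "z * r\<^sup>2 + r \<le> z" using m0 by (simp add: mult_le_0_iff)
  have "z * ((1 - R) * (1 + R)) = t * (1 + R) / (1 + t)"
  proof -
    have "1 - t\<^sup>2 = (1 + t) * (1 - t)" by (simp add: power2_eq_square algebra_simps)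
    then have "z * (1 - R) = t / (1 + t)" unfolding z_def R_def using t y by simp
    then show ?thesis by (simp add: mult.assoc[symmetric])
  qed
  also have "\<dots> \<le> R" using R t by (simp add: divide_le_eq algebra_simps)
  finally have Rz: "z \<le> z * R\<^sup>2 + R" by (simp add: power2_eq_square algebra_simps)
  have "r \<le> R"
  proof (rule ccontr)
    assume "\<not> r \<le> R"
    then have "R < r" "R\<^sup>2 \<le> r\<^sup>2" using R t0 by (auto intro: power_mono)
    then have "z * R\<^sup>2 + R < z * r\<^sup>2 + r" using z by (intro add_le_less_mono mult_left_mono) auto
    then show False using rz Rz by linarith
  qed
  then show ?thesis unfolding m1 R_def using m0 by (intro mult_right_mono) auto
qed

lemma two_gamma_density_ratio_antimono:
  assumes t: "0 \<le> t" "t < 1" and b: "0 < b" "b \<le> 1 / (1 + t)" and y: "1 \<le> y" "y \<le> z"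
  shows "two_gamma_density (1 / (1 + t)) (1 / (1 - t)) z / gamma_density b b z
    \<le> two_gamma_density (1 / (1 + t)) (1 / (1 - t)) y / gamma_density b b y"
proof -
  define r where "r = 1 - t\<^sup>2"
  have tt: "0 < 1 + t" "0 < 1 - t" using t by auto
  have rt: "r = (1 + t) * (1 - t)" by (simp add: r_def power2_eq_square algebra_simps)
  have r: "0 < r" unfolding rt using tt by simp
  have G: "0 < Gamma b" using b(1) by (rule Gamma_real_pos)
  define C where "C = sqrt (1 / (1 + t) * (1 / (1 - t))) / pi * Gamma b / b powr b"
  have C: "0 \<le> C" using tt G b by (simp add: C_def)
  define g where "g u = (1 - b) * ln u + (b - 1 / r) * u + ln (cos_moment 0 (t / r * u))" for u
  have f: "two_gamma_density (1 / (1 + t)) (1 / (1 - t)) u / gamma_density b b u = C * exp (g u)" if u: "1 \<le> u" for u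
  proof -
    have m: "exp (- mixed_rate (1 / (1 + t)) (1 / (1 - t)) \<phi> * u) = exp (- (u / r)) * (cos \<phi> ^ 0 * exp (t / r * u * cos \<phi>))" for \<phi>
    proof -
      have "mixed_rate (1 / (1 + t)) (1 / (1 - t)) \<phi> = 1 / r - t / r * cos \<phi>"
        using mixed_rate_two_weights[of t \<phi>] t by (simp add: r_def diff_divide_distrib)
      moreover have "- (1 / r - t / r * C) * u = - (u / r) + t / r * u * C" for C by (simp add: ring_distribs)
      ultimately show ?thesis by (simp only: mult_exp_exp power_0 mult_1_left)
    qed
    have "two_gamma_density (1 / (1 + t)) (1 / (1 - t)) u = sqrt (1 / (1 + t) * (1 / (1 - t))) / pi * (exp (- (u / r)) * cos_moment 0 (t / r * u))"
      unfolding two_gamma_density_def m cos_moment_def using u by simp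
    moreover have "gamma_density b b u = b powr b / Gamma b * exp (- ((1 - b) * ln u) - b * u)"
      using u by (simp add: gamma_density_def powr_def mult_exp_exp algebra_simps)
    moreover have "exp (g u) = exp (- (u / r)) * cos_moment 0 (t / r * u) / exp (- ((1 - b) * ln u) - b * u)"
    proof -
      have "g u = - (u / r) + ln (cos_moment 0 (t / r * u)) - (- ((1 - b) * ln u) - b * u)"
        unfolding g_def by (simp add: left_diff_distrib)
      then show ?thesis using cos_moment_0_pos[of "t / r * u"] by (simp only: exp_diff exp_add exp_ln)
    qed
    ultimately show ?thesis by (simp add: C_def ac_simps)
  qed
  have "g z \<le> g y"
  proof (rule DERIV_nonpos_imp_nonincreasing[where f = g, OF y(2)])
    fix u assume u: "y \<le> u" "u \<le> z"
    define s where "s = t / r * u"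
    have u1: "1 \<le> u" using u y by simp
    have m0: "0 < cos_moment 0 s" by (rule cos_moment_0_pos)
    have "((\<lambda>u. cos_moment 0 (t / r * u)) has_real_derivative cos_moment 1 s * (t / r)) (at u)"
    proof (rule DERIV_chain2[where f = "cos_moment 0" and g = "\<lambda>u. t / r * u"])
      show "(cos_moment 0 has_real_derivative cos_moment 1 s) (at (t / r * u))"
        using cos_moment_has_derivative[of 0 "t / r * u"] by (simp add: s_def)
      show "((\<lambda>u. t / r * u) has_real_derivative t / r) (at u)" using r by (auto intro!: derivative_eq_intros)
    qed
    then have d: "(g has_real_derivative (1 - b) / u + (b - 1 / r) + cos_moment 1 s * (t / r) / cos_moment 0 s) (at u)"
      unfolding g_def using u1 m0 by (auto intro!: derivative_eq_intros simp: s_def)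
    have "cos_moment 1 s \<le> (1 - (1 - t) / u) * cos_moment 0 s"
      using cos_moment_ratio_le[OF t u1] by (simp add: s_def r_def)
    then have "cos_moment 1 s / cos_moment 0 s \<le> 1 - (1 - t) / u" using m0 by (simp add: divide_le_eq)
    then have "t / r * (cos_moment 1 s / cos_moment 0 s) \<le> t / r * (1 - (1 - t) / u)"
      using t r by (intro mult_left_mono) auto
    moreover have "(1 - b) / u + b \<le> 1 / u + 1 / (1 + t) * (1 - 1 / u)"
    proof -
      have "b * (1 - 1 / u) \<le> 1 / (1 + t) * (1 - 1 / u)" using b u1 by (intro mult_right_mono) auto
      then show ?thesis by (simp add: diff_divide_distrib right_diff_distrib)
    qed
    moreover have "1 / u + 1 / (1 + t) * (1 - 1 / u) - 1 / r + t / r * (1 - (1 - t) / u) = 0"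
    proof -
      have "U + A * (1 - U) - P + t * P * (1 - (1 - t) * U) = 0" if "P * (1 - t) = A" "A * (1 + t) = 1" for U A P :: real
      proof -
        have "U + A * (1 - U) - P + t * P * (1 - (1 - t) * U) = (A - P * (1 - t)) + U * (1 - A - t * (P * (1 - t)))"
          by (simp add: algebra_simps)
        moreover have "1 - A - t * A = 0" using that(2) by (simp add: algebra_simps)
        ultimately show ?thesis using that(1) by simp
      qed
      from this[of "1 / r" "1 / (1 + t)" "1 / u"] show ?thesis using tt by (simp add: rt)
    qed
    ultimately have "(1 - b) / u + (b - 1 / r) + cos_moment 1 s * (t / r) / cos_moment 0 s \<le> 0" by (simp add: ac_simps)
    then show "\<exists>d. (g has_real_derivative d) (at u) \<and> d \<le> 0" using d by blast
  qed
  then have "C * exp (g z) \<le> C * exp (g y)" using C by (intro mult_left_mono) auto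
  then show ?thesis using f[of y] f[of z] y by simp
qed

definition exp_minus_partial_sum :: "nat \<Rightarrow> real \<Rightarrow> real" where
  "exp_minus_partial_sum N u = (\<Sum>n<N. (- u) ^ n / fact n)"

lemma exp_minus_partial_sum_derivative:
  "(exp_minus_partial_sum (Suc N) has_real_derivative - exp_minus_partial_sum N u) (at u)"
proof -
  have e: "exp_minus_partial_sum (Suc N) = (\<lambda>u. 1 + (\<Sum>n<N. (- u) ^ Suc n / fact (Suc n)))"
    by (rule ext) (simp add: exp_minus_partial_sum_def sum.lessThan_Suc_shift del: sum.lessThan_Suc)
  have "((\<lambda>u. (- u) ^ Suc n / fact (Suc n)) has_real_derivative - ((- u) ^ n / fact n)) (at u)" for n
  proof -
    have "((\<lambda>u. (- u) ^ Suc n) has_real_derivative real (Suc n) * (- u) ^ (Suc n - Suc 0) * - 1) (at u)"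
      by (rule DERIV_chain2[OF DERIV_pow]) (auto intro!: derivative_eq_intros)
    from DERIV_cdivide[OF this, of "fact (Suc n)"]
    have "((\<lambda>u. (- u) ^ Suc n / fact (Suc n)) has_real_derivative (real (Suc n) * (- u) ^ (Suc n - Suc 0) * - 1) / fact (Suc n)) (at u)" .
    also have "(real (Suc n) * (- u) ^ (Suc n - Suc 0) * - 1) / fact (Suc n) = - ((- u) ^ n / fact n)"
      by (simp add: fact_Suc del: of_nat_Suc)
    finally show ?thesis .
  qed
  then have "((\<lambda>u. 1 + (\<Sum>n<N. (- u) ^ Suc n / fact (Suc n))) has_real_derivative 0 + (\<Sum>n<N. - ((- u) ^ n / fact n))) (at u)"
    by (intro DERIV_add DERIV_const DERIV_sum)
  then show ?thesis unfolding e by (simp add: exp_minus_partial_sum_def sum_negf)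
qed

lemma exp_minus_partial_sum_alternates:
  assumes "0 \<le> u"
  shows "0 \<le> (- 1) ^ N * (exp (- u) - exp_minus_partial_sum N u)"
  using assms
proof (induction N arbitrary: u)
  case 0
  then show ?case by (simp add: exp_minus_partial_sum_def)
next
  case (Suc N)
  let ?R = "\<lambda>u. (- 1) ^ Suc N * (exp (- u) - exp_minus_partial_sum (Suc N) u)"
  have "?R 0 \<le> ?R u"
  proof (rule DERIV_nonneg_imp_nondecreasing[where f = ?R, OF Suc.prems])
    fix v :: real assume v: "0 \<le> v" "v \<le> u"
    have "((\<lambda>u. exp (- u) - exp_minus_partial_sum (Suc N) u) has_real_derivative - exp (- v) - - exp_minus_partial_sum N v) (at v)"
      by (intro DERIV_diff exp_minus_partial_sum_derivative) (auto intro!: derivative_eq_intros)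
    from DERIV_cmult[OF this, of "(- 1) ^ Suc N"]
    have "(?R has_real_derivative (- 1) ^ N * (exp (- v) - exp_minus_partial_sum N v)) (at v)" by (simp add: algebra_simps)
    then show "\<exists>y. (?R has_real_derivative y) (at v) \<and> 0 \<le> y" using Suc.IH[OF v(1)] by blast
  qed
  moreover have "exp_minus_partial_sum (Suc N) 0 = 1"
    by (simp add: exp_minus_partial_sum_def sum.lessThan_Suc_shift del: sum.lessThan_Suc)
  ultimately show ?case by simp
qed

lemma exp_minus_bounds:
  assumes "0 \<le> u"
  shows "even N \<Longrightarrow> exp_minus_partial_sum N u \<le> exp (- u)" and "odd N \<Longrightarrow> exp (- u) \<le> exp_minus_partial_sum N u"
  using exp_minus_partial_sum_alternates[OF assms, of N] by auto

definition half_normal_integral :: "real \<Rightarrow> real" where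
  "half_normal_integral c = integral {0..c} (\<lambda>s. exp (- s\<^sup>2 / 2))"

definition half_normal_series :: "nat \<Rightarrow> real \<Rightarrow> real" where
  "half_normal_series N v = (\<Sum>n<N. (- v / 2) ^ n / (fact n * (2 * real n + 1)))"

lemma half_normal_integral_bounds:
  assumes v: "0 \<le> v"
  shows "even N \<Longrightarrow> sqrt v * half_normal_series N v \<le> half_normal_integral (sqrt v)"
    and "odd N \<Longrightarrow> half_normal_integral (sqrt v) \<le> sqrt v * half_normal_series N v"
proof -
  define F where "F s = (\<Sum>n<N. s ^ (2 * n + 1) * ((- 1 / 2) ^ n / (fact n * (2 * real n + 1))))" for s :: real
  have sv: "0 \<le> sqrt v" using v by simp
  have "((\<lambda>s. exp_minus_partial_sum N (s\<^sup>2 / 2)) has_integral F (sqrt v) - F 0) {0..sqrt v}"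
  proof (rule fundamental_theorem_of_calculus[OF sv])
    fix s :: real
    have "((\<lambda>s. s ^ (2 * n + 1) * ((- 1 / 2) ^ n / (fact n * (2 * real n + 1)))) has_real_derivative (- (s\<^sup>2 / 2)) ^ n / fact n) (at s)" for n
    proof -
      have "((\<lambda>s. s ^ (2 * n + 1) * ((- 1 / 2) ^ n / (fact n * (2 * real n + 1)))) has_real_derivative
         (2 * real n + 1) * s ^ (2 * n) * ((- 1 / 2) ^ n / (fact n * (2 * real n + 1)))) (at s)"
        by (rule DERIV_cmult_right) (use DERIV_pow[of "2 * n + 1" s] in \<open>simp add: add.commute\<close>)
      also have "(2 * real n + 1) * s ^ (2 * n) * ((- 1 / 2) ^ n / (fact n * (2 * real n + 1))) = (s\<^sup>2) ^ n * (- 1 / 2) ^ n / fact n"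
        by (simp add: power_mult divide_simps) (simp add: algebra_simps)?
      also have "(s\<^sup>2) ^ n * (- 1 / 2) ^ n = (- (s\<^sup>2 / 2)) ^ n" by (simp add: power_mult_distrib[symmetric])
      finally show ?thesis .
    qed
    then have "(F has_real_derivative exp_minus_partial_sum N (s\<^sup>2 / 2)) (at s)"
      unfolding F_def exp_minus_partial_sum_def by (intro DERIV_sum)
    then show "(F has_vector_derivative exp_minus_partial_sum N (s\<^sup>2 / 2)) (at s within {0..sqrt v})"
      unfolding has_real_derivative_iff_has_vector_derivative[symmetric] by (rule has_field_derivative_at_within)
  qed
  moreover have "F (sqrt v) = sqrt v * half_normal_series N v"
    unfolding F_def half_normal_series_def sum_distrib_left
  proof (rule sum.cong)
    fix n
    have "sqrt v ^ (2 * n + 1) = sqrt v * v ^ n" using v by (simp add: power_mult)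
    moreover have "v ^ n * (- 1 / 2) ^ n = (- v / 2) ^ n" by (simp add: power_mult_distrib[symmetric])
    ultimately show "sqrt v ^ (2 * n + 1) * ((- 1 / 2) ^ n / (fact n * (2 * real n + 1))) = sqrt v * ((- v / 2) ^ n / (fact n * (2 * real n + 1)))"
      by (metis (no_types) mult.assoc times_divide_eq_right)
  qed simp
  moreover have "F 0 = 0" by (simp add: F_def)
  ultimately have P: "((\<lambda>s. exp_minus_partial_sum N (s\<^sup>2 / 2)) has_integral sqrt v * half_normal_series N v) {0..sqrt v}" by simp
  have I: "((\<lambda>s. exp (- s\<^sup>2 / 2)) has_integral half_normal_integral (sqrt v)) {0..sqrt v}"
    unfolding half_normal_integral_def by (intro integrable_integral integrable_continuous_interval continuous_intros) auto
  show "even N \<Longrightarrow> sqrt v * half_normal_series N v \<le> half_normal_integral (sqrt v)"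
    using exp_minus_bounds(1)[of "s\<^sup>2 / 2" N for s] by (intro has_integral_le[OF P I]) (metis divide_nonneg_nonneg minus_divide_left zero_le_numeral zero_le_power2)
  show "odd N \<Longrightarrow> half_normal_integral (sqrt v) \<le> sqrt v * half_normal_series N v"
    using exp_minus_bounds(2)[of "s\<^sup>2 / 2" N for s] by (intro has_integral_le[OF I P]) (metis divide_nonneg_nonneg minus_divide_left zero_le_numeral zero_le_power2)
qed

lemma measure_gamma_law_half:
  assumes v: "0 \<le> v"
  shows "measure (gamma_law (1/2) (1/2)) {..v} = sqrt (2 / pi) * half_normal_integral (sqrt v)"
proof (cases "v = 0")
  case True
  have "AE w in gamma_law (1/2) (1/2). w \<notin> {..0}" using AE_gamma_law_pos by eventually_elim auto
  then have "emeasure (gamma_law (1/2) (1/2)) {..0} = 0"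
    by (subst (asm) AE_iff_measurable[where N = "{..0}"]) auto
  then show ?thesis using True by (simp add: measure_def half_normal_integral_def)
next
  case False
  then have v0: "0 < v" using v by simp
  have "emeasure (gamma_law (1/2) (1/2)) {..v} = (\<integral>\<^sup>+w. ennreal (gamma_density (1/2) (1/2) w) * indicator {..v} w \<partial>lborel)"
    unfolding gamma_law_def by (rule emeasure_density) auto
  also have "\<dots> = (\<integral>\<^sup>+w. ennreal (gamma_density (1/2) (1/2) w) * indicator {0\<^sup>2..(sqrt v)\<^sup>2} w \<partial>lborel)"
    using v by (intro nn_integral_cong) (auto simp: gamma_density_def split: split_indicator)
  also have "\<dots> = (\<integral>\<^sup>+s. ennreal (gamma_density (1/2) (1/2) (s\<^sup>2)) * ennreal (2 * s) * indicator {0..sqrt v} s \<partial>lborel)"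
    by (rule nn_integral_substitution_aux) (use v0 in \<open>auto intro!: derivative_eq_intros continuous_intros\<close>)
  also have "\<dots> = (\<integral>\<^sup>+s. ennreal (sqrt (2 / pi) * exp (- s\<^sup>2 / 2)) * indicator {0..sqrt v} s \<partial>lborel)"
  proof (rule nn_integral_cong_AE, rule AE_mp[OF AE_lborel_singleton[of 0]], intro AE_I2 impI)
    fix s :: real assume "s \<noteq> 0"
    show "ennreal (gamma_density (1/2) (1/2) (s\<^sup>2)) * ennreal (2 * s) * indicator {0..sqrt v} s
      = ennreal (sqrt (2 / pi) * exp (- s\<^sup>2 / 2)) * indicator {0..sqrt v} s"
    proof (cases "0 < s")
      case True
      have "gamma_density (1/2) (1/2) (s\<^sup>2) * (2 * s) = sqrt (1/2) / sqrt pi * exp (- s\<^sup>2 / 2) / s * (2 * s)"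
        using True gamma_density_half[of "s\<^sup>2" "1/2"] by simp
      also have "\<dots> = (sqrt (1/2) * 2) / sqrt pi * exp (- s\<^sup>2 / 2)" using True by simp
      also have "sqrt (1/2) * 2 = sqrt 2" by (simp add: real_sqrt_divide real_div_sqrt)
      finally have "gamma_density (1/2) (1/2) (s\<^sup>2) * (2 * s) = sqrt (2 / pi) * exp (- s\<^sup>2 / 2)" by (simp add: real_sqrt_divide)
      moreover have "0 \<le> gamma_density (1/2) (1/2) (s\<^sup>2)" by (simp add: gamma_density_nonneg)
      ultimately show ?thesis by (metis ennreal_mult')
    qed (use \<open>s \<noteq> 0\<close> in auto)
  qed
  also have "\<dots> = ennreal (integral {0..sqrt v} (\<lambda>s. sqrt (2 / pi) * exp (- s\<^sup>2 / 2)))"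
    by (rule nn_integral_continuous_interval) (auto intro!: continuous_intros)
  also have "\<dots> = ennreal (sqrt (2 / pi) * half_normal_integral (sqrt v))" by (simp add: half_normal_integral_def)
  finally show ?thesis
    by (simp add: measure_def half_normal_integral_def Henstock_Kurzweil_Integration.integral_nonneg integrable_continuous_interval continuous_intros)
qed

lemma measure_gamma_law_half_tail:
  assumes "0 \<le> v"
  shows "measure (gamma_law (1/2) (1/2)) {v<..} = 1 - sqrt (2 / pi) * half_normal_integral (sqrt v)"
proof -
  interpret prob_space "gamma_law (1/2) (1/2)" by (rule prob_space_gamma_law) auto
  have "{v<..} = space (gamma_law (1/2) (1/2)) - {..v}" by auto
  then show ?thesis using prob_compl[of "{..v}"] measure_gamma_law_half[OF assms] by simp
qed

lemma normal_square_tail_at_3_2: "measure (gamma_law (1/2) (1/2)) {3/2<..} \<le> exp (- (3/2))"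
proof -
  have pi: "pi \<le> 31416 / 10000" using pi_approx(2) by simp
  define S where "S = half_normal_series 4 (3/2)"
  define e where "e = exp_minus_partial_sum 8 (3/2)"
  have eval: "(1 - e)\<^sup>2 * (31416 / 10000) \<le> 3 * S\<^sup>2" "0 \<le> S" "0 \<le> 1 - e"
    by (simp_all add: S_def e_def half_normal_series_def exp_minus_partial_sum_def numeral_eq_Suc lessThan_Suc power2_eq_square) 
  have "(1 - e)\<^sup>2 * pi \<le> (1 - e)\<^sup>2 * (31416 / 10000)" using pi by (intro mult_left_mono) auto
  also note eval(1)
  finally have "(1 - e)\<^sup>2 \<le> 2 / pi * (3/2) * S\<^sup>2" by (simp add: field_simps)
  also have "\<dots> = (sqrt (2 / pi) * (sqrt (3/2) * S))\<^sup>2" by (simp add: power_mult_distrib)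
  finally have "1 - e \<le> sqrt (2 / pi) * (sqrt (3/2) * S)"
    by (rule power2_le_imp_le) (use eval in auto)
  also have "\<dots> \<le> sqrt (2 / pi) * half_normal_integral (sqrt (3/2))"
    using half_normal_integral_bounds(1)[of "3/2" 4] by (intro mult_left_mono) (auto simp: S_def)
  finally show ?thesis using exp_minus_bounds(1)[of "3/2" 8] measure_gamma_law_half_tail[of "3/2"] by (simp add: e_def)
qed

lemma normal_square_tail_at_1_5365: "exp (- 1.5365) < measure (gamma_law (1/2) (1/2)) {1.5365<..}"
proof -
  have pi: "314159 / 100000 \<le> pi" using pi_approx(1) by simp
  define S where "S = half_normal_series 9 1.5365"
  define e where "e = exp_minus_partial_sum 13 1.5365"
  have eval: "2 * 1.5365 * S\<^sup>2 < (1 - e)\<^sup>2 * (314159 / 100000)" "0 \<le> S" "0 \<le> 1 - e"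
    by (simp_all add: S_def e_def half_normal_series_def exp_minus_partial_sum_def numeral_eq_Suc lessThan_Suc power2_eq_square) 
  have "(sqrt (2 / pi) * (sqrt 1.5365 * S))\<^sup>2 = 2 * 1.5365 * S\<^sup>2 / pi" by (simp add: power_mult_distrib)
  also have "\<dots> < (1 - e)\<^sup>2"
  proof -
    note eval(1)
    also have "(1 - e)\<^sup>2 * (314159 / 100000) \<le> (1 - e)\<^sup>2 * pi" using pi by (intro mult_left_mono) auto
    finally show ?thesis by (simp add: field_simps)
  qed
  finally have lt: "sqrt (2 / pi) * (sqrt 1.5365 * S) < 1 - e"
    by (rule power2_less_imp_less) (use eval in auto)
  have le: "half_normal_integral (sqrt 1.5365) \<le> sqrt 1.5365 * S"
    unfolding S_def by (rule half_normal_integral_bounds(2)) auto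
  have "0 \<le> sqrt (2 / pi)" by simp
  from mult_left_mono[OF le this] have "sqrt (2 / pi) * half_normal_integral (sqrt 1.5365) < 1 - e"
    using lt by linarith
  then show ?thesis using exp_minus_bounds(2)[of "1.5365" 13] measure_gamma_law_half_tail[of "1.5365"] by (simp add: e_def)
qed

lemma crossing_point:
  obtains xc where "3/2 \<le> xc" "xc < 1.5365" "measure (gamma_law (1/2) (1/2)) {xc<..} = exp (- xc)"
proof -
  define D where "D v = 1 - sqrt (2 / pi) * half_normal_integral (sqrt v) - exp (- v)" for v
  have c: "continuous_on {0..sqrt 1.5365} half_normal_integral"
    unfolding half_normal_integral_def
    by (intro indefinite_integral_continuous_1 integrable_continuous_interval continuous_intros) auto
  have "continuous_on {3/2..1.5365} (\<lambda>v. half_normal_integral (sqrt v))"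
    by (rule continuous_on_compose2[OF c]) (auto intro!: continuous_intros)
  then have "continuous_on {3/2..1.5365} D" unfolding D_def by (intro continuous_intros)
  moreover have "D (3/2) \<le> 0" "0 < D 1.5365"
    using normal_square_tail_at_3_2 normal_square_tail_at_1_5365 by (auto simp: D_def measure_gamma_law_half_tail)
  ultimately obtain xc where xc: "3/2 \<le> xc" "xc \<le> 1.5365" "D xc = 0"
    using IVT'[of D "3/2" 0 "1.5365"] by auto
  moreover have "xc \<noteq> 1.5365" using xc(3) \<open>0 < D 1.5365\<close> by (metis less_irrefl)
  ultimately show ?thesis using that[of xc] by (auto simp: D_def measure_gamma_law_half_tail)
qed

lemma measure_exponential_tail: "0 \<le> x \<Longrightarrow> measure (gamma_law 1 1) {x<..} = exp (- x)"
  using two_weight_tail_eq[of 0 x] gamma_law_convolution[of "1/2" "1/2" 1] by (simp add: two_weight_tail_def)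

lemma exponential_tail_le_gamma_tail:
  assumes b: "1/2 \<le> b" "b \<le> 1" and xc: "1 \<le> xc" "measure (gamma_law (1/2) (1/2)) {xc<..} = exp (- xc)" and x: "xc \<le> x"
  shows "exp (- x) \<le> measure (gamma_law b b) {x<..}"
proof -
  have "measure (gamma_law 1 1) {x<..} \<le> measure (gamma_law b b) {x<..}"
    unfolding gamma_law_def
  proof (rule tail_le_of_antimono_density_ratio[where c = xc])
    show "finite_measure (density lborel (\<lambda>x. ennreal (gamma_density 1 1 x)))" "finite_measure (density lborel (\<lambda>x. ennreal (gamma_density b b x)))"
      using prob_space_gamma_law[of 1 1] prob_space_gamma_law[of b b] b unfolding gamma_law_def by (auto intro: prob_space.finite_measure)
    show "measure (density lborel (\<lambda>x. ennreal (gamma_density 1 1 x))) {xc<..} \<le> measure (density lborel (\<lambda>x. ennreal (gamma_density b b x))) {xc<..}"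
      using gamma_law_tail_quasi_concave[of "1/2" b 1 xc] xc b measure_exponential_tail[of xc] by (simp add: gamma_law_def)
    have G: "0 < Gamma b" using b by (intro Gamma_real_pos) auto
    fix y assume y: "xc < y"
    have y1: "1 < y" using y xc by simp
    then show "0 < gamma_density b b y" using b G by (simp add: gamma_density_def)
    fix z assume z: "y \<le> z"
    have f: "gamma_density 1 1 u / gamma_density b b u = Gamma b / b powr b * exp ((1 - b) * (ln u - u))" if "0 < u" for u
      using that b G by (simp add: gamma_density_def powr_def exp_diff[symmetric] exp_add[symmetric] field_simps)
    have "ln z - ln y \<le> z / y - 1" using ln_le_minus_one[of "z / y"] y1 z by (simp add: ln_div)
    also have "\<dots> = (z - y) / y" using y1 by (simp add: diff_divide_distrib)
    also have "\<dots> \<le> z - y" using y1 z by (simp add: divide_le_eq mult_le_cancel_left1)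
    finally have "(1 - b) * (ln z - z) \<le> (1 - b) * (ln y - y)" using b by (intro mult_left_mono) auto
    then show "gamma_density 1 1 z / gamma_density b b z \<le> gamma_density 1 1 y / gamma_density b b y"
      using f[of y] f[of z] y1 z b G by (simp add: divide_right_mono mult_left_mono)
  qed (use x in \<open>auto simp: gamma_density_nonneg\<close>)
  then show ?thesis using measure_exponential_tail[of x] x xc by simp
qed

lemma two_weights_tail_le_gamma_tail:
  assumes a: "1/2 < a" "a < 1" "a \<le> \<alpha>" "\<alpha> \<le> 1"
    and xc: "3/2 \<le> xc" "xc < 2" "measure (gamma_law (1/2) (1/2)) {xc<..} = exp (- xc)" and x: "xc \<le> x"
  shows "measure (gamma_sum_law (chi_params [1 - a, a])) {x<..} \<le> measure (gamma_law (1 / (2 * \<alpha>)) (1 / (2 * \<alpha>))) {x<..}"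
proof -
  define t where "t = 2 * a - 1"
  define b where "b = 1 / (2 * \<alpha>)"
  have t: "0 \<le> t" "t < 1" "1 / (2 * a) = 1 / (1 + t)" "1 / (2 * (1 - a)) = 1 / (1 - t)" using a by (auto simp: t_def)
  have b: "1/2 \<le> b" "b \<le> 1" "b \<le> 1 / (1 + t)" using a by (auto simp: b_def t_def field_simps)
  let ?f = "two_gamma_density (1 / (1 + t)) (1 / (1 - t))"
  have tt: "0 < 1 / (1 + t)" "0 < 1 / (1 - t)" using t by auto
  have fin: "finite_measure (gamma_law (1/2) (1 / (1 + t)))" "finite_measure (gamma_law (1/2) (1 / (1 - t)))"
    using tt by (auto intro!: prob_space.finite_measure prob_space_gamma_law)
  have "gamma_sum_law (chi_params [1 - a, a]) = (gamma_law (1/2) (1 / (1 - t)) \<star> gamma_law (1/2) (1 / (1 + t)))"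
    using tt gamma_sum_law_single[of "1/2" "1 / (1 + t)"] unfolding chi_params_simps t(3,4) by simp
  also have "\<dots> = (gamma_law (1/2) (1 / (1 + t)) \<star> gamma_law (1/2) (1 / (1 - t)))"
    using fin by (intro convolution_commutative) auto
  finally have law: "gamma_sum_law (chi_params [1 - a, a]) = (gamma_law (1/2) (1 / (1 + t)) \<star> gamma_law (1/2) (1 / (1 - t)))" .
  have dens: "gamma_sum_law (chi_params [1 - a, a]) = density lborel (\<lambda>y. ennreal (?f y))"
    unfolding law by (rule gamma_law_half_convolution(1)[OF tt])
  have "measure (gamma_sum_law (chi_params [1 - a, a])) {xc<..} = two_weight_tail xc t"
    unfolding law by (rule two_weight_tail_eq) (use t xc in auto)
  also have "\<dots> \<le> exp (- xc)" using two_weight_tail_le[of xc t] xc t by simp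
  also have "\<dots> \<le> measure (gamma_law b b) {xc<..}" by (rule exponential_tail_le_gamma_tail) (use b xc in auto)
  finally have start: "measure (density lborel (\<lambda>y. ennreal (?f y))) {xc<..} \<le> measure (density lborel (\<lambda>x. ennreal (gamma_density b b x))) {xc<..}"
    unfolding dens gamma_law_def .
  have "measure (density lborel (\<lambda>y. ennreal (?f y))) {x<..} \<le> measure (density lborel (\<lambda>x. ennreal (gamma_density b b x))) {x<..}"
  proof (rule tail_le_of_antimono_density_ratio[OF _ _ _ _ _ _ _ start x])
    show "?f \<in> borel_measurable borel" by (rule gamma_law_half_convolution(2)[OF tt])
    show "finite_measure (density lborel (\<lambda>y. ennreal (?f y)))"
      unfolding dens[symmetric] law by (rule convolution_finite) (use fin in auto)
    show "finite_measure (density lborel (\<lambda>x. ennreal (gamma_density b b x)))"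
      using prob_space_gamma_law[of b b] b unfolding gamma_law_def by (auto intro: prob_space.finite_measure)
    have G: "0 < Gamma b" using b by (intro Gamma_real_pos) auto
    show "0 < gamma_density b b y" if "xc < y" for y using b G that xc by (simp add: gamma_density_def)
    show "0 \<le> ?f y" for y
      unfolding two_gamma_density_def using tt
      by (auto intro!: divide_nonneg_nonneg mult_nonneg_nonneg Henstock_Kurzweil_Integration.integral_nonneg integrable_continuous_interval continuous_intros)
    show "?f z / gamma_density b b z \<le> ?f y / gamma_density b b y" if "xc < y" "y \<le> z" for y z
      by (rule two_gamma_density_ratio_antimono) (use t b that xc in auto)
  qed auto
  then show ?thesis unfolding dens by (simp add: gamma_law_def b_def)
qed

theorem chi_sum_tail_le:
  assumes ws: "sorted ws" "\<And>a. a \<in> set ws \<Longrightarrow> 0 < a \<and> a \<le> \<alpha>" and \<alpha>: "\<alpha> \<le> 1" and sum: "sum_list ws = 1"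
    and xc: "3/2 \<le> xc" "xc < 2" "measure (gamma_law (1/2) (1/2)) {xc<..} = exp (- xc)" and x: "xc \<le> x"
  shows "measure (gamma_sum_law (chi_params ws)) {x<..} \<le> measure (gamma_law (1 / (2 * \<alpha>)) (1 / (2 * \<alpha>))) {x<..}"
proof (cases "\<alpha> \<le> 1/2")
  case True
  have "ws \<noteq> []" using sum by auto
  then show ?thesis using ws True sum x xc by (intro chi_sum_tail_le_gamma_tail) auto
next
  case False
  define b where "b = 1 / (2 * \<alpha>)"
  have b: "1/2 \<le> b" "b \<le> 1" using False \<alpha> by (auto simp: b_def field_simps)
  have "ws \<noteq> []" using sum by auto
  define vs where "vs = butlast ws" define a where "a = last ws"
  have w: "ws = vs @ [a]" using \<open>ws \<noteq> []\<close> by (simp add: vs_def a_def)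
  have va: "v \<le> a" if "v \<in> set vs" for v using ws(1) that unfolding w by (auto simp: sorted_append)
  have a: "0 < a" "a \<le> \<alpha>" using ws(2)[of a] w by auto
  show ?thesis
  proof (cases "a \<le> 1/2")
    case True
    have "measure (gamma_sum_law (chi_params ws)) {x<..} \<le> measure (gamma_law (1 / (2 * (1/2))) (1 / (2 * (1/2)))) {x<..}"
    proof (rule chi_sum_tail_le_gamma_tail)
      fix v assume "v \<in> set ws"
      then show "0 < v \<and> v \<le> 1/2" using ws(2)[of v] va[of v] True w by auto
    qed (use ws \<open>ws \<noteq> []\<close> sum x xc in auto)
    also have "\<dots> = exp (- x)" using measure_exponential_tail[of x] x xc by simp
    also have "\<dots> \<le> measure (gamma_law b b) {x<..}" by (rule exponential_tail_le_gamma_tail) (use b xc x in auto)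
    finally show ?thesis by (simp add: b_def)
  next
    case False
    show ?thesis
    proof (cases "vs = []")
      case True
      then have "a = 1" using sum w by simp
      then have "\<alpha> = 1" using a \<alpha> by simp
      then show ?thesis using \<open>a = 1\<close> True w gamma_sum_law_single[of "1/2" "1/2"] by simp
    next
      case vs: False
      have vpos: "0 < v" if "v \<in> set vs" for v using ws(2)[of v] that w by auto
      obtain v us where vs': "vs = v # us" using vs by (cases vs) auto
      have "0 \<le> sum_list us" using vpos vs' by (intro sum_list_nonneg) (auto intro: less_imp_le)
      then have "0 < sum_list vs" using vpos[of v] vs' by simp
      then have a1: "a < 1" using sum w by simp
      have "measure (gamma_sum_law (chi_params ws)) {x<..} \<le> measure (gamma_sum_law (chi_params [1 - a, a])) {x<..}"
        unfolding w by (rule chi_sum_tail_le_two_weights) (use ws w vs vpos False sum x xc in \<open>auto simp: sorted_append\<close>)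
      also have "\<dots> \<le> measure (gamma_law (1 / (2 * \<alpha>)) (1 / (2 * \<alpha>))) {x<..}"
        by (rule two_weights_tail_le_gamma_tail) (use False a1 a \<alpha> xc x in auto)
      finally show ?thesis .
    qed
  qed
qed

locale independent_standard_normals = prob_space M for M :: "'a measure" +
  fixes Z :: "nat \<Rightarrow> 'a \<Rightarrow> real"
  assumes indep: "indep_vars (\<lambda>_. borel) Z UNIV"
    and normal: "\<And>i. distributed M lborel (Z i) std_normal_density"
begin

lemma Z_measurable [measurable]: "Z i \<in> borel_measurable M"
  using distributed_measurable[OF normal[of i]] by simp

lemma nn_integral_Z: "f \<in> borel_measurable borel \<Longrightarrow> (\<integral>\<^sup>+\<omega>. f (Z i \<omega>) \<partial>M) = (\<integral>\<^sup>+s. ennreal (std_normal_density s) * f s \<partial>lborel)"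
  using distributed_nn_integral[OF normal[of i], of f] by simp

lemma distr_square: "distr M borel (\<lambda>\<omega>. (Z i \<omega>)\<^sup>2) = gamma_law (1/2) (1/2)"
proof (rule cdf_unique')
  interpret D: prob_space "distr M borel (\<lambda>\<omega>. (Z i \<omega>)\<^sup>2)" by (rule prob_space_distr) measurable
  interpret G: prob_space "gamma_law (1/2) (1/2)" by (rule prob_space_gamma_law) auto
  show "finite_borel_measure (distr M borel (\<lambda>\<omega>. (Z i \<omega>)\<^sup>2))" by unfold_locales simp
  show "finite_borel_measure (gamma_law (1/2) (1/2))" by unfold_locales simp
  show "cdf (distr M borel (\<lambda>\<omega>. (Z i \<omega>)\<^sup>2)) = cdf (gamma_law (1/2) (1/2))"
  proof
    fix v :: real
    have m: "emeasure (distr M borel (\<lambda>\<omega>. (Z i \<omega>)\<^sup>2)) {..v} = (\<integral>\<^sup>+s. ennreal (std_normal_density s) * indicator {..v} (s\<^sup>2) \<partial>lborel)"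
    proof -
      have "emeasure (distr M borel (\<lambda>\<omega>. (Z i \<omega>)\<^sup>2)) {..v} = (\<integral>\<^sup>+u. indicator {..v} u \<partial>distr M borel (\<lambda>\<omega>. (Z i \<omega>)\<^sup>2))" by simp
      also have "\<dots> = (\<integral>\<^sup>+\<omega>. indicator {..v} ((Z i \<omega>)\<^sup>2) \<partial>M)" by (rule nn_integral_distr) auto
      also have "\<dots> = (\<integral>\<^sup>+s. ennreal (std_normal_density s) * indicator {..v} (s\<^sup>2) \<partial>lborel)"
        by (rule nn_integral_Z[where f = "\<lambda>s. indicator {..v} (s\<^sup>2)"]) measurable
      finally show ?thesis .
    qed
    show "cdf (distr M borel (\<lambda>\<omega>. (Z i \<omega>)\<^sup>2)) v = cdf (gamma_law (1/2) (1/2)) v"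
    proof (cases "0 \<le> v")
      case False
      have "indicator {..v} (s\<^sup>2) = (0 :: ennreal)" for s :: real using False by (auto simp: indicator_def intro: order_trans[OF zero_le_power2])
      then have "cdf (distr M borel (\<lambda>\<omega>. (Z i \<omega>)\<^sup>2)) v = 0" by (simp add: cdf_def measure_def m)
      moreover have "AE w in gamma_law (1/2) (1/2). w \<notin> {..v}" using AE_gamma_law_pos by eventually_elim (use False in auto)
      then have "emeasure (gamma_law (1/2) (1/2)) {..v} = 0" by (subst (asm) AE_iff_measurable[where N = "{..v}"]) auto
      ultimately show ?thesis by (simp add: cdf_def measure_def)
    next
      case True
      define c where "c = sqrt v"
      have c: "0 \<le> c" using True by (simp add: c_def)
      have "s\<^sup>2 \<le> v \<longleftrightarrow> s \<in> {- c..c}" for s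
        using real_sqrt_le_iff[of "s\<^sup>2" v] by (auto simp: c_def)
      then have "(\<integral>\<^sup>+s. ennreal (std_normal_density s) * indicator {..v} (s\<^sup>2) \<partial>lborel) = (\<integral>\<^sup>+s. ennreal (std_normal_density s) * indicator {- c..c} s \<partial>lborel)"
        by (intro nn_integral_cong) (simp add: indicator_def)
      also have "\<dots> = ennreal (integral {- c..c} std_normal_density)"
        by (rule nn_integral_continuous_interval) (auto simp: std_normal_density_def intro!: continuous_intros)
      also have "integral {- c..c} std_normal_density = integral {- c..0} std_normal_density + integral {0..c} std_normal_density"
        using c by (intro Henstock_Kurzweil_Integration.integral_combine[symmetric] integrable_continuous_interval)
          (auto simp: std_normal_density_def intro!: continuous_intros)
      also have "integral {- c..0} std_normal_density = integral {0..c} std_normal_density"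
      proof -
        have "std_normal_density (- s) = std_normal_density s" for s by (simp add: std_normal_density_def)
        then show ?thesis
          using Henstock_Kurzweil_Integration.integral_reflect_real[where a = 0 and b = c and f = std_normal_density]
          by (simp only: minus_zero)
      qed
      also have "integral {0..c} std_normal_density = 1 / sqrt (2 * pi) * half_normal_integral c"
        unfolding half_normal_integral_def std_normal_density_def by (rule Henstock_Kurzweil_Integration.integral_mult_right)
      also have "1 / sqrt (2 * pi) * half_normal_integral c + 1 / sqrt (2 * pi) * half_normal_integral c = sqrt (2 / pi) * half_normal_integral c"
      proof -
        have "2 / sqrt 2 = sqrt 2" by (simp add: real_div_sqrt)
        then have "2 / sqrt (2 * pi) = sqrt (2 / pi)" by (simp add: real_sqrt_mult real_sqrt_divide divide_divide_eq_left[symmetric])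
        moreover have "1 / A * h + 1 / A * h = 2 / A * h" for A h :: real by simp
        ultimately show ?thesis by (simp only:)
      qed
      also have "\<dots> = measure (gamma_law (1/2) (1/2)) {..v}"
        unfolding c_def by (rule measure_gamma_law_half[OF True, symmetric])
      finally have "emeasure (distr M borel (\<lambda>\<omega>. (Z i \<omega>)\<^sup>2)) {..v} = ennreal (measure (gamma_law (1/2) (1/2)) {..v})"
        unfolding m .
      then show ?thesis unfolding cdf_def by (metis Sigma_Algebra.measure_def enn2real_ennreal measure_nonneg)
    qed
  qed
qed

lemma distr_weighted_square:
  assumes "0 < c" shows "distr M borel (\<lambda>\<omega>. c * (Z i \<omega>)\<^sup>2) = gamma_law (1/2) (1 / (2 * c))"
proof -
  have "distr M borel (\<lambda>\<omega>. c * (Z i \<omega>)\<^sup>2) = distr (distr M borel (\<lambda>\<omega>. (Z i \<omega>)\<^sup>2)) borel (\<lambda>w. c * w)"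
    by (subst distr_distr) (auto simp: comp_def)
  then show ?thesis unfolding distr_square using distr_gamma_law_scale[of c "1/2" "1/2"] assms by simp
qed

lemma distr_weighted_square_sum:
  assumes "distinct js" "\<And>j. j \<in> set js \<Longrightarrow> 0 < c j"
  shows "distr M borel (\<lambda>\<omega>. \<Sum>j\<in>set js. c j * (Z j \<omega>)\<^sup>2) = gamma_sum_law (chi_params (map c js))"
  using assms
proof (induction js)
  case Nil
  have "distr M borel (\<lambda>\<omega>. 0::real) = return borel 0" by (rule measure_eqI) (auto simp: emeasure_distr emeasure_space_1 indicator_def)
  then show ?case by simp
next
  case (Cons j js)
  have "indep_vars (\<lambda>_. borel) (\<lambda>i \<omega>. c i * (Z i \<omega>)\<^sup>2) UNIV" by (rule indep_vars_compose2[OF indep]) measurable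
  then have "indep_vars (\<lambda>_. borel) (\<lambda>i \<omega>. c i * (Z i \<omega>)\<^sup>2) (insert j (set js))" by (rule indep_vars_subset) simp
  then have "indep_var borel (\<lambda>\<omega>. c j * (Z j \<omega>)\<^sup>2) borel (\<lambda>\<omega>. \<Sum>i\<in>set js. c i * (Z i \<omega>)\<^sup>2)"
    using Cons.prems by (intro indep_vars_sum[of "set js" j "\<lambda>i \<omega>. c i * (Z i \<omega>)\<^sup>2"]) auto
  then have "distr M borel (\<lambda>\<omega>. c j * (Z j \<omega>)\<^sup>2 + (\<Sum>i\<in>set js. c i * (Z i \<omega>)\<^sup>2))
    = (distr M borel (\<lambda>\<omega>. c j * (Z j \<omega>)\<^sup>2) \<star> distr M borel (\<lambda>\<omega>. \<Sum>i\<in>set js. c i * (Z i \<omega>)\<^sup>2))"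
    by (rule sum_indep_random_variable) measurable
  moreover have "distr M borel (\<lambda>\<omega>. \<Sum>i\<in>set js. c i * (Z i \<omega>)\<^sup>2) = gamma_sum_law (chi_params (map c js))"
    using Cons.prems by (intro Cons.IH) auto
  moreover have "distr M borel (\<lambda>\<omega>. c j * (Z j \<omega>)\<^sup>2) = gamma_law (1/2) (1 / (2 * c j))"
    using Cons.prems by (intro distr_weighted_square) auto
  moreover have "(\<lambda>\<omega>. \<Sum>i\<in>set (j # js). c i * (Z i \<omega>)\<^sup>2) = (\<lambda>\<omega>. c j * (Z j \<omega>)\<^sup>2 + (\<Sum>i\<in>set js. c i * (Z i \<omega>)\<^sup>2))"
    using Cons.prems by (intro ext) simp
  ultimately show ?case by (simp only: list.map chi_params_simps gamma_sum_law.simps)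
qed

lemma finite_weighted_tail_le:
  assumes I: "finite I" "\<And>i. i \<in> I \<Longrightarrow> 0 \<le> c i \<and> c i \<le> \<alpha>" "(\<Sum>i\<in>I. c i) = 1" and \<alpha>: "\<alpha> \<le> 1"
    and xc: "3/2 \<le> xc" "xc < 2" "measure (gamma_law (1/2) (1/2)) {xc<..} = exp (- xc)" and x: "xc \<le> x"
  shows "prob {\<omega> \<in> space M. x < (\<Sum>i\<in>I. c i * (Z i \<omega>)\<^sup>2)} \<le> measure (gamma_law (1 / (2 * \<alpha>)) (1 / (2 * \<alpha>))) {x<..}"
proof -
  define J where "J = {i\<in>I. c i \<noteq> 0}"
  define js where "js = sort_key c (sorted_list_of_set J)"
  have J: "finite J" using I by (simp add: J_def)
  have js: "distinct js" "set js = J" "sorted (map c js)" using J by (auto simp: js_def)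
  have drop: "(\<Sum>i\<in>I. c i * (Z i \<omega>)\<^sup>2) = (\<Sum>j\<in>set js. c j * (Z j \<omega>)\<^sup>2)" for \<omega>
    unfolding js(2) by (rule sum.mono_neutral_right) (use I in \<open>auto simp: J_def\<close>)
  have "sum_list (map c js) = (\<Sum>j\<in>set js. c j)" using js(1) by (rule sum_list_distinct_conv_sum_set)
  also have "\<dots> = (\<Sum>i\<in>I. c i)" unfolding js(2) by (rule sum.mono_neutral_left) (use I in \<open>auto simp: J_def\<close>)
  finally have sum: "sum_list (map c js) = 1" using I by simp
  have "prob {\<omega> \<in> space M. x < (\<Sum>i\<in>I. c i * (Z i \<omega>)\<^sup>2)} = measure (distr M borel (\<lambda>\<omega>. \<Sum>j\<in>set js. c j * (Z j \<omega>)\<^sup>2)) {x<..}"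
    unfolding drop by (subst measure_distr) (auto intro!: arg_cong[where f = prob])
  also have "\<dots> = measure (gamma_sum_law (chi_params (map c js))) {x<..}"
    by (subst distr_weighted_square_sum) (use js I in \<open>force simp: J_def\<close>)+
  also have "\<dots> \<le> measure (gamma_law (1 / (2 * \<alpha>)) (1 / (2 * \<alpha>))) {x<..}"
  proof (rule chi_sum_tail_le[OF js(3) _ \<alpha> sum xc x])
    fix a assume "a \<in> set (map c js)"
    then show "0 < a \<and> a \<le> \<alpha>" using I(2) js(2) by (force simp: J_def)
  qed
  finally show ?thesis .
qed

end

context independent_standard_normals
begin

lemma nn_integral_square: "(\<integral>\<^sup>+\<omega>. ennreal ((Z i \<omega>)\<^sup>2) \<partial>M) = 1"
proof -
  have m: "has_bochner_integral lborel (\<lambda>s. std_normal_density s * s\<^sup>2) 1"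
    using std_normal_moment_even[of 1] by simp
  have "(\<integral>\<^sup>+\<omega>. ennreal ((Z i \<omega>)\<^sup>2) \<partial>M) = (\<integral>\<^sup>+s. ennreal (std_normal_density s) * ennreal (s\<^sup>2) \<partial>lborel)"
    by (rule nn_integral_Z[where f = "\<lambda>s. ennreal (s\<^sup>2)"]) measurable
  also have "\<dots> = (\<integral>\<^sup>+s. ennreal (std_normal_density s * s\<^sup>2) \<partial>lborel)"
    by (intro nn_integral_cong) (simp add: ennreal_mult')
  also have "\<dots> = ennreal (integral\<^sup>L lborel (\<lambda>s. std_normal_density s * s\<^sup>2))"
    by (rule nn_integral_eq_integral) (use m in \<open>auto simp: has_bochner_integral_iff\<close>)
  also have "\<dots> = 1" using m by (simp add: has_bochner_integral_iff)
  finally show ?thesis .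
qed

lemma nn_integral_series_remainder:
  assumes a: "\<And>i. 0 \<le> a i" "summable a"
  shows "(\<integral>\<^sup>+\<omega>. (\<Sum>i. ennreal (a (i + n) * (Z (i + n) \<omega>)\<^sup>2)) \<partial>M) = ennreal (\<Sum>i. a (i + n))"
proof -
  have "(\<integral>\<^sup>+\<omega>. (\<Sum>i. ennreal (a (i + n) * (Z (i + n) \<omega>)\<^sup>2)) \<partial>M) = (\<Sum>i. \<integral>\<^sup>+\<omega>. ennreal (a (i + n) * (Z (i + n) \<omega>)\<^sup>2) \<partial>M)"
    by (rule nn_integral_suminf) measurable
  also have "\<dots> = (\<Sum>i. ennreal (a (i + n)))"
  proof (rule suminf_cong)
    fix i
    have "(\<integral>\<^sup>+\<omega>. ennreal (a (i + n) * (Z (i + n) \<omega>)\<^sup>2) \<partial>M) = (\<integral>\<^sup>+\<omega>. ennreal (a (i + n)) * ennreal ((Z (i + n) \<omega>)\<^sup>2) \<partial>M)"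
      by (intro nn_integral_cong ennreal_mult' a)
    also have "\<dots> = ennreal (a (i + n)) * (\<integral>\<^sup>+\<omega>. ennreal ((Z (i + n) \<omega>)\<^sup>2) \<partial>M)" by (rule nn_integral_cmult) measurable
    finally show "(\<integral>\<^sup>+\<omega>. ennreal (a (i + n) * (Z (i + n) \<omega>)\<^sup>2) \<partial>M) = ennreal (a (i + n))" by (simp add: nn_integral_square)
  qed
  also have "\<dots> = ennreal (\<Sum>i. a (i + n))"
    by (rule suminf_ennreal2) (use a in \<open>auto simp: summable_iff_shift\<close>)
  finally show ?thesis .
qed

lemma AE_summable_squares:
  assumes a: "\<And>i. 0 \<le> a i" "summable a"
  shows "AE \<omega> in M. summable (\<lambda>i. a i * (Z i \<omega>)\<^sup>2)"
proof -
  have "AE \<omega> in M. (\<Sum>i. ennreal (a i * (Z i \<omega>)\<^sup>2)) \<noteq> \<infinity>"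
    by (rule nn_integral_PInf_AE) (use nn_integral_series_remainder[OF a, of 0] in auto)
  then show ?thesis by eventually_elim (use a in \<open>auto intro!: summable_suminf_not_top\<close>)
qed

lemma series_tail_le_finite:
  fixes n :: nat
  assumes a: "\<And>i. 0 \<le> a i" "summable a" and e: "0 < e"
  defines "R \<equiv> (\<Sum>i. a (i + n))"
  shows "prob {\<omega> \<in> space M. x \<le> (\<Sum>i. a i * (Z i \<omega>)\<^sup>2)}
    \<le> prob {\<omega> \<in> space M. x - e < (\<Sum>i\<le>n. (if i < n then a i else R) * (Z i \<omega>)\<^sup>2)} + R / e"
proof -
  define U where "U \<omega> = (\<Sum>i. ennreal (a (i + n) * (Z (i + n) \<omega>)\<^sup>2))" for \<omega>
  have [measurable]: "U \<in> borel_measurable M" unfolding U_def by measurable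
  have R: "0 \<le> R" unfolding R_def by (rule suminf_nonneg) (use a in \<open>auto simp: summable_iff_shift\<close>)
  let ?E = "{\<omega> \<in> space M. x - e < (\<Sum>i\<le>n. (if i < n then a i else R) * (Z i \<omega>)\<^sup>2)}"
  have "emeasure M {\<omega> \<in> space M. 1 \<le> ennreal (1 / e) * U \<omega>} \<le> ennreal (1 / e) * (\<integral>\<^sup>+\<omega>. U \<omega> * indicator (space M) \<omega> \<partial>M)"
    using nn_integral_Markov_inequality[where u = U and A = "space M" and M = M and c = "ennreal (1 / e)"] by (simp add: Int_def conj_commute)
  also have "(\<integral>\<^sup>+\<omega>. U \<omega> * indicator (space M) \<omega> \<partial>M) = ennreal R"
    unfolding R_def nn_integral_series_remainder[OF a, of n, symmetric] U_def by (intro nn_integral_cong) simp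
  also have "ennreal (1 / e) * ennreal R = ennreal (R / e)" using e by (simp add: ennreal_mult'[symmetric])
  finally have markov: "prob {\<omega> \<in> space M. 1 \<le> ennreal (1 / e) * U \<omega>} \<le> R / e"
    using R e by (simp add: emeasure_eq_measure)
  have "prob {\<omega> \<in> space M. x \<le> (\<Sum>i. a i * (Z i \<omega>)\<^sup>2)} \<le> prob (?E \<union> {\<omega> \<in> space M. 1 \<le> ennreal (1 / e) * U \<omega>})"
  proof (rule finite_measure_mono_AE)
    show "AE \<omega> in M. \<omega> \<in> {\<omega> \<in> space M. x \<le> (\<Sum>i. a i * (Z i \<omega>)\<^sup>2)} \<longrightarrow> \<omega> \<in> ?E \<union> {\<omega> \<in> space M. 1 \<le> ennreal (1 / e) * U \<omega>}"
      using AE_summable_squares[OF a]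
    proof eventually_elim
      case (elim \<omega>)
      define T where "T = (\<Sum>i. a (i + n) * (Z (i + n) \<omega>)\<^sup>2)"
      have UT: "U \<omega> = ennreal T" unfolding U_def T_def
        by (rule suminf_ennreal2) (use a elim in \<open>auto simp: summable_iff_shift[of "\<lambda>i. a i * (Z i \<omega>)\<^sup>2"]\<close>)
      have split: "(\<Sum>i. a i * (Z i \<omega>)\<^sup>2) = T + (\<Sum>i<n. a i * (Z i \<omega>)\<^sup>2)"
        unfolding T_def using suminf_split_initial_segment[OF elim, of n] by simp
      have "(\<Sum>i\<le>n. (if i < n then a i else R) * (Z i \<omega>)\<^sup>2) = (\<Sum>i<n. a i * (Z i \<omega>)\<^sup>2) + R * (Z n \<omega>)\<^sup>2"
        unfolding lessThan_Suc_atMost[symmetric] by simp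
      then have Q: "(\<Sum>i<n. a i * (Z i \<omega>)\<^sup>2) \<le> (\<Sum>i\<le>n. (if i < n then a i else R) * (Z i \<omega>)\<^sup>2)" using R by simp
      show ?case
      proof (cases "T < e")
        case True
        then show ?thesis using split Q by auto
      next
        case False
        then have "1 \<le> 1 / e * T" using e by simp
        then have "ennreal 1 \<le> ennreal (1 / e) * U \<omega>" unfolding UT using e by (subst ennreal_mult'[symmetric]) (auto intro: ennreal_leI)
        then show ?thesis by auto
      qed
    qed
  qed measurable
  also have "\<dots> \<le> prob ?E + prob {\<omega> \<in> space M. 1 \<le> ennreal (1 / e) * U \<omega>}"
    by (rule measure_Un_le) measurable
  finally show ?thesis using markov by linarith
qed

lemma series_tail_le:
  assumes a: "\<And>i. 0 \<le> a i" "\<And>i. a i \<le> \<alpha>" "a sums 1" and \<alpha>: "0 < \<alpha>" "\<alpha> \<le> 1"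
    and xc: "3/2 \<le> xc" "xc < 2" "measure (gamma_law (1/2) (1/2)) {xc<..} = exp (- xc)" and x: "xc < x"
  shows "prob {\<omega> \<in> space M. x \<le> (\<Sum>i. a i * (Z i \<omega>)\<^sup>2)} \<le> measure (gamma_law (1 / (2 * \<alpha>)) (1 / (2 * \<alpha>))) {x<..}"
proof -
  let ?H = "gamma_law (1 / (2 * \<alpha>)) (1 / (2 * \<alpha>))"
  let ?P = "prob {\<omega> \<in> space M. x \<le> (\<Sum>i. a i * (Z i \<omega>)\<^sup>2)}"
  interpret H: prob_space ?H by (rule prob_space_gamma_law) (use \<alpha> in auto)
  have sm: "summable a" using a(3) by (rule sums_summable)
  define R where "R n = (\<Sum>i. a (i + n))" for n
  have R: "R n + (\<Sum>i<n. a i) = 1" for n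
    using suminf_split_initial_segment[OF sm, of n] sums_unique[OF a(3)] by (simp add: R_def)
  have R0: "0 \<le> R n" for n unfolding R_def by (rule suminf_nonneg) (use a sm in \<open>auto simp: summable_iff_shift\<close>)
  have Rlim: "R \<longlonglongrightarrow> 0"
  proof -
    have "(\<lambda>n. 1 - (\<Sum>i<n. a i)) \<longlonglongrightarrow> 1 - 1" using a(3) unfolding sums_def by (intro tendsto_intros)
    moreover have "R = (\<lambda>n. 1 - (\<Sum>i<n. a i))" using R by (auto simp: fun_eq_iff algebra_simps)
    ultimately show ?thesis by simp
  qed
  have step: "?P \<le> measure ?H {x - e<..}" if e: "0 < e" "xc \<le> x - e" for e
  proof (rule tendsto_lowerbound)
    show "(\<lambda>n. measure ?H {x - e<..} + R n / e) \<longlonglongrightarrow> measure ?H {x - e<..}"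
      using tendsto_add[OF tendsto_const tendsto_divide[OF Rlim tendsto_const[of e]]] e by simp
    have "\<forall>\<^sub>F n in sequentially. R n < \<alpha>" using Rlim \<alpha>(1) by (rule order_tendstoD(2))
    then show "\<forall>\<^sub>F n in sequentially. ?P \<le> measure ?H {x - e<..} + R n / e"
    proof eventually_elim
      case (elim n)
      let ?c = "\<lambda>i. if i < n then a i else R n"
      have "(\<Sum>i\<le>n. ?c i) = 1" unfolding lessThan_Suc_atMost[symmetric] using R[of n] by simp
      then have "prob {\<omega> \<in> space M. x - e < (\<Sum>i\<le>n. ?c i * (Z i \<omega>)\<^sup>2)} \<le> measure ?H {x - e<..}"
        by (intro finite_weighted_tail_le[where xc = xc]) (use a R0 elim \<alpha> xc e in auto)
      then show ?case using series_tail_le_finite[OF a(1) sm e(1), of x n] unfolding R_def by linarith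
    qed
  qed simp
  show ?thesis
  proof (rule tendsto_lowerbound)
    show "(\<lambda>n. measure ?H {x - 1 / real (Suc n)<..}) \<longlonglongrightarrow> measure ?H {x<..}"
      by (rule measure_upper_tail_left_limit[OF H.prob_space_axioms]) (auto simp: measure_def emeasure_gamma_law_singleton)
    have "\<forall>\<^sub>F n in sequentially. 1 / real (Suc n) < x - xc"
      using LIMSEQ_inverse_real_of_nat x by (intro order_tendstoD(2)[where y = 0]) (auto simp: inverse_eq_divide)
    then show "\<forall>\<^sub>F n in sequentially. ?P \<le> measure ?H {x - 1 / real (Suc n)<..}"
      by eventually_elim (rule step, auto)
  qed simp
qed

lemma series_no_atom:
  assumes a: "\<And>i. 0 \<le> a i" "summable a" and j: "0 < a j"
  shows "prob {\<omega> \<in> space M. (\<Sum>i. a i * (Z i \<omega>)\<^sup>2) = x} = 0"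
proof -
  let ?r = "\<lambda>i w. if i = j then 0 else a i * (w i)\<^sup>2 :: real"
  define X where "X \<omega> = a j * (Z j \<omega>)\<^sup>2" for \<omega>
  define Y where "Y \<omega> = (\<Sum>i. if i = j then 0 else a i * (Z i \<omega>)\<^sup>2)" for \<omega>
  have [measurable]: "X \<in> borel_measurable M" "Y \<in> borel_measurable M" unfolding X_def Y_def by measurable
  let ?B = "UNIV - {j}"
  define f where "f w = a j * (w j)\<^sup>2" for w :: "nat \<Rightarrow> real"
  define g where "g w = (\<Sum>i. ?r i w)" for w
  have "indep_var borel (g \<circ> (\<lambda>\<omega>. restrict (\<lambda>i. Z i \<omega>) ?B)) borel (f \<circ> (\<lambda>\<omega>. restrict (\<lambda>i. Z i \<omega>) {j}))"
  proof (rule indep_var_compose[OF indep_var_restrict[OF indep]])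
    show "f \<in> borel_measurable (Pi\<^sub>M {j} (\<lambda>_. borel))" unfolding f_def by measurable
    show "g \<in> borel_measurable (Pi\<^sub>M ?B (\<lambda>_. borel))"
      unfolding g_def
    proof (rule borel_measurable_suminf)
      fix i
      show "?r i \<in> borel_measurable (Pi\<^sub>M ?B (\<lambda>_. borel))" by (cases "i = j") auto
    qed
  qed auto
  moreover have "f \<circ> (\<lambda>\<omega>. restrict (\<lambda>i. Z i \<omega>) {j}) = X" by (auto simp: f_def X_def)
  moreover have "g \<circ> (\<lambda>\<omega>. restrict (\<lambda>i. Z i \<omega>) ?B) = Y" by (auto simp: g_def Y_def fun_eq_iff intro!: suminf_cong)
  ultimately have "indep_var borel Y borel X" by simp
  then have law: "distr M borel (\<lambda>\<omega>. Y \<omega> + X \<omega>) = (distr M borel Y \<star> gamma_law (1/2) (1 / (2 * a j)))"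
    using sum_indep_random_variable[of Y X] distr_weighted_square[OF j, of j] by (simp add: X_def[abs_def])
  interpret Y: prob_space "distr M borel Y" by (rule prob_space_distr) measurable
  interpret G: prob_space "gamma_law (1/2) (1 / (2 * a j))" by (rule prob_space_gamma_law) (use j in auto)
  have "emeasure (distr M borel (\<lambda>\<omega>. Y \<omega> + X \<omega>)) {x} = (\<integral>\<^sup>+y. emeasure (gamma_law (1/2) (1 / (2 * a j))) {u. u + y \<in> {x}} \<partial>distr M borel Y)"
    unfolding law by (rule convolution_emeasure) (auto intro: Y.finite_measure_axioms G.finite_measure_axioms)
  also have "\<dots> = 0"
  proof -
    have "{u. u + y \<in> {x}} = {x - y}" for y by auto
    then show ?thesis by (simp add: emeasure_gamma_law_singleton)
  qed
  finally have "measure (distr M borel (\<lambda>\<omega>. Y \<omega> + X \<omega>)) {x} = 0" by (simp add: measure_def)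
  then have "prob ((\<lambda>\<omega>. Y \<omega> + X \<omega>) -` {x} \<inter> space M) = 0" by (subst (asm) measure_distr) auto
  moreover have "prob {\<omega> \<in> space M. (\<Sum>i. a i * (Z i \<omega>)\<^sup>2) = x} \<le> prob ((\<lambda>\<omega>. Y \<omega> + X \<omega>) -` {x} \<inter> space M)"
  proof (rule finite_measure_mono_AE)
    show "AE \<omega> in M. \<omega> \<in> {\<omega> \<in> space M. (\<Sum>i. a i * (Z i \<omega>)\<^sup>2) = x} \<longrightarrow> \<omega> \<in> (\<lambda>\<omega>. Y \<omega> + X \<omega>) -` {x} \<inter> space M"
      using AE_summable_squares[OF a]
    proof eventually_elim
      case (elim \<omega>)
      have "(\<lambda>i. if i = j then a i * (Z i \<omega>)\<^sup>2 else 0) sums X \<omega>" unfolding X_def by (rule sums_single)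
      from sums_diff[OF summable_sums[OF elim] this]
      have "(\<lambda>i. if i = j then 0 else a i * (Z i \<omega>)\<^sup>2) sums ((\<Sum>i. a i * (Z i \<omega>)\<^sup>2) - X \<omega>)"
        by (rule sums_cong[THEN iffD1, rotated]) auto
      then have "Y \<omega> = (\<Sum>i. a i * (Z i \<omega>)\<^sup>2) - X \<omega>" unfolding Y_def by (rule sums_unique[symmetric])
      then show ?case by auto
    qed
  qed measurable
  ultimately show ?thesis using measure_nonneg[of M "{\<omega> \<in> space M. (\<Sum>i. a i * (Z i \<omega>)\<^sup>2) = x}"] by linarith
qed

end

lemma chi_squared_density_eq: "chi_squared_density r x = gamma_density (r / 2) (1/2) x"
  by (simp add: chi_squared_density_def gamma_density_def powr_divide)

lemma scaled_tail_eq: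
  assumes N: "prob_space (N (1 / \<alpha>))" and Y: "distributed (N (1 / \<alpha>)) lborel (Y (1 / \<alpha>)) (chi_squared_density (1 / \<alpha>))"
    and \<alpha>: "0 < \<alpha>"
  shows "scaled_tail N Y \<alpha> x = measure (gamma_law (1 / (2 * \<alpha>)) (1 / (2 * \<alpha>))) {x<..}"
proof -
  define r where "r = 1 / \<alpha>"
  define H where "H = gamma_law (1 / (2 * \<alpha>)) (1 / (2 * \<alpha>))"
  have [measurable]: "Y r \<in> borel_measurable (N r)" using distributed_measurable[OF Y] by (simp add: r_def)
  have "distr (N r) borel (Y r) = distr (N r) lborel (Y r)" by (intro distr_cong) auto
  also have "\<dots> = gamma_law (r / 2) (1/2)"
    unfolding gamma_law_def using distributed_distr_eq_density[OF Y] by (simp add: chi_squared_density_eq r_def)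
  finally have law: "distr (N r) borel (Y r) = gamma_law (r / 2) (1/2)" .
  have "distr (N r) borel (\<lambda>\<omega>. \<alpha> * Y r \<omega>) = distr (distr (N r) borel (Y r)) borel (\<lambda>w. \<alpha> * w)"
    by (subst distr_distr) (auto simp: comp_def)
  also have "\<dots> = H" unfolding law H_def using distr_gamma_law_scale[OF \<alpha>, of "1/2" "r / 2"] by (simp add: r_def mult.commute)
  finally have lawH: "distr (N r) borel (\<lambda>\<omega>. \<alpha> * Y r \<omega>) = H" .
  interpret H: prob_space H unfolding H_def by (rule prob_space_gamma_law) (use \<alpha> in auto)
  have "scaled_tail N Y \<alpha> x = measure (distr (N r) borel (\<lambda>\<omega>. \<alpha> * Y r \<omega>)) {x..}"
    unfolding scaled_tail_def r_def[symmetric] by (subst measure_distr) (auto intro!: arg_cong[where f = "measure (N r)"])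
  also have "\<dots> = measure H ({x} \<union> {x<..})" unfolding lawH by (intro arg_cong[where f = "measure H"]) auto
  also have "\<dots> = measure H {x} + measure H {x<..}" by (rule H.finite_measure_Union) (auto simp: H_def)
  also have "measure H {x} = 0" by (simp add: measure_def H_def emeasure_gamma_law_singleton)
  finally show ?thesis by (simp add: H_def)
qed

lemma least_dominating_point:
  fixes F G :: "real \<Rightarrow> real"
  assumes y0: "dominates_from G F y0"
    and right: "\<And>s. (\<lambda>n. F (s + 1 / real (Suc n))) \<longlonglongrightarrow> F s"
    and mono: "\<And>s t. s \<le> t \<Longrightarrow> G t \<le> G s"
  obtains s where "dominates_from G F s" "\<And>y. dominates_from G F y \<Longrightarrow> s \<le> y"
proof -
  define S where "S = {y. dominates_from G F y}"
  have S: "S \<noteq> {}" "bdd_below S" using y0 by (auto simp: S_def dominates_from_def intro: bdd_belowI[of _ 0])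
  define s where "s = Inf S"
  have le: "s \<le> y" if "dominates_from G F y" for y unfolding s_def by (rule cInf_lower) (use that S in \<open>auto simp: S_def\<close>)
  have above: "F x \<le> G x" if x: "s < x" for x
  proof -
    obtain y where "y \<in> S" "y < x" using x S(1) unfolding s_def by (meson cInf_lessD)
    then show ?thesis by (auto simp: S_def dominates_from_def)
  qed
  have "0 \<le> s" unfolding s_def by (rule cInf_greatest) (use S in \<open>auto simp: S_def dominates_from_def\<close>)
  moreover have "F s \<le> G s"
  proof (rule tendsto_upperbound[OF right])
    show "\<forall>\<^sub>F n in sequentially. F (s + 1 / real (Suc n)) \<le> G s"
    proof (intro always_eventually allI)
      fix n
      have "0 < 1 / real (Suc n)" by simp
      then show "F (s + 1 / real (Suc n)) \<le> G s"
        using above[of "s + 1 / real (Suc n)"] mono[of s "s + 1 / real (Suc n)"] by linarith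
    qed
  qed simp
  ultimately have "dominates_from G F s"
    unfolding dominates_from_def using above by (metis order_le_less)
  then show ?thesis using le that by blast
qed

lemma (in independent_standard_normals) weighted_tail_right_continuous:
  assumes a: "\<And>i. 0 \<le> a i" "summable a" and j: "0 < a j"
  shows "(\<lambda>n. weighted_tail M Z a (s + 1 / real (Suc n))) \<longlonglongrightarrow> weighted_tail M Z a s"
proof -
  define A where "A \<omega> = (\<Sum>i. a i * (Z i \<omega>)\<^sup>2)" for \<omega>
  have [measurable]: "A \<in> borel_measurable M" unfolding A_def by measurable
  have w: "weighted_tail M Z a x = prob {\<omega> \<in> space M. x \<le> A \<omega>}" for x by (simp add: weighted_tail_def A_def)
  have "(\<lambda>n. prob {\<omega> \<in> space M. s + 1 / real (Suc n) \<le> A \<omega>}) \<longlonglongrightarrow> prob (\<Union>n. {\<omega> \<in> space M. s + 1 / real (Suc n) \<le> A \<omega>})"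
  proof (rule finite_Lim_measure_incseq)
    show "range (\<lambda>n. {\<omega> \<in> space M. s + 1 / real (Suc n) \<le> A \<omega>}) \<subseteq> events" by auto
    show "incseq (\<lambda>n. {\<omega> \<in> space M. s + 1 / real (Suc n) \<le> A \<omega>})"
    proof (rule incseq_SucI)
      fix n
      have "1 / real (Suc (Suc n)) \<le> 1 / real (Suc n)" by (intro divide_left_mono) auto
      then show "{\<omega> \<in> space M. s + 1 / real (Suc n) \<le> A \<omega>} \<subseteq> {\<omega> \<in> space M. s + 1 / real (Suc (Suc n)) \<le> A \<omega>}" by auto
    qed
  qed
  also have "(\<Union>n. {\<omega> \<in> space M. s + 1 / real (Suc n) \<le> A \<omega>}) = {\<omega> \<in> space M. s < A \<omega>}"
  proof (intro equalityI subsetI)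
    fix \<omega> assume "\<omega> \<in> {\<omega> \<in> space M. s < A \<omega>}"
    moreover from this obtain n where "inverse (real (Suc n)) < A \<omega> - s" using reals_Archimedean[of "A \<omega> - s"] by auto
    then have "s + 1 / real (Suc n) \<le> A \<omega>" by (simp add: inverse_eq_divide)
    ultimately show "\<omega> \<in> (\<Union>n. {\<omega> \<in> space M. s + 1 / real (Suc n) \<le> A \<omega>})" by blast
  next
    fix \<omega> assume "\<omega> \<in> (\<Union>n. {\<omega> \<in> space M. s + 1 / real (Suc n) \<le> A \<omega>})"
    then obtain n where "\<omega> \<in> space M" "s + 1 / real (Suc n) \<le> A \<omega>" by blast
    moreover have "0 < 1 / real (Suc n)" by simp
    ultimately show "\<omega> \<in> {\<omega> \<in> space M. s < A \<omega>}" by (auto intro: less_le_trans[rotated])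
  qed
  also have "prob {\<omega> \<in> space M. s < A \<omega>} = prob {\<omega> \<in> space M. s \<le> A \<omega>}"
  proof -
    have "prob ({\<omega> \<in> space M. A \<omega> = s} \<union> {\<omega> \<in> space M. s < A \<omega>}) = prob {\<omega> \<in> space M. A \<omega> = s} + prob {\<omega> \<in> space M. s < A \<omega>}"
      by (rule finite_measure_Union) auto
    moreover have "{\<omega> \<in> space M. A \<omega> = s} \<union> {\<omega> \<in> space M. s < A \<omega>} = {\<omega> \<in> space M. s \<le> A \<omega>}" by auto
    ultimately show ?thesis using series_no_atom[OF a j, of s] by (simp add: A_def)
  qed
  finally show ?thesis by (simp add: w)
qed

theorem theorem2p1:
  fixes M :: "'a measure" and Z :: "nat \<Rightarrow> 'a \<Rightarrow> real"
    and N :: "real \<Rightarrow> 'b measure" and Y :: "real \<Rightarrow> 'b \<Rightarrow> real"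
  assumes "prob_space M"
    and "prob_space.indep_vars M (\<lambda>_. borel) Z UNIV"
    and "\<And>i. distributed M lborel (Z i) std_normal_density"
    and "\<And>r. r > 0 \<Longrightarrow> prob_space (N r)"
    and "\<And>r. r > 0 \<Longrightarrow> distributed (N r) lborel (Y r) (chi_squared_density r)"
  shows "(\<forall>\<alpha> a. admissible_weights \<alpha> a \<longrightarrow>
            (\<exists>x\<^sub>0. dominates_from (scaled_tail N Y \<alpha>) (weighted_tail M Z a) x\<^sub>0 \<and>
                  (\<forall>y. dominates_from (scaled_tail N Y \<alpha>) (weighted_tail M Z a) y \<longrightarrow> x\<^sub>0 \<le> y)))
       \<and> (\<forall>\<alpha>. 0 < \<alpha> \<and> \<alpha> \<le> 1 \<longrightarrow> worst_threshold M Z N Y \<alpha> \<le> ereal 1.5365)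
       \<and> (\<forall>\<alpha> a x. admissible_weights \<alpha> a \<and> \<alpha> < 1 \<and> x \<ge> 1.5365 \<longrightarrow>
            weighted_tail M Z a x \<le> scaled_tail N Y \<alpha> x)"
proof -
  interpret independent_standard_normals M Z
    by (intro independent_standard_normals.intro independent_standard_normals_axioms.intro assms(1-3))
  obtain xc where xc: "3/2 \<le> xc" "xc < 1.5365" "measure (gamma_law (1/2) (1/2)) {xc<..} = exp (- xc)"
    by (rule crossing_point)
  have pos: "\<exists>j. 0 < a j" "0 < \<alpha>" if "admissible_weights \<alpha> a" for \<alpha> a
  proof -
    have a: "\<And>i. 0 \<le> a i" "\<And>i. a i \<le> \<alpha>" "a sums 1" using that by (auto simp: admissible_weights_def)
    show ex: "\<exists>j. 0 < a j"
    proof (rule ccontr)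
      assume "\<not> (\<exists>j. 0 < a j)"
      then have "a = (\<lambda>_. 0)" using a(1) by (auto simp: fun_eq_iff intro!: antisym simp: not_less)
      then show False using a(3) by (auto dest: sums_unique2[OF sums_zero])
    qed
    then show "0 < \<alpha>" using a(2) by (meson less_le_trans)
  qed
  have scaled: "scaled_tail N Y \<alpha> x = measure (gamma_law (1 / (2 * \<alpha>)) (1 / (2 * \<alpha>))) {x<..}" if "0 < \<alpha>" for \<alpha> x
    by (rule scaled_tail_eq) (use assms(4,5) that in auto)
  have le: "weighted_tail M Z a x \<le> scaled_tail N Y \<alpha> x" if "admissible_weights \<alpha> a" "1.5365 \<le> x" for \<alpha> a x
    unfolding scaled[OF pos(2)[OF that(1)]] weighted_tail_def
    by (rule series_tail_le[where xc = xc]) (use that pos(2)[OF that(1)] xc in \<open>auto simp: admissible_weights_def\<close>)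
  then have dom: "dominates_from (scaled_tail N Y \<alpha>) (weighted_tail M Z a) 1.5365" if "admissible_weights \<alpha> a" for \<alpha> a
    using that by (simp add: dominates_from_def)
  have least: "\<exists>x\<^sub>0. dominates_from (scaled_tail N Y \<alpha>) (weighted_tail M Z a) x\<^sub>0 \<and>
      (\<forall>y. dominates_from (scaled_tail N Y \<alpha>) (weighted_tail M Z a) y \<longrightarrow> x\<^sub>0 \<le> y)" if adm: "admissible_weights \<alpha> a" for \<alpha> a
  proof -
    obtain j where j: "0 < a j" using pos(1)[OF adm] by blast
    have \<alpha>: "0 < \<alpha>" by (rule pos(2)[OF adm])
    interpret H: prob_space "gamma_law (1 / (2 * \<alpha>)) (1 / (2 * \<alpha>))" by (rule prob_space_gamma_law) (use \<alpha> in auto)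
    have right: "(\<lambda>n. weighted_tail M Z a (s + 1 / real (Suc n))) \<longlonglongrightarrow> weighted_tail M Z a s" for s
      by (rule weighted_tail_right_continuous[where j = j]) (use adm j in \<open>auto simp: admissible_weights_def intro: sums_summable\<close>)
    have mono: "scaled_tail N Y \<alpha> t \<le> scaled_tail N Y \<alpha> s" if "s \<le> t" for s t
      unfolding scaled[OF \<alpha>] by (rule H.finite_measure_mono) (use that in auto)
    show ?thesis by (rule least_dominating_point[OF dom[OF adm] right mono]) blast+
  qed
  have "worst_threshold M Z N Y \<alpha> \<le> ereal 1.5365" for \<alpha>
    unfolding worst_threshold_def
  proof (rule SUP_least)
    fix a assume "a \<in> {a. admissible_weights \<alpha> a}"
    then have adm: "admissible_weights \<alpha> a" by simp
    from least[OF adm] obtain x0 where x0: "dominates_from (scaled_tail N Y \<alpha>) (weighted_tail M Z a) x0"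
      "\<And>y. dominates_from (scaled_tail N Y \<alpha>) (weighted_tail M Z a) y \<Longrightarrow> x0 \<le> y" by blast
    then have "smallest_threshold M Z N Y \<alpha> a = x0" unfolding smallest_threshold_def by (intro Least_equality) auto
    then show "ereal (smallest_threshold M Z N Y \<alpha> a) \<le> ereal 1.5365" using x0(2)[OF dom[OF adm]] by simp
  qed
  then show ?thesis using least le by blast
qed

end
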